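(* Let $1<p<\infty$, $p\ne2$, and let $\mathcal{U}$ be a selective nonprincipal ultrafilter on $\mathbb{N}$. Then there are exactly four closed subspaces of $(L^{p})^{\mathcal{U}}$, other than $\{0\}$ and $(L^{p})^{\mathcal{U}}$, that are invariant under $T^{\mathcal{U}}$ for all $T\in B(L^{p})$, namely $L^{p}$, $\widehat{L^{p}}$, $M$ and $L^{p}\oplus M$. Here $M$ is the unique complemented closed subspace of $\widehat{L^{p}}$ such that an operator $S\in B((L^{p})^{\mathcal{U}})$ lies in the WOT closure of $\{T^{\mathcal{U}}:T\in B(L^{p})\}$ iff $S$ leaves $L^{p}$, $\widehat{L^{p}}$ and $M$ invariant; for $p>2$ one has $M=\{(f_n)_{n,\mathcal{U}}\in(L^{p})^{\mathcal{U}}:\lim_{n,\mathcal{U}}\|f_n\|_2=0\}$.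
   Context: $L^{p}=L^{p}([0,1],\mu)$, $\mu$ Lebesgue measure. $(L^{p})^{\mathcal{U}}$ is the ultrapower (bounded sequences modulo those with $\lim_{n,\mathcal{U}}\|f_n\|_p=0$), $(f_n)_{n,\mathcal{U}}$ the class of $(f_n)$, $T^{\mathcal{U}}(f_n)_{n,\mathcal{U}}=(Tf_n)_{n,\mathcal{U}}$. $L^p$ is identified with constant classes, $\widehat{L^{p}}=\{(f_n)_{n,\mathcal{U}}:w\text{-}\lim_{n,\mathcal{U}}f_n=0\}$, and $(L^{p})^{\mathcal{U}}=L^{p}\oplus\widehat{L^{p}}$. An ultrafilter $\mathcal{U}$ on $\mathbb{N}$ is selective if (1) for every sequence $A_1,A_2,\dots$ in $\mathcal{U}$ there is $A\in\mathcal{U}$ with $A\setminus A_k$ finite for each $k$; and (2) for every partition of $\mathbb{N}$ into finite sets $A_1,A_2,\dots$ there is $A\in\mathcal{U}$ with $A\cap A_k$ a singleton for each $k$. *)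

theory Defs
  imports "HOL-Analysis.Analysis"
begin

definition nonprincipal_ultrafilter :: "nat filter \<Rightarrow> bool" where
  "nonprincipal_ultrafilter U \<longleftrightarrow>
     U \<noteq> bot \<and>
     (\<forall>A. eventually (\<lambda>n. n \<in> A) U \<or> eventually (\<lambda>n. n \<notin> A) U) \<and>
     (\<forall>k. \<not> eventually (\<lambda>n. n = k) U)"

definition selective_ultrafilter :: "nat filter \<Rightarrow> bool" where
  "selective_ultrafilter U \<longleftrightarrow>
     nonprincipal_ultrafilter U \<and>
     (\<forall>As :: nat \<Rightarrow> nat set. (\<forall>k. eventually (\<lambda>n. n \<in> As k) U) \<longrightarrow>
        (\<exists>A. eventually (\<lambda>n. n \<in> A) U \<and> (\<forall>k. finite (A - As k)))) \<and>
     (\<forall>As :: nat \<Rightarrow> nat set.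
        ((\<forall>k. finite (As k) \<and> As k \<noteq> {}) \<and> (\<forall>k l. k \<noteq> l \<longrightarrow> As k \<inter> As l = {}) \<and>
         (\<Union>k. As k) = UNIV) \<longrightarrow>
        (\<exists>A. eventually (\<lambda>n. n \<in> A) U \<and> (\<forall>k. \<exists>m. A \<inter> As k = {m})))"

definition M01 :: "real measure" where
  "M01 = restrict_space lborel {0..1}"

definition Lp :: "real \<Rightarrow> (real \<Rightarrow> real) set" where
  "Lp p = {f. f \<in> borel_measurable M01 \<and> integrable M01 (\<lambda>x. \<bar>f x\<bar> powr p)}"

definition lpnorm :: "real \<Rightarrow> (real \<Rightarrow> real) \<Rightarrow> real" where
  "lpnorm p f = (\<integral>x. \<bar>f x\<bar> powr p \<partial>M01) powr (1 / p)"

text \<open>Bounded linear operators on L^p (acting on representatives, linear modulo a.e. equality).\<close>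
definition bop_Lp :: "real \<Rightarrow> ((real \<Rightarrow> real) \<Rightarrow> (real \<Rightarrow> real)) \<Rightarrow> bool" where
  "bop_Lp p T \<longleftrightarrow>
     (\<forall>f \<in> Lp p. T f \<in> Lp p) \<and>
     (\<forall>f \<in> Lp p. \<forall>g \<in> Lp p. \<forall>a b :: real.
        AE x in M01. T (\<lambda>y. a * f y + b * g y) x = a * T f x + b * T g x) \<and>
     (\<forall>f \<in> Lp p. \<forall>g \<in> Lp p. (AE x in M01. f x = g x) \<longrightarrow> (AE x in M01. T f x = T g x)) \<and>
     (\<exists>C. \<forall>f \<in> Lp p. lpnorm p (T f) \<le> C * lpnorm p f)"

definition dual_Lp :: "real \<Rightarrow> ((real \<Rightarrow> real) \<Rightarrow> real) \<Rightarrow> bool" where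
  "dual_Lp p \<phi> \<longleftrightarrow>
     (\<forall>f \<in> Lp p. \<forall>g \<in> Lp p. \<forall>a b :: real.
        \<phi> (\<lambda>y. a * f y + b * g y) = a * \<phi> f + b * \<phi> g) \<and>
     (\<exists>C. \<forall>f \<in> Lp p. \<bar>\<phi> f\<bar> \<le> C * lpnorm p f)"

type_synonym useq = "nat \<Rightarrow> real \<Rightarrow> real"

text \<open>Bounded sequences in L^p (representatives of elements of the ultrapower).\<close>
definition UP :: "real \<Rightarrow> useq set" where
  "UP p = {F. (\<forall>n. F n \<in> Lp p) \<and> (\<exists>C. \<forall>n. lpnorm p (F n) \<le> C)}"

definition uminus_seq :: "useq \<Rightarrow> useq \<Rightarrow> useq" where
  "uminus_seq F G = (\<lambda>n x. F n x - G n x)"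

definition unorm :: "real \<Rightarrow> nat filter \<Rightarrow> useq \<Rightarrow> real" where
  "unorm p U F = Lim U (\<lambda>n. lpnorm p (F n))"

text \<open>Two representatives define the same element of the ultrapower.\<close>
definition ueq :: "real \<Rightarrow> nat filter \<Rightarrow> useq \<Rightarrow> useq \<Rightarrow> bool" where
  "ueq p U F G \<longleftrightarrow> ((\<lambda>n. lpnorm p (F n - G n)) \<longlongrightarrow> 0) U"

text \<open>A closed linear subspace of (L^p)^U, represented as the (saturated) set of all
  representing sequences of its elements.\<close>
definition closed_usub :: "real \<Rightarrow> nat filter \<Rightarrow> useq set \<Rightarrow> bool" where
  "closed_usub p U X \<longleftrightarrow>
     X \<subseteq> UP p \<and>
     (\<forall>F \<in> X. \<forall>G \<in> UP p. ueq p U F G \<longrightarrow> G \<in> X) \<and>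
     (\<lambda>n x. 0) \<in> X \<and>
     (\<forall>F \<in> X. \<forall>G \<in> X. \<forall>a b :: real. (\<lambda>n x. a * F n x + b * G n x) \<in> X) \<and>
     (\<forall>G \<in> UP p. (\<forall>\<epsilon>>0. \<exists>F \<in> X. unorm p U (uminus_seq G F) < \<epsilon>) \<longrightarrow> G \<in> X)"

definition uzero :: "real \<Rightarrow> nat filter \<Rightarrow> useq set" where
  "uzero p U = {F \<in> UP p. ueq p U F (\<lambda>n x. 0)}"

definition LpC :: "real \<Rightarrow> nat filter \<Rightarrow> useq set" where
  "LpC p U = {F \<in> UP p. \<exists>f \<in> Lp p. ueq p U F (\<lambda>n. f)}"

definition Lhat :: "real \<Rightarrow> nat filter \<Rightarrow> useq set" where
  "Lhat p U = {F \<in> UP p. \<forall>\<phi>. dual_Lp p \<phi> \<longrightarrow> ((\<lambda>n. \<phi> (F n)) \<longlongrightarrow> 0) U}"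

definition subspace_sum :: "real \<Rightarrow> nat filter \<Rightarrow> useq set \<Rightarrow> useq set \<Rightarrow> useq set" where
  "subspace_sum p U X Y = {F \<in> UP p. \<exists>G \<in> X. \<exists>H \<in> Y. ueq p U F (\<lambda>n x. G n x + H n x)}"

definition ultra_op :: "((real \<Rightarrow> real) \<Rightarrow> (real \<Rightarrow> real)) \<Rightarrow> useq \<Rightarrow> useq" where
  "ultra_op T F = (\<lambda>n. T (F n))"

definition invariant_under :: "(useq \<Rightarrow> useq) \<Rightarrow> useq set \<Rightarrow> bool" where
  "invariant_under S X \<longleftrightarrow> (\<forall>F \<in> X. S F \<in> X)"

definition bop_U :: "real \<Rightarrow> nat filter \<Rightarrow> (useq \<Rightarrow> useq) \<Rightarrow> bool" where
  "bop_U p U S \<longleftrightarrow>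
     (\<forall>F \<in> UP p. S F \<in> UP p) \<and>
     (\<forall>F \<in> UP p. \<forall>G \<in> UP p. ueq p U F G \<longrightarrow> ueq p U (S F) (S G)) \<and>
     (\<forall>F \<in> UP p. \<forall>G \<in> UP p. \<forall>a b :: real.
        ueq p U (S (\<lambda>n x. a * F n x + b * G n x)) (\<lambda>n x. a * S F n x + b * S G n x)) \<and>
     (\<exists>C. \<forall>F \<in> UP p. unorm p U (S F) \<le> C * unorm p U F)"

definition dual_U :: "real \<Rightarrow> nat filter \<Rightarrow> (useq \<Rightarrow> real) \<Rightarrow> bool" where
  "dual_U p U \<Phi> \<longleftrightarrow>
     (\<forall>F \<in> UP p. \<forall>G \<in> UP p. ueq p U F G \<longrightarrow> \<Phi> F = \<Phi> G) \<and>
     (\<forall>F \<in> UP p. \<forall>G \<in> UP p. \<forall>a b :: real.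
        \<Phi> (\<lambda>n x. a * F n x + b * G n x) = a * \<Phi> F + b * \<Phi> G) \<and>
     (\<exists>C. \<forall>F \<in> UP p. \<bar>\<Phi> F\<bar> \<le> C * unorm p U F)"

text \<open>S lies in the weak operator topology closure of the set of all T^U, T in B(L^p):
  every basic WOT neighbourhood of S (given by finitely many vectors and functionals)
  contains some T^U.\<close>
definition in_wot_closure :: "real \<Rightarrow> nat filter \<Rightarrow> (useq \<Rightarrow> useq) \<Rightarrow> bool" where
  "in_wot_closure p U S \<longleftrightarrow>
     (\<forall>P :: (useq \<times> (useq \<Rightarrow> real)) set. finite P \<longrightarrow>
        (\<forall>(F, \<Phi>) \<in> P. F \<in> UP p \<and> dual_U p U \<Phi>) \<longrightarrow>
        (\<forall>\<epsilon>>0. \<exists>T. bop_Lp p T \<and>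
            (\<forall>(F, \<Phi>) \<in> P. \<bar>\<Phi> (S F) - \<Phi> (ultra_op T F)\<bar> < \<epsilon>)))"

definition M_char :: "real \<Rightarrow> nat filter \<Rightarrow> useq set \<Rightarrow> bool" where
  "M_char p U M \<longleftrightarrow>
     closed_usub p U M \<and> M \<subseteq> Lhat p U \<and>
     (\<exists>N. closed_usub p U N \<and> N \<subseteq> Lhat p U \<and> M \<inter> N = uzero p U \<and>
          subspace_sum p U M N = Lhat p U) \<and>
     (\<forall>S. bop_U p U S \<longrightarrow>
        (in_wot_closure p U S \<longleftrightarrow>
           invariant_under S (LpC p U) \<and> invariant_under S (Lhat p U) \<and> invariant_under S M))"

definition inv_subspaces :: "real \<Rightarrow> nat filter \<Rightarrow> useq set set" where
  "inv_subspaces p U =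
     {X. closed_usub p U X \<and> X \<noteq> uzero p U \<and> X \<noteq> UP p \<and>
         (\<forall>T. bop_Lp p T \<longrightarrow> invariant_under (ultra_op T) X)}"

end

theory Submission
  imports Defs
begin

text \<open>
  Every bounded sequence in $L^p$ splits, along the ultrafilter, into its weak limit, a part that
  tends to zero in $L^1$ (hence is asymptotically disjoint) and a uniformly $p$-integrable weakly
  null part. By smoothness of the norm, a weakly null sequence in $L^q$ satisfies, on a set of the
  ultrafilter, an upper $q$-estimate if $q \le 2$ and an upper $2$-estimate if $q \ge 2$; sequences
  tending to zero in $L^1$ always satisfy an upper $q$-estimate, and $L^2$-bounded ones an upper
  $2$-estimate. Selectivity is what allows one to pass to a subsequence indexed by a member of
  the ultrafilter.

  If $(G_m)$ in $L^{p'}$ and $(H_m)$ in $L^p$ are weakly null with dual upper estimates, then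
  $f \mapsto \sum_m \langle f, G_m\rangle H_m$ is bounded, and its ultrapower is close to the rank one
  operator $G \otimes H$ on any given finite set of vectors. Such operators are available exactly
  when $G$ annihilates $M$ or $H$ lies in $M$, where $M$ consists of the sequences tending to zero
  in $L^1$ if $p > 2$, and of the uniformly $p$-integrable weakly null ones if $p < 2$. Finite sums of
  them show that every operator leaving $L^p$, $\widehat{L^p}$ and $M$ invariant is a
  limit of ultrapowers, and they force every invariant closed subspace to be one of the listed
  ones. Conversely $M$ is invariant: comparing $\langle \sum_{n\in s} T F_n, \sum_{n\in s} G_n\rangle$,
  which grows like $|s|$, with the upper estimates for both factors gives a contradiction.
\<close>

section \<open>The spaces $L^p$ on the unit interval\<close>

text \<open>The map f -> sum <f, G_m> H_m is bounded because it factors through ell^r, so the upper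
  estimate of \<open>G\<close> in the dual space must carry the exponent conjugate to that of
  \<open>H\<close>. Two pairings are available: exponents (2, 2) and (p, q). For p > 2 a general
  weakly null \<open>H\<close> has only exponent 2 and a general weakly null \<open>G\<close> only
  exponent q, so one of the two factors must be special; for p < 2 the two sides exchange roles. At
  p = 2 all these exponents equal 2, and the averaging argument, which compares N with N powr (1/r +
  1/r'), says nothing since the exponent is 1. The other organising principle is duality: L^p, the
  weakly null part, M and L^p + M are all written as annihilators of families in the conjugate
  ultrapower. Closedness and stability under WOT limits are then automatic, and both ranges of p are
  served by one argument with a parameter \<open>\<G>\<close>, the family in the dual that cuts M
  out of the weakly null part. Selectivity enters twice in the same form: to obtain the upper
  estimates, and to make the off-diagonal sums of |<F_n, G_m>| small.\<close>

lemma space_M01 [simp]: "space M01 = {0..1}"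
  by (simp add: M01_def space_restrict_space)

lemma sets_M01_Icc [simp]: "{0..1} \<in> sets M01"
  using sets.top[of M01] by simp

lemma emeasure_M01_space [simp]: "emeasure M01 {0..1} = 1"
  by (simp add: M01_def emeasure_restrict_space)

lemma measure_M01_space [simp]: "measure M01 {0..1} = 1"
  by (simp add: measure_def)

interpretation M01: finite_measure M01
  by (intro finite_measureI) simp

lemma measurable_M01_borel: "f \<in> borel_measurable borel \<Longrightarrow> f \<in> borel_measurable M01"
  unfolding M01_def by (simp add: measurable_restrict_space1)

lemma abs_add_powr_le:
  fixes a b p :: real
  assumes "0 \<le> p"
  shows "\<bar>a + b\<bar> powr p \<le> 2 powr p * (\<bar>a\<bar> powr p + \<bar>b\<bar> powr p)"
proof -
  have "\<bar>a + b\<bar> powr p \<le> (2 * max \<bar>a\<bar> \<bar>b\<bar>) powr p"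
    using assms by (intro powr_mono2) auto
  also have "\<dots> = 2 powr p * (max \<bar>a\<bar> \<bar>b\<bar>) powr p"
    by (simp add: powr_mult)
  also have "(max \<bar>a\<bar> \<bar>b\<bar>) powr p \<le> \<bar>a\<bar> powr p + \<bar>b\<bar> powr p"
    by (simp add: max_def)
  finally show ?thesis by simp
qed

text \<open>The interior case is convexity on the positive axis; a zero argument reduces to
  \<open>s powr p \<le> s\<close> on the unit interval.\<close>

lemma powr_convex_ineq:
  fixes a b p t :: real
  assumes "1 \<le> p" "0 \<le> a" "0 \<le> b" "0 \<le> t" "t \<le> 1"
  shows "(t * a + (1 - t) * b) powr p \<le> t * a powr p + (1 - t) * b powr p"
proof -
  have *: "(s * x) powr p \<le> s * x powr p" if "0 \<le> s" "s \<le> 1" "0 \<le> x" for s x :: real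
  proof (cases "s = 0")
    case False
    then have "s powr p \<le> s" using that assms by (intro powr_le_one_le) auto
    then show ?thesis using that by (simp add: powr_mult mult_right_mono)
  qed auto
  consider "a = 0" | "b = 0" | "a > 0" "b > 0" using assms by linarith
  then show ?thesis
  proof cases
    case 1 then show ?thesis using *[of "1 - t" b] assms by simp
  next
    case 2 then show ?thesis using *[of t a] assms by simp
  next
    case 3
    then show ?thesis
      using convex_onD[OF powr_convex[OF assms(1)], of "1 - t" a b] assms by simp
  qed
qed

lemma LpI: "f \<in> borel_measurable M01 \<Longrightarrow> integrable M01 (\<lambda>x. \<bar>f x\<bar> powr p) \<Longrightarrow> f \<in> Lp p"
  by (simp add: Lp_def)

lemma Lp_measurable: "f \<in> Lp p \<Longrightarrow> f \<in> borel_measurable M01"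
  by (simp add: Lp_def)

lemma Lp_integrable_powr: "f \<in> Lp p \<Longrightarrow> integrable M01 (\<lambda>x. \<bar>f x\<bar> powr p)"
  by (simp add: Lp_def)

lemma Lp_mono:
  assumes "f \<in> borel_measurable M01" "g \<in> Lp p" "0 \<le> p"
    and "\<And>x. x \<in> {0..1} \<Longrightarrow> \<bar>f x\<bar> \<le> \<bar>g x\<bar>"
  shows "f \<in> Lp p"
proof (rule LpI)
  show "f \<in> borel_measurable M01" by fact
  show "integrable M01 (\<lambda>x. \<bar>f x\<bar> powr p)"
    apply (rule Bochner_Integration.integrable_bound[OF Lp_integrable_powr[OF assms(2)]])
    subgoal using assms(1) by measurable
    subgoal using assms by (intro AE_I2) (auto intro!: powr_mono2)
    done
qed

lemma Lp_bounded:
  assumes "f \<in> borel_measurable M01" "0 \<le> p" "\<And>x. x \<in> {0..1} \<Longrightarrow> \<bar>f x\<bar> \<le> K"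
  shows "f \<in> Lp p"
proof (rule Lp_mono[OF assms(1)])
  show "(\<lambda>x. K) \<in> Lp p" by (rule LpI) auto
  show "\<bar>f x\<bar> \<le> \<bar>K\<bar>" if "x \<in> {0..1}" for x using assms(3)[OF that] by simp
qed fact

lemma Lp_const [simp]: "0 \<le> p \<Longrightarrow> (\<lambda>x. c) \<in> Lp p"
  by (rule Lp_bounded[where K = "\<bar>c\<bar>"]) auto

lemma Lp_scale: "f \<in> Lp p \<Longrightarrow> (\<lambda>x. a * f x) \<in> Lp p"
  by (auto simp: Lp_def abs_mult powr_mult)

lemma Lp_add:
  assumes "f \<in> Lp p" "g \<in> Lp p" "0 \<le> p"
  shows "(\<lambda>x. f x + g x) \<in> Lp p"
proof (rule LpI)
  note [measurable] = Lp_measurable[OF assms(1)] Lp_measurable[OF assms(2)]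
  show "(\<lambda>x. f x + g x) \<in> borel_measurable M01" by measurable
  show "integrable M01 (\<lambda>x. \<bar>f x + g x\<bar> powr p)"
  proof (rule Bochner_Integration.integrable_bound)
    show "integrable M01 (\<lambda>x. 2 powr p * (\<bar>f x\<bar> powr p + \<bar>g x\<bar> powr p))"
      using assms by (intro integrable_mult_right Bochner_Integration.integrable_add Lp_integrable_powr)
    show "AE x in M01. norm (\<bar>f x + g x\<bar> powr p) \<le> norm (2 powr p * (\<bar>f x\<bar> powr p + \<bar>g x\<bar> powr p))"
      using abs_add_powr_le[OF assms(3)] by (intro AE_I2) (simp add: abs_mult)
  qed measurable
qed

lemma Lp_lin:
  assumes "f \<in> Lp p" "g \<in> Lp p" "0 \<le> p"
  shows "(\<lambda>x. a * f x + b * g x) \<in> Lp p"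
  using assms by (intro Lp_add Lp_scale)

lemma Lp_uminus: "f \<in> Lp p \<Longrightarrow> (\<lambda>x. - f x) \<in> Lp p"
  using Lp_scale[of f p "-1"] by simp

lemma Lp_diff:
  assumes "f \<in> Lp p" "g \<in> Lp p" "0 \<le> p"
  shows "(\<lambda>x. f x - g x) \<in> Lp p"
  using Lp_add[OF assms(1) Lp_uminus[OF assms(2)] assms(3)] by simp

lemma Lp_sum:
  assumes "\<And>i. i \<in> s \<Longrightarrow> f i \<in> Lp p" "0 \<le> p"
  shows "(\<lambda>x. \<Sum>i\<in>s. f i x) \<in> Lp p"
  using assms by (induction s rule: infinite_finite_induct) (auto intro!: Lp_add)

lemma Lp_cong_AE:
  assumes "f \<in> Lp p" "g \<in> borel_measurable M01" "AE x in M01. f x = g x"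
  shows "g \<in> Lp p"
proof (rule LpI)
  note [measurable] = assms(2) Lp_measurable[OF assms(1)]
  show "g \<in> borel_measurable M01" by fact
  have "integrable M01 (\<lambda>x. \<bar>f x\<bar> powr p) \<longleftrightarrow> integrable M01 (\<lambda>x. \<bar>g x\<bar> powr p)"
    using assms(3) by (intro integrable_cong_AE) (measurable, auto)
  then show "integrable M01 (\<lambda>x. \<bar>g x\<bar> powr p)" using Lp_integrable_powr[OF assms(1)] by simp
qed

lemma lpnorm_nonneg [simp]: "0 \<le> lpnorm p f"
  by (simp add: lpnorm_def)

lemma lpnorm_powr: "0 < p \<Longrightarrow> lpnorm p f powr p = (LINT x|M01. \<bar>f x\<bar> powr p)"
  by (simp add: lpnorm_def powr_powr)

lemma lpnorm_le_iff:
  assumes "0 < p" "0 \<le> A"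
  shows "lpnorm p f \<le> A \<longleftrightarrow> (LINT x|M01. \<bar>f x\<bar> powr p) \<le> A powr p"
proof -
  have "lpnorm p f \<le> A \<longleftrightarrow> lpnorm p f powr p \<le> A powr p"
    using assms by (smt (verit) lpnorm_nonneg powr_less_mono2 powr_mono2)
  then show ?thesis using assms by (simp add: lpnorm_powr)
qed

lemma lpnorm_mono:
  assumes "f \<in> borel_measurable M01" "g \<in> Lp p" "0 < p"
    and "\<And>x. x \<in> {0..1} \<Longrightarrow> \<bar>f x\<bar> \<le> \<bar>g x\<bar>"
  shows "lpnorm p f \<le> lpnorm p g"
proof -
  have "f \<in> Lp p" using Lp_mono[OF assms(1,2) _ assms(4)] assms(3) by simp
  then have "(LINT x|M01. \<bar>f x\<bar> powr p) \<le> (LINT x|M01. \<bar>g x\<bar> powr p)"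
    using assms by (intro integral_mono Lp_integrable_powr) (auto intro!: powr_mono2)
  then show ?thesis unfolding lpnorm_def using assms by (intro powr_mono2) auto
qed

lemma lpnorm_zero [simp]: "lpnorm p (\<lambda>x. 0) = 0"
  by (simp add: lpnorm_def)

lemma lpnorm_bounded:
  assumes "f \<in> borel_measurable M01" "0 < p" "\<And>x. x \<in> {0..1} \<Longrightarrow> \<bar>f x\<bar> \<le> K" "0 \<le> K"
  shows "lpnorm p f \<le> K"
proof -
  have "lpnorm p f \<le> lpnorm p (\<lambda>x. K)" using assms by (intro lpnorm_mono) auto
  also have "\<dots> = K" using assms by (simp add: lpnorm_def powr_powr)
  finally show ?thesis .
qed

lemma lpnorm_scale:
  assumes "0 < p"
  shows "lpnorm p (\<lambda>x. a * f x) = \<bar>a\<bar> * lpnorm p f"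
proof -
  have "(LINT x|M01. \<bar>a * f x\<bar> powr p) = \<bar>a\<bar> powr p * (LINT x|M01. \<bar>f x\<bar> powr p)"
    by (simp add: abs_mult powr_mult)
  then show ?thesis using assms by (simp add: lpnorm_def powr_mult powr_powr)
qed

lemma lpnorm_minus_commute: "lpnorm p (\<lambda>x. f x - g x) = lpnorm p (\<lambda>x. g x - f x)"
  by (simp add: lpnorm_def abs_minus_commute)

lemma lpnorm_eq_0_iff:
  assumes "f \<in> Lp p" "0 < p"
  shows "lpnorm p f = 0 \<longleftrightarrow> (AE x in M01. f x = 0)"
proof -
  have "lpnorm p f = 0 \<longleftrightarrow> (LINT x|M01. \<bar>f x\<bar> powr p) = 0"
    using assms by (simp add: lpnorm_def)
  also have "\<dots> \<longleftrightarrow> (AE x in M01. \<bar>f x\<bar> powr p = 0)"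
    by (rule integral_nonneg_eq_0_iff_AE[OF Lp_integrable_powr[OF assms(1)]]) simp
  finally show ?thesis using assms by simp
qed

text \<open>Minkowski's inequality by homogeneity: for \<open>A\<close>, \<open>B\<close> strictly
  above the two norms, |f + g| / (A + B) is at most the convex combination, with weights A / (A + B)
  and B / (A + B), of |f| / A and |g| / B, and convexity of the p-th power is integrated. Strict
  bounds keep the denominators positive when a norm vanishes.\<close>

theorem lpnorm_triangle:
  assumes f: "f \<in> Lp p" and g: "g \<in> Lp p" and p: "1 \<le> p"
  shows "lpnorm p (\<lambda>x. f x + g x) \<le> lpnorm p f + lpnorm p g"
proof -
  have *: "lpnorm p (\<lambda>x. f x + g x) \<le> A + B" if A: "lpnorm p f < A" and B: "lpnorm p g < B" for A B
  proof -
    have A0: "0 < A" and B0: "0 < B" using A B lpnorm_nonneg[of p f] lpnorm_nonneg[of p g] by linarith+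
    define t where "t = A / (A + B)"
    have t: "0 \<le> t" "t \<le> 1" "1 - t = B / (A + B)" using A0 B0 by (auto simp: t_def field_simps)
    have pt: "\<bar>f x + g x\<bar> powr p \<le> (A + B) powr p * (t * (\<bar>f x\<bar> powr p / A powr p) + (1 - t) * (\<bar>g x\<bar> powr p / B powr p))" for x
    proof -
      have "t * (\<bar>f x\<bar> / A) = \<bar>f x\<bar> / (A + B)" "(1 - t) * (\<bar>g x\<bar> / B) = \<bar>g x\<bar> / (A + B)"
        using A0 B0 unfolding t(3) by (simp_all add: t_def)
      then have "(A + B) * (t * (\<bar>f x\<bar> / A) + (1 - t) * (\<bar>g x\<bar> / B)) = \<bar>f x\<bar> + \<bar>g x\<bar>"
        using A0 B0 by (simp add: add_divide_distrib[symmetric])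
      then have "\<bar>f x + g x\<bar> \<le> (A + B) * (t * (\<bar>f x\<bar> / A) + (1 - t) * (\<bar>g x\<bar> / B))"
        by simp
      then have "\<bar>f x + g x\<bar> powr p \<le> ((A + B) * (t * (\<bar>f x\<bar> / A) + (1 - t) * (\<bar>g x\<bar> / B))) powr p"
        using p by (intro powr_mono2) auto
      also have "\<dots> = (A + B) powr p * (t * (\<bar>f x\<bar> / A) + (1 - t) * (\<bar>g x\<bar> / B)) powr p"
        by (simp add: powr_mult)
      also have "\<dots> \<le> (A + B) powr p * (t * (\<bar>f x\<bar> / A) powr p + (1 - t) * (\<bar>g x\<bar> / B) powr p)"
        using p A0 B0 t by (intro mult_left_mono powr_convex_ineq) auto
      finally show ?thesis by (simp add: powr_divide)
    qed
    have If: "(LINT x|M01. \<bar>f x\<bar> powr p) \<le> A powr p" and Ig: "(LINT x|M01. \<bar>g x\<bar> powr p) \<le> B powr p"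
      using lpnorm_le_iff[of p A f] lpnorm_le_iff[of p B g] A B A0 B0 p by auto
    have "(LINT x|M01. \<bar>f x + g x\<bar> powr p) \<le> (LINT x|M01. (A + B) powr p * (t * (\<bar>f x\<bar> powr p / A powr p) + (1 - t) * (\<bar>g x\<bar> powr p / B powr p)))"
      using p pt Lp_integrable_powr[OF f] Lp_integrable_powr[OF g]
      by (intro integral_mono Lp_integrable_powr[OF Lp_add[OF f g]]) auto
    also have "\<dots> = (A + B) powr p * (t * ((LINT x|M01. \<bar>f x\<bar> powr p) / A powr p) + (1 - t) * ((LINT x|M01. \<bar>g x\<bar> powr p) / B powr p))"
      using Lp_integrable_powr[OF f] Lp_integrable_powr[OF g] by simp
    also have "\<dots> \<le> (A + B) powr p * (t * 1 + (1 - t) * 1)"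
      using If Ig A0 B0 t by (intro mult_left_mono add_mono) auto
    finally show ?thesis using A0 B0 p by (subst lpnorm_le_iff) auto
  qed
  show ?thesis
  proof (rule field_le_epsilon)
    fix e :: real assume "0 < e"
    then show "lpnorm p (\<lambda>x. f x + g x) \<le> lpnorm p f + lpnorm p g + e"
      using *[of "lpnorm p f + e/2" "lpnorm p g + e/2"] by simp
  qed
qed

lemma lpnorm_diff_trans:
  assumes "f \<in> Lp p" "g \<in> Lp p" "h \<in> Lp p" "1 \<le> p"
  shows "lpnorm p (\<lambda>x. f x - h x) \<le> lpnorm p (\<lambda>x. f x - g x) + lpnorm p (\<lambda>x. g x - h x)"
  using lpnorm_triangle[OF Lp_diff[OF assms(1,2)] Lp_diff[OF assms(2,3)]] assms(4) by simp

lemma lpnorm_reverse_triangle: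
  assumes "f \<in> Lp p" "g \<in> Lp p" "1 \<le> p"
  shows "\<bar>lpnorm p f - lpnorm p g\<bar> \<le> lpnorm p (\<lambda>x. f x - g x)"
  using lpnorm_triangle[OF Lp_diff[OF assms(1,2)] assms(2)]
    lpnorm_triangle[OF Lp_diff[OF assms(2,1)] assms(1)] assms(3)
    lpnorm_minus_commute[of p f g] by simp

lemma lpnorm_lin_le:
  assumes "f \<in> Lp p" "g \<in> Lp p" "1 \<le> p"
  shows "lpnorm p (\<lambda>x. a * f x + b * g x) \<le> \<bar>a\<bar> * lpnorm p f + \<bar>b\<bar> * lpnorm p g"
  using lpnorm_triangle[OF Lp_scale[OF assms(1)] Lp_scale[OF assms(2)] assms(3), of a b] assms(3)
  by (simp add: lpnorm_scale)

lemma lpnorm_sum_le: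
  assumes "\<And>i. i \<in> s \<Longrightarrow> f i \<in> Lp p" "1 \<le> p"
  shows "lpnorm p (\<lambda>x. \<Sum>i\<in>s. f i x) \<le> (\<Sum>i\<in>s. lpnorm p (f i))"
  using assms
proof (induction s rule: infinite_finite_induct)
  case (insert i s)
  have "lpnorm p (\<lambda>x. f i x + (\<Sum>i\<in>s. f i x)) \<le> lpnorm p (f i) + lpnorm p (\<lambda>x. \<Sum>i\<in>s. f i x)"
    using insert by (intro lpnorm_triangle Lp_sum) auto
  then show ?case using insert by simp
qed auto

section \<open>Conjugate exponents, Hoelder's inequality and the duality map\<close>

definition conjugate_exponents :: "real \<Rightarrow> real \<Rightarrow> bool" where
  "conjugate_exponents p q \<longleftrightarrow> 1 < p \<and> 1 < q \<and> 1 / p + 1 / q = 1"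

lemma conjugate_exponents_sym: "conjugate_exponents p q \<Longrightarrow> conjugate_exponents q p"
  by (auto simp: conjugate_exponents_def)

lemma conjugate_exponentsD:
  assumes "conjugate_exponents p q"
  shows "1 < p" "1 < q" "p * q = p + q" "(p - 1) * q = p" "1 / p = 1 - 1 / q" "p / q = p - 1"
  using assms unfolding conjugate_exponents_def by (auto simp: field_simps)

lemma conjugate_exponents_exists: "1 < p \<Longrightarrow> conjugate_exponents p (p / (p - 1))"
  by (auto simp: conjugate_exponents_def field_simps)

text \<open>Young's inequality for |f| / A and |g| / B, where \<open>A\<close> and \<open>B\<close>
  exceed the norms, integrates to a bound by \<open>A * B\<close>; then \<open>A\<close> and
  \<open>B\<close> decrease to the norms. The case \<open>A = B = 1\<close> gives integrability of
  the product.\<close>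

theorem Lp_Holder:
  assumes pq: "conjugate_exponents p q" and f: "f \<in> Lp p" and g: "g \<in> Lp q"
  shows "integrable M01 (\<lambda>x. f x * g x)"
    and "(LINT x|M01. \<bar>f x * g x\<bar>) \<le> lpnorm p f * lpnorm q g"
    and "\<bar>LINT x|M01. f x * g x\<bar> \<le> lpnorm p f * lpnorm q g"
proof -
  note pq' = conjugate_exponentsD[OF pq]
  note [measurable] = Lp_measurable[OF f] Lp_measurable[OF g]
  note ints = Lp_integrable_powr[OF f] Lp_integrable_powr[OF g]
  have Y: "\<bar>f x * g x\<bar> \<le> A * B * ((\<bar>f x\<bar> powr p / A powr p) / p + (\<bar>g x\<bar> powr q / B powr q) / q)"
    if "0 < A" "0 < B" for A B x
  proof -
    have "\<bar>f x * g x\<bar> = A * B * ((\<bar>f x\<bar> / A) * (\<bar>g x\<bar> / B))" using that by (simp add: abs_mult)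
    also have "\<dots> \<le> A * B * ((\<bar>f x\<bar> / A) powr p / p + (\<bar>g x\<bar> / B) powr q / q)"
      using that pq by (intro mult_left_mono Youngs_inequality) (auto simp: conjugate_exponents_def)
    finally show ?thesis by (simp add: powr_divide)
  qed
  show I: "integrable M01 (\<lambda>x. f x * g x)"
    apply (rule Bochner_Integration.integrable_bound[of _ "\<lambda>x. \<bar>f x\<bar> powr p / p + \<bar>g x\<bar> powr q / q"])
    subgoal using ints by auto
    subgoal by measurable
    subgoal using Y[of 1 1] pq' by (intro AE_I2) (simp add: abs_mult)
    done
  have *: "(LINT x|M01. \<bar>f x * g x\<bar>) \<le> A * B" if A: "lpnorm p f < A" and B: "lpnorm q g < B" for A B
  proof -
    have A0: "0 < A" and B0: "0 < B" using A B lpnorm_nonneg[of p f] lpnorm_nonneg[of q g] by linarith+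
    have If: "(LINT x|M01. \<bar>f x\<bar> powr p) \<le> A powr p" and Ig: "(LINT x|M01. \<bar>g x\<bar> powr q) \<le> B powr q"
      using lpnorm_le_iff[of p A f] lpnorm_le_iff[of q B g] A B A0 B0 pq' by auto
    have "(LINT x|M01. \<bar>f x * g x\<bar>) \<le> (LINT x|M01. A * B * ((\<bar>f x\<bar> powr p / A powr p) / p + (\<bar>g x\<bar> powr q / B powr q) / q))"
      using Y[OF A0 B0] ints I by (intro integral_mono) auto
    also have "\<dots> = A * B * (((LINT x|M01. \<bar>f x\<bar> powr p) / A powr p) / p + ((LINT x|M01. \<bar>g x\<bar> powr q) / B powr q) / q)"
      using ints by simp
    also have "\<dots> \<le> A * B * (1 / p + 1 / q)"
      using If Ig A0 B0 pq' by (intro mult_left_mono add_mono divide_right_mono) auto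
    finally show ?thesis using pq by (simp add: conjugate_exponents_def)
  qed
  have "((\<lambda>e. (lpnorm p f + e) * (lpnorm q g + e)) \<longlongrightarrow> (lpnorm p f + 0) * (lpnorm q g + 0)) (at_right 0)"
    by (intro tendsto_intros)
  moreover have "\<forall>\<^sub>F e in at_right 0. (LINT x|M01. \<bar>f x * g x\<bar>) \<le> (lpnorm p f + e) * (lpnorm q g + e)"
    using * by (auto simp: eventually_at_filter intro!: always_eventually)
  ultimately show B: "(LINT x|M01. \<bar>f x * g x\<bar>) \<le> lpnorm p f * lpnorm q g"
    using tendsto_lowerbound[of _ _ "at_right (0::real)"] by fastforce
  have "\<bar>LINT x|M01. f x * g x\<bar> \<le> (LINT x|M01. \<bar>f x * g x\<bar>)"
    by (rule integral_abs_bound)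
  from this B show "\<bar>LINT x|M01. f x * g x\<bar> \<le> lpnorm p f * lpnorm q g" by (rule order_trans)
qed

lemma lpnorm_one [simp]: "lpnorm p (\<lambda>x. 1) = 1"
  by (simp add: lpnorm_def)

lemma Lp_integrable:
  assumes "f \<in> Lp p" "1 < p"
  shows "integrable M01 f" "(LINT x|M01. \<bar>f x\<bar>) \<le> lpnorm p f"
  using Lp_Holder[OF conjugate_exponents_exists[OF assms(2)] assms(1), of "\<lambda>x. 1"] assms
  by auto

text \<open>The measure has total mass one, so Hoelder against the constant 1, applied to
  \<open>|f| powr r\<close> in the space of exponent \<open>p / r\<close>, loses no
  constant.\<close>

lemma Lp_exponent_mono:
  assumes f: "f \<in> Lp p" and rp: "1 < r" "r \<le> p"
  shows "f \<in> Lp r" "lpnorm r f \<le> lpnorm p f"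
proof -
  note [measurable] = Lp_measurable[OF f]
  have "f \<in> Lp r \<and> lpnorm r f \<le> lpnorm p f"
  proof (cases "r = p")
    case True then show ?thesis using f by simp
  next
    case False
    then have s: "1 < p / r" using rp by (simp add: field_simps)
    have m: "(\<lambda>x. \<bar>f x\<bar> powr r) \<in> Lp (p / r)"
      using Lp_integrable_powr[OF f] rp by (intro LpI) (auto simp: powr_powr)
    have 1: "f \<in> Lp r" using Lp_integrable(1)[OF m s] by (intro LpI) auto
    have "(LINT x|M01. \<bar>f x\<bar> powr r) \<le> lpnorm (p / r) (\<lambda>x. \<bar>f x\<bar> powr r)"
      using Lp_integrable(2)[OF m s] by simp
    also have "\<dots> = lpnorm p f powr r"
      using rp by (simp add: lpnorm_def powr_powr)
    finally have "lpnorm r f \<le> lpnorm p f" using rp by (subst lpnorm_le_iff) auto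
    with 1 show ?thesis by simp
  qed
  then show "f \<in> Lp r" "lpnorm r f \<le> lpnorm p f" by auto
qed

text \<open>The duality map of $L^p$, up to normalisation.\<close>
definition Jmap :: "real \<Rightarrow> real \<Rightarrow> real" where
  "Jmap p x = sgn x * \<bar>x\<bar> powr (p - 1)"

lemma Jmap_measurable [measurable]: "Jmap p \<in> borel_measurable borel"
  unfolding Jmap_def by measurable

lemma abs_Jmap: "\<bar>Jmap p x\<bar> = \<bar>x\<bar> powr (p - 1)"
  by (cases "x = 0") (auto simp: Jmap_def abs_mult abs_sgn_eq)

lemma mult_Jmap: "x * Jmap p x = \<bar>x\<bar> powr p"
  using powr_mult_base[of "\<bar>x\<bar>" "p - 1"]
  by (cases "x > 0"; cases "x = 0") (auto simp: Jmap_def sgn_real_def)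

lemma Jmap_Lp:
  assumes pq: "conjugate_exponents p q" and f: "f \<in> Lp p"
  shows "(\<lambda>x. Jmap p (f x)) \<in> Lp q"
    and "lpnorm q (\<lambda>x. Jmap p (f x)) = lpnorm p f powr (p - 1)"
    and "(LINT x|M01. f x * Jmap p (f x)) = lpnorm p f powr p"
proof -
  note [measurable] = Lp_measurable[OF f]
  note pq' = conjugate_exponentsD[OF pq]
  show "(\<lambda>x. Jmap p (f x)) \<in> Lp q"
    using Lp_integrable_powr[OF f] pq' by (intro LpI) (auto simp: abs_Jmap powr_powr)
  show "lpnorm q (\<lambda>x. Jmap p (f x)) = lpnorm p f powr (p - 1)"
    using pq' by (simp add: lpnorm_def abs_Jmap powr_powr) (simp add: field_simps)
  show "(LINT x|M01. f x * Jmap p (f x)) = lpnorm p f powr p"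
    using pq' by (simp add: mult_Jmap lpnorm_powr)
qed

text \<open>Up to normalisation the duality map of \<open>f\<close> attains the supremum over
  \<open>g\<close>, so testing there is enough; a factor \<open>lpnorm p f powr (p - 1)\<close> is
  then cancelled.\<close>

lemma lpnorm_le_dual:
  assumes pq: "conjugate_exponents p q" and f: "f \<in> Lp p"
    and C: "\<And>g. g \<in> Lp q \<Longrightarrow> (LINT x|M01. f x * g x) \<le> C * lpnorm q g" "0 \<le> C"
  shows "lpnorm p f \<le> C"
proof (cases "lpnorm p f = 0")
  case False
  have "lpnorm p f powr p \<le> C * lpnorm p f powr (p - 1)"
    using C(1)[OF Jmap_Lp(1)[OF pq f]] Jmap_Lp[OF pq f] by simp
  moreover have "lpnorm p f powr p = lpnorm p f * lpnorm p f powr (p - 1)"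
    by (simp add: powr_mult_base)
  ultimately show ?thesis using False by auto
qed (use C in simp)

lemma Lp_zero_dual:
  assumes pq: "conjugate_exponents p q" and f: "f \<in> Lp p"
    and 0: "\<And>g. g \<in> Lp q \<Longrightarrow> (LINT x|M01. f x * g x) = 0"
  shows "lpnorm p f = 0"
  using lpnorm_le_dual[OF pq f, of 0] 0 lpnorm_nonneg[of p f] by simp

text \<open>Dominated convergence with majorant \<open>3 powr p * |f| powr p\<close>. The factor 2
  in the hypothesis is the one that comes with metric approximation by simple functions, and it also
  covers plain truncations.\<close>

lemma Lp_truncation_tendsto:
  assumes f: "f \<in> Lp p" and p: "1 \<le> p"
    and m: "\<And>i. s i \<in> borel_measurable M01"
    and lim: "\<And>x. x \<in> {0..1} \<Longrightarrow> (\<lambda>i. s i x) \<longlonglongrightarrow> f x"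
    and bd: "\<And>i x. x \<in> {0..1} \<Longrightarrow> \<bar>s i x\<bar> \<le> 2 * \<bar>f x\<bar>"
  shows "(\<lambda>i. lpnorm p (\<lambda>x. f x - s i x)) \<longlonglongrightarrow> 0"
proof -
  note [measurable] = Lp_measurable[OF f] m
  have "(\<lambda>i. LINT x|M01. \<bar>f x - s i x\<bar> powr p) \<longlonglongrightarrow> (LINT x|M01. 0)"
  proof (rule integral_dominated_convergence[where w = "\<lambda>x. 3 powr p * \<bar>f x\<bar> powr p"])
    show "integrable M01 (\<lambda>x. 3 powr p * \<bar>f x\<bar> powr p)"
      using Lp_integrable_powr[OF f] by simp
    show "AE x in M01. (\<lambda>i. \<bar>f x - s i x\<bar> powr p) \<longlonglongrightarrow> 0"
    proof (rule AE_I2)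
      fix x assume "x \<in> space M01"
      then have "(\<lambda>i. \<bar>f x - s i x\<bar>) \<longlonglongrightarrow> \<bar>f x - f x\<bar>"
        using lim[of x] by (intro tendsto_intros) auto
      then show "(\<lambda>i. \<bar>f x - s i x\<bar> powr p) \<longlonglongrightarrow> 0"
        using p by (intro tendsto_zero_powrI[where b = p]) auto
    qed
    show "AE x in M01. norm (\<bar>f x - s i x\<bar> powr p) \<le> 3 powr p * \<bar>f x\<bar> powr p" for i
    proof (rule AE_I2)
      fix x assume "x \<in> space M01"
      then have "\<bar>f x - s i x\<bar> \<le> 3 * \<bar>f x\<bar>" using bd[of x i] by auto
      then have "\<bar>f x - s i x\<bar> powr p \<le> (3 * \<bar>f x\<bar>) powr p" using p by (intro powr_mono2) auto
      then show "norm (\<bar>f x - s i x\<bar> powr p) \<le> 3 powr p * \<bar>f x\<bar> powr p" by (simp add: powr_mult)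
    qed
  qed (use m in measurable)
  then have "(\<lambda>i. (LINT x|M01. \<bar>f x - s i x\<bar> powr p) powr (1 / p)) \<longlonglongrightarrow> 0"
    using p by (intro tendsto_zero_powrI[where b = "1/p"]) auto
  then show ?thesis by (simp add: lpnorm_def)
qed

lemma Lp_simple_dense:
  assumes f: "f \<in> Lp p" and p: "1 \<le> p" and e: "0 < e"
  obtains s where "simple_function M01 s" "s \<in> Lp p" "lpnorm p (\<lambda>x. f x - s x) < e"
proof -
  obtain s where s: "\<And>i. simple_function M01 (s i)"
    "\<And>x. x \<in> space M01 \<Longrightarrow> (\<lambda>i. s i x) \<longlonglongrightarrow> f x"
    "\<And>i x. x \<in> space M01 \<Longrightarrow> dist (s i x) 0 \<le> 2 * dist (f x) 0"
    using borel_measurable_implies_sequence_metric[OF Lp_measurable[OF f], of 0] by metis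
  have m: "s i \<in> borel_measurable M01" for i using s(1) by (rule borel_measurable_simple_function)
  have "(\<lambda>i. lpnorm p (\<lambda>x. f x - s i x)) \<longlonglongrightarrow> 0"
    using s m by (intro Lp_truncation_tendsto[OF f p]) (auto simp: dist_real_def)
  then have "\<forall>\<^sub>F i in sequentially. lpnorm p (\<lambda>x. f x - s i x) < e"
    using e by (rule order_tendstoD)
  then obtain i where i: "lpnorm p (\<lambda>x. f x - s i x) < e" by (auto simp: eventually_sequentially)
  have "s i \<in> Lp p"
    using s p Lp_scale[OF f, of 2] m by (intro Lp_mono[of "s i" "\<lambda>x. 2 * f x"]) (auto simp: abs_mult dist_real_def)
  then show thesis using that[of "s i"] s i by auto
qed

section \<open>The dual of $L^p$\<close>

text \<open>The power bound does two jobs. Along decreasing sequences with empty intersection it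
  forces \<open>\<nu>\<close> to zero, which upgrades finite to countable additivity; and it makes
  null sets \<open>\<nu>\<close>-null, so that a density with respect to \<open>M01\<close>
  exists.\<close>

lemma Radon_Nikodym_set_function:
  fixes \<nu> :: "real set \<Rightarrow> real"
  assumes nonneg: "\<And>A. A \<in> sets M01 \<Longrightarrow> 0 \<le> \<nu> A"
    and add: "\<And>A B. A \<in> sets M01 \<Longrightarrow> B \<in> sets M01 \<Longrightarrow> A \<inter> B = {} \<Longrightarrow> \<nu> (A \<union> B) = \<nu> A + \<nu> B"
    and bound: "\<And>A. A \<in> sets M01 \<Longrightarrow> \<nu> A \<le> C * measure M01 A powr \<alpha>" and \<alpha>: "0 < \<alpha>"
  obtains g where "g \<in> borel_measurable M01" "integrable M01 g"
    "\<And>A. A \<in> sets M01 \<Longrightarrow> \<nu> A = (LINT x|M01. indicator A x * g x)"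
proof -
  define N where "N = measure_of (space M01) (sets M01) (\<lambda>A. ennreal (\<nu> A))"
  have sN [measurable_cong]: "sets N = sets M01"
    unfolding N_def by (rule sets.sets_measure_of_eq)
  have pos: "positive (sets M01) (\<lambda>A. ennreal (\<nu> A))"
    using add[of "{}" "{}"] by (simp add: positive_def)
  have "countably_additive (sets M01) (\<lambda>A. ennreal (\<nu> A))"
  proof (rule sets.empty_continuous_imp_countably_additive[OF pos])
    show "additive (sets M01) (\<lambda>A. ennreal (\<nu> A))"
      by (auto simp: additive_def add nonneg ennreal_plus)
    fix A :: "nat \<Rightarrow> real set" assume A: "range A \<subseteq> sets M01" "decseq A" "(\<Inter>i. A i) = {}"
    have "(\<lambda>i. measure M01 (A i)) \<longlonglongrightarrow> measure M01 (\<Inter>i. A i)"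
      using A by (intro M01.finite_Lim_measure_decseq)
    then have "(\<lambda>i. measure M01 (A i) powr \<alpha>) \<longlonglongrightarrow> 0"
      using A(3) \<alpha> by (intro tendsto_zero_powrI[where b = \<alpha>]) auto
    then have "(\<lambda>i. C * measure M01 (A i) powr \<alpha>) \<longlonglongrightarrow> 0" by (rule tendsto_mult_right_zero)
    from tendsto_sandwich[OF _ _ tendsto_const this, of "\<lambda>i. \<nu> (A i)"] have "(\<lambda>i. \<nu> (A i)) \<longlonglongrightarrow> 0"
      using A nonneg bound by (auto intro!: always_eventually)
    then show "(\<lambda>i. ennreal (\<nu> (A i))) \<longlonglongrightarrow> 0"
      using tendsto_ennrealI by fastforce
  qed simp
  then have eN: "emeasure N A = ennreal (\<nu> A)" if "A \<in> sets M01" for A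
    unfolding N_def using that by (intro emeasure_measure_of_sigma[OF sets.sigma_algebra_axioms pos])
  have "absolutely_continuous M01 N"
  proof (unfold absolutely_continuous_def, rule subsetI)
    fix A assume A: "A \<in> null_sets M01"
    then have m: "measure M01 A = 0" "A \<in> sets M01" by (auto simp: measure_def null_setsD1)
    then have "\<nu> A = 0" using nonneg[OF m(2)] bound[OF m(2)] by simp
    then show "A \<in> null_sets N" using eN[OF m(2)] m sN by (intro null_setsI) auto
  qed
  from M01.Radon_Nikodym[OF this sN] obtain f where f: "f \<in> borel_measurable M01" "density M01 f = N"
    by auto
  note [measurable] = f(1)
  define g where "g = (\<lambda>x. enn2real (f x))"
  have [measurable]: "g \<in> borel_measurable M01" unfolding g_def by measurable
  have fi: "(\<integral>\<^sup>+x. f x * indicator A x \<partial>M01) = ennreal (\<nu> A)" if "A \<in> sets M01" for A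
    using emeasure_density[OF f(1) that] eN[OF that] f(2) by simp
  have "(\<integral>\<^sup>+x. f x \<partial>M01) = (\<integral>\<^sup>+x. f x * indicator (space M01) x \<partial>M01)"
    by (intro nn_integral_cong) auto
  then have fin: "(\<integral>\<^sup>+x. f x \<partial>M01) \<noteq> \<infinity>" using fi[OF sets.top] by simp
  then have "AE x in M01. f x \<noteq> \<infinity>" by (intro nn_integral_PInf_AE) auto
  then have AE: "AE x in M01. f x = ennreal (g x)" by eventually_elim (auto simp: g_def less_top)
  have gi: "(\<integral>\<^sup>+x. ennreal (indicator A x * g x) \<partial>M01) = ennreal (\<nu> A)" if "A \<in> sets M01" for A
    unfolding fi[OF that, symmetric] using AE
    by (intro nn_integral_cong_AE) (auto simp: indicator_def elim!: eventually_mono)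
  have "integrable M01 g"
  proof (rule integrableI_nonneg)
    show "(\<integral>\<^sup>+x. ennreal (g x) \<partial>M01) < \<infinity>"
      using fin nn_integral_cong_AE[OF AE] by (simp add: less_top)
  qed (auto simp: g_def)
  moreover have "\<nu> A = (LINT x|M01. indicator A x * g x)" if A: "A \<in> sets M01" for A
  proof -
    have "(LINT x|M01. indicator A x * g x) = enn2real (\<integral>\<^sup>+x. ennreal (indicator A x * g x) \<partial>M01)"
      using A by (intro integral_eq_nn_integral) (auto simp: g_def)
    then show ?thesis using gi[OF A] nonneg[OF A] by simp
  qed
  ultimately show thesis using that[of g] by auto
qed

lemma indicator_Lp: "A \<in> sets M01 \<Longrightarrow> 0 \<le> p \<Longrightarrow> (\<lambda>x. indicator A x) \<in> Lp p"
  by (rule Lp_bounded[where K = 1]) (auto simp: indicator_def)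

lemma lpnorm_indicator:
  assumes "A \<in> sets M01" "0 < p"
  shows "lpnorm p (\<lambda>x. indicator A x) = measure M01 A powr (1 / p)"
proof -
  have "(LINT x|M01. \<bar>indicator A x\<bar> powr p) = (LINT x|M01. indicator A x)"
    by (intro Bochner_Integration.integral_cong) (auto simp: indicator_def)
  then show ?thesis using assms by (simp add: lpnorm_def) (metis Int_absorb2 sets.sets_into_space space_M01)
qed

text \<open>Compatibility with a.e. equality is extracted from the norm bound: the difference of two
  a.e. equal functions has norm zero.\<close>

lemma dual_LpD:
  assumes \<phi>: "dual_Lp p \<phi>" and p: "1 \<le> p"
  shows "\<And>f g a b. f \<in> Lp p \<Longrightarrow> g \<in> Lp p \<Longrightarrow> \<phi> (\<lambda>y. a * f y + b * g y) = a * \<phi> f + b * \<phi> g"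
    and "\<exists>C\<ge>0. \<forall>f\<in>Lp p. \<bar>\<phi> f\<bar> \<le> C * lpnorm p f"
    and "\<And>f g. f \<in> Lp p \<Longrightarrow> g \<in> Lp p \<Longrightarrow> AE x in M01. f x = g x \<Longrightarrow> \<phi> f = \<phi> g"
    and "\<And>s c u. (\<And>i. i \<in> s \<Longrightarrow> u i \<in> Lp p) \<Longrightarrow> \<phi> (\<lambda>x. \<Sum>i\<in>s. c i * u i x) = (\<Sum>i\<in>s. c i * \<phi> (u i))"
proof -
  show lin: "\<phi> (\<lambda>y. a * f y + b * g y) = a * \<phi> f + b * \<phi> g" if "f \<in> Lp p" "g \<in> Lp p" for f g a b
    using \<phi> that by (auto simp: dual_Lp_def)
  obtain C where "\<forall>f\<in>Lp p. \<bar>\<phi> f\<bar> \<le> C * lpnorm p f" using \<phi> by (auto simp: dual_Lp_def)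
  then have C: "\<forall>f\<in>Lp p. \<bar>\<phi> f\<bar> \<le> \<bar>C\<bar> * lpnorm p f"
    by (meson abs_ge_self lpnorm_nonneg mult_right_mono order_trans)
  then show "\<exists>C\<ge>0. \<forall>f\<in>Lp p. \<bar>\<phi> f\<bar> \<le> C * lpnorm p f" by (intro exI[of _ "\<bar>C\<bar>"]) auto
  show "\<phi> f = \<phi> g" if fg: "f \<in> Lp p" "g \<in> Lp p" "AE x in M01. f x = g x" for f g
  proof -
    have d: "(\<lambda>y. 1 * f y + (-1) * g y) \<in> Lp p" using fg p by (intro Lp_lin) auto
    have "lpnorm p (\<lambda>y. 1 * f y + (-1) * g y) = 0"
      using fg(3) p by (subst lpnorm_eq_0_iff[OF d]) auto
    then have "\<phi> (\<lambda>y. 1 * f y + (-1) * g y) = 0" using C d by fastforce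
    then show ?thesis using lin[OF fg(1,2), of 1 "-1"] by simp
  qed
  have z: "\<phi> (\<lambda>x. 0) = 0" using C p Lp_const[of p 0] by fastforce
  show "\<phi> (\<lambda>x. \<Sum>i\<in>s. c i * u i x) = (\<Sum>i\<in>s. c i * \<phi> (u i))" if "\<And>i. i \<in> s \<Longrightarrow> u i \<in> Lp p" for s :: "'z set" and c u
    using that
  proof (induction s rule: infinite_finite_induct)
    case (insert i s)
    have "\<phi> (\<lambda>x. c i * u i x + 1 * (\<Sum>i\<in>s. c i * u i x)) = c i * \<phi> (u i) + 1 * \<phi> (\<lambda>x. \<Sum>i\<in>s. c i * u i x)"
      using insert p by (intro lin Lp_sum Lp_scale) auto
    then show ?case using insert by simp
  qed (auto simp: z)
qed

text \<open>The signed set function $A \mapsto \varphi(1_A)$ is split into its positive and negative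
  variation, so that the Radon-Nikodym theorem applies to both.\<close>
lemma dual_Lp_density:
  assumes \<phi>: "dual_Lp p \<phi>" and p: "1 \<le> p"
  obtains g where "g \<in> borel_measurable M01" "integrable M01 g"
    "\<And>A. A \<in> sets M01 \<Longrightarrow> \<phi> (\<lambda>x. indicator A x) = (LINT x|M01. indicator A x * g x)"
proof -
  note D = dual_LpD[OF \<phi> p]
  obtain C where C: "0 \<le> C" "\<And>f. f \<in> Lp p \<Longrightarrow> \<bar>\<phi> f\<bar> \<le> C * lpnorm p f" using D(2) by auto
  define \<nu> where "\<nu> A = \<phi> (\<lambda>x. indicator A x)" for A :: "real set"
  have \<nu>b: "\<bar>\<nu> A\<bar> \<le> C * measure M01 A powr (1 / p)" if "A \<in> sets M01" for A
    using C(2)[OF indicator_Lp[OF that, of p]] lpnorm_indicator[OF that, of p] p by (simp add: \<nu>_def)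
  have \<nu>add: "\<nu> (A \<union> B) = \<nu> A + \<nu> B" if "A \<in> sets M01" "B \<in> sets M01" "A \<inter> B = {}" for A B
  proof -
    have "(\<lambda>x. indicator (A \<union> B) x) = (\<lambda>x. 1 * indicator A x + 1 * indicator B x :: real)"
      using that by (auto simp: indicator_def fun_eq_iff)
    then show ?thesis unfolding \<nu>_def using that p by (simp only: D(1) indicator_Lp)
  qed
  define S where "S A = {B \<in> sets M01. B \<subseteq> A}" for A :: "real set"
  \<comment> \<open>The positive variation of \<open>\<nu>\<close> on \<open>A\<close>. It inherits
    the power bound because every competitor lies inside \<open>A\<close>.\<close>
  define P where "P A = (SUP B\<in>S A. \<nu> B)" for A
  have mono: "C * measure M01 B powr (1 / p) \<le> C * measure M01 A powr (1 / p)" if "A \<in> sets M01" "B \<in> S A" for A B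
    using that C(1) p by (intro mult_left_mono powr_mono2 M01.finite_measure_mono) (auto simp: S_def)
  have ub: "\<nu> B \<le> C * measure M01 A powr (1 / p)" if "A \<in> sets M01" "B \<in> S A" for A B
    using \<nu>b[of B] mono[OF that] that by (auto simp: S_def)
  have bdd: "bdd_above (\<nu> ` S A)" if "A \<in> sets M01" for A
    using ub[OF that] by (auto intro!: bdd_aboveI)
  have Pge: "\<nu> B \<le> P A" if "A \<in> sets M01" "B \<in> S A" for A B
    unfolding P_def using bdd that by (intro cSUP_upper) auto
  have ne: "S A \<noteq> {}" for A by (auto simp: S_def)
  have Ple: "P A \<le> c" if "\<And>B. B \<in> S A \<Longrightarrow> \<nu> B \<le> c" for A c
    unfolding P_def using that ne by (intro cSUP_least) auto
  have Padd: "P (A \<union> B) = P A + P B" if AB: "A \<in> sets M01" "B \<in> sets M01" "A \<inter> B = {}" for A B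
  proof (rule antisym)
    show "P (A \<union> B) \<le> P A + P B"
    proof (rule Ple)
      fix E assume E: "E \<in> S (A \<union> B)"
      then have "E = (E \<inter> A) \<union> (E \<inter> B)" by (auto simp: S_def)
      moreover have "\<nu> ((E \<inter> A) \<union> (E \<inter> B)) = \<nu> (E \<inter> A) + \<nu> (E \<inter> B)"
        using E AB by (intro \<nu>add) (auto simp: S_def)
      moreover have "\<nu> (E \<inter> A) \<le> P A" "\<nu> (E \<inter> B) \<le> P B"
        using E AB by (auto intro!: Pge simp: S_def)
      ultimately show "\<nu> E \<le> P A + P B" by simp
    qed
    have "P A \<le> P (A \<union> B) - P B"
    proof (rule Ple)
      fix E assume E: "E \<in> S A"
      have "P B \<le> P (A \<union> B) - \<nu> E"
      proof (rule Ple)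
        fix F assume F: "F \<in> S B"
        have "\<nu> (E \<union> F) = \<nu> E + \<nu> F" using E F AB by (intro \<nu>add) (auto simp: S_def)
        moreover have "\<nu> (E \<union> F) \<le> P (A \<union> B)" using E F AB by (intro Pge) (auto simp: S_def)
        ultimately show "\<nu> F \<le> P (A \<union> B) - \<nu> E" by simp
      qed
      then show "\<nu> E \<le> P (A \<union> B) - P B" by simp
    qed
    then show "P A + P B \<le> P (A \<union> B)" by simp
  qed
  have \<nu>0: "\<nu> {} = 0" using \<nu>b[of "{}"] p by simp
  have P0: "0 \<le> P A" if "A \<in> sets M01" for A
    using Pge[OF that, of "{}"] \<nu>0 by (simp add: S_def)
  have Pb: "P A \<le> C * measure M01 A powr (1 / p)" if "A \<in> sets M01" for A
    using ub[OF that] by (rule Ple)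
  obtain g1 where g1: "g1 \<in> borel_measurable M01" "integrable M01 g1"
    "\<And>A. A \<in> sets M01 \<Longrightarrow> P A = (LINT x|M01. indicator A x * g1 x)"
    using Radon_Nikodym_set_function[of P C "1 / p"] P0 Padd Pb p by auto
  \<comment> \<open>The negative variation, written as a difference so that additivity and the power
    bound are inherited; nonnegativity comes from the competitor \<open>A\<close> itself in the
    supremum.\<close>
  define Q where "Q A = P A - \<nu> A" for A
  have Q0: "0 \<le> Q A" if "A \<in> sets M01" for A using Pge[OF that, of A] that by (simp add: Q_def S_def)
  have Qadd: "Q (A \<union> B) = Q A + Q B" if "A \<in> sets M01" "B \<in> sets M01" "A \<inter> B = {}" for A B
    using Padd[OF that] \<nu>add[OF that] by (simp add: Q_def)
  have Qb: "Q A \<le> (2 * C) * measure M01 A powr (1 / p)" if "A \<in> sets M01" for A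
    using Pb[OF that] \<nu>b[OF that] by (simp add: Q_def)
  obtain g2 where g2: "g2 \<in> borel_measurable M01" "integrable M01 g2"
    "\<And>A. A \<in> sets M01 \<Longrightarrow> Q A = (LINT x|M01. indicator A x * g2 x)"
    using Radon_Nikodym_set_function[of Q "2 * C" "1 / p"] Q0 Qadd Qb p by auto
  have [simp]: "integrable M01 (\<lambda>x. indicator A x * g1 x)" "integrable M01 (\<lambda>x. indicator A x * g2 x)"
    if "A \<in> sets M01" for A
    using integrable_mult_indicator[OF that g1(2)] integrable_mult_indicator[OF that g2(2)] by simp_all
  show thesis
  proof (rule that[of "\<lambda>x. g1 x - g2 x"])
    fix A assume A: "A \<in> sets M01"
    have "\<nu> A = P A - Q A" by (simp add: Q_def)
    also have "\<dots> = (LINT x|M01. indicator A x * g1 x - indicator A x * g2 x)"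
      using A g1(3) g2(3) by simp
    finally show "\<phi> (\<lambda>x. indicator A x) = (LINT x|M01. indicator A x * (g1 x - g2 x))"
      by (simp add: \<nu>_def right_diff_distrib)
  qed (use g1 g2 in auto)
qed

text \<open>The density from \<open>dual_Lp_density\<close> is at first only integrable. The
  representation is extended from simple to bounded functions and then tested on truncations of the
  duality map of \<open>g\<close>; this gives \<open>g \<in> Lp q\<close>, after which truncation of
  \<open>f\<close> reaches all of \<open>Lp p\<close>.\<close>

theorem Lp_Riesz:
  assumes pq: "conjugate_exponents p q" and \<phi>: "dual_Lp p \<phi>"
  obtains g where "g \<in> Lp q" "\<And>f. f \<in> Lp p \<Longrightarrow> \<phi> f = (LINT x|M01. f x * g x)"
proof -
  note pq' = conjugate_exponentsD[OF pq]
  have p: "1 \<le> p" using pq'(1,2) by simp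
  note D = dual_LpD[OF \<phi> p]
  obtain C where C: "0 \<le> C" "\<And>f. f \<in> Lp p \<Longrightarrow> \<bar>\<phi> f\<bar> \<le> C * lpnorm p f" using D(2) by auto
  obtain g where g[measurable]: "g \<in> borel_measurable M01" and gi: "integrable M01 g"
    and ind: "\<And>A. A \<in> sets M01 \<Longrightarrow> \<phi> (\<lambda>x. indicator A x) = (LINT x|M01. indicator A x * g x)"
    using dual_Lp_density[OF \<phi> p] by blast
  have cont: "(\<lambda>i. \<phi> (s i)) \<longlonglongrightarrow> \<phi> f"
    if f: "f \<in> Lp p" and s: "\<And>i. s i \<in> borel_measurable M01"
      "\<And>x. x \<in> {0..1} \<Longrightarrow> (\<lambda>i. s i x) \<longlonglongrightarrow> f x"
      "\<And>i x. x \<in> {0..1} \<Longrightarrow> \<bar>s i x\<bar> \<le> 2 * \<bar>f x\<bar>" for s f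
  proof -
    have sL: "s i \<in> Lp p" for i
      using s p by (intro Lp_mono[OF s(1) Lp_scale[OF f, of 2]]) (auto simp: abs_mult)
    have "(\<lambda>i. C * lpnorm p (\<lambda>x. f x - s i x)) \<longlonglongrightarrow> 0"
      by (rule tendsto_mult_right_zero) (rule Lp_truncation_tendsto[OF f p s])
    moreover have bnd: "norm (\<phi> f - \<phi> (s i)) \<le> C * lpnorm p (\<lambda>x. f x - s i x)" for i
    proof -
      have "(\<lambda>x. f x - s i x) \<in> Lp p" using Lp_diff[OF f sL[of i]] p by simp
      then show ?thesis using D(1)[OF f sL[of i], of 1 "-1"] C(2)[of "\<lambda>x. f x - s i x"] by simp
    qed
    ultimately have "(\<lambda>i. \<phi> f - \<phi> (s i)) \<longlonglongrightarrow> 0"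
      by (intro Lim_null_comparison[OF always_eventually[OF allI[OF bnd]]])
    from tendsto_diff[OF tendsto_const[of "\<phi> f"] this] show ?thesis by simp
  qed
  have simple: "\<phi> s = (LINT x|M01. s x * g x)" if s: "simple_function M01 s" for s
  proof -
    let ?E = "\<lambda>y. s -` {y} \<inter> space M01"
    have E: "?E y \<in> sets M01" for y using s by (rule simple_functionD)
    have fin: "finite (s ` space M01)" using s by (rule simple_functionD)
    have rep: "s x = (\<Sum>y\<in>s ` space M01. y * indicator (?E y) x)" if "x \<in> space M01" for x
    proof -
      have "(\<Sum>y\<in>s ` space M01. y * indicator (?E y) x) = (\<Sum>y\<in>s ` space M01. if s x = y then y else 0)"
        using that by (intro sum.cong) (simp_all add: indicator_def)
      also have "\<dots> = s x" by (subst sum.delta'[OF fin]) (use that in simp)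
      finally show ?thesis by simp
    qed
    have [measurable]: "s \<in> borel_measurable M01" using s by (rule borel_measurable_simple_function)
    have L: "(\<lambda>x. \<Sum>y\<in>s ` space M01. y * indicator (?E y) x) \<in> Lp p"
      using E p by (intro Lp_sum Lp_scale indicator_Lp) auto
    have AE: "AE x in M01. (\<Sum>y\<in>s ` space M01. y * indicator (?E y) x) = s x"
      by (rule AE_I2) (rule rep[symmetric])
    have sL: "s \<in> Lp p" using Lp_cong_AE[OF L _ AE] by simp
    have "\<phi> s = \<phi> (\<lambda>x. \<Sum>y\<in>s ` space M01. y * indicator (?E y) x)"
      using D(3)[OF L sL AE] by simp
    also have "\<dots> = (\<Sum>y\<in>s ` space M01. y * \<phi> (\<lambda>x. indicator (?E y) x))"
      using E p by (intro D(4) indicator_Lp) auto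
    also have "\<dots> = (\<Sum>y\<in>s ` space M01. y * (LINT x|M01. indicator (?E y) x * g x))"
      using ind[OF E] by simp
    also have "\<dots> = (LINT x|M01. (\<Sum>y\<in>s ` space M01. y * (indicator (?E y) x * g x)))"
      using integrable_mult_indicator[OF E gi] by (subst Bochner_Integration.integral_sum) auto
    also have "\<dots> = (LINT x|M01. s x * g x)"
    proof (intro Bochner_Integration.integral_cong refl)
      fix x assume "x \<in> space M01"
      from arg_cong[OF rep[OF this], of "\<lambda>t. t * g x"]
      show "(\<Sum>y\<in>s ` space M01. y * (indicator (?E y) x * g x)) = s x * g x"
        by (simp only: sum_distrib_right mult.assoc)
    qed
    finally show ?thesis .
  qed
  have bounded: "\<phi> h = (LINT x|M01. h x * g x)"
    if h[measurable]: "h \<in> borel_measurable M01" and K: "\<And>x. x \<in> {0..1} \<Longrightarrow> \<bar>h x\<bar> \<le> K" for h K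
  proof -
    obtain s where s: "\<And>i. simple_function M01 (s i)"
      "\<And>x. x \<in> space M01 \<Longrightarrow> (\<lambda>i. s i x) \<longlonglongrightarrow> h x"
      "\<And>i x. x \<in> space M01 \<Longrightarrow> dist (s i x) 0 \<le> 2 * dist (h x) 0"
      using borel_measurable_implies_sequence_metric[OF h, of 0] by metis
    have m[measurable]: "s i \<in> borel_measurable M01" for i using s(1) by (rule borel_measurable_simple_function)
    have hL: "h \<in> Lp p" using h K p by (intro Lp_bounded[where K = K]) auto
    have 1: "(\<lambda>i. \<phi> (s i)) \<longlonglongrightarrow> \<phi> h" using s by (intro cont[OF hL m]) (auto simp: dist_real_def)
    have "(\<lambda>i. LINT x|M01. s i x * g x) \<longlonglongrightarrow> (LINT x|M01. h x * g x)"
    proof (rule integral_dominated_convergence[where w = "\<lambda>x. 2 * K * \<bar>g x\<bar>"])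
      show "integrable M01 (\<lambda>x. 2 * K * \<bar>g x\<bar>)" using gi by simp
      show "AE x in M01. (\<lambda>i. s i x * g x) \<longlonglongrightarrow> h x * g x"
        using s by (intro AE_I2 tendsto_intros) auto
      show "AE x in M01. norm (s i x * g x) \<le> 2 * K * \<bar>g x\<bar>" for i
      proof (rule AE_I2)
        fix x assume x: "x \<in> space M01"
        have "\<bar>s i x\<bar> \<le> 2 * K" using s(3)[OF x, of i] K[of x] x by (auto simp: dist_real_def)
        then show "norm (s i x * g x) \<le> 2 * K * \<bar>g x\<bar>" by (simp add: abs_mult mult_right_mono)
      qed
    qed measurable
    then show ?thesis using 1 simple[OF s(1)] LIMSEQ_unique by auto
  qed
  have "integrable M01 (\<lambda>x. \<bar>g x\<bar> powr q)"
  proof -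
    \<comment> \<open>\<open>h n\<close> is the truncated duality map of \<open>g\<close>, so that
      both \<open>h n * g\<close> and \<open>|h n| powr p\<close> equal \<open>k n\<close>. With
      \<open>I\<close> the integral of \<open>k n\<close>, the bound on \<open>\<phi>\<close>
      becomes \<open>I \<le> C * I powr (1 / p)\<close>, hence \<open>I powr (1 / q) \<le> C\<close>
      uniformly in \<open>n\<close>.\<close>
    define h where "h n x = (if \<bar>g x\<bar> \<le> real n then Jmap q (g x) else 0)" for n x
    define k where "k n x = (if \<bar>g x\<bar> \<le> real n then \<bar>g x\<bar> powr q else 0)" for n x
    have hm[measurable]: "h n \<in> borel_measurable M01" for n unfolding h_def by measurable
    have km[measurable]: "k n \<in> borel_measurable M01" for n unfolding k_def by measurable
    have hK: "\<bar>h n x\<bar> \<le> real n powr (q - 1)" for n x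
      using pq'(1,2) by (auto simp: h_def abs_Jmap intro!: powr_mono2)
    have kint: "integrable M01 (k n)" for n
    proof (rule M01.integrable_const_bound[where B = "real n powr q"])
      show "AE x in M01. norm (k n x) \<le> real n powr q"
        using pq'(1,2) by (intro AE_I2) (auto simp: k_def intro!: powr_mono2)
    qed measurable
    have hL: "h n \<in> Lp p" for n using hK p by (intro Lp_bounded[where K = "real n powr (q - 1)"]) auto
    have kI: "(LINT x|M01. k n x) \<le> C powr q" for n
    proof (cases "(LINT x|M01. k n x) = 0")
      case True then show ?thesis by simp
    next
      case False
      define I where "I = (LINT x|M01. k n x)"
      have "0 \<le> I" unfolding I_def by (intro integral_nonneg_AE AE_I2) (auto simp: k_def)
      then have I0: "0 < I" using False by (simp add: I_def)
      have "\<phi> (h n) = (LINT x|M01. h n x * g x)" using hK by (intro bounded[where K = "real n powr (q - 1)"]) auto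
      also have "\<dots> = I" unfolding I_def
        using mult_Jmap[of _ q] by (intro Bochner_Integration.integral_cong) (auto simp: h_def k_def mult.commute)
      finally have "I \<le> C * lpnorm p (h n)" using C(2)[OF hL, of n] by simp
      also have "lpnorm p (h n) = I powr (1 / p)"
      proof -
        have "\<bar>h n x\<bar> powr p = k n x" for x
          using pq'(1,2)
          by (simp add: h_def k_def abs_Jmap powr_powr conjugate_exponentsD(4)[OF conjugate_exponents_sym[OF pq]])
        then show ?thesis by (simp add: lpnorm_def I_def)
      qed
      also have "\<dots> = I * I powr (- (1 / q))"
        using I0 powr_add[of I 1 "- (1 / q)"] by (simp add: pq'(5))
      finally have "I powr (1 / q) \<le> C" using I0 by (simp add: powr_minus field_simps)
      then have "(I powr (1 / q)) powr q \<le> C powr q" using pq'(1,2) by (intro powr_mono2) auto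
      then show ?thesis using I0 pq'(1,2) by (simp add: powr_powr I_def)
    qed
    have mono: "k m x \<le> k n x" if "m \<le> n" for m n x using that by (auto simp: k_def)
    have "incseq (\<lambda>n. LINT x|M01. k n x)"
      using mono kint by (intro incseq_SucI integral_mono) auto
    then obtain L where L: "(\<lambda>n. LINT x|M01. k n x) \<longlonglongrightarrow> L"
      using kI incseq_convergent[of _ "C powr q"] by blast
    show ?thesis
    proof (rule integrable_monotone_convergence[where f = k and x = L])
      show "AE x in M01. (\<lambda>i. k i x) \<longlonglongrightarrow> \<bar>g x\<bar> powr q"
      proof (rule AE_I2, rule tendsto_eventually)
        fix x
        obtain N :: nat where "\<bar>g x\<bar> \<le> real N" using real_arch_simple by blast
        then show "\<forall>\<^sub>F i in sequentially. k i x = \<bar>g x\<bar> powr q"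
          by (intro eventually_sequentiallyI[of N]) (auto simp: k_def)
      qed
    qed (use kint L mono in \<open>auto simp: mono_def\<close>)
  qed
  then have gL: "g \<in> Lp q" by (intro LpI) auto
  have "\<phi> f = (LINT x|M01. f x * g x)" if f: "f \<in> Lp p" for f
  proof -
    define s where "s n x = (if \<bar>f x\<bar> \<le> real n then f x else 0)" for n x
    note [measurable] = Lp_measurable[OF f]
    have sm[measurable]: "s n \<in> borel_measurable M01" for n unfolding s_def by measurable
    have lim: "(\<lambda>n. s n x) \<longlonglongrightarrow> f x" for x
    proof (rule tendsto_eventually)
      obtain N :: nat where "\<bar>f x\<bar> \<le> real N" using real_arch_simple by blast
      then show "\<forall>\<^sub>F i in sequentially. s i x = f x"
        by (intro eventually_sequentiallyI[of N]) (auto simp: s_def)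
    qed
    have 1: "(\<lambda>i. \<phi> (s i)) \<longlonglongrightarrow> \<phi> f" using lim by (intro cont[OF f sm]) (auto simp: s_def)
    have 2: "\<phi> (s i) = (LINT x|M01. s i x * g x)" for i
      by (rule bounded[where K = "real i"]) (auto simp: s_def)
    have "(\<lambda>i. LINT x|M01. s i x * g x) \<longlonglongrightarrow> (LINT x|M01. f x * g x)"
    proof (rule integral_dominated_convergence[where w = "\<lambda>x. \<bar>f x * g x\<bar>"])
      show "integrable M01 (\<lambda>x. \<bar>f x * g x\<bar>)" using Lp_Holder(1)[OF pq f gL] by simp
      show "AE x in M01. (\<lambda>i. s i x * g x) \<longlonglongrightarrow> f x * g x"
        using lim by (intro AE_I2 tendsto_intros) auto
      show "AE x in M01. norm (s i x * g x) \<le> \<bar>f x * g x\<bar>" for i by (intro AE_I2) (auto simp: s_def)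
    qed measurable
    then show ?thesis using 1 2 LIMSEQ_unique by auto
  qed
  then show thesis using that gL by blast
qed

lemma dual_Lp_pairing:
  assumes pq: "conjugate_exponents p q" and g: "g \<in> Lp q"
  shows "dual_Lp p (\<lambda>f. LINT x|M01. f x * g x)"
  unfolding dual_Lp_def
proof (intro conjI ballI allI exI[of _ "lpnorm q g"])
  fix f h a b assume "f \<in> Lp p" "h \<in> Lp p"
  then show "(LINT x|M01. (a * f x + b * h x) * g x) = a * (LINT x|M01. f x * g x) + b * (LINT x|M01. h x * g x)"
    using Lp_Holder(1)[OF pq _ g] by (simp add: distrib_right mult.assoc)
next
  fix f assume "f \<in> Lp p"
  then show "\<bar>LINT x|M01. f x * g x\<bar> \<le> lpnorm q g * lpnorm p f"
    using Lp_Holder(3)[OF pq _ g] by (simp add: mult.commute)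
qed

section \<open>Ultrafilters\<close>

lemma ultrafilter_dichotomy:
  assumes U: "nonprincipal_ultrafilter U"
  shows "(\<forall>\<^sub>F n in U. P n) \<or> (\<forall>\<^sub>F n in U. \<not> P n)"
proof -
  have "(\<forall>\<^sub>F n in U. n \<in> Collect P) \<or> (\<forall>\<^sub>F n in U. n \<notin> Collect P)"
    using U unfolding nonprincipal_ultrafilter_def by blast
  then show ?thesis by simp
qed

text \<open>Compactness of the interval gives a cluster point of the image filter, and the
  ultrafilter dichotomy turns a cluster point into a limit.\<close>

lemma ultrafilter_convergent:
  fixes x :: "nat \<Rightarrow> real"
  assumes U: "nonprincipal_ultrafilter U" and C: "\<forall>\<^sub>F n in U. \<bar>x n\<bar> \<le> C"
  obtains l where "(x \<longlongrightarrow> l) U"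
proof -
  have "filtermap x U \<noteq> bot" using U by (simp add: nonprincipal_ultrafilter_def filtermap_bot_iff)
  moreover have "\<forall>\<^sub>F y in filtermap x U. y \<in> {-C..C}"
    using C by (auto simp: eventually_filtermap elim!: eventually_mono)
  ultimately obtain l where l: "inf (nhds l) (filtermap x U) \<noteq> bot"
    using compact_Icc[of "-C" C] unfolding compact_filter by blast
  have "(x \<longlongrightarrow> l) U"
  proof (rule topological_tendstoI, rule ccontr)
    fix S assume S: "open S" "l \<in> S" "\<not> (\<forall>\<^sub>F n in U. x n \<in> S)"
    then have "\<forall>\<^sub>F n in U. x n \<notin> S"
      using ultrafilter_dichotomy[OF U, of "\<lambda>n. x n \<in> S"] by blast
    then have "eventually (\<lambda>y. y \<notin> S) (filtermap x U)" by (simp add: eventually_filtermap)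
    moreover have "eventually (\<lambda>y. y \<in> S) (nhds l)" using S by (intro eventually_nhds_in_open)
    ultimately have "eventually (\<lambda>y. False) (inf (nhds l) (filtermap x U))"
      unfolding eventually_inf by blast
    then show False using l by (simp add: trivial_limit_def)
  qed
  then show thesis by (rule that)
qed

lemma nonprincipal_ultrafilterD:
  assumes U: "nonprincipal_ultrafilter U"
  shows "U \<noteq> bot" "\<And>P. (\<forall>\<^sub>F n in U. P n) \<or> (\<forall>\<^sub>F n in U. \<not> P n)" "\<And>k. \<forall>\<^sub>F n in U. n > k"
    "\<And>A. \<forall>\<^sub>F n in U. n \<in> A \<Longrightarrow> infinite A" "U \<le> sequentially"
proof -
  show 1: "U \<noteq> bot" using U by (simp add: nonprincipal_ultrafilter_def)
  show 2: "(\<forall>\<^sub>F n in U. P n) \<or> (\<forall>\<^sub>F n in U. \<not> P n)" for P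
    using ultrafilter_dichotomy[OF U] .
  have ne: "\<forall>\<^sub>F n in U. n \<noteq> k" for k
    using 2[of "\<lambda>n. n = k"] U by (auto simp: nonprincipal_ultrafilter_def)
  have fin: "\<forall>\<^sub>F n in U. n \<notin> A" if "finite A" for A :: "nat set"
    using eventually_ball_finite[OF that, of "\<lambda>n k. n \<noteq> k" U] ne by (auto elim!: eventually_mono)
  show 3: "\<forall>\<^sub>F n in U. n > k" for k
    using fin[of "{..k}"] by (auto elim!: eventually_mono)
  show "infinite A" if A: "\<forall>\<^sub>F n in U. n \<in> A" for A
  proof
    assume "finite A"
    then have "\<forall>\<^sub>F n in U. False" using fin[of A] A by (auto elim: eventually_elim2)
    with 1 show False by (simp add: trivial_limit_def)
  qed
  have "filterlim (\<lambda>n::nat. n) sequentially U"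
    unfolding filterlim_at_top by (intro allI, rule eventually_mono[OF 3 less_imp_le])
  then show "U \<le> sequentially" by (simp add: filterlim_def filtermap_ident)
qed

lemma selective_nonprincipal: "selective_ultrafilter U \<Longrightarrow> nonprincipal_ultrafilter U"
  unfolding selective_ultrafilter_def by (rule conjunct1)

text \<open>The P-point property yields the conclusion for $n$ large compared to $m$; the
  Q-point property then thins out the set so that it meets every second interval of a fast
  growing partition in one point.\<close>
theorem selective_diagonal:
  fixes B :: "nat \<Rightarrow> nat set"
  assumes U: "selective_ultrafilter U" and B: "\<And>m. \<forall>\<^sub>F n in U. n \<in> B m"
  shows "\<exists>A. (\<forall>\<^sub>F n in U. n \<in> A) \<and> (\<forall>m\<in>A. \<forall>n\<in>A. m < n \<longrightarrow> n \<in> B m)"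
proof -
  have np: "nonprincipal_ultrafilter U" by (rule selective_nonprincipal[OF U])
  note N = nonprincipal_ultrafilterD[OF np]
  \<comment> \<open>A decreasing version of \<open>B\<close>: membership at a later index yields
    membership at all earlier ones, so a comparison made at an interval endpoint serves every
    \<open>m\<close> below it.\<close>
  define B' where "B' m = (\<Inter>k\<in>{..m}. B k)" for m
  have "\<forall>\<^sub>F n in U. n \<in> B' m" for m
    using B eventually_ball_finite[of "{..m}" "\<lambda>n k. n \<in> B k" U] by (simp add: B'_def)
  moreover have "(\<forall>k. \<forall>\<^sub>F n in U. n \<in> B' k) \<longrightarrow> (\<exists>A. (\<forall>\<^sub>F n in U. n \<in> A) \<and> (\<forall>k. finite (A - B' k)))"
    using U unfolding selective_ultrafilter_def by (elim conjE) (rule spec[of _ B'])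
  ultimately obtain A0 where A0: "\<forall>\<^sub>F n in U. n \<in> A0" "\<And>k. finite (A0 - B' k)"
    by auto
  have "\<exists>b>k. \<forall>n\<in>A0. b \<le> n \<longrightarrow> n \<in> B' k" for k
  proof -
    obtain b where "\<And>n. n \<in> A0 - B' k \<Longrightarrow> n < b"
      using A0(2)[of k] unfolding finite_nat_iff_bounded by auto
    then have "n \<in> B' k" if "n \<in> A0" "max b (Suc k) \<le> n" for n
      using that by (meson DiffI leD max.boundedE)
    moreover have "max b (Suc k) > k" by simp
    ultimately show ?thesis by blast
  qed
  then obtain h where h: "\<And>k. h k > k" "\<And>k n. n \<in> A0 \<Longrightarrow> h k \<le> n \<Longrightarrow> n \<in> B' k" by metis
  \<comment> \<open>Each endpoint is the threshold \<open>h\<close> of the preceding one; two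
    elements of \<open>A0\<close> with a full interval between them are therefore far enough
    apart.\<close>
  define x where "x j = (h ^^ j) 0" for j :: nat
  have x0: "x 0 = 0" and xS: "x (Suc j) = h (x j)" for j by (auto simp: x_def)
  have xm: "strict_mono x" by (rule strict_monoI_Suc) (simp add: xS h)
  define I where "I j = {x j..<x (Suc j)}" for j
  have disj: "I k \<inter> I l = {}" if "k < l" for k l
  proof -
    have "x (Suc k) \<le> x l" using xm that by (simp add: strict_mono_less_eq)
    then show ?thesis by (auto simp: I_def)
  qed
  have cover: "\<exists>j. n \<in> I j" for n
  proof -
    have ex: "\<exists>j. n < x (Suc j)" using strict_mono_imp_increasing[OF xm, of "Suc n"]
      by (intro exI[of _ n]) simp
    define j where "j = (LEAST j. n < x (Suc j))"
    have "n < x (Suc j)" unfolding j_def using ex by (rule LeastI_ex)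
    moreover have "x j \<le> n"
    proof (cases j)
      case (Suc i)
      then show ?thesis using not_less_Least[of i "\<lambda>j. n < x (Suc j)"] by (simp add: j_def[symmetric] not_less)
    qed (simp add: x0)
    ultimately show ?thesis by (auto simp: I_def)
  qed
  have "\<exists>A. (\<forall>\<^sub>F n in U. n \<in> A) \<and> (\<forall>k. \<exists>m. A \<inter> I k = {m})"
  proof -
    have "finite (I k) \<and> I k \<noteq> {}" for k using xm by (simp add: I_def strict_mono_less)
    moreover have "I k \<inter> I l = {}" if "k \<noteq> l" for k l
      using that disj[of k l] disj[of l k] by (cases "k < l") (simp_all add: Int_commute)
    moreover have "(\<Union>k. I k) = UNIV" using cover by blast
    moreover have "((\<forall>k. finite (I k) \<and> I k \<noteq> {}) \<and> (\<forall>k l. k \<noteq> l \<longrightarrow> I k \<inter> I l = {}) \<and> (\<Union>k. I k) = UNIV)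
        \<longrightarrow> (\<exists>A. (\<forall>\<^sub>F n in U. n \<in> A) \<and> (\<forall>k. \<exists>m. A \<inter> I k = {m}))"
      using U unfolding selective_ultrafilter_def by (elim conjE) (rule spec[of _ I])
    ultimately show ?thesis by simp
  qed
  then obtain A1 where A1: "\<forall>\<^sub>F n in U. n \<in> A1" "\<And>k. \<exists>m. A1 \<inter> I k = {m}" by blast
  \<comment> \<open>One of the two parity classes of intervals has its union in the ultrafilter;
    restricting to it leaves a gap interval between any two selected points.\<close>
  obtain Q :: "nat \<Rightarrow> bool" where Q: "\<forall>\<^sub>F n in U. \<exists>j. Q j \<and> n \<in> I j" "\<And>j. Q j \<Longrightarrow> \<not> Q (Suc j)"
  proof (cases "\<forall>\<^sub>F n in U. \<exists>j. even j \<and> n \<in> I j")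
    case True then show ?thesis using that[of even] by auto
  next
    case False
    then have "\<forall>\<^sub>F n in U. \<not> (\<exists>j. even j \<and> n \<in> I j)" using N(2) by blast
    then have "\<forall>\<^sub>F n in U. \<exists>j. odd j \<and> n \<in> I j" using cover by (auto elim!: eventually_mono)
    then show ?thesis using that[of odd] by auto
  qed
  define A where "A = {n \<in> A0 \<inter> A1. \<exists>j. Q j \<and> n \<in> I j}"
  have "\<forall>\<^sub>F n in U. n \<in> A" using A0(1) A1(1) Q(1) by eventually_elim (simp add: A_def)
  moreover have "n \<in> B m" if mn: "m \<in> A" "n \<in> A" "m < n" for m n
  proof -
    obtain j l where j: "Q j" "m \<in> I j" and l: "Q l" "n \<in> I l" using mn by (auto simp: A_def)
    have "j \<noteq> l"
    proof
      assume "j = l"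
      then have "{m, n} \<subseteq> A1 \<inter> I j" using mn j l by (auto simp: A_def)
      then show False using A1(2)[of j] mn(3) by (metis insert_subset less_irrefl singletonD)
    qed
    moreover have "\<not> l < j"
    proof
      assume "l < j"
      then have "x (Suc l) \<le> x j" using xm by (simp add: strict_mono_less_eq)
      then show False using j l mn(3) by (auto simp: I_def)
    qed
    ultimately have "j < l" by simp
    then have "Suc (Suc j) \<le> l" using Q(2)[OF j(1)] l(1) by (cases "l = Suc j") auto
    then have "x (Suc (Suc j)) \<le> x l" using xm by (simp add: strict_mono_less_eq)
    then have "h (x (Suc j)) \<le> n" using l by (simp add: xS I_def)
    then have "n \<in> B' (x (Suc j))" using h(2) mn by (auto simp: A_def)
    moreover have "m \<le> x (Suc j)" using j by (simp add: I_def)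
    ultimately show ?thesis by (auto simp: B'_def)
  qed
  ultimately show ?thesis by blast
qed

section \<open>Ultrapowers of $L^p$\<close>

lemma UP_Lp: "F \<in> UP p \<Longrightarrow> F n \<in> Lp p"
  by (simp add: UP_def)

lemma UP_bound: "F \<in> UP p \<Longrightarrow> \<exists>C\<ge>0. \<forall>n. lpnorm p (F n) \<le> C"
  unfolding UP_def by (auto intro: order_trans[OF lpnorm_nonneg])

lemma UPI: "(\<And>n. F n \<in> Lp p) \<Longrightarrow> (\<And>n. lpnorm p (F n) \<le> C) \<Longrightarrow> F \<in> UP p"
  unfolding UP_def by blast

lemma UP_const: "f \<in> Lp p \<Longrightarrow> (\<lambda>n. f) \<in> UP p"
  by (rule UPI[where C = "lpnorm p f"]) auto

lemma UP_lin:
  assumes F: "F \<in> UP p" and G: "G \<in> UP p" and p: "1 \<le> p"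
  shows "(\<lambda>n x. a * F n x + b * G n x) \<in> UP p"
proof -
  obtain C D where C: "\<And>n. lpnorm p (F n) \<le> C" and D: "\<And>n. lpnorm p (G n) \<le> D"
    using UP_bound[OF F] UP_bound[OF G] by blast
  show ?thesis
  proof (rule UPI)
    fix n
    show "(\<lambda>x. a * F n x + b * G n x) \<in> Lp p" using UP_Lp[OF F] UP_Lp[OF G] p by (intro Lp_lin) auto
    have "lpnorm p (\<lambda>x. a * F n x + b * G n x) \<le> \<bar>a\<bar> * lpnorm p (F n) + \<bar>b\<bar> * lpnorm p (G n)"
      using UP_Lp[OF F] UP_Lp[OF G] p by (intro lpnorm_lin_le)
    also have "\<dots> \<le> \<bar>a\<bar> * C + \<bar>b\<bar> * D" using C D by (intro add_mono mult_left_mono) auto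
    finally show "lpnorm p (\<lambda>x. a * F n x + b * G n x) \<le> \<bar>a\<bar> * C + \<bar>b\<bar> * D" .
  qed
qed

lemma UP_add: "F \<in> UP p \<Longrightarrow> G \<in> UP p \<Longrightarrow> 1 \<le> p \<Longrightarrow> (\<lambda>n x. F n x + G n x) \<in> UP p"
  using UP_lin[of F p G 1 1] by simp

lemma UP_diff: "F \<in> UP p \<Longrightarrow> G \<in> UP p \<Longrightarrow> 1 \<le> p \<Longrightarrow> (\<lambda>n x. F n x - G n x) \<in> UP p"
  using UP_lin[of F p G 1 "-1"] by simp

lemma UP_scale: "F \<in> UP p \<Longrightarrow> 1 \<le> p \<Longrightarrow> (\<lambda>n x. a * F n x) \<in> UP p"
  using UP_lin[of F p F a 0] by simp

lemma UP_zero: "1 \<le> p \<Longrightarrow> (\<lambda>n x. 0) \<in> UP p"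
  by (rule UP_const) simp

lemma UP_sum:
  assumes "\<And>i. i \<in> s \<Longrightarrow> F i \<in> UP p" "1 \<le> p"
  shows "(\<lambda>n x. \<Sum>i\<in>s. F i n x) \<in> UP p"
  using assms
proof (induction s rule: infinite_finite_induct)
  case (insert i s)
  have "(\<lambda>n x. F i n x + (\<Sum>i\<in>s. F i n x)) \<in> UP p" using insert by (intro UP_add) auto
  then show ?case using insert by simp
qed (auto simp: UP_zero)

lemma UP_exponent_mono:
  assumes F: "F \<in> UP p" and r: "1 < r" "r \<le> p"
  shows "F \<in> UP r"
proof -
  obtain C where C: "\<And>n. lpnorm p (F n) \<le> C" using UP_bound[OF F] by blast
  show ?thesis
  proof (rule UPI)
    fix n
    show "F n \<in> Lp r" by (rule Lp_exponent_mono[OF UP_Lp[OF F] r])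
    show "lpnorm r (F n) \<le> C" by (rule order_trans[OF Lp_exponent_mono(2)[OF UP_Lp[OF F] r] C])
  qed
qed

lemma UP_uniformly_bounded:
  assumes "\<And>n. H n \<in> borel_measurable M01" "\<And>n x. x \<in> {0..1} \<Longrightarrow> \<bar>H n x\<bar> \<le> K" "0 < p"
  shows "H \<in> UP p"
proof (rule UPI)
  have K: "0 \<le> K" using assms(2)[of 0 0] by simp
  show "H n \<in> Lp p" for n using assms by (intro Lp_bounded[where K = K]) auto
  show "lpnorm p (H n) \<le> K" for n using assms K by (intro lpnorm_bounded) auto
qed

section \<open>The duality pairing, weak limits and annihilators in the ultrapower\<close>

definition upair :: "nat filter \<Rightarrow> useq \<Rightarrow> useq \<Rightarrow> real" where
  "upair U F G = Lim U (\<lambda>n. LINT x|M01. F n x * G n x)"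

lemma upair_commute: "upair U F G = upair U G F"
  by (simp add: upair_def mult.commute)

text \<open>The conjugate exponent is spelled out so that the weak limit depends on
  \<open>p\<close>, \<open>U\<close> and \<open>F\<close> alone. The choice operator fixes one
  representative of an a.e. class; it is unique up to norm zero by
  \<open>lpnorm_wlim_unique\<close>.\<close>

definition wlim :: "real \<Rightarrow> nat filter \<Rightarrow> useq \<Rightarrow> real \<Rightarrow> real" where
  "wlim p U F = (SOME f. f \<in> Lp p \<and>
     (\<forall>g\<in>Lp (p / (p - 1)). (LINT x|M01. f x * g x) = upair U F (\<lambda>n. g)))"

text \<open>All subspaces of interest are brought into this form: annihilators are closed, and a WOT
  limit of operators that preserve one preserves it too
  (\<open>wot_closure_annih_invariant\<close>).\<close>

definition annih :: "real \<Rightarrow> nat filter \<Rightarrow> useq set \<Rightarrow> useq set" where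
  "annih p U S = {F \<in> UP p. \<forall>G\<in>S. upair U F G = 0}"

locale ultra =
  fixes U :: "nat filter"
  assumes nonprincipal: "nonprincipal_ultrafilter U"
begin

lemmas U_ne_bot = nonprincipal_ultrafilterD(1)[OF nonprincipal]
lemmas U_gt = nonprincipal_ultrafilterD(3)[OF nonprincipal]
lemmas U_infinite = nonprincipal_ultrafilterD(4)[OF nonprincipal]
lemmas U_le_sequentially = nonprincipal_ultrafilterD(5)[OF nonprincipal]

lemma LimI: "(f \<longlongrightarrow> (l::real)) U \<Longrightarrow> Lim U f = l"
  using U_ne_bot by (rule tendsto_Lim)

lemma bounded_tendsto_Lim:
  fixes x :: "nat \<Rightarrow> real"
  assumes "\<And>n. \<bar>x n\<bar> \<le> C"
  shows "(x \<longlongrightarrow> Lim U x) U"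
proof -
  have "\<forall>\<^sub>F n in U. \<bar>x n\<bar> \<le> C" using assms by simp
  then obtain l where "(x \<longlongrightarrow> l) U" by (rule ultrafilter_convergent[OF nonprincipal])
  then show ?thesis using LimI by simp
qed

lemma eventually_ex: "\<forall>\<^sub>F n in U. P n \<Longrightarrow> \<exists>n. P n"
  by (rule eventually_happens'[OF U_ne_bot])

lemma sequentially_tendsto: "x \<longlonglongrightarrow> (l::real) \<Longrightarrow> (x \<longlongrightarrow> l) U"
  using U_le_sequentially by (rule tendsto_mono)

lemma unorm_tendsto:
  assumes "F \<in> UP p"
  shows "((\<lambda>n. lpnorm p (F n)) \<longlongrightarrow> unorm p U F) U"
proof -
  obtain C where "\<And>n. lpnorm p (F n) \<le> C" using UP_bound[OF assms] by blast
  then show ?thesis unfolding unorm_def by (intro bounded_tendsto_Lim[where C = C]) simp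
qed

lemma unorm_le:
  assumes "F \<in> UP p" "\<forall>\<^sub>F n in U. lpnorm p (F n) \<le> c"
  shows "unorm p U F \<le> c"
  by (rule tendsto_upperbound[OF unorm_tendsto[OF assms(1)] assms(2) U_ne_bot])

lemma unorm_nonneg: "F \<in> UP p \<Longrightarrow> 0 \<le> unorm p U F"
  by (rule tendsto_lowerbound[OF unorm_tendsto _ U_ne_bot]) auto

lemma unorm_const: "unorm p U (\<lambda>n. f) = lpnorm p f"
  unfolding unorm_def by (rule LimI) simp

lemma unorm_lin_le:
  assumes F: "F \<in> UP p" and G: "G \<in> UP p" and p: "1 \<le> p"
  shows "unorm p U (\<lambda>n x. a * F n x + b * G n x) \<le> \<bar>a\<bar> * unorm p U F + \<bar>b\<bar> * unorm p U G"
proof (rule tendsto_le[OF U_ne_bot])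
  show "((\<lambda>n. \<bar>a\<bar> * lpnorm p (F n) + \<bar>b\<bar> * lpnorm p (G n)) \<longlongrightarrow> \<bar>a\<bar> * unorm p U F + \<bar>b\<bar> * unorm p U G) U"
    by (intro tendsto_intros unorm_tendsto F G)
  show "((\<lambda>n. lpnorm p (\<lambda>x. a * F n x + b * G n x)) \<longlongrightarrow> unorm p U (\<lambda>n x. a * F n x + b * G n x)) U"
    by (intro unorm_tendsto UP_lin F G p)
  show "\<forall>\<^sub>F n in U. lpnorm p (\<lambda>x. a * F n x + b * G n x) \<le> \<bar>a\<bar> * lpnorm p (F n) + \<bar>b\<bar> * lpnorm p (G n)"
    by (intro always_eventually allI lpnorm_lin_le UP_Lp F G p)
qed

lemma unorm_scale:
  assumes F: "F \<in> UP p" and p: "1 \<le> p"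
  shows "unorm p U (\<lambda>n x. a * F n x) = \<bar>a\<bar> * unorm p U F"
proof -
  have "((\<lambda>n. \<bar>a\<bar> * lpnorm p (F n)) \<longlongrightarrow> \<bar>a\<bar> * unorm p U F) U"
    by (intro tendsto_intros unorm_tendsto F)
  then show ?thesis unfolding unorm_def[of p U "\<lambda>n x. a * F n x"]
    using p by (intro LimI) (simp add: lpnorm_scale)
qed

lemma unorm_triangle:
  assumes "F \<in> UP p" "G \<in> UP p" "1 \<le> p"
  shows "unorm p U (\<lambda>n x. F n x + G n x) \<le> unorm p U F + unorm p U G"
  using unorm_lin_le[OF assms, of 1 1] by simp

lemma unorm_diff_trans:
  assumes "F \<in> UP p" "G \<in> UP p" "H \<in> UP p" "1 \<le> p"
  shows "unorm p U (\<lambda>n x. F n x - H n x) \<le> unorm p U (\<lambda>n x. F n x - G n x) + unorm p U (\<lambda>n x. G n x - H n x)"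
  using unorm_triangle[OF UP_diff[OF assms(1,2,4)] UP_diff[OF assms(2,3,4)] assms(4)] by simp

lemma unorm_minus_commute: "unorm p U (\<lambda>n x. F n x - G n x) = unorm p U (\<lambda>n x. G n x - F n x)"
  unfolding unorm_def by (subst lpnorm_minus_commute) (rule refl)

lemma ueq_iff:
  assumes "F \<in> UP p" "G \<in> UP p" "1 \<le> p"
  shows "ueq p U F G \<longleftrightarrow> unorm p U (\<lambda>n x. F n x - G n x) = 0"
proof -
  have "((\<lambda>n. lpnorm p (\<lambda>x. F n x - G n x)) \<longlongrightarrow> unorm p U (\<lambda>n x. F n x - G n x)) U"
    by (intro unorm_tendsto UP_diff assms)
  then show ?thesis unfolding ueq_def fun_diff_def using tendsto_unique[OF U_ne_bot] by auto
qed

lemma uzero_iff: "1 \<le> p \<Longrightarrow> F \<in> uzero p U \<longleftrightarrow> F \<in> UP p \<and> unorm p U F = 0"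
  by (auto simp: uzero_def ueq_iff UP_zero)

lemma pairing_tendsto:
  assumes pq: "conjugate_exponents p q" and F: "F \<in> UP p" and G: "G \<in> UP q"
  shows "((\<lambda>n. LINT x|M01. F n x * G n x) \<longlongrightarrow> upair U F G) U"
proof -
  obtain C D where C: "\<And>n. lpnorm p (F n) \<le> C" "0 \<le> C" and D: "\<And>n. lpnorm q (G n) \<le> D"
    using UP_bound[OF F] UP_bound[OF G] by blast
  have "\<bar>LINT x|M01. F n x * G n x\<bar> \<le> C * D" for n
    using Lp_Holder(3)[OF pq UP_Lp[OF F] UP_Lp[OF G], of n n] mult_mono[OF C(1)[of n] D[of n] C(2) lpnorm_nonneg] by linarith
  then show ?thesis unfolding upair_def by (rule bounded_tendsto_Lim)
qed

lemma upair_lin_left: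
  assumes pq: "conjugate_exponents p q" and F: "F \<in> UP p" and F': "F' \<in> UP p" and G: "G \<in> UP q"
  shows "upair U (\<lambda>n x. a * F n x + b * F' n x) G = a * upair U F G + b * upair U F' G"
proof -
  have "((\<lambda>n. a * (LINT x|M01. F n x * G n x) + b * (LINT x|M01. F' n x * G n x)) \<longlongrightarrow> a * upair U F G + b * upair U F' G) U"
    by (intro tendsto_intros pairing_tendsto[OF pq] F F' G)
  moreover have "(LINT x|M01. (a * F n x + b * F' n x) * G n x) = a * (LINT x|M01. F n x * G n x) + b * (LINT x|M01. F' n x * G n x)" for n
    using Lp_Holder(1)[OF pq UP_Lp[OF F] UP_Lp[OF G], of n n] Lp_Holder(1)[OF pq UP_Lp[OF F'] UP_Lp[OF G], of n n]
    by (simp add: distrib_right mult.assoc)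
  ultimately show ?thesis unfolding upair_def[of U "\<lambda>n x. a * F n x + b * F' n x"] by (intro LimI) simp
qed

lemma upair_lin_right:
  assumes pq: "conjugate_exponents p q" and "F \<in> UP p" "G \<in> UP q" "G' \<in> UP q"
  shows "upair U F (\<lambda>n x. a * G n x + b * G' n x) = a * upair U F G + b * upair U F G'"
  using upair_lin_left[OF conjugate_exponents_sym[OF pq] assms(3,4,2)] by (simp add: upair_commute[of U F])

lemma upair_diff_left:
  assumes "conjugate_exponents p q" "F \<in> UP p" "F' \<in> UP p" "G \<in> UP q"
  shows "upair U (\<lambda>n x. F n x - F' n x) G = upair U F G - upair U F' G"
  using upair_lin_left[OF assms, of 1 "-1"] by simp

lemma upair_add_left:
  assumes "conjugate_exponents p q" "F \<in> UP p" "F' \<in> UP p" "G \<in> UP q"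
  shows "upair U (\<lambda>n x. F n x + F' n x) G = upair U F G + upair U F' G"
  using upair_lin_left[OF assms, of 1 1] by simp

lemma upair_diff_right:
  assumes "conjugate_exponents p q" "F \<in> UP p" "G \<in> UP q" "G' \<in> UP q"
  shows "upair U F (\<lambda>n x. G n x - G' n x) = upair U F G - upair U F G'"
  using upair_lin_right[OF assms, of 1 "-1"] by simp

lemma upair_zero_left: "upair U (\<lambda>n x. 0) G = 0"
  unfolding upair_def by (rule LimI) simp

lemma upair_sum_left:
  assumes pq: "conjugate_exponents p q" and F: "\<And>i. i \<in> s \<Longrightarrow> F i \<in> UP p" and G: "G \<in> UP q"
  shows "upair U (\<lambda>n x. \<Sum>i\<in>s. c i * F i n x) G = (\<Sum>i\<in>s. c i * upair U (F i) G)"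
  using F
proof (induction s rule: infinite_finite_induct)
  case (insert i s)
  have p: "1 \<le> p" using conjugate_exponentsD(1)[OF pq] by simp
  have "upair U (\<lambda>n x. c i * F i n x + 1 * (\<Sum>i\<in>s. c i * F i n x)) G = c i * upair U (F i) G + 1 * upair U (\<lambda>n x. \<Sum>i\<in>s. c i * F i n x) G"
    using insert p by (intro upair_lin_left[OF pq] UP_sum UP_scale G) auto
  then show ?case using insert by simp
qed (auto simp: upair_zero_left)

lemma upair_sum_right:
  assumes pq: "conjugate_exponents p q" and "\<And>i. i \<in> s \<Longrightarrow> G i \<in> UP q" and "F \<in> UP p"
  shows "upair U F (\<lambda>n x. \<Sum>i\<in>s. c i * G i n x) = (\<Sum>i\<in>s. c i * upair U F (G i))"
  using upair_sum_left[OF conjugate_exponents_sym[OF pq] assms(2,3)] by (simp add: upair_commute[of U F])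

lemma upair_bound:
  assumes pq: "conjugate_exponents p q" and F: "F \<in> UP p" and G: "G \<in> UP q"
  shows "\<bar>upair U F G\<bar> \<le> unorm p U F * unorm q U G"
proof (rule tendsto_le[OF U_ne_bot])
  show "((\<lambda>n. lpnorm p (F n) * lpnorm q (G n)) \<longlongrightarrow> unorm p U F * unorm q U G) U"
    by (intro tendsto_intros unorm_tendsto F G)
  show "((\<lambda>n. \<bar>LINT x|M01. F n x * G n x\<bar>) \<longlongrightarrow> \<bar>upair U F G\<bar>) U"
    by (intro tendsto_intros pairing_tendsto[OF pq] F G)
  show "\<forall>\<^sub>F n in U. \<bar>LINT x|M01. F n x * G n x\<bar> \<le> lpnorm p (F n) * lpnorm q (G n)"
    by (intro always_eventually allI Lp_Holder(3)[OF pq] UP_Lp F G)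
qed

lemma upair_null_left:
  assumes "conjugate_exponents p q" "F \<in> UP p" "G \<in> UP q" "unorm p U F = 0"
  shows "upair U F G = 0"
  using upair_bound[OF assms(1-3)] assms(4) by simp

lemma upair_ueq_left:
  assumes pq: "conjugate_exponents p q" and F: "F \<in> UP p" "F' \<in> UP p" "G \<in> UP q" and e: "ueq p U F F'"
  shows "upair U F G = upair U F' G"
proof -
  have p: "1 \<le> p" using conjugate_exponentsD(1)[OF pq] by simp
  have "upair U (\<lambda>n x. F n x - F' n x) G = 0"
    using e F p by (intro upair_null_left[OF pq] UP_diff) (auto simp: ueq_iff)
  then show ?thesis using upair_diff_left[OF pq F] by simp
qed

text \<open>Weak compactness through reflexivity:
  \<open>\<lambda>g. upair U F (\<lambda>n. g)\<close> is a bounded functional on the conjugate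
  space, and the Riesz theorem represents it by a function in \<open>Lp p\<close>.\<close>

lemma wlim_exists:
  assumes pq: "conjugate_exponents p q" and F: "F \<in> UP p"
  shows "\<exists>f. f \<in> Lp p \<and> (\<forall>g\<in>Lp q. (LINT x|M01. f x * g x) = upair U F (\<lambda>n. g))"
proof -
  note qp = conjugate_exponents_sym[OF pq]
  have "dual_Lp q (\<lambda>g. upair U F (\<lambda>n. g))"
    unfolding dual_Lp_def
  proof (intro conjI ballI allI exI[of _ "unorm p U F"])
    fix f g a b assume fg: "f \<in> Lp q" "g \<in> Lp q"
    show "upair U F (\<lambda>n y. a * f y + b * g y) = a * upair U F (\<lambda>n. f) + b * upair U F (\<lambda>n. g)"
      by (rule upair_lin_right[OF pq F UP_const[OF fg(1)] UP_const[OF fg(2)]])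
  next
    fix f assume f: "f \<in> Lp q"
    show "\<bar>upair U F (\<lambda>n. f)\<bar> \<le> unorm p U F * lpnorm q f"
      using upair_bound[OF pq F UP_const[OF f]] by (simp add: unorm_const)
  qed
  then obtain f where "f \<in> Lp p" "\<And>g. g \<in> Lp q \<Longrightarrow> upair U F (\<lambda>n. g) = (LINT x|M01. g x * f x)"
    using Lp_Riesz[OF qp] by blast
  then show ?thesis by (intro exI[of _ f]) (auto simp: mult.commute)
qed

lemma conjugate_unique: "conjugate_exponents p q \<Longrightarrow> p / (p - 1) = q"
  unfolding conjugate_exponents_def by (auto simp: field_simps)

lemma wlim:
  assumes pq: "conjugate_exponents p q" and F: "F \<in> UP p"
  shows wlim_Lp: "wlim p U F \<in> Lp p"
    and wlim_pairing: "\<And>g. g \<in> Lp q \<Longrightarrow> (LINT x|M01. wlim p U F x * g x) = upair U F (\<lambda>n. g)"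
  using someI_ex[OF wlim_exists[OF pq F]] unfolding wlim_def conjugate_unique[OF pq] by auto

lemma upair_const: "upair U (\<lambda>n. f) (\<lambda>n. g) = (LINT x|M01. f x * g x)"
  unfolding upair_def by (rule LimI) simp

lemma wlim_upair:
  assumes pq: "conjugate_exponents p q" and F: "F \<in> UP p" and g: "g \<in> Lp q"
  shows "upair U (\<lambda>n. wlim p U F) (\<lambda>n. g) = upair U F (\<lambda>n. g)"
  using wlim_pairing[OF assms] by (simp add: upair_const)

lemma lpnorm_wlim_le:
  assumes pq: "conjugate_exponents p q" and F: "F \<in> UP p"
  shows "lpnorm p (wlim p U F) \<le> unorm p U F"
proof (rule lpnorm_le_dual[OF pq wlim_Lp[OF pq F] _ unorm_nonneg[OF F]])
  fix g assume g: "g \<in> Lp q"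
  show "(LINT x|M01. wlim p U F x * g x) \<le> unorm p U F * lpnorm q g"
    using wlim_pairing[OF pq F g] upair_bound[OF pq F UP_const[OF g]] by (simp add: unorm_const)
qed

lemma lpnorm_wlim_unique:
  assumes pq: "conjugate_exponents p q" and F: "F \<in> UP p" and f: "f \<in> Lp p"
    and e: "\<And>g. g \<in> Lp q \<Longrightarrow> upair U F (\<lambda>n. g) = (LINT x|M01. f x * g x)"
  shows "lpnorm p (\<lambda>x. wlim p U F x - f x) = 0"
proof (rule Lp_zero_dual[OF pq])
  have p: "0 \<le> p" using conjugate_exponentsD(1)[OF pq] by simp
  show "(\<lambda>x. wlim p U F x - f x) \<in> Lp p" by (rule Lp_diff[OF wlim_Lp[OF pq F] f p])
  fix g assume g: "g \<in> Lp q"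
  show "(LINT x|M01. (wlim p U F x - f x) * g x) = 0"
    using Lp_Holder(1)[OF pq wlim_Lp[OF pq F] g] Lp_Holder(1)[OF pq f g] wlim_pairing[OF pq F g] e[OF g]
    by (simp add: left_diff_distrib)
qed

text \<open>By the Riesz theorem the functionals in the definition of \<open>Lhat\<close> are
  pairings with fixed functions, so weak nullity becomes annihilation of constant sequences.\<close>

lemma Lhat_iff:
  assumes pq: "conjugate_exponents p q"
  shows "F \<in> Lhat p U \<longleftrightarrow> F \<in> UP p \<and> (\<forall>g\<in>Lp q. upair U F (\<lambda>n. g) = 0)"
proof (intro iffI conjI ballI)
  assume F: "F \<in> Lhat p U"
  then show "F \<in> UP p" by (simp add: Lhat_def)
  fix g assume "g \<in> Lp q"
  then have "((\<lambda>n. LINT x|M01. F n x * g x) \<longlongrightarrow> 0) U"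
    using F dual_Lp_pairing[OF pq, of g] unfolding Lhat_def by blast
  then show "upair U F (\<lambda>n. g) = 0" unfolding upair_def by (rule LimI)
next
  assume F: "F \<in> UP p \<and> (\<forall>g\<in>Lp q. upair U F (\<lambda>n. g) = 0)"
  show "F \<in> Lhat p U" unfolding Lhat_def
  proof (intro CollectI conjI allI impI)
    fix \<phi> assume "dual_Lp p \<phi>"
    then obtain g where g: "g \<in> Lp q" "\<And>f. f \<in> Lp p \<Longrightarrow> \<phi> f = (LINT x|M01. f x * g x)"
      using Lp_Riesz[OF pq] by blast
    have "((\<lambda>n. LINT x|M01. F n x * g x) \<longlongrightarrow> upair U F (\<lambda>n. g)) U"
      using pairing_tendsto[OF pq conjunct1[OF F] UP_const[OF g(1)]] .
    then show "((\<lambda>n. \<phi> (F n)) \<longlongrightarrow> 0) U" using F g UP_Lp[of F p] by simp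
  qed (use F in simp)
qed

lemma Lhat_UP: "F \<in> Lhat p U \<Longrightarrow> F \<in> UP p"
  by (simp add: Lhat_def)

lemma Lhat_const:
  assumes pq: "conjugate_exponents p q" and F: "F \<in> Lhat p U" and g: "g \<in> Lp q"
  shows "upair U F (\<lambda>n. g) = 0" "upair U (\<lambda>n. g) F = 0" "((\<lambda>n. LINT x|M01. F n x * g x) \<longlongrightarrow> 0) U"
proof -
  show "upair U F (\<lambda>n. g) = 0" using F g Lhat_iff[OF pq] by blast
  then show "upair U (\<lambda>n. g) F = 0" "((\<lambda>n. LINT x|M01. F n x * g x) \<longlongrightarrow> 0) U"
    using pairing_tendsto[OF pq Lhat_UP[OF F] UP_const[OF g]] by (simp_all add: upair_commute)
qed

lemma Lhat_lin:
  assumes pq: "conjugate_exponents p q" and F: "F \<in> Lhat p U" "G \<in> Lhat p U"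
  shows "(\<lambda>n x. a * F n x + b * G n x) \<in> Lhat p U"
proof -
  have p: "1 \<le> p" using conjugate_exponentsD(1)[OF pq] by simp
  show ?thesis
    using F p unfolding Lhat_iff[OF pq] by (auto simp: upair_lin_left[OF pq] UP_const intro!: UP_lin)
qed

lemma hat_Lhat:
  assumes pq: "conjugate_exponents p q" and F: "F \<in> UP p"
  shows "(\<lambda>n x. F n x - wlim p U F x) \<in> Lhat p U"
proof -
  have p: "1 \<le> p" using conjugate_exponentsD(1)[OF pq] by simp
  note W = UP_const[OF wlim_Lp[OF pq F]]
  show ?thesis unfolding Lhat_iff[OF pq]
    using upair_diff_left[OF pq F W] wlim_upair[OF pq F] UP_diff[OF F W p] by (auto simp: UP_const)
qed

text \<open>The duality map has degree \<open>p - 1\<close>, so it takes bounded sequences to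
  bounded sequences, and termwise norming survives the limit along \<open>U\<close>.\<close>

lemma norming:
  assumes pq: "conjugate_exponents p q" and F: "F \<in> UP p"
  shows "(\<lambda>n x. Jmap p (F n x)) \<in> UP q" "upair U F (\<lambda>n x. Jmap p (F n x)) = unorm p U F powr p"
proof -
  have p: "1 < p" using conjugate_exponentsD(1)[OF pq] by simp
  obtain C where C: "\<And>n. lpnorm p (F n) \<le> C" using UP_bound[OF F] by blast
  show "(\<lambda>n x. Jmap p (F n x)) \<in> UP q"
  proof (rule UPI)
    fix n
    show "(\<lambda>x. Jmap p (F n x)) \<in> Lp q" by (rule Jmap_Lp[OF pq UP_Lp[OF F]])
    have "lpnorm p (F n) powr (p - 1) \<le> C powr (p - 1)" using C p by (intro powr_mono2) auto
    then show "lpnorm q (\<lambda>x. Jmap p (F n x)) \<le> C powr (p - 1)" using Jmap_Lp(2)[OF pq UP_Lp[OF F]] by simp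
  qed
  have "((\<lambda>n. lpnorm p (F n) powr p) \<longlongrightarrow> unorm p U F powr p) U"
    using p by (intro tendsto_powr' unorm_tendsto F tendsto_const) auto
  then show "upair U F (\<lambda>n x. Jmap p (F n x)) = unorm p U F powr p"
    unfolding upair_def using Jmap_Lp(3)[OF pq UP_Lp[OF F]] by (intro LimI) simp
qed

text \<open>The weak limit of the norming sequence can be subtracted for free, because a weakly null
  \<open>F\<close> pairs to zero with constants.\<close>

lemma Lhat_separation:
  assumes pq: "conjugate_exponents p q" and F: "F \<in> Lhat p U" and nz: "unorm p U F \<noteq> 0"
  obtains G where "G \<in> Lhat q U" "upair U F G \<noteq> 0"
proof -
  note FU = Lhat_UP[OF F] and qp = conjugate_exponents_sym[OF pq]
  let ?J = "\<lambda>n x. Jmap p (F n x)"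
  note J = norming[OF pq FU]
  note W = wlim_Lp[OF qp J(1)]
  have "upair U F (\<lambda>n x. ?J n x - wlim q U ?J x) = unorm p U F powr p"
    using upair_diff_right[OF pq FU J(1) UP_const[OF W]] J(2) Lhat_const(1)[OF pq F W] by simp
  then show thesis using that[OF hat_Lhat[OF qp J(1)]] nz by simp
qed

lemma annihD: "F \<in> annih p U S \<Longrightarrow> G \<in> S \<Longrightarrow> upair U F G = 0"
  by (simp add: annih_def)

lemma closed_usub_annih:
  assumes pq: "conjugate_exponents p q" and S: "S \<subseteq> UP q"
  shows "closed_usub p U (annih p U S)"
proof -
  have p: "1 \<le> p" using conjugate_exponentsD(1)[OF pq] by simp
  have SU: "G \<in> UP q" if "G \<in> S" for G using S that by blast
  show ?thesis unfolding closed_usub_def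
  proof (intro conjI ballI allI impI)
    show "annih p U S \<subseteq> UP p" by (auto simp: annih_def)
    show "(\<lambda>n x. 0) \<in> annih p U S" using p by (simp add: annih_def UP_zero upair_zero_left)
  next
    fix F G assume "F \<in> annih p U S" "G \<in> UP p" "ueq p U F G"
    then show "G \<in> annih p U S" using upair_ueq_left[OF pq _ _ SU, of F G] by (simp add: annih_def)
  next
    fix F G a b assume "F \<in> annih p U S" "G \<in> annih p U S"
    then show "(\<lambda>n x. a * F n x + b * G n x) \<in> annih p U S"
      using p by (auto simp: annih_def upair_lin_left[OF pq _ _ SU] intro!: UP_lin)
  next
    fix G assume G: "G \<in> UP p" "\<forall>\<epsilon>>0. \<exists>F\<in>annih p U S. unorm p U (uminus_seq G F) < \<epsilon>"
    have "upair U G H = 0" if H: "H \<in> S" for H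
    proof (rule ccontr)
      assume "upair U G H \<noteq> 0"
      define C where "C = unorm q U H + 1"
      have C: "0 < C" using unorm_nonneg[OF SU[OF H]] by (simp add: C_def)
      then have "0 < \<bar>upair U G H\<bar> / C" using \<open>upair U G H \<noteq> 0\<close> by simp
      then obtain F where F: "F \<in> annih p U S" "unorm p U (uminus_seq G F) < \<bar>upair U G H\<bar> / C"
        using G(2) by blast
      have FU: "F \<in> UP p" using F(1) by (simp add: annih_def)
      have n0: "0 \<le> unorm p U (\<lambda>n x. G n x - F n x)" by (intro unorm_nonneg UP_diff G(1) FU p)
      have "\<bar>upair U G H\<bar> = \<bar>upair U (\<lambda>n x. G n x - F n x) H\<bar>"
        using upair_diff_left[OF pq G(1) FU SU[OF H]] annihD[OF F(1) H] by simp
      also have "\<dots> \<le> unorm p U (\<lambda>n x. G n x - F n x) * unorm q U H"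
        by (intro upair_bound[OF pq] UP_diff G(1) FU SU[OF H] p)
      also have "\<dots> \<le> unorm p U (\<lambda>n x. G n x - F n x) * C"
        using n0 by (intro mult_left_mono) (auto simp: C_def)
      also have "\<dots> < \<bar>upair U G H\<bar>" using F(2) C by (simp add: uminus_seq_def field_simps)
      finally show False by simp
    qed
    then show "G \<in> annih p U S" using G(1) by (simp add: annih_def)
  qed
qed

lemma Lhat_annih:
  assumes "conjugate_exponents p q"
  shows "Lhat p U = annih p U ((\<lambda>g n. g) ` Lp q)"
  unfolding annih_def using Lhat_iff[OF assms] by auto

lemma wlim_decomposition:
  assumes pq: "conjugate_exponents p q" and F: "F \<in> UP p" and G: "G \<in> Lhat q U"
  shows "upair U (\<lambda>n x. F n x - wlim p U F x) G = upair U F G"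
  using upair_diff_left[OF pq F UP_const[OF wlim_Lp[OF pq F]] Lhat_UP[OF G]]
    Lhat_const(2)[OF conjugate_exponents_sym[OF pq] G wlim_Lp[OF pq F]] by simp

lemma LpC_iff_wlim:
  assumes pq: "conjugate_exponents p q" and F: "F \<in> UP p"
  shows "F \<in> LpC p U \<longleftrightarrow> unorm p U (\<lambda>n x. F n x - wlim p U F x) = 0"
proof
  have p: "1 \<le> p" using conjugate_exponentsD(1)[OF pq] by simp
  assume "F \<in> LpC p U"
  then obtain f where f: "f \<in> Lp p" "ueq p U F (\<lambda>n. f)" by (auto simp: LpC_def)
  show "unorm p U (\<lambda>n x. F n x - wlim p U F x) = 0"
  proof (rule ccontr)
    assume "unorm p U (\<lambda>n x. F n x - wlim p U F x) \<noteq> 0"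
    then obtain G where G: "G \<in> Lhat q U" "upair U (\<lambda>n x. F n x - wlim p U F x) G \<noteq> 0"
      using Lhat_separation[OF pq hat_Lhat[OF pq F]] by blast
    moreover have "upair U F G = upair U (\<lambda>n. f) G"
      by (intro upair_ueq_left[OF pq F UP_const[OF f(1)] Lhat_UP[OF G(1)] f(2)])
    ultimately show False
      using wlim_decomposition[OF pq F G(1)] Lhat_const(2)[OF conjugate_exponents_sym[OF pq] G(1) f(1)] by simp
  qed
next
  assume "unorm p U (\<lambda>n x. F n x - wlim p U F x) = 0"
  then have "ueq p U F (\<lambda>n. wlim p U F)"
    using F UP_const[OF wlim_Lp[OF pq F]] conjugate_exponentsD(1)[OF pq] by (simp add: ueq_iff)
  then show "F \<in> LpC p U" using F wlim_Lp[OF pq F] by (auto simp: LpC_def)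
qed

text \<open>Subtracting the weak limit does not change pairings with weakly null \<open>G\<close>.
  Hence if \<open>F\<close> annihilates all of them, so does its weakly null part, which is then
  null by \<open>Lhat_separation\<close>.\<close>

lemma LpC_annih:
  assumes pq: "conjugate_exponents p q"
  shows "LpC p U = annih p U (Lhat q U)"
proof (intro equalityI subsetI)
  fix F assume F: "F \<in> LpC p U"
  then have FU: "F \<in> UP p" by (simp add: LpC_def)
  have "upair U F G = 0" if G: "G \<in> Lhat q U" for G
    using wlim_decomposition[OF pq FU G] F LpC_iff_wlim[OF pq FU]
      upair_null_left[OF pq Lhat_UP[OF hat_Lhat[OF pq FU]] Lhat_UP[OF G]] by simp
  then show "F \<in> annih p U (Lhat q U)" using FU by (simp add: annih_def)
next
  fix F assume F: "F \<in> annih p U (Lhat q U)"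
  then have FU: "F \<in> UP p" by (simp add: annih_def)
  have "unorm p U (\<lambda>n x. F n x - wlim p U F x) = 0"
  proof (rule ccontr)
    assume "\<not> ?thesis"
    then obtain G where G: "G \<in> Lhat q U" "upair U (\<lambda>n x. F n x - wlim p U F x) G \<noteq> 0"
      using Lhat_separation[OF pq hat_Lhat[OF pq FU]] by blast
    then show False using wlim_decomposition[OF pq FU G(1)] annihD[OF F G(1)] by simp
  qed
  then show "F \<in> LpC p U" using LpC_iff_wlim[OF pq FU] by simp
qed

end

section \<open>Sequences tending to zero in $L^1$\<close>

definition L1null :: "real \<Rightarrow> nat filter \<Rightarrow> useq set" where
  "L1null p U = {F \<in> UP p. ((\<lambda>n. LINT x|M01. \<bar>F n x\<bar>) \<longlongrightarrow> 0) U}"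

text \<open>Uniform p-integrability along \<open>U\<close>, phrased as approximability in ultrapower
  norm by uniformly bounded sequences; this is the form in which such a sequence can be paired with
  an \<open>L1null\<close> one.\<close>

definition tight_seq :: "real \<Rightarrow> nat filter \<Rightarrow> useq \<Rightarrow> bool" where
  "tight_seq p U e \<longleftrightarrow> (\<forall>\<epsilon>>0. \<exists>H K. (\<forall>n. H n \<in> borel_measurable M01) \<and>
     (\<forall>n x. \<bar>H n x\<bar> \<le> K) \<and> unorm p U (\<lambda>n x. e n x - H n x) < \<epsilon>)"

context ultra
begin

lemma L1null_UP: "F \<in> L1null p U \<Longrightarrow> F \<in> UP p"
  by (simp add: L1null_def)

lemma L1null_lin:
  assumes p: "1 < p" and F: "F \<in> L1null p U" and G: "G \<in> L1null p U"
  shows "(\<lambda>n x. a * F n x + b * G n x) \<in> L1null p U"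
proof -
  note FU = L1null_UP[OF F] and GU = L1null_UP[OF G]
  have L: "(\<lambda>n x. a * F n x + b * G n x) \<in> UP p" using p by (intro UP_lin FU GU) simp
  have "((\<lambda>n. \<bar>a\<bar> * (LINT x|M01. \<bar>F n x\<bar>) + \<bar>b\<bar> * (LINT x|M01. \<bar>G n x\<bar>)) \<longlongrightarrow> \<bar>a\<bar> * 0 + \<bar>b\<bar> * 0) U"
    using F G by (intro tendsto_intros) (auto simp: L1null_def)
  then have lim: "((\<lambda>n. \<bar>a\<bar> * (LINT x|M01. \<bar>F n x\<bar>) + \<bar>b\<bar> * (LINT x|M01. \<bar>G n x\<bar>)) \<longlongrightarrow> 0) U" by simp
  have bnd: "norm (LINT x|M01. \<bar>a * F n x + b * G n x\<bar>) \<le> \<bar>a\<bar> * (LINT x|M01. \<bar>F n x\<bar>) + \<bar>b\<bar> * (LINT x|M01. \<bar>G n x\<bar>)" for n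
  proof -
    note I = Lp_integrable(1)[OF UP_Lp[OF FU] p, of n] Lp_integrable(1)[OF UP_Lp[OF GU] p, of n] Lp_integrable(1)[OF UP_Lp[OF L] p, of n]
    have "(LINT x|M01. \<bar>a * F n x + b * G n x\<bar>) \<le> (LINT x|M01. \<bar>a\<bar> * \<bar>F n x\<bar> + \<bar>b\<bar> * \<bar>G n x\<bar>)"
      using I by (intro integral_mono) (auto simp: abs_mult[symmetric])
    also have "\<dots> = \<bar>a\<bar> * (LINT x|M01. \<bar>F n x\<bar>) + \<bar>b\<bar> * (LINT x|M01. \<bar>G n x\<bar>)" using I by simp
    finally show ?thesis by simp
  qed
  show ?thesis unfolding L1null_def
    using L Lim_null_comparison[OF always_eventually[OF allI[OF bnd]] lim] by simp
qed

lemma L1null_upair_bounded: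
  assumes p: "1 < p" and F: "F \<in> L1null p U"
    and H: "\<And>n. H n \<in> borel_measurable M01" "\<And>n x. x \<in> {0..1} \<Longrightarrow> \<bar>H n x\<bar> \<le> K"
  shows "upair U F H = 0"
proof -
  note FU = L1null_UP[OF F]
  have lim: "((\<lambda>n. K * (LINT x|M01. \<bar>F n x\<bar>)) \<longlongrightarrow> 0) U"
    using F by (intro tendsto_mult_right_zero) (simp add: L1null_def)
  have bnd: "norm (LINT x|M01. F n x * H n x) \<le> K * (LINT x|M01. \<bar>F n x\<bar>)" for n
  proof -
    note I = Lp_integrable(1)[OF UP_Lp[OF FU] p, of n]
    note [measurable] = H(1)[of n] Lp_measurable[OF UP_Lp[OF FU], of n]
    have le: "\<bar>F n x * H n x\<bar> \<le> K * \<bar>F n x\<bar>" if "x \<in> space M01" for x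
      using mult_left_mono[OF H(2)[of x n], of "\<bar>F n x\<bar>"] that by (simp add: abs_mult mult.commute)
    have I2: "integrable M01 (\<lambda>x. F n x * H n x)"
    proof (rule Bochner_Integration.integrable_bound[of _ "\<lambda>x. K * \<bar>F n x\<bar>"])
      show "AE x in M01. norm (F n x * H n x) \<le> norm (K * \<bar>F n x\<bar>)"
        using order_trans[OF le abs_ge_self] by (intro AE_I2) simp
    qed (use I in auto)
    have "\<bar>LINT x|M01. F n x * H n x\<bar> \<le> (LINT x|M01. \<bar>F n x * H n x\<bar>)" by (rule integral_abs_bound)
    also have "\<dots> \<le> (LINT x|M01. K * \<bar>F n x\<bar>)" using I I2 le by (intro integral_mono) auto
    finally show ?thesis by simp
  qed
  show ?thesis unfolding upair_def
    by (rule LimI[OF Lim_null_comparison[OF always_eventually[OF allI[OF bnd]] lim]])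
qed

text \<open>Against a simple, hence bounded, function the pairings are controlled by the L^1 norms,
  and simple functions are dense in \<open>Lp q\<close>.\<close>

lemma L1null_Lhat:
  assumes pq: "conjugate_exponents p q" and F: "F \<in> L1null p U"
  shows "F \<in> Lhat p U"
  unfolding Lhat_iff[OF pq]
proof (intro conjI ballI)
  note pq' = conjugate_exponentsD(1,2)[OF pq]
  show FU: "F \<in> UP p" using F by (rule L1null_UP)
  fix g assume g: "g \<in> Lp q"
  have "\<bar>upair U F (\<lambda>n. g)\<bar> \<le> 0 + e" if e: "0 < e" for e
  proof -
    define c where "c = unorm p U F + 1"
    have c: "0 < c" using unorm_nonneg[OF FU] by (simp add: c_def)
    have ec: "0 < e / c" using e c by simp
    have q1: "1 \<le> q" using pq' by simp
    obtain s where s: "simple_function M01 s" "s \<in> Lp q" "lpnorm q (\<lambda>x. g x - s x) < e / c"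
      using Lp_simple_dense[OF g q1 ec] .
    have sb: "\<bar>s x\<bar> \<le> Max (abs ` s ` space M01)" if "x \<in> {0..1}" for x
      using that simple_functionD(1)[OF s(1)] by (intro Max_ge) auto
    have z: "upair U F (\<lambda>n. s) = 0"
      using L1null_upair_bounded[OF pq'(1) F borel_measurable_simple_function[OF s(1)] sb] .
    have d: "(\<lambda>x. g x - s x) \<in> Lp q" using g s q1 by (intro Lp_diff) auto
    have "\<bar>upair U F (\<lambda>n. g)\<bar> = \<bar>upair U F (\<lambda>n x. g x - s x)\<bar>"
      using upair_diff_right[OF pq FU UP_const[OF g] UP_const[OF s(2)]] z by simp
    also have "\<dots> \<le> unorm p U F * lpnorm q (\<lambda>x. g x - s x)"
      using upair_bound[OF pq FU UP_const[OF d]] by (simp add: unorm_const)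
    also have "\<dots> \<le> c * (e / c)"
      using s(3) unorm_nonneg[OF FU] by (intro mult_mono) (auto simp: c_def)
    finally show ?thesis using c by simp
  qed
  then have "\<bar>upair U F (\<lambda>n. g)\<bar> \<le> 0" by (rule field_le_epsilon)
  then show "upair U F (\<lambda>n. g) = 0" by simp
qed

text \<open>Interpolation between the L^1 norm and the bounded p-th moment: small values contribute
  at most \<open>e powr s\<close>, middle values are dominated by a multiple of |y|, and large ones
  by \<open>K powr (s - p) * |y| powr p\<close>.\<close>

lemma L1null_powr:
  assumes p: "1 < p" and F: "F \<in> L1null p U" and s: "0 < s" "s < p"
  shows "((\<lambda>n. LINT x|M01. \<bar>F n x\<bar> powr s) \<longlongrightarrow> 0) U"
proof (rule tendstoI)
  note FU = L1null_UP[OF F]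
  fix d :: real assume d: "0 < d"
  obtain C where C: "\<And>n. lpnorm p (F n) \<le> C" "0 \<le> C" using UP_bound[OF FU] by blast
  have CI: "(LINT x|M01. \<bar>F n x\<bar> powr p) \<le> C powr p" for n
    using C(1)[of n] C(2) p lpnorm_le_iff[of p C "F n"] by simp
  define e where "e = (d / 4) powr (1 / s)"
  have e: "0 < e" "e powr s = d / 4" using d s by (auto simp: e_def powr_powr)
  \<comment> \<open>Chosen so that the tail term \<open>K powr (s - p) * C powr p\<close> is at most
    \<open>d / 4\<close>; the added 1 guards against \<open>C = 0\<close>.\<close>
  define L where "L = 4 * (C powr p + 1) / d"
  have C1: "0 < C powr p + 1" by (simp add: add_nonneg_pos)
  then have L: "0 < L" using d by (simp add: L_def)
  define K where "K = L powr (1 / (p - s))"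
  have K: "0 < K" using L by (simp add: K_def)
  have "K powr (p - s) = L" using L s by (simp add: K_def powr_powr)
  then have K2: "K powr (s - p) = 1 / L" using powr_minus_divide[of K "p - s"] by simp
  have K3: "K powr (s - p) * C powr p \<le> d / 4"
  proof -
    have "1 / L * C powr p = d / 4 * (C powr p / (C powr p + 1))" using C1 d by (simp add: L_def field_simps)
    also have "\<dots> \<le> d / 4 * 1" using C1 d by (intro mult_left_mono) auto
    finally show ?thesis using K2 by simp
  qed
  have pt: "\<bar>y\<bar> powr s \<le> e powr s + (K powr s / e) * \<bar>y\<bar> + K powr (s - p) * \<bar>y\<bar> powr p" for y :: real
  proof -
    have nn: "0 \<le> (K powr s / e) * \<bar>y\<bar>" "0 \<le> K powr (s - p) * \<bar>y\<bar> powr p" "0 \<le> e powr s" using e K by auto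
    consider "\<bar>y\<bar> \<le> e" | "e < \<bar>y\<bar>" "\<bar>y\<bar> \<le> K" | "K < \<bar>y\<bar>" by linarith
    then show ?thesis
    proof cases
      case 1 then show ?thesis using powr_mono2[of s "\<bar>y\<bar>" e] s nn by linarith
    next
      case 2
      have "\<bar>y\<bar> powr s \<le> K powr s * 1" using powr_mono2[of s "\<bar>y\<bar>" K] s 2 by simp
      also have "\<dots> \<le> K powr s * (\<bar>y\<bar> / e)" using 2 e by (intro mult_left_mono) auto
      also have "\<dots> = (K powr s / e) * \<bar>y\<bar>" by simp
      finally show ?thesis using nn by linarith
    next
      case 3
      have "\<bar>y\<bar> powr s = \<bar>y\<bar> powr (s - p) * \<bar>y\<bar> powr p" using 3 K by (simp add: powr_add[symmetric])
      also have "\<dots> \<le> K powr (s - p) * \<bar>y\<bar> powr p" using 3 K s by (intro mult_right_mono powr_mono2') auto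
      finally show ?thesis using nn by linarith
    qed
  qed
  have "((\<lambda>n. (K powr s / e) * (LINT x|M01. \<bar>F n x\<bar>)) \<longlongrightarrow> 0) U"
    using F by (intro tendsto_mult_right_zero) (simp add: L1null_def)
  then have "\<forall>\<^sub>F n in U. (K powr s / e) * (LINT x|M01. \<bar>F n x\<bar>) < d / 4"
    using d by (intro order_tendstoD) auto
  then show "\<forall>\<^sub>F n in U. dist (LINT x|M01. \<bar>F n x\<bar> powr s) 0 < d"
  proof eventually_elim
    case (elim n)
    note I = Lp_integrable(1)[OF UP_Lp[OF FU] p, of n] Lp_integrable_powr[OF UP_Lp[OF FU], of n]
    note [measurable] = Lp_measurable[OF UP_Lp[OF FU], of n]
    have Is: "integrable M01 (\<lambda>x. \<bar>F n x\<bar> powr s)"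
    proof (rule Bochner_Integration.integrable_bound[of _ "\<lambda>x. e powr s + (K powr s / e) * \<bar>F n x\<bar> + K powr (s - p) * \<bar>F n x\<bar> powr p"])
      show "integrable M01 (\<lambda>x. e powr s + (K powr s / e) * \<bar>F n x\<bar> + K powr (s - p) * \<bar>F n x\<bar> powr p)"
        using I by simp
      show "AE x in M01. norm (\<bar>F n x\<bar> powr s) \<le> norm (e powr s + (K powr s / e) * \<bar>F n x\<bar> + K powr (s - p) * \<bar>F n x\<bar> powr p)"
        using order_trans[OF pt abs_ge_self] by (intro AE_I2) simp
    qed measurable
    have "(LINT x|M01. \<bar>F n x\<bar> powr s) \<le> (LINT x|M01. e powr s + (K powr s / e) * \<bar>F n x\<bar> + K powr (s - p) * \<bar>F n x\<bar> powr p)"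
      using I Is pt by (intro integral_mono) auto
    also have "\<dots> = e powr s + (K powr s / e) * (LINT x|M01. \<bar>F n x\<bar>) + K powr (s - p) * (LINT x|M01. \<bar>F n x\<bar> powr p)"
      using I by simp
    also have "\<dots> < d / 4 + d / 4 + d / 4 + d / 4"
      using elim e(2) K3 d mult_left_mono[OF CI[of n], of "K powr (s - p)"] powr_ge_zero[of K "s - p"] by linarith
    finally show ?case by (simp add: dist_real_def)
  qed
qed

lemma L1null_Jmap:
  assumes pq: "conjugate_exponents p q" and F: "F \<in> L1null p U"
  shows "(\<lambda>n x. Jmap p (F n x)) \<in> L1null q U"
proof -
  have "1 < p" using conjugate_exponentsD(1)[OF pq] .
  then have "((\<lambda>n. LINT x|M01. \<bar>F n x\<bar> powr (p - 1)) \<longlongrightarrow> 0) U"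
    using F by (intro L1null_powr) auto
  then show ?thesis using norming(1)[OF pq L1null_UP[OF F]] by (simp add: L1null_def abs_Jmap)
qed

text \<open>Since \<open>|Jmap p (F n)| = |F n| powr (p - 1)\<close> with exponent strictly between
  0 and \<open>p\<close>, the norming sequence of an \<open>L1null\<close> sequence is again
  \<open>L1null\<close>. The class is thus normed by its counterpart in the conjugate space.\<close>

lemma L1null_self_dual:
  assumes pq: "conjugate_exponents p q" and F: "F \<in> L1null p U"
    and 0: "\<And>G. G \<in> L1null q U \<Longrightarrow> upair U F G = 0"
  shows "unorm p U F = 0"
  using norming(2)[OF pq L1null_UP[OF F]] 0[OF L1null_Jmap[OF pq F]] by simp

text \<open>The subsequence splitting lemma: truncate $F_n$ at a level $k_n$ tending to infinity along
  $U$ so slowly that the $p$-th moments of the truncations converge to their supremum.\<close>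
theorem subsequence_splitting:
  assumes p: "1 < p" and F: "F \<in> UP p"
  obtains d e where "d \<in> L1null p U" "e \<in> UP p" "\<And>n x. F n x = d n x + e n x"
    "tight_seq p U e"
proof -
  obtain C where C: "\<And>n. lpnorm p (F n) \<le> C" "0 \<le> C" using UP_bound[OF F] by blast
  have CI: "(LINT x|M01. \<bar>F n x\<bar> powr p) \<le> C powr p" for n
    using C(1)[of n] C(2) p lpnorm_le_iff[of p C "F n"] by simp
  note Fm[measurable] = Lp_measurable[OF UP_Lp[OF F]]
  define g where "g K n x = (if \<bar>F n x\<bar> \<le> real K then F n x else 0)" for K :: nat and n x
  have gm[measurable]: "g K n \<in> borel_measurable M01" for K n unfolding g_def by measurable
  have gle: "\<bar>g K n x\<bar> \<le> \<bar>F n x\<bar>" for K n x by (simp add: g_def)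
  have gL: "g K n \<in> Lp p" for K n using p gle by (intro Lp_mono[OF gm UP_Lp[OF F, of n]]) auto
  note gI = Lp_integrable_powr[OF gL]
  define m where "m K n = (LINT x|M01. \<bar>g K n x\<bar> powr p)" for K n
  have m0: "0 \<le> m K n" for K n by (simp add: m_def)
  have mC: "m K n \<le> C powr p" for K n
    unfolding m_def using gI Lp_integrable_powr[OF UP_Lp[OF F]] p gle
    by (intro order_trans[OF integral_mono CI[of n]]) (auto intro!: powr_mono2)
  have mmono: "m K n \<le> m L n" if "K \<le> L" for K L n
    unfolding m_def using gI p that by (intro integral_mono) (auto intro!: powr_mono2 simp: g_def)
  define b where "b K = Lim U (m K)" for K
  have b: "(m K \<longlongrightarrow> b K) U" for K
    unfolding b_def using m0 mC by (intro bounded_tendsto_Lim[where C = "C powr p"]) simp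
  have bmono: "incseq b"
    by (rule incseq_SucI, rule tendsto_le[OF U_ne_bot b b]) (simp add: mmono)
  have bC: "b K \<le> C powr p" for K
    by (rule tendsto_upperbound[OF b _ U_ne_bot]) (simp add: mC)
  obtain B where B: "b \<longlonglongrightarrow> B" "\<And>K. b K \<le> B"
    using incseq_convergent[OF bmono allI[OF bC]] by blast
  \<comment> \<open>Levels \<open>K \<le> n\<close> whose truncated moment exceeds its limit by less
    than \<open>1 / (K + 1)\<close>; each fixed \<open>K\<close> belongs to \<open>A n\<close> for
    \<open>U\<close>-almost all \<open>n\<close>.\<close>
  define A where "A n = {K. K \<le> n \<and> m K n < b K + 1 / (real K + 1)}" for n
  have Afin: "finite (A n)" for n by (rule finite_subset[of _ "{..n}"]) (auto simp: A_def)
  \<comment> \<open>The largest admissible level. The value 0 is a default for empty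
    \<open>A n\<close>; wherever \<open>1 \<le> k n\<close>, the level does lie in
    \<open>A n\<close>.\<close>
  define k where "k n = Max (insert 0 (A n))" for n
  have kA: "k n \<in> insert 0 (A n)" for n unfolding k_def using Afin by (intro Max_in) auto
  have Ak: "K \<le> k n" if "K \<in> A n" for K n unfolding k_def using Afin that by (intro Max_ge) auto
  have evA: "\<forall>\<^sub>F n in U. K \<in> A n" for K
  proof -
    have "\<forall>\<^sub>F n in U. m K n < b K + 1 / (real K + 1)" using b[of K] by (rule order_tendstoD) simp
    then show ?thesis using U_gt[of K] by eventually_elim (simp add: A_def)
  qed
  have evk: "\<forall>\<^sub>F n in U. K \<le> k n" for K using evA[of K] by (rule eventually_mono) (rule Ak)
  define e where "e n x = g (k n) n x" for n x
  define d where "d n x = F n x - e n x" for n x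
  have eU: "e \<in> UP p"
  proof (rule UPI)
    fix n
    show "e n \<in> Lp p" unfolding e_def using gL by simp
    have "lpnorm p (g (k n) n) \<le> lpnorm p (F n)" using p gle by (intro lpnorm_mono[OF gm UP_Lp[OF F]]) auto
    then show "lpnorm p (e n) \<le> C" unfolding e_def using C(1)[of n] by simp
  qed
  have dU: "d \<in> UP p" unfolding d_def using p by (intro UP_diff F eU) simp
  have "((\<lambda>n. LINT x|M01. \<bar>d n x\<bar>) \<longlongrightarrow> 0) U"
  proof (rule tendstoI)
    fix \<delta> :: real assume \<delta>: "0 < \<delta>"
    \<comment> \<open>Chebyshev: \<open>d n\<close> lives where \<open>|F n|\<close> exceeds the
      level \<open>k n\<close>, and there |y| is at most \<open>K powr (1 - p) * |y| powr p\<close>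
      for every \<open>K\<close> below that level.\<close>
    have "(\<lambda>K. real K powr (1 - p)) \<longlonglongrightarrow> 0"
      using p by (intro tendsto_neg_powr filterlim_real_sequentially) auto
    then have "(\<lambda>K. C powr p * real K powr (1 - p)) \<longlonglongrightarrow> 0" by (rule tendsto_mult_right_zero)
    from order_tendstoD(2)[OF this \<delta>] eventually_gt_at_top[of 0]
    have "\<forall>\<^sub>F K in sequentially. C powr p * real K powr (1 - p) < \<delta> \<and> 0 < K"
      by (rule eventually_conj)
    then obtain K where K: "C powr p * real K powr (1 - p) < \<delta>" "0 < K"
      by (auto simp: eventually_sequentially)
    show "\<forall>\<^sub>F n in U. dist (LINT x|M01. \<bar>d n x\<bar>) 0 < \<delta>"
      using evk[of K]
    proof eventually_elim
      case (elim n)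
      have pt: "\<bar>d n x\<bar> \<le> real K powr (1 - p) * \<bar>F n x\<bar> powr p" for x
      proof (cases "\<bar>F n x\<bar> \<le> real (k n)")
        case True then show ?thesis by (simp add: d_def e_def g_def)
      next
        case False
        then have l: "real K \<le> \<bar>F n x\<bar>" "0 < \<bar>F n x\<bar>" using elim K(2) by auto
        have "\<bar>d n x\<bar> = \<bar>F n x\<bar>" using False by (simp add: d_def e_def g_def)
        also have "\<dots> = \<bar>F n x\<bar> powr (1 - p) * \<bar>F n x\<bar> powr p" using l by (simp add: powr_add[symmetric])
        also have "\<dots> \<le> real K powr (1 - p) * \<bar>F n x\<bar> powr p"
          using l p K(2) by (intro mult_right_mono powr_mono2') auto
        finally show ?thesis .
      qed
      have "(LINT x|M01. \<bar>d n x\<bar>) \<le> (LINT x|M01. real K powr (1 - p) * \<bar>F n x\<bar> powr p)"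
        using pt Lp_integrable(1)[OF UP_Lp[OF dU] p] Lp_integrable_powr[OF UP_Lp[OF F]] by (intro integral_mono) auto
      also have "\<dots> = real K powr (1 - p) * (LINT x|M01. \<bar>F n x\<bar> powr p)" by simp
      also have "\<dots> \<le> real K powr (1 - p) * C powr p" using CI by (intro mult_left_mono) auto
      also have "\<dots> < \<delta>" using K by (simp add: mult.commute)
      finally show ?case by (simp add: dist_real_def)
    qed
  qed
  then have dN: "d \<in> L1null p U" using dU by (simp add: L1null_def)
  have tight: "\<exists>H K. (\<forall>n. H n \<in> borel_measurable M01) \<and> (\<forall>n x. \<bar>H n x\<bar> \<le> K) \<and>
        unorm p U (\<lambda>n x. e n x - H n x) < \<epsilon>" if \<epsilon>: "0 < \<epsilon>" for \<epsilon>
  proof -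
    \<comment> \<open>Three errors of size \<open>\<eta>\<close> add up below: \<open>B\<close>
      against \<open>b K\<close>, \<open>b K\<close> against \<open>m K n\<close>, and the slack
      granted to the level \<open>k n\<close> by membership in \<open>A n\<close>.\<close>
    define \<eta> where "\<eta> = (\<epsilon> / 2) powr p / 3"
    have \<eta>: "0 < \<eta>" using \<epsilon> by (simp add: \<eta>_def)
    have "\<forall>\<^sub>F K in sequentially. B - \<eta> < b K" using B(1) \<eta> by (intro order_tendstoD) auto
    then obtain K where K: "B - \<eta> < b K" by (auto simp: eventually_sequentially)
    obtain L :: nat where L: "1 / \<eta> < real L" using reals_Archimedean2 by blast
    have HU: "g K \<in> UP p"
      using gm by (rule UP_uniformly_bounded[where K = "real K"]) (use p in \<open>auto simp: g_def\<close>)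
    have ev: "\<forall>\<^sub>F n in U. b K - \<eta> < m K n" using b[of K] \<eta> by (intro order_tendstoD) auto
    have "\<forall>\<^sub>F n in U. lpnorm p (\<lambda>x. e n x - g K n x) \<le> \<epsilon> / 2"
      using evk[of K] evk[of L] evk[of 1] ev
    proof eventually_elim
      case (elim n)
      have "k n \<in> A n" using kA[of n] elim(3) by auto
      then have m1: "m (k n) n < b (k n) + 1 / (real (k n) + 1)" by (simp add: A_def)
      have "1 / \<eta> < real (k n) + 1" using L elim(2) by linarith
      then have "1 / (real (k n) + 1) < \<eta>" using \<eta> by (simp add: field_simps)
      with m1 B(2)[of "k n"] K elim(4) have m2: "m (k n) n - m K n \<le> 3 * \<eta>" by linarith
      \<comment> \<open>For \<open>K \<le> k n\<close> the two truncations agree at a point or the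
        lower one vanishes there, so the p-th power of the difference is the difference of the p-th
        powers.\<close>
      have "\<bar>e n x - g K n x\<bar> powr p = \<bar>g (k n) n x\<bar> powr p - \<bar>g K n x\<bar> powr p" for x
        using elim(1) by (auto simp: e_def g_def)
      then have "(LINT x|M01. \<bar>e n x - g K n x\<bar> powr p) = m (k n) n - m K n"
        using gI by (simp add: m_def)
      also have "\<dots> \<le> (\<epsilon> / 2) powr p" using m2 by (simp add: \<eta>_def)
      finally show ?case using \<epsilon> p by (subst lpnorm_le_iff) auto
    qed
    then have "unorm p U (\<lambda>n x. e n x - g K n x) \<le> \<epsilon> / 2"
      using p by (intro unorm_le UP_diff eU HU) auto
    then have "unorm p U (\<lambda>n x. e n x - g K n x) < \<epsilon>" using \<epsilon> by simp
    then show ?thesis by (intro exI[of _ "g K"] exI[of _ "real K"]) (auto simp: g_def intro: gm)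
  qed
  then have "tight_seq p U e" unfolding tight_seq_def by blast
  then show thesis by (intro that[OF dN eU]) (simp_all add: d_def)
qed

lemma tight_annihilates_L1null:
  assumes pq: "conjugate_exponents p q" and e: "e \<in> UP p" and G: "G \<in> L1null q U"
    and tight: "tight_seq p U e"
  shows "upair U e G = 0"
proof -
  note GU = L1null_UP[OF G] and pq' = conjugate_exponentsD(1,2)[OF pq]
  have p: "1 \<le> p" using pq' by simp
  have "\<bar>upair U e G\<bar> \<le> 0 + \<epsilon>" if \<epsilon>: "0 < \<epsilon>" for \<epsilon>
  proof -
    define c where "c = unorm q U G + 1"
    have c: "0 < c" using unorm_nonneg[OF GU] by (simp add: c_def)
    obtain H K where H: "\<And>n. H n \<in> borel_measurable M01" "\<And>n x. \<bar>H n x\<bar> \<le> K" "unorm p U (\<lambda>n x. e n x - H n x) < \<epsilon> / c"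
      using tight[unfolded tight_seq_def, rule_format, of "\<epsilon> / c"] \<epsilon> c by auto
    have HU: "H \<in> UP p" using H(1) by (rule UP_uniformly_bounded[where K = K]) (use H(2) p in auto)
    have "upair U G H = 0" by (rule L1null_upair_bounded[OF pq'(2) G H(1)]) (rule H(2))
    then have "upair U H G = 0" by (simp add: upair_commute)
    then have "\<bar>upair U e G\<bar> = \<bar>upair U (\<lambda>n x. e n x - H n x) G\<bar>"
      using upair_diff_left[OF pq e HU GU] by simp
    also have "\<dots> \<le> unorm p U (\<lambda>n x. e n x - H n x) * unorm q U G"
      by (intro upair_bound[OF pq] UP_diff e HU GU p)
    also have "\<dots> \<le> \<epsilon> / c * c"
      using H(3) unorm_nonneg[OF GU] unorm_nonneg[OF UP_diff[OF e HU p]] \<epsilon> c by (intro mult_mono) (auto simp: c_def)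
    finally show ?thesis using c by simp
  qed
  then have "\<bar>upair U e G\<bar> \<le> 0" by (rule field_le_epsilon)
  then show ?thesis by simp
qed

lemma L1null_decomposition:
  assumes pq: "conjugate_exponents p q" and F: "F \<in> UP p"
  obtains d e where "d \<in> L1null p U" "e \<in> annih p U (L1null q U)" "\<And>n x. F n x = d n x + e n x"
proof -
  have p: "1 < p" using conjugate_exponentsD(1)[OF pq] .
  obtain d e where de: "d \<in> L1null p U" "e \<in> UP p" "\<And>n x. F n x = d n x + e n x"
    "tight_seq p U e"
    using subsequence_splitting[OF p F] by blast
  have "e \<in> annih p U (L1null q U)"
    using de(2) tight_annihilates_L1null[OF pq de(2) _ de(4)] by (simp add: annih_def)
  then show thesis using that de by blast
qed

text \<open>Both \<open>F\<close> and the tight part of its splitting annihilate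
  \<open>L1null q U\<close>, hence so does the \<open>L1null\<close> part; by self-duality that part
  is null, and \<open>F\<close> itself is approximable by bounded sequences.\<close>

lemma annih_L1null_approx:
  assumes pq: "conjugate_exponents p q" and F: "F \<in> annih p U (L1null q U)" and \<epsilon>: "0 < \<epsilon>"
  obtains H K where "\<And>n. H n \<in> borel_measurable M01" "\<And>n x. \<bar>H n x\<bar> \<le> K"
    "unorm p U (\<lambda>n x. F n x - H n x) < \<epsilon>"
proof -
  have p: "1 < p" "1 \<le> p" using conjugate_exponentsD(1)[OF pq] by auto
  have FU: "F \<in> UP p" using F by (simp add: annih_def)
  obtain d e where de: "d \<in> L1null p U" "e \<in> UP p" "\<And>n x. F n x = d n x + e n x"
    and tight: "tight_seq p U e"
    using subsequence_splitting[OF p(1) FU] by blast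
  have d: "d = (\<lambda>n x. F n x - e n x)" using de(3) by (simp add: fun_eq_iff)
  have "upair U d G = 0" if G: "G \<in> L1null q U" for G
    unfolding d using upair_diff_left[OF pq FU de(2) L1null_UP[OF G]] annihD[OF F G]
      tight_annihilates_L1null[OF pq de(2) G tight] by simp
  then have d0: "unorm p U (\<lambda>n x. F n x - e n x) = 0" using L1null_self_dual[OF pq de(1)] d by simp
  obtain H K where H: "\<And>n. H n \<in> borel_measurable M01" "\<And>n x. \<bar>H n x\<bar> \<le> K" "unorm p U (\<lambda>n x. e n x - H n x) < \<epsilon>"
    using tight[unfolded tight_seq_def, rule_format, OF \<epsilon>] by auto
  have HU: "H \<in> UP p" using H(1) by (rule UP_uniformly_bounded[where K = K]) (use H(2) p in auto)
  have "unorm p U (\<lambda>n x. F n x - H n x) < \<epsilon>"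
    using unorm_diff_trans[OF FU de(2) HU p(2)] d0 H(3) by simp
  then show thesis using that H(1,2) by blast
qed

end

section \<open>Operators\<close>

lemma bop_LpD:
  assumes T: "bop_Lp p T"
  shows "\<And>f. f \<in> Lp p \<Longrightarrow> T f \<in> Lp p"
    and "\<And>f g a b. f \<in> Lp p \<Longrightarrow> g \<in> Lp p \<Longrightarrow> AE x in M01. T (\<lambda>y. a * f y + b * g y) x = a * T f x + b * T g x"
    and "\<And>f g. f \<in> Lp p \<Longrightarrow> g \<in> Lp p \<Longrightarrow> AE x in M01. f x = g x \<Longrightarrow> AE x in M01. T f x = T g x"
    and "\<exists>C\<ge>0. \<forall>f\<in>Lp p. lpnorm p (T f) \<le> C * lpnorm p f"
proof -
  show "T f \<in> Lp p" if "f \<in> Lp p" for f using T that unfolding bop_Lp_def by blast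
  show "AE x in M01. T (\<lambda>y. a * f y + b * g y) x = a * T f x + b * T g x" if "f \<in> Lp p" "g \<in> Lp p" for f g a b
    using T that unfolding bop_Lp_def by blast
  show "AE x in M01. T f x = T g x" if "f \<in> Lp p" "g \<in> Lp p" "AE x in M01. f x = g x" for f g
    using T that unfolding bop_Lp_def by blast
  obtain C where C: "\<forall>f\<in>Lp p. lpnorm p (T f) \<le> C * lpnorm p f" using T unfolding bop_Lp_def by blast
  have "lpnorm p (T f) \<le> \<bar>C\<bar> * lpnorm p f" if "f \<in> Lp p" for f
    using C that mult_right_mono[OF abs_ge_self lpnorm_nonneg, of C p f] by fastforce
  then show "\<exists>C\<ge>0. \<forall>f\<in>Lp p. lpnorm p (T f) \<le> C * lpnorm p f" by (intro exI[of _ "\<bar>C\<bar>"]) simp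
qed

lemma bop_Lp_lin_norm:
  assumes T: "bop_Lp p T" and f: "f \<in> Lp p" and g: "g \<in> Lp p" and p: "1 \<le> p"
  shows "lpnorm p (\<lambda>x. T (\<lambda>y. a * f y + b * g y) x - (a * T f x + b * T g x)) = 0"
proof -
  note D = bop_LpD[OF T]
  have L: "(\<lambda>x. T (\<lambda>y. a * f y + b * g y) x - (a * T f x + b * T g x)) \<in> Lp p"
    using f g p by (intro Lp_diff Lp_lin D(1)) auto
  show ?thesis using D(2)[OF f g, of a b] p by (subst lpnorm_eq_0_iff[OF L]) auto
qed

lemma bop_Lp_add:
  assumes S: "bop_Lp p S" and T: "bop_Lp p T" and p: "1 \<le> p"
  shows "bop_Lp p (\<lambda>f x. S f x + T f x)"
  unfolding bop_Lp_def
proof (intro conjI ballI allI impI)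
  note DS = bop_LpD[OF S] and DT = bop_LpD[OF T]
  show "(\<lambda>x. S f x + T f x) \<in> Lp p" if "f \<in> Lp p" for f
    using that p by (intro Lp_add DS(1) DT(1)) auto
  show "AE x in M01. S (\<lambda>y. a * f y + b * g y) x + T (\<lambda>y. a * f y + b * g y) x
      = a * (S f x + T f x) + b * (S g x + T g x)" if "f \<in> Lp p" "g \<in> Lp p" for f g a b
    using DS(2)[OF that, of a b] DT(2)[OF that, of a b] by eventually_elim (simp add: distrib_left)
  show "AE x in M01. S f x + T f x = S g x + T g x" if "f \<in> Lp p" "g \<in> Lp p" "AE x in M01. f x = g x" for f g
    using DS(3)[OF that] DT(3)[OF that] by eventually_elim simp
  obtain C D where C: "\<forall>f\<in>Lp p. lpnorm p (S f) \<le> C * lpnorm p f" and D: "\<forall>f\<in>Lp p. lpnorm p (T f) \<le> D * lpnorm p f"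
    using DS(4) DT(4) by blast
  have "lpnorm p (\<lambda>x. S f x + T f x) \<le> (C + D) * lpnorm p f" if f: "f \<in> Lp p" for f
    using lpnorm_triangle[OF DS(1)[OF f] DT(1)[OF f] p] bspec[OF C f] bspec[OF D f] by (simp add: distrib_right)
  then show "\<exists>C. \<forall>f\<in>Lp p. lpnorm p (\<lambda>x. S f x + T f x) \<le> C * lpnorm p f" by blast
qed

lemma bop_Lp_zero: "1 \<le> p \<Longrightarrow> bop_Lp p (\<lambda>f x. 0)"
  unfolding bop_Lp_def by (auto intro!: exI[of _ 0])

lemma bop_Lp_rank_one:
  assumes pq: "conjugate_exponents p q" and g: "g \<in> Lp q" and h: "h \<in> Lp p"
  shows "bop_Lp p (\<lambda>f x. (LINT y|M01. f y * g y) * h x)"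
  unfolding bop_Lp_def
proof (intro conjI ballI allI impI)
  have p: "0 < p" using conjugate_exponentsD(1)[OF pq] by simp
  show "(\<lambda>x. (LINT y|M01. f y * g y) * h x) \<in> Lp p" for f using h by (rule Lp_scale)
  show "AE x in M01. (LINT y|M01. (a * f y + b * k y) * g y) * h x = a * ((LINT y|M01. f y * g y) * h x) + b * ((LINT y|M01. k y * g y) * h x)"
    if "f \<in> Lp p" "k \<in> Lp p" for f k a b
    using Lp_Holder(1)[OF pq that(1) g] Lp_Holder(1)[OF pq that(2) g] by (simp add: distrib_right mult.assoc)
  show "AE x in M01. (LINT y|M01. f y * g y) * h x = (LINT y|M01. k y * g y) * h x"
    if "f \<in> Lp p" "k \<in> Lp p" "AE x in M01. f x = k x" for f k
  proof -
    note [measurable] = Lp_measurable[OF that(1)] Lp_measurable[OF that(2)] Lp_measurable[OF g]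
    have "(LINT y|M01. f y * g y) = (LINT y|M01. k y * g y)"
      using that(3) by (intro integral_cong_AE) auto
    then show ?thesis by simp
  qed
  have "lpnorm p (\<lambda>x. (LINT y|M01. f y * g y) * h x) \<le> (lpnorm q g * lpnorm p h) * lpnorm p f" if f: "f \<in> Lp p" for f
    using mult_right_mono[OF Lp_Holder(3)[OF pq f g] lpnorm_nonneg[of p h]] unfolding lpnorm_scale[OF p]
    by (simp add: mult_ac)
  then show "\<exists>C. \<forall>f\<in>Lp p. lpnorm p (\<lambda>x. (LINT y|M01. f y * g y) * h x) \<le> C * lpnorm p f" by blast
qed

context ultra
begin

lemma ultra_op_UP:
  assumes T: "bop_Lp p T" and F: "F \<in> UP p"
  shows "ultra_op T F \<in> UP p"
proof -
  obtain C where C: "0 \<le> C" "\<And>f. f \<in> Lp p \<Longrightarrow> lpnorm p (T f) \<le> C * lpnorm p f" using bop_LpD(4)[OF T] by blast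
  obtain D where D: "\<And>n. lpnorm p (F n) \<le> D" using UP_bound[OF F] by blast
  show ?thesis unfolding ultra_op_def
  proof (rule UPI)
    fix n
    show "T (F n) \<in> Lp p" by (intro bop_LpD(1)[OF T] UP_Lp F)
    show "lpnorm p (T (F n)) \<le> C * D"
      using C(2)[OF UP_Lp[OF F, of n]] mult_left_mono[OF D[of n] C(1)] by linarith
  qed
qed

lemma unorm_ultra_op_le:
  assumes T: "bop_Lp p T"
  shows "\<exists>C\<ge>0. \<forall>F\<in>UP p. unorm p U (ultra_op T F) \<le> C * unorm p U F"
proof -
  obtain C where C: "0 \<le> C" "\<And>f. f \<in> Lp p \<Longrightarrow> lpnorm p (T f) \<le> C * lpnorm p f" using bop_LpD(4)[OF T] by blast
  have "unorm p U (ultra_op T F) \<le> C * unorm p U F" if F: "F \<in> UP p" for F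
  proof (rule tendsto_le[OF U_ne_bot])
    show "((\<lambda>n. C * lpnorm p (F n)) \<longlongrightarrow> C * unorm p U F) U" by (intro tendsto_intros unorm_tendsto F)
    show "((\<lambda>n. lpnorm p (ultra_op T F n)) \<longlongrightarrow> unorm p U (ultra_op T F)) U" by (intro unorm_tendsto ultra_op_UP T F)
    show "\<forall>\<^sub>F n in U. lpnorm p (ultra_op T F n) \<le> C * lpnorm p (F n)"
      using C(2)[OF UP_Lp[OF F]] by (simp add: ultra_op_def)
  qed
  then show ?thesis using C(1) by blast
qed

lemma unorm_ultra_op_lin:
  assumes T: "bop_Lp p T" and F: "F \<in> UP p" and G: "G \<in> UP p" and p: "1 \<le> p"
  shows "unorm p U (\<lambda>n x. ultra_op T (\<lambda>n x. a * F n x + b * G n x) n x - (a * ultra_op T F n x + b * ultra_op T G n x)) = 0"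
  unfolding unorm_def ultra_op_def using bop_Lp_lin_norm[OF T UP_Lp[OF F] UP_Lp[OF G] p] by (intro LimI) simp

lemma unorm_ultra_op_diff:
  assumes T: "bop_Lp p T" and F: "F \<in> UP p" and G: "G \<in> UP p" and p: "1 \<le> p"
  shows "unorm p U (\<lambda>n x. ultra_op T F n x - ultra_op T G n x) = unorm p U (ultra_op T (\<lambda>n x. F n x - G n x))"
proof -
  let ?D = "ultra_op T (\<lambda>n x. F n x - G n x)" and ?E = "\<lambda>n x. ultra_op T F n x - ultra_op T G n x"
  have DU: "?D \<in> UP p" and EU: "?E \<in> UP p" using T F G p by (auto intro!: ultra_op_UP UP_diff)
  have 0: "unorm p U (\<lambda>n x. ?D n x - ?E n x) = 0"
    using unorm_ultra_op_lin[OF T F G p, of 1 "-1"] by simp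
  then have z: "unorm p U (\<lambda>n x. ?E n x - ?D n x) = 0" by (subst unorm_minus_commute)
  show ?thesis
    using unorm_triangle[OF UP_diff[OF DU EU p] EU p] unorm_triangle[OF UP_diff[OF EU DU p] DU p] 0 z by simp
qed

lemma bop_U_ultra_op:
  assumes T: "bop_Lp p T" and p: "1 \<le> p"
  shows "bop_U p U (ultra_op T)"
  unfolding bop_U_def
proof (intro conjI ballI allI impI)
  obtain C where C: "0 \<le> C" "\<forall>F\<in>UP p. unorm p U (ultra_op T F) \<le> C * unorm p U F" using unorm_ultra_op_le[OF T] by blast
  then show "\<exists>C. \<forall>F\<in>UP p. unorm p U (ultra_op T F) \<le> C * unorm p U F" by blast
  show "ultra_op T F \<in> UP p" if "F \<in> UP p" for F by (intro ultra_op_UP T that)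
  show "ueq p U (ultra_op T F) (ultra_op T G)" if FG: "F \<in> UP p" "G \<in> UP p" "ueq p U F G" for F G
  proof -
    have "unorm p U (\<lambda>n x. F n x - G n x) = 0" using FG p by (simp add: ueq_iff)
    then have "unorm p U (ultra_op T (\<lambda>n x. F n x - G n x)) \<le> 0" using bspec[OF C(2) UP_diff[OF FG(1,2) p]] by simp
    then show ?thesis
      using unorm_ultra_op_diff[OF T FG(1,2) p] unorm_nonneg[OF ultra_op_UP[OF T UP_diff[OF FG(1,2) p]]] FG p T
      by (simp add: ueq_iff ultra_op_UP)
  qed
  show "ueq p U (ultra_op T (\<lambda>n x. a * F n x + b * G n x)) (\<lambda>n x. a * ultra_op T F n x + b * ultra_op T G n x)"
    if FG: "F \<in> UP p" "G \<in> UP p" for F G a b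
    using unorm_ultra_op_lin[OF T FG p, of a b] ultra_op_UP[OF T] FG p
    by (subst ueq_iff) (auto intro!: UP_lin)
qed

text \<open>The adjoint acts on test functionals: for bounded \<open>\<phi>\<close> the composition
  of \<open>\<phi>\<close> with \<open>T\<close> is again a bounded functional.\<close>

lemma Lhat_invariant:
  assumes T: "bop_Lp p T" and p: "1 \<le> p" and F: "F \<in> Lhat p U"
  shows "ultra_op T F \<in> Lhat p U"
  unfolding Lhat_def
proof (intro CollectI conjI allI impI)
  show "ultra_op T F \<in> UP p" by (intro ultra_op_UP T Lhat_UP F)
  fix \<phi> assume \<phi>: "dual_Lp p \<phi>"
  note D = dual_LpD[OF \<phi> p] and DT = bop_LpD[OF T]
  have "dual_Lp p (\<lambda>f. \<phi> (T f))" unfolding dual_Lp_def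
  proof (intro conjI ballI allI)
    fix f g a b assume fg: "f \<in> Lp p" "g \<in> Lp p"
    have "\<phi> (T (\<lambda>y. a * f y + b * g y)) = \<phi> (\<lambda>y. a * T f y + b * T g y)"
      using fg p by (intro D(3) DT(1) Lp_lin DT(2)) auto
    also have "\<dots> = a * \<phi> (T f) + b * \<phi> (T g)" using fg by (intro D(1) DT(1))
    finally show "\<phi> (T (\<lambda>y. a * f y + b * g y)) = a * \<phi> (T f) + b * \<phi> (T g)" .
  next
    obtain C where C: "0 \<le> C" "\<forall>f\<in>Lp p. lpnorm p (T f) \<le> C * lpnorm p f" using DT(4) by blast
    obtain E where E: "0 \<le> E" "\<forall>f\<in>Lp p. \<bar>\<phi> f\<bar> \<le> E * lpnorm p f" using D(2) by blast
    have "\<bar>\<phi> (T f)\<bar> \<le> (E * C) * lpnorm p f" if f: "f \<in> Lp p" for f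
      using bspec[OF E(2) DT(1)[OF f]] mult_left_mono[OF bspec[OF C(2) f] E(1)] by (simp add: mult.assoc)
    then show "\<exists>C. \<forall>f\<in>Lp p. \<bar>\<phi> (T f)\<bar> \<le> C * lpnorm p f" by blast
  qed
  then show "((\<lambda>n. \<phi> (ultra_op T F n)) \<longlongrightarrow> 0) U" using F unfolding Lhat_def ultra_op_def by blast
qed

lemma LpC_invariant:
  assumes T: "bop_Lp p T" and p: "1 \<le> p" and F: "F \<in> LpC p U"
  shows "ultra_op T F \<in> LpC p U"
proof -
  obtain f where f: "f \<in> Lp p" "ueq p U F (\<lambda>n. f)" "F \<in> UP p" using F by (auto simp: LpC_def)
  have "ueq p U (ultra_op T F) (ultra_op T (\<lambda>n. f))"
    using bop_U_ultra_op[OF T p] f UP_const[OF f(1)] unfolding bop_U_def by blast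
  then show ?thesis unfolding LpC_def using ultra_op_UP[OF T f(3)] bop_LpD(1)[OF T f(1)] by (auto simp: ultra_op_def)
qed

end

section \<open>Upper estimates for weakly null sequences\<close>

text \<open>Convexity: the graph of the q-th power lies above its tangent at \<open>x + y\<close>,
  of slope \<open>q * Jmap q (x + y)\<close>; Young's inequality yields this algebraically. With the
  tangent taken at \<open>x + y\<close>, only the difference
  \<open>Jmap q (x + y) - Jmap q x\<close> remains to be estimated by smoothness.\<close>

lemma abs_powr_tangent:
  fixes x y q :: real
  assumes q: "1 < q"
  shows "\<bar>x + y\<bar> powr q \<le> \<bar>x\<bar> powr q + q * (Jmap q (x + y) * y)"
proof -
  define z where "z = x + y"
  define q' where "q' = q / (q - 1)"
  have c: "conjugate_exponents q q'" unfolding q'_def by (rule conjugate_exponents_exists[OF q])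
  have "\<bar>x\<bar> * \<bar>z\<bar> powr (q - 1) \<le> \<bar>x\<bar> powr q / q + (\<bar>z\<bar> powr (q - 1)) powr q' / q'"
    using c by (intro Youngs_inequality) (auto simp: conjugate_exponents_def)
  also have "(\<bar>z\<bar> powr (q - 1)) powr q' / q' = \<bar>z\<bar> powr q * (1 - 1 / q)"
    using conjugate_exponentsD(4,5)[OF conjugate_exponents_sym[OF c]] conjugate_exponentsD(4)[OF c]
    by (simp add: powr_powr divide_inverse)
  finally have "q * (\<bar>x\<bar> * \<bar>z\<bar> powr (q - 1)) \<le> q * (\<bar>x\<bar> powr q / q + \<bar>z\<bar> powr q * (1 - 1 / q))"
    using q by (intro mult_left_mono) auto
  also have "\<dots> = \<bar>x\<bar> powr q + (q - 1) * \<bar>z\<bar> powr q" using q by (simp add: field_simps)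
  finally have 1: "q * (\<bar>x\<bar> * \<bar>z\<bar> powr (q - 1)) \<le> \<bar>x\<bar> powr q + (q - 1) * \<bar>z\<bar> powr q" .
  have "Jmap q z * x \<le> \<bar>Jmap q z * x\<bar>" by simp
  also have "\<dots> = \<bar>x\<bar> * \<bar>z\<bar> powr (q - 1)" by (simp add: abs_mult abs_Jmap)
  finally have "q * (Jmap q z * x) \<le> q * (\<bar>x\<bar> * \<bar>z\<bar> powr (q - 1))" using q by (intro mult_left_mono) auto
  with 1 have 2: "q * (Jmap q z * x) \<le> \<bar>x\<bar> powr q + (q - 1) * \<bar>z\<bar> powr q" by linarith
  have "q * (Jmap q z * y) = q * (Jmap q z * z) - q * (Jmap q z * x)" by (simp add: z_def algebra_simps)
  also have "Jmap q z * z = \<bar>z\<bar> powr q" using mult_Jmap[of z q] by (simp add: mult.commute)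
  finally show ?thesis using 2 by (simp add: z_def algebra_simps)
qed

lemma powr_subadditive:
  fixes u v \<alpha> :: real
  assumes "0 \<le> u" "0 \<le> v" "0 < \<alpha>" "\<alpha> \<le> 1"
  shows "(u + v) powr \<alpha> \<le> u powr \<alpha> + v powr \<alpha>"
proof (cases "u + v = 0")
  case False
  then have s: "0 < u + v" using assms by simp
  have *: "t \<le> t powr \<alpha>" if "0 \<le> t" "t \<le> 1" for t :: real
    using powr_mono'[of \<alpha> 1 t] that assms by simp
  have "1 = u / (u + v) + v / (u + v)" using s by (simp add: add_divide_distrib[symmetric])
  also have "\<dots> \<le> (u / (u + v)) powr \<alpha> + (v / (u + v)) powr \<alpha>"
    using s assms by (intro add_mono *) auto
  also have "\<dots> = (u powr \<alpha> + v powr \<alpha>) / (u + v) powr \<alpha>" by (simp add: powr_divide add_divide_distrib)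
  finally show ?thesis using s by (simp add: field_simps)
qed (use assms in simp)

lemma powr_superadditive:
  fixes x y t :: real
  assumes "0 \<le> x" "0 \<le> y" "1 \<le> t"
  shows "x powr t + y powr t \<le> (x + y) powr t"
proof -
  have "x powr t = x * x powr (t - 1)" "y powr t = y * y powr (t - 1)" "(x + y) powr t = (x + y) * (x + y) powr (t - 1)"
    using powr_mult_base[of x "t - 1"] powr_mult_base[of y "t - 1"] powr_mult_base[of "x + y" "t - 1"] assms by auto
  moreover have "x * x powr (t - 1) \<le> x * (x + y) powr (t - 1)" "y * y powr (t - 1) \<le> y * (x + y) powr (t - 1)"
    using assms by (auto intro!: mult_left_mono powr_mono2)
  ultimately show ?thesis by (simp add: distrib_right)
qed

lemma powr_add_ge:
  fixes x y t :: real
  assumes "0 \<le> x" "0 \<le> y" "1 \<le> t"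
  shows "x powr t + y * x powr (t - 1) \<le> (x + y) powr t"
proof -
  have "x powr t = x * x powr (t - 1)" "(x + y) powr t = (x + y) * (x + y) powr (t - 1)"
    using powr_mult_base[of x "t - 1"] powr_mult_base[of "x + y" "t - 1"] assms by auto
  moreover have "(x + y) * x powr (t - 1) \<le> (x + y) * (x + y) powr (t - 1)"
    using assms by (auto intro!: mult_left_mono powr_mono2)
  ultimately show ?thesis by (simp add: distrib_right)
qed

text \<open>Half of \<open>K * b\<close> absorbs the mixed term through \<open>powr_add_ge\<close>,
  the other half absorbs \<open>b powr t\<close> through superadditivity, and \<open>z\<close> is
  absorbed in the same way. This is the inductive step of \<open>upper_est_of_step\<close>.\<close>

lemma powr_step:
  fixes X b z t C K :: real
  assumes t: "1 \<le> t" and nn: "0 \<le> X" "0 \<le> b" "0 \<le> z" and K: "2 \<le> K" "2 * C \<le> K"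
  shows "X powr t + z powr t + C * (X powr (t - 1) * b + b powr t) \<le> (X + K * b + z) powr t"
proof -
  define h where "h = K / 2"
  have h: "1 \<le> h" "C \<le> h" "K * b = h * b + h * b" using K by (auto simp: h_def)
  have hb: "0 \<le> h * b" using h nn by simp
  have ht: "h \<le> h powr t" using h(1) t powr_mono[of 1 t h] by simp
  have "C * (X powr (t - 1) * b) \<le> h * (X powr (t - 1) * b)" using h nn by (intro mult_right_mono) auto
  moreover have "C * b powr t \<le> h powr t * b powr t" using h ht by (intro mult_right_mono) auto
  moreover have "X powr t + (h * b) * X powr (t - 1) \<le> (X + h * b) powr t" using nn t hb by (intro powr_add_ge)
  moreover have "(X + h * b) powr t + (h * b) powr t \<le> (X + h * b + h * b) powr t" using nn t hb by (intro powr_superadditive) auto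
  moreover have "(X + h * b + h * b) powr t + z powr t \<le> (X + h * b + h * b + z) powr t" using nn t hb by (intro powr_superadditive add_nonneg_nonneg)
  moreover have "(h * b) powr t = h powr t * b powr t" by (simp add: powr_mult)
  moreover have "C * (X powr (t - 1) * b + b powr t) = C * (X powr (t - 1) * b) + C * b powr t" by (simp add: distrib_left)
  moreover have "h * (X powr (t - 1) * b) = (h * b) * X powr (t - 1)" by simp
  ultimately have "X powr t + z powr t + C * (X powr (t - 1) * b + b powr t) \<le> (X + h * b + h * b + z) powr t"
    by linarith
  also have "X + h * b + h * b + z = X + K * b + z" using h(3) by linarith
  finally show ?thesis .
qed

lemma powr_diff_le:
  fixes x y \<alpha> :: real
  assumes "0 \<le> x" "0 \<le> y" "0 < \<alpha>" "\<alpha> \<le> 1"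
  shows "\<bar>x powr \<alpha> - y powr \<alpha>\<bar> \<le> \<bar>x - y\<bar> powr \<alpha>"
proof -
  have *: "\<bar>u powr \<alpha> - v powr \<alpha>\<bar> \<le> \<bar>u - v\<bar> powr \<alpha>" if "0 \<le> v" "v \<le> u" for u v
    using powr_subadditive[of v "u - v" \<alpha>] powr_mono2[of \<alpha> v u] that assms by simp
  show ?thesis using *[of x y] *[of y x] assms by (cases "y \<le> x") (auto simp: abs_minus_commute)
qed

lemma Jmap_cases:
  "0 \<le> x \<Longrightarrow> Jmap q x = x powr (q - 1)" "x \<le> 0 \<Longrightarrow> Jmap q x = - ((- x) powr (q - 1))"
  by (cases "x = 0"; auto simp: Jmap_def)+

text \<open>The exponent \<open>q - 1\<close> is at most one, so its power is subadditive and the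
  derivative of the q-th power is Hoelder continuous of order \<open>q - 1\<close>. The factor 2
  accounts for arguments of opposite sign.\<close>

lemma Jmap_Holder:
  fixes a b q :: real
  assumes "1 < q" "q \<le> 2"
  shows "\<bar>Jmap q a - Jmap q b\<bar> \<le> 2 * \<bar>a - b\<bar> powr (q - 1)"
proof -
  have nn: "0 \<le> \<bar>a - b\<bar> powr (q - 1)" by simp
  have mixed: "\<bar>u powr (q - 1) + v powr (q - 1)\<bar> \<le> 2 * (u + v) powr (q - 1)" if "0 \<le> u" "0 \<le> v" for u v :: real
    using powr_mono2[of "q - 1" u "u + v"] powr_mono2[of "q - 1" v "u + v"] that assms by simp
  consider "0 \<le> a" "0 \<le> b" | "a \<le> 0" "b \<le> 0" | "0 \<le> a" "b \<le> 0" | "a \<le> 0" "0 \<le> b" by linarith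
  then show ?thesis
  proof cases
    case 1 then show ?thesis using powr_diff_le[of a b "q - 1"] assms nn by (simp add: Jmap_cases)
  next
    case 2
    then have "\<bar>(-a) powr (q - 1) - (-b) powr (q - 1)\<bar> \<le> \<bar>(-a) - (-b)\<bar> powr (q - 1)"
      using assms by (intro powr_diff_le) auto
    moreover have "\<bar>(-a) - (-b)\<bar> = \<bar>a - b\<bar>" by simp
    moreover have "\<bar>Jmap q a - Jmap q b\<bar> = \<bar>(-a) powr (q - 1) - (-b) powr (q - 1)\<bar>" using 2 by (simp add: Jmap_cases(2))
    ultimately show ?thesis using nn by simp
  next
    case 3 then show ?thesis using mixed[of a "-b"] by (simp add: Jmap_cases)
  next
    case 4
    then have "Jmap q a - Jmap q b = - ((-a) powr (q - 1) + b powr (q - 1))" by (simp add: Jmap_cases)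
    then have "\<bar>Jmap q a - Jmap q b\<bar> = \<bar>(-a) powr (q - 1) + b powr (q - 1)\<bar>" by (simp only: abs_minus_cancel)
    moreover have "\<bar>a - b\<bar> = - a + b" using 4 by simp
    ultimately show ?thesis using mixed[of "-a" b] 4 by simp
  qed
qed

text \<open>Uniform smoothness of power type q: replacing the slope at \<open>x + y\<close> by the
  one at \<open>x\<close> costs a multiple of \<open>|y| powr q\<close>.\<close>

lemma abs_powr_add_le_smooth:
  fixes x y q :: real
  assumes q: "1 < q" "q \<le> 2"
  shows "\<bar>x + y\<bar> powr q \<le> \<bar>x\<bar> powr q + q * (Jmap q x * y) + 2 * q * \<bar>y\<bar> powr q"
proof -
  have "(Jmap q (x + y) - Jmap q x) * y \<le> \<bar>Jmap q (x + y) - Jmap q x\<bar> * \<bar>y\<bar>"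
    by (metis abs_ge_self abs_mult)
  also have "\<dots> \<le> (2 * \<bar>y\<bar> powr (q - 1)) * \<bar>y\<bar>" using Jmap_Holder[OF q, of "x + y" x] by (intro mult_right_mono) auto
  also have "\<dots> = 2 * \<bar>y\<bar> powr q" using powr_mult_base[of "\<bar>y\<bar>" "q - 1"] by (simp add: mult.commute)
  finally have "q * ((Jmap q (x + y) - Jmap q x) * y) \<le> q * (2 * \<bar>y\<bar> powr q)" using q by (intro mult_left_mono) auto
  then show ?thesis using abs_powr_tangent[OF q(1), of x y] by (simp add: algebra_simps)
qed

lemma powr_diff_le_convex:
  fixes x y \<alpha> :: real
  assumes "0 \<le> y" "y \<le> x" "1 < \<alpha>"
  shows "x powr \<alpha> - y powr \<alpha> \<le> \<alpha> * (x powr (\<alpha> - 1) * (x - y))"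
  using abs_powr_tangent[OF assms(3), of y "x - y"] assms by (simp add: Jmap_cases)

text \<open>For \<open>q > 2\<close> the derivative of the q-th power is locally Lipschitz, with
  constant growing like the power \<open>q - 2\<close>. This second-order control is what produces
  the exponent 2 of \<open>upper_est_type2\<close>.\<close>

lemma Jmap_Lipschitz:
  fixes a b q :: real
  assumes q: "2 < q"
  shows "\<bar>Jmap q a - Jmap q b\<bar> \<le> 2 * q * ((\<bar>a\<bar> + \<bar>b\<bar>) powr (q - 2) * \<bar>a - b\<bar>)"
proof -
  define R where "R = (\<bar>a\<bar> + \<bar>b\<bar>) powr (q - 2)"
  have R: "0 \<le> R" by (simp add: R_def)
  have same': "u powr (q - 1) - v powr (q - 1) \<le> 2 * q * (R * \<bar>a - b\<bar>)"
    if uv: "0 \<le> v" "v \<le> u" "u \<le> \<bar>a\<bar> + \<bar>b\<bar>" "u - v = \<bar>a - b\<bar>" for u v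
  proof -
    have "u powr (q - 1) - v powr (q - 1) \<le> (q - 1) * (u powr (q - 2) * (u - v))"
      using powr_diff_le_convex[of v u "q - 1"] uv q by simp
    also have "\<dots> \<le> (2 * q) * (R * \<bar>a - b\<bar>)"
      using q R uv by (intro mult_mono) (auto simp: R_def intro!: powr_mono2)
    finally show ?thesis by simp
  qed
  have same: "\<bar>u powr (q - 1) - v powr (q - 1)\<bar> \<le> 2 * q * (R * \<bar>a - b\<bar>)"
    if "0 \<le> u" "0 \<le> v" "\<bar>u - v\<bar> = \<bar>a - b\<bar>" "u \<le> \<bar>a\<bar> + \<bar>b\<bar>" "v \<le> \<bar>a\<bar> + \<bar>b\<bar>" for u v
    using same'[of v u] same'[of u v] that powr_mono2[of "q - 1" u v] powr_mono2[of "q - 1" v u] q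
    by (cases "v \<le> u") auto
  have mixed: "\<bar>u powr (q - 1) + v powr (q - 1)\<bar> \<le> 2 * q * (R * \<bar>a - b\<bar>)"
    if "0 \<le> u" "0 \<le> v" "u + v = \<bar>a - b\<bar>" "u + v = \<bar>a\<bar> + \<bar>b\<bar>" for u v
  proof -
    have "u powr (q - 1) + v powr (q - 1) \<le> (u + v) powr (q - 1)" using that q by (intro powr_superadditive) auto
    also have "\<dots> = (u + v) * (u + v) powr (q - 2)" using powr_mult_base[of "u + v" "q - 2"] that by simp
    also have "\<dots> = 1 * (R * \<bar>a - b\<bar>)" using that by (simp add: R_def mult.commute)
    also have "\<dots> \<le> 2 * q * (R * \<bar>a - b\<bar>)" using q R by (intro mult_right_mono) auto
    finally show ?thesis by simp
  qed
  consider "0 \<le> a" "0 \<le> b" | "a \<le> 0" "b \<le> 0" | "0 \<le> a" "b \<le> 0" | "a \<le> 0" "0 \<le> b" by linarith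
  then have "\<bar>Jmap q a - Jmap q b\<bar> \<le> 2 * q * (R * \<bar>a - b\<bar>)"
  proof cases
    case 1 then show ?thesis using same[of a b] by (simp add: Jmap_cases)
  next
    case 2
    then have "\<bar>Jmap q a - Jmap q b\<bar> = \<bar>(-b) powr (q - 1) - (-a) powr (q - 1)\<bar>" by (simp add: Jmap_cases(2))
    then show ?thesis using same[of "-b" "-a"] 2 by simp
  next
    case 3 then show ?thesis using mixed[of a "-b"] by (simp add: Jmap_cases)
  next
    case 4
    then have "Jmap q a - Jmap q b = - ((-a) powr (q - 1) + b powr (q - 1))" by (simp add: Jmap_cases)
    then have "\<bar>Jmap q a - Jmap q b\<bar> = \<bar>(-a) powr (q - 1) + b powr (q - 1)\<bar>" by (simp only: abs_minus_cancel)
    then show ?thesis using mixed[of "-a" b] 4 by simp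
  qed
  then show ?thesis by (simp add: R_def)
qed

text \<open>The Lipschitz bound leaves a remainder of size
  \<open>(|x + y| + |x|) powr (q - 2)\<close> times the square of \<open>y\<close>; it splits into a
  quadratic term, dominant for small \<open>y\<close>, and a q-th power, dominant for large
  \<open>y\<close>.\<close>

lemma abs_powr_add_le_type2:
  fixes q :: real
  assumes q: "2 < q"
  shows "\<exists>C\<ge>0. \<forall>x y. \<bar>x + y\<bar> powr q \<le> \<bar>x\<bar> powr q + q * (Jmap q x * y) + C * (\<bar>x\<bar> powr (q - 2) * y\<^sup>2 + \<bar>y\<bar> powr q)"
proof -
  define c where "c = 2 powr (q - 2)"
  have c: "1 \<le> c" using q by (simp add: c_def ge_one_powr_ge_zero)
  define C where "C = 2 * q * q * c * c"
  have "\<bar>x + y\<bar> powr q \<le> \<bar>x\<bar> powr q + q * (Jmap q x * y) + C * (\<bar>x\<bar> powr (q - 2) * y\<^sup>2 + \<bar>y\<bar> powr q)" for x y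
  proof -
    define A where "A = \<bar>x\<bar> powr (q - 2)"
    define B where "B = \<bar>y\<bar> powr (q - 2)"
    have AB: "0 \<le> A" "0 \<le> B" by (auto simp: A_def B_def)

    have "(\<bar>x + y\<bar> + \<bar>x\<bar>) powr (q - 2) \<le> \<bar>2 * \<bar>x\<bar> + \<bar>y\<bar>\<bar> powr (q - 2)" using q by (intro powr_mono2) auto
    also have "\<dots> \<le> c * (\<bar>2 * \<bar>x\<bar>\<bar> powr (q - 2) + \<bar>\<bar>y\<bar>\<bar> powr (q - 2))"
      unfolding c_def using q by (intro abs_add_powr_le) simp
    also have "\<dots> = c * (c * A + B)" by (simp add: A_def B_def c_def powr_mult)
    also have "\<dots> \<le> c * (c * A + c * B)" using c AB mult_right_mono[of 1 c B] by (intro mult_left_mono add_mono) auto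
    finally have 1: "(\<bar>x + y\<bar> + \<bar>x\<bar>) powr (q - 2) \<le> c * c * (A + B)" by (simp add: algebra_simps)
    have "(Jmap q (x + y) - Jmap q x) * y \<le> \<bar>Jmap q (x + y) - Jmap q x\<bar> * \<bar>y\<bar>" by (metis abs_ge_self abs_mult)
    also have "\<dots> \<le> (2 * q * ((\<bar>x + y\<bar> + \<bar>x\<bar>) powr (q - 2) * \<bar>y\<bar>)) * \<bar>y\<bar>"
      using Jmap_Lipschitz[OF q, of "x + y" x] by (intro mult_right_mono) auto
    also have "\<dots> = 2 * q * ((\<bar>x + y\<bar> + \<bar>x\<bar>) powr (q - 2) * y\<^sup>2)" by (simp add: power2_eq_square)
    also have "\<dots> \<le> 2 * q * ((c * c * (A + B)) * y\<^sup>2)"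
      using 1 q by (intro mult_left_mono mult_right_mono) auto
    finally have "q * ((Jmap q (x + y) - Jmap q x) * y) \<le> q * (2 * q * ((c * c * (A + B)) * y\<^sup>2))"
      using q by (intro mult_left_mono) auto
    also have "\<dots> = C * (A * y\<^sup>2 + B * y\<^sup>2)" by (simp add: C_def algebra_simps)
    also have "y\<^sup>2 = \<bar>y\<bar> * \<bar>y\<bar>" by (simp add: power2_eq_square)
    then have "B * y\<^sup>2 = \<bar>y\<bar> * (\<bar>y\<bar> * \<bar>y\<bar> powr (q - 2))" by (simp only: B_def mult_ac)
    then have "B * y\<^sup>2 = \<bar>y\<bar> powr q"
      using powr_mult_base[of "\<bar>y\<bar>" "q - 1"] powr_mult_base[of "\<bar>y\<bar>" "q - 2"] by simp
    finally show ?thesis using abs_powr_tangent[of q x y] q by (simp add: A_def algebra_simps)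
  qed
  moreover have "0 \<le> C" using q c by (simp add: C_def)
  ultimately show ?thesis by blast
qed

text \<open>Here the linear term is kept in absolute value instead of being cancelled by weak
  convergence; the inequality is meant for increments that are small in L^1.\<close>

lemma abs_powr_add_le_crude:
  fixes x y q :: real
  assumes q: "1 < q"
  shows "\<bar>x + y\<bar> powr q \<le> \<bar>x\<bar> powr q + q * 2 powr (q - 1) * (\<bar>x\<bar> powr (q - 1) * \<bar>y\<bar> + \<bar>y\<bar> powr q)"
proof -
  have "Jmap q (x + y) * y \<le> \<bar>Jmap q (x + y)\<bar> * \<bar>y\<bar>" by (metis abs_ge_self abs_mult)
  also have "\<dots> = \<bar>x + y\<bar> powr (q - 1) * \<bar>y\<bar>" by (simp add: abs_Jmap)
  also have "\<dots> \<le> (2 powr (q - 1) * (\<bar>x\<bar> powr (q - 1) + \<bar>y\<bar> powr (q - 1))) * \<bar>y\<bar>"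
    using q by (intro mult_right_mono abs_add_powr_le) auto
  also have "\<dots> = 2 powr (q - 1) * (\<bar>x\<bar> powr (q - 1) * \<bar>y\<bar> + \<bar>y\<bar> powr q)"
    using powr_mult_base[of "\<bar>y\<bar>" "q - 1"] by (simp add: algebra_simps)
  finally have "q * (Jmap q (x + y) * y) \<le> q * (2 powr (q - 1) * (\<bar>x\<bar> powr (q - 1) * \<bar>y\<bar> + \<bar>y\<bar> powr q))"
    using q by (intro mult_left_mono) auto
  then show ?thesis using abs_powr_tangent[OF q, of x y] by (simp add: mult.assoc)
qed

text \<open>In other words: sending the n-th unit vector of ell^r to \<open>H n\<close>, for
  \<open>n\<close> in some member \<open>A\<close> of the ultrafilter, defines a bounded map into
  L^q.\<close>

definition upper_est :: "real \<Rightarrow> real \<Rightarrow> nat filter \<Rightarrow> useq \<Rightarrow> bool" where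
  "upper_est q r U H \<longleftrightarrow> (\<exists>A C. (\<forall>\<^sub>F n in U. n \<in> A) \<and> 0 \<le> C \<and>
     (\<forall>s a. finite s \<longrightarrow> s \<subseteq> A \<longrightarrow>
        lpnorm q (\<lambda>x. \<Sum>n\<in>s. a n * H n x) \<le> C * (\<Sum>n\<in>s. \<bar>a n\<bar> powr r) powr (1 / r)))"

lemma abs_le_powr_sum:
  fixes a :: "nat \<Rightarrow> real"
  assumes "finite s" "n \<in> s" "0 < r"
  shows "\<bar>a n\<bar> \<le> (\<Sum>n\<in>s. \<bar>a n\<bar> powr r) powr (1 / r)"
proof -
  have "\<bar>a n\<bar> = (\<bar>a n\<bar> powr r) powr (1 / r)" using assms by (simp add: powr_powr)
  also have "\<dots> \<le> (\<Sum>n\<in>s. \<bar>a n\<bar> powr r) powr (1 / r)"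
    using assms by (intro powr_mono2 member_le_sum) auto
  finally show ?thesis .
qed

lemma sum_half_powers_le: "finite s \<Longrightarrow> (\<Sum>n\<in>s. (1 / 2 :: real) ^ n) \<le> 2"
  using sum_le_suminf[of "\<lambda>n. (1 / 2 :: real) ^ n" s] suminf_geometric[of "1 / 2 :: real"] by simp

text \<open>Each coefficient is at most the ell^r norm, so an error summable over all indices adds
  only 2 to the constant. This permits replacing a sequence by simple functions.\<close>

lemma upper_est_perturb:
  assumes q: "1 \<le> q" and r: "0 < r" and H': "upper_est q r U H'"
    and L: "\<And>n. H n \<in> Lp q" "\<And>n. H' n \<in> Lp q"
    and d: "\<And>n. lpnorm q (\<lambda>x. H n x - H' n x) \<le> (1 / 2) ^ n"
  shows "upper_est q r U H"
proof -
  obtain A C where A: "\<forall>\<^sub>F n in U. n \<in> A" "0 \<le> C"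
    and C: "\<And>s a. finite s \<Longrightarrow> s \<subseteq> A \<Longrightarrow> lpnorm q (\<lambda>x. \<Sum>n\<in>s. a n * H' n x) \<le> C * (\<Sum>n\<in>s. \<bar>a n\<bar> powr r) powr (1 / r)"
    using H' unfolding upper_est_def by blast
  have "lpnorm q (\<lambda>x. \<Sum>n\<in>s. a n * H n x) \<le> (C + 2) * (\<Sum>n\<in>s. \<bar>a n\<bar> powr r) powr (1 / r)"
    if s: "finite s" "s \<subseteq> A" for s a
  proof -
    let ?R = "(\<Sum>n\<in>s. \<bar>a n\<bar> powr r) powr (1 / r)"
    have D: "(\<lambda>x. H n x - H' n x) \<in> Lp q" for n using L q by (intro Lp_diff) auto
    have "lpnorm q (\<lambda>x. \<Sum>n\<in>s. a n * (H n x - H' n x)) \<le> (\<Sum>n\<in>s. lpnorm q (\<lambda>x. a n * (H n x - H' n x)))"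
      using q by (intro lpnorm_sum_le Lp_scale D) auto
    also have "\<dots> = (\<Sum>n\<in>s. \<bar>a n\<bar> * lpnorm q (\<lambda>x. H n x - H' n x))"
      using q by (intro sum.cong refl lpnorm_scale) simp
    also have "\<dots> \<le> (\<Sum>n\<in>s. ?R * (1 / 2) ^ n)"
      using abs_le_powr_sum[OF s(1) _ r] d by (intro sum_mono mult_mono) auto
    also have "\<dots> = ?R * (\<Sum>n\<in>s. (1 / 2) ^ n)" by (simp add: sum_distrib_left)
    also have "\<dots> \<le> ?R * 2" using sum_half_powers_le[OF s(1)] by (intro mult_left_mono) auto
    finally have 1: "lpnorm q (\<lambda>x. \<Sum>n\<in>s. a n * (H n x - H' n x)) \<le> 2 * ?R" by simp
    have "(\<lambda>x. \<Sum>n\<in>s. a n * H n x) = (\<lambda>x. (\<Sum>n\<in>s. a n * H' n x) + (\<Sum>n\<in>s. a n * (H n x - H' n x)))"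
      by (simp add: sum.distrib[symmetric] algebra_simps)
    moreover have "lpnorm q (\<lambda>x. (\<Sum>n\<in>s. a n * H' n x) + (\<Sum>n\<in>s. a n * (H n x - H' n x)))
        \<le> lpnorm q (\<lambda>x. \<Sum>n\<in>s. a n * H' n x) + lpnorm q (\<lambda>x. \<Sum>n\<in>s. a n * (H n x - H' n x))"
      using L q D by (intro lpnorm_triangle Lp_sum Lp_scale) auto
    ultimately show ?thesis using 1 C[OF s, of a] by (simp add: distrib_right)
  qed
  then show ?thesis unfolding upper_est_def using A by (intro exI[of _ A] exI[of _ "C + 2"]) simp
qed

lemma upper_est_exponent_mono:
  assumes H: "upper_est p r U H" and L: "\<And>n. H n \<in> Lp p" and q: "1 < q" "q \<le> p"
  shows "upper_est q r U H"
proof -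
  obtain A C where A: "\<forall>\<^sub>F n in U. n \<in> A" "0 \<le> C"
    and C: "\<And>s a. finite s \<Longrightarrow> s \<subseteq> A \<Longrightarrow> lpnorm p (\<lambda>x. \<Sum>n\<in>s. a n * H n x) \<le> C * (\<Sum>n\<in>s. \<bar>a n\<bar> powr r) powr (1 / r)"
    using H unfolding upper_est_def by blast
  have "lpnorm q (\<lambda>x. \<Sum>n\<in>s. a n * H n x) \<le> C * (\<Sum>n\<in>s. \<bar>a n\<bar> powr r) powr (1 / r)"
    if "finite s" "s \<subseteq> A" for s a
  proof (rule order_trans[OF _ C[OF that]])
    show "lpnorm q (\<lambda>x. \<Sum>n\<in>s. a n * H n x) \<le> lpnorm p (\<lambda>x. \<Sum>n\<in>s. a n * H n x)"
      using L q by (intro Lp_exponent_mono(2)[OF _ q] Lp_sum Lp_scale) auto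
  qed
  then show ?thesis unfolding upper_est_def using A by blast
qed

section \<open>Upper estimates along members of a selective ultrafilter\<close>

locale selective = ultra +
  assumes selective: "selective_ultrafilter U"
begin

text \<open>The bound is uniform in all coefficients of modulus at most one, because the index set
  is selected before any coefficients are known. For \<open>r < q\<close> the increment may depend
  on the current norm through the power \<open>q - r\<close>.\<close>

definition upper_step :: "real \<Rightarrow> real \<Rightarrow> real \<Rightarrow> real \<Rightarrow> useq \<Rightarrow> nat set \<Rightarrow> nat \<Rightarrow> bool" where
  "upper_step q r C \<epsilon> H s n \<longleftrightarrow> (\<forall>a. (\<forall>i. \<bar>a i\<bar> \<le> 1) \<longrightarrow>
     lpnorm q (\<lambda>x. (\<Sum>i\<in>s. a i * H i x) + a n * H n x) powr q
       \<le> lpnorm q (\<lambda>x. \<Sum>i\<in>s. a i * H i x) powr q + \<epsilon>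
          + C * (lpnorm q (\<lambda>x. \<Sum>i\<in>s. a i * H i x) powr (q - r) * \<bar>a n\<bar> powr r + \<bar>a n\<bar> powr q))"

text \<open>With $t = q/r$ the partial sums satisfy
  $\|S\|_q^q \le (K (\sum |a_i|^r + \sum_{k<|s|} 2^{-k}))^t$, by induction on the largest index.\<close>
theorem upper_est_of_step:
  assumes r: "0 < r" "r \<le> q" and C: "0 \<le> C"
    and step: "\<And>s \<epsilon>. finite s \<Longrightarrow> 0 < \<epsilon> \<Longrightarrow> \<forall>\<^sub>F n in U. upper_step q r C \<epsilon> H s n"
  shows "upper_est q r U H"
proof -
  define t where "t = q / r"
  have t: "1 \<le> t" using r by (simp add: t_def)
  have q: "0 < q" using r by simp
  define K where "K = 2 * max 1 C"
  have K: "2 \<le> K" "2 * C \<le> K" by (auto simp: K_def)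
  \<comment> \<open>The t-th root of the error granted at rank \<open>k\<close> is
    \<open>K * (1 / 2) ^ k\<close>, so that the errors add up geometrically inside the t-th
    power.\<close>
  define \<delta> where "\<delta> k = (K * (1 / 2) ^ k) powr t" for k :: nat
  have \<delta>: "0 < \<delta> k" for k using K by (simp add: \<delta>_def)
  have \<delta>mono: "\<delta> k \<le> \<delta> l" if "l \<le> k" for k l
    unfolding \<delta>_def using K t that by (intro powr_mono2 mult_left_mono power_decreasing) auto
  \<comment> \<open>All subsets of an initial segment are treated together: there are finitely many
    of them, and the set built so far is one.\<close>
  define B where "B m = {n. \<forall>s\<in>Pow {..m}. upper_step q r C (\<delta> (Suc m)) H s n}" for m
  have evB: "\<forall>\<^sub>F n in U. n \<in> B m" for m
  proof -
    have "\<forall>s\<in>Pow {..m}. \<forall>\<^sub>F n in U. upper_step q r C (\<delta> (Suc m)) H s n"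
      using \<delta> finite_subset[of _ "{..m}"] by (auto intro!: step)
    then have "\<forall>\<^sub>F n in U. \<forall>s\<in>Pow {..m}. upper_step q r C (\<delta> (Suc m)) H s n"
      by (intro eventually_ball_finite) auto
    then show ?thesis by (simp add: B_def)
  qed
  obtain A0 where A0: "\<forall>\<^sub>F n in U. n \<in> A0" "\<forall>m\<in>A0. \<forall>n\<in>A0. m < n \<longrightarrow> n \<in> B m"
    using selective_diagonal[of U B, OF selective evB] by blast
  \<comment> \<open>The first element of a set has no predecessor in it, so its step from the empty
    sum is imposed separately.\<close>
  define A where "A = {n \<in> A0. upper_step q r C (\<delta> 0) H {} n}"
  have evA: "\<forall>\<^sub>F n in U. n \<in> A"
    using A0(1) step[of "{}", OF _ \<delta>[of 0]] by (simp add: A_def eventually_conj)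
  have sA: "upper_step q r C (\<delta> (card s)) H s n" if s: "finite s" "s \<subseteq> A" "\<forall>m\<in>s. m < n" "n \<in> A" for s n
  proof (cases "s = {}")
    case True then show ?thesis using s(4) by (simp add: A_def)
  next
    case False
    define m where "m = Max s"
    have m: "m \<in> s" "\<And>k. k \<in> s \<Longrightarrow> k \<le> m" using s(1) False by (auto simp: m_def)
    have sm: "s \<subseteq> {..m}" using m by auto
    \<comment> \<open>A set with maximum \<open>m\<close> has at most \<open>m + 1\<close> elements,
      so the error granted at \<open>m\<close> is no larger than the one budgeted for its
      cardinality.\<close>
    have "card s \<le> card {..m}" using sm by (intro card_mono) auto
    then have c: "card s \<le> Suc m" by simp
    have "n \<in> B m" using A0(2) m s by (auto simp: A_def)
    then have u: "upper_step q r C (\<delta> (Suc m)) H s n" using sm by (auto simp: B_def)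
    show ?thesis unfolding upper_step_def
    proof (intro allI impI)
      fix a :: "nat \<Rightarrow> real" assume "\<forall>i. \<bar>a i\<bar> \<le> 1"
      then show "lpnorm q (\<lambda>x. (\<Sum>i\<in>s. a i * H i x) + a n * H n x) powr q
       \<le> lpnorm q (\<lambda>x. \<Sum>i\<in>s. a i * H i x) powr q + \<delta> (card s)
          + C * (lpnorm q (\<lambda>x. \<Sum>i\<in>s. a i * H i x) powr (q - r) * \<bar>a n\<bar> powr r + \<bar>a n\<bar> powr q)"
        using u[unfolded upper_step_def, rule_format, of a] \<delta>mono[OF c] by fastforce
    qed
  qed
  have main: "lpnorm q (\<lambda>x. \<Sum>i\<in>s. a i * H i x) powr q
      \<le> (K * ((\<Sum>i\<in>s. \<bar>a i\<bar> powr r) + (\<Sum>k<card s. (1 / 2) ^ k))) powr t"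
    if s: "finite s" "s \<subseteq> A" and a: "\<forall>i. \<bar>a i\<bar> \<le> 1" for s a
    using s
  proof (induction s rule: finite_linorder_max_induct)
    case empty then show ?case by simp
  next
    case (insert n s)
    let ?S = "\<lambda>x. \<Sum>i\<in>s. a i * H i x"
    define X where "X = K * ((\<Sum>i\<in>s. \<bar>a i\<bar> powr r) + (\<Sum>k<card s. (1 / 2) ^ k))"
    have X0: "0 \<le> X" unfolding X_def using K by (intro mult_nonneg_nonneg add_nonneg_nonneg sum_nonneg) auto
    have IH: "lpnorm q ?S powr q \<le> X powr t" using insert by (simp add: X_def)
    define b where "b = \<bar>a n\<bar> powr r"
    define z where "z = K * (1 / 2) ^ card s"
    have b: "0 \<le> b" "b powr t = \<bar>a n\<bar> powr q" using r by (auto simp: b_def t_def powr_powr)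
    have z: "0 \<le> z" "z powr t = \<delta> (card s)" using K by (auto simp: z_def \<delta>_def)
    have S: "lpnorm q ?S powr (q - r) \<le> X powr (t - 1)"
    proof -
      have "lpnorm q ?S powr (q - r) = (lpnorm q ?S powr q) powr ((q - r) / q)" using q by (simp add: powr_powr)
      also have "\<dots> \<le> (X powr t) powr ((q - r) / q)" using IH q r by (intro powr_mono2) auto
      also have "t * ((q - r) / q) = t - 1" using r q by (simp add: t_def field_simps)
      then have "(X powr t) powr ((q - r) / q) = X powr (t - 1)" by (simp add: powr_powr)
      finally show ?thesis .
    qed
    have "upper_step q r C (\<delta> (card s)) H s n" using insert by (intro sA) auto
    then have "lpnorm q (\<lambda>x. ?S x + a n * H n x) powr q \<le> lpnorm q ?S powr q + \<delta> (card s)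
          + C * (lpnorm q ?S powr (q - r) * \<bar>a n\<bar> powr r + \<bar>a n\<bar> powr q)"
      using a unfolding upper_step_def by blast
    also have "\<dots> \<le> X powr t + z powr t + C * (X powr (t - 1) * b + b powr t)"
      unfolding z(2) b(2) b_def[symmetric] using IH S C b by (intro add_mono mult_left_mono mult_right_mono) auto
    also have "\<dots> \<le> (X + K * b + z) powr t" using t X0 b z K by (intro powr_step) auto
    also have "X + K * b + z = K * ((\<Sum>i\<in>insert n s. \<bar>a i\<bar> powr r) + (\<Sum>k<card (insert n s). (1 / 2) ^ k))"
      using insert by (auto simp: X_def b_def z_def algebra_simps)
    also have "(\<lambda>x. ?S x + a n * H n x) = (\<lambda>x. \<Sum>i\<in>insert n s. a i * H i x)"
      using insert by (auto simp: fun_eq_iff)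
    finally show ?case .
  qed
  \<comment> \<open>For coefficients of ell^r norm one the bracket is at most 1 + 2, the 2 bounding
    the geometric sum of the errors.\<close>
  define C' where "C' = (3 * K) powr (1 / r)"
  have "lpnorm q (\<lambda>x. \<Sum>i\<in>s. a i * H i x) \<le> C' * (\<Sum>i\<in>s. \<bar>a i\<bar> powr r) powr (1 / r)"
    if s: "finite s" "s \<subseteq> A" for s a
  proof (cases "(\<Sum>i\<in>s. \<bar>a i\<bar> powr r) = 0")
    case True
    then have "\<forall>i\<in>s. a i = 0" using s by (subst (asm) sum_nonneg_eq_0_iff) auto
    then have "(\<lambda>x. \<Sum>i\<in>s. a i * H i x) = (\<lambda>x. 0)" by simp
    then show ?thesis by (simp add: C'_def)
  next
    case False
    define R where "R = (\<Sum>i\<in>s. \<bar>a i\<bar> powr r) powr (1 / r)"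
    have R: "0 < R" using False by (simp add: R_def)
    have Rr: "R powr r = (\<Sum>i\<in>s. \<bar>a i\<bar> powr r)" using r by (simp add: R_def powr_powr sum_nonneg)
    define a' where "a' i = (if i \<in> s then a i / R else 0)" for i
    have a': "\<forall>i. \<bar>a' i\<bar> \<le> 1"
      using abs_le_powr_sum[OF s(1) _ r(1), of _ a] R by (auto simp: a'_def R_def[symmetric] divide_le_eq)
    have "(\<Sum>i\<in>s. \<bar>a' i\<bar> powr r) = (\<Sum>i\<in>s. \<bar>a i\<bar> powr r / R powr r)"
      using R by (intro sum.cong) (auto simp: a'_def powr_divide)
    also have "\<dots> = R powr r / R powr r" by (simp only: sum_divide_distrib[symmetric] Rr)
    also have "\<dots> = 1" using R by simp
    finally have 1: "(\<Sum>i\<in>s. \<bar>a' i\<bar> powr r) = 1" .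
    have "lpnorm q (\<lambda>x. \<Sum>i\<in>s. a' i * H i x) powr q \<le> (K * (1 + (\<Sum>k<card s. (1 / 2) ^ k))) powr t"
      using main[OF s a'] 1 by simp
    also have "\<dots> \<le> (3 * K) powr t"
      using K t sum_half_powers_le[of "{..<card s}"] mult_left_mono[of "1 + (\<Sum>k<card s. (1 / 2) ^ k)" 3 K]
      by (intro powr_mono2) (auto intro!: mult_nonneg_nonneg add_nonneg_nonneg sum_nonneg simp: mult.commute)
    finally have "(lpnorm q (\<lambda>x. \<Sum>i\<in>s. a' i * H i x) powr q) powr (1 / q) \<le> ((3 * K) powr t) powr (1 / q)"
      using q by (intro powr_mono2) auto
    then have 2: "lpnorm q (\<lambda>x. \<Sum>i\<in>s. a' i * H i x) \<le> C'"
      using q r by (simp add: powr_powr C'_def t_def)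
    have "(\<lambda>x. \<Sum>i\<in>s. a i * H i x) = (\<lambda>x. R * (\<Sum>i\<in>s. a' i * H i x))"
      using R by (simp add: sum_distrib_left a'_def)
    then have "lpnorm q (\<lambda>x. \<Sum>i\<in>s. a i * H i x) = R * lpnorm q (\<lambda>x. \<Sum>i\<in>s. a' i * H i x)"
      using q R by (simp add: lpnorm_scale)
    also have "\<dots> \<le> R * C'" using 2 R by (intro mult_left_mono) auto
    finally show ?thesis by (simp add: R_def mult.commute)
  qed
  then show ?thesis unfolding upper_est_def using evA by (intro exI[of _ A] exI[of _ C']) (auto simp: C'_def)
qed

text \<open>Finitely many simple functions generate a finite algebra of sets, which makes the
  weak convergence uniform over all functions of them.\<close>
lemma weak_uniform_small:
  fixes s :: "nat set" and u :: "nat \<Rightarrow> real \<Rightarrow> real"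
  assumes fin: "finite s" and u: "\<And>i. i \<in> s \<Longrightarrow> simple_function M01 (u i)"
    and k: "\<And>n. integrable M01 (k n)"
    and lim: "\<And>E. E \<in> sets M01 \<Longrightarrow> ((\<lambda>n. LINT x|M01. indicator E x * k n x) \<longlongrightarrow> 0) U"
    and \<epsilon>: "0 < \<epsilon>" and R: "0 \<le> (R::real)"
  shows "\<forall>\<^sub>F n in U. \<forall>\<theta>. (\<forall>x\<in>{0..1}. \<bar>\<theta> (\<lambda>i\<in>s. u i x)\<bar> \<le> R) \<longrightarrow>
     \<bar>LINT x|M01. \<theta> (\<lambda>i\<in>s. u i x) * k n x\<bar> \<le> \<epsilon>"
proof -
  define \<rho> where "\<rho> x = (\<lambda>i\<in>s. u i x)" for x
  define V where "V = \<rho> ` {0..1}"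
  define E where "E v = {x \<in> {0..1}. \<rho> x = v}" for v
  have "V \<subseteq> Pi\<^sub>E s (\<lambda>i. u i ` space M01)" by (auto simp: V_def \<rho>_def)
  then have V: "finite V" using fin simple_functionD(1)[OF u] finite_PiE[OF fin] finite_subset by (metis (no_types, lifting))
  have E: "E v \<in> sets M01" if "v \<in> V" for v
  proof -
    have "E v = space M01 \<inter> (\<Inter>i\<in>s. u i -` {v i} \<inter> space M01)" if "s \<noteq> {}"
      using \<open>v \<in> V\<close> that by (auto simp: E_def V_def \<rho>_def fun_eq_iff restrict_def)
    moreover have "E v = space M01" if "s = {}" using \<open>v \<in> V\<close> that by (auto simp: E_def V_def \<rho>_def)
    moreover have "(\<Inter>i\<in>s. u i -` {v i} \<inter> space M01) \<in> sets M01" if "s \<noteq> {}"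
      using fin that simple_functionD(2)[OF u] by (intro sets.finite_INT) auto
    ultimately show ?thesis using sets.Int[OF sets.top] by (cases "s = {}") (simp_all del: space_M01)
  qed
  have "((\<lambda>n. R * (\<Sum>v\<in>V. \<bar>LINT x|M01. indicator (E v) x * k n x\<bar>)) \<longlongrightarrow> R * (\<Sum>v\<in>V. \<bar>0\<bar>)) U"
    using lim E by (intro tendsto_intros) auto
  then have "((\<lambda>n. R * (\<Sum>v\<in>V. \<bar>LINT x|M01. indicator (E v) x * k n x\<bar>)) \<longlongrightarrow> 0) U" by simp
  from order_tendstoD(2)[OF this \<epsilon>] show ?thesis
  proof eventually_elim
    case (elim n)
    show ?case
    proof (intro allI impI)
      fix \<theta> :: "(nat \<Rightarrow> real) \<Rightarrow> real" assume \<theta>: "\<forall>x\<in>{0..1}. \<bar>\<theta> (\<lambda>i\<in>s. u i x)\<bar> \<le> R"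
      have \<theta>V: "\<bar>\<theta> v\<bar> \<le> R" if "v \<in> V" for v using that \<theta> by (auto simp: V_def \<rho>_def)
      have I: "integrable M01 (\<lambda>x. indicator (E v) x * k n x)" if "v \<in> V" for v
        using integrable_mult_indicator[OF E[OF that] k[of n]] by simp
      have "(LINT x|M01. \<theta> (\<lambda>i\<in>s. u i x) * k n x) = (LINT x|M01. (\<Sum>v\<in>V. \<theta> v * (indicator (E v) x * k n x)))"
      proof (intro Bochner_Integration.integral_cong refl)
        fix x assume x: "x \<in> space M01"
        have "(\<Sum>v\<in>V. \<theta> v * (indicator (E v) x * k n x)) = (\<Sum>v\<in>V. if \<rho> x = v then \<theta> v * k n x else 0)"
          using x by (intro sum.cong) (auto simp: E_def indicator_def)
        also have "\<dots> = \<theta> (\<rho> x) * k n x" using x V by (subst sum.delta'[OF V]) (auto simp: V_def)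
        finally show "\<theta> (\<lambda>i\<in>s. u i x) * k n x = (\<Sum>v\<in>V. \<theta> v * (indicator (E v) x * k n x))" by (simp add: \<rho>_def)
      qed
      also have "\<dots> = (\<Sum>v\<in>V. \<theta> v * (LINT x|M01. indicator (E v) x * k n x))"
        using I by (subst Bochner_Integration.integral_sum) auto
      finally have "\<bar>LINT x|M01. \<theta> (\<lambda>i\<in>s. u i x) * k n x\<bar> \<le> (\<Sum>v\<in>V. \<bar>\<theta> v * (LINT x|M01. indicator (E v) x * k n x)\<bar>)"
        by simp
      also have "\<dots> \<le> (\<Sum>v\<in>V. R * \<bar>LINT x|M01. indicator (E v) x * k n x\<bar>)"
        using \<theta>V by (intro sum_mono) (auto simp: abs_mult intro!: mult_right_mono)
      also have "\<dots> \<le> \<epsilon>" using elim by (simp add: sum_distrib_left)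
      finally show "\<bar>LINT x|M01. \<theta> (\<lambda>i\<in>s. u i x) * k n x\<bar> \<le> \<epsilon>" .
    qed
  qed
qed

lemma simple_approximation:
  assumes H: "H \<in> UP q" and q: "1 \<le> q"
  obtains H' B where "\<And>n. simple_function M01 (H' n)" "\<And>n. H' n \<in> Lp q"
    "\<And>n. lpnorm q (\<lambda>x. H n x - H' n x) \<le> (1 / 2) ^ n" "\<And>n. lpnorm q (H' n) \<le> B" "0 \<le> B"
proof -
  have "\<exists>h. simple_function M01 h \<and> h \<in> Lp q \<and> lpnorm q (\<lambda>x. H n x - h x) < (1 / 2) ^ n" for n
  proof -
    obtain h where "simple_function M01 h" "h \<in> Lp q" "lpnorm q (\<lambda>x. H n x - h x) < (1 / 2) ^ n"
      using Lp_simple_dense[OF UP_Lp[OF H, of n] q, of "(1 / 2) ^ n"] by auto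
    then show ?thesis by blast
  qed
  then obtain H' where H': "\<And>n. simple_function M01 (H' n)" "\<And>n. H' n \<in> Lp q"
    "\<And>n. lpnorm q (\<lambda>x. H n x - H' n x) < (1 / 2) ^ n" by metis
  obtain B where B: "0 \<le> B" "\<And>n. lpnorm q (H n) \<le> B" using UP_bound[OF H] by blast
  have "lpnorm q (H' n) \<le> B + 1" for n
  proof -
    have "lpnorm q (H' n) \<le> lpnorm q (H n) + lpnorm q (\<lambda>x. H n x - H' n x)"
      using lpnorm_reverse_triangle[OF UP_Lp[OF H, of n] H'(2)[of n] q] by linarith
    moreover have "(1 / 2 :: real) ^ n \<le> 1" by (simp add: power_le_one)
    ultimately show ?thesis using B(2)[of n] H'(3)[of n] by linarith
  qed
  then show thesis using that[of H' "B + 1", OF H'(1,2) H'(3)[THEN less_imp_le]] B(1) by simp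
qed

lemma simple_sum_bound:
  fixes s :: "nat set" and u :: "nat \<Rightarrow> real \<Rightarrow> real"
  assumes fin: "finite s" and u: "\<And>i. simple_function M01 (u i)"
  shows "\<exists>m\<ge>0. \<forall>a x. (\<forall>i. \<bar>a i\<bar> \<le> 1) \<longrightarrow> x \<in> {0..1} \<longrightarrow> \<bar>\<Sum>i\<in>s. a i * u i x\<bar> \<le> m"
proof -
  define m where "m = (\<Sum>i\<in>s. Max (insert 0 (abs ` u i ` space M01)))"
  have b: "\<bar>u i x\<bar> \<le> Max (insert 0 (abs ` u i ` space M01))" if "x \<in> {0..1}" for i x
    using that simple_functionD(1)[OF u[of i]] by (intro Max_ge) auto
  have "\<bar>\<Sum>i\<in>s. a i * u i x\<bar> \<le> m" if a: "\<forall>i. \<bar>a i\<bar> \<le> 1" and x: "x \<in> {0..1}" for a x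
  proof -
    have "\<bar>\<Sum>i\<in>s. a i * u i x\<bar> \<le> (\<Sum>i\<in>s. \<bar>a i * u i x\<bar>)" by (rule sum_abs)
    also have "\<dots> \<le> m" unfolding m_def
    proof (rule sum_mono)
      fix i
      have "\<bar>a i * u i x\<bar> \<le> 1 * \<bar>u i x\<bar>" unfolding abs_mult using a by (intro mult_right_mono) auto
      then show "\<bar>a i * u i x\<bar> \<le> Max (insert 0 (abs ` u i ` space M01))" using b[OF x, of i] by simp
    qed
    finally show ?thesis .
  qed
  moreover have "0 \<le> m" unfolding m_def using simple_functionD(1)[OF u] by (intro sum_nonneg Max_ge) auto
  ultimately show ?thesis by blast
qed

text \<open>The functions \<open>Jmap q (\<Sum>i\<in>s. a i * u i x)\<close> all depend on the same
  finite tuple of simple functions and share one bound, so \<open>weak_uniform_small\<close> treats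
  every admissible \<open>a\<close> at once.\<close>

lemma Jmap_sum_small:
  fixes s :: "nat set" and u :: "nat \<Rightarrow> real \<Rightarrow> real"
  assumes q: "1 < q" and fin: "finite s" and u: "\<And>i. simple_function M01 (u i)"
    and k: "\<And>n. integrable M01 (k n)"
    and lim: "\<And>E. E \<in> sets M01 \<Longrightarrow> ((\<lambda>n. LINT x|M01. indicator E x * k n x) \<longlongrightarrow> 0) U"
    and \<epsilon>: "0 < \<epsilon>"
  shows "\<forall>\<^sub>F n in U. \<forall>a. (\<forall>i. \<bar>a i\<bar> \<le> 1) \<longrightarrow> \<bar>LINT x|M01. Jmap q (\<Sum>i\<in>s. a i * u i x) * k n x\<bar> \<le> \<epsilon>"
proof -
  obtain m where m: "0 \<le> m" "\<forall>a x. (\<forall>i. \<bar>a i\<bar> \<le> 1) \<longrightarrow> x \<in> {0..1} \<longrightarrow> \<bar>\<Sum>i\<in>s. a i * u i x\<bar> \<le> m"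
    using simple_sum_bound[of s u, OF fin u] by blast
  have "\<forall>\<^sub>F n in U. \<forall>\<theta>. (\<forall>x\<in>{0..1}. \<bar>\<theta> (\<lambda>i\<in>s. u i x)\<bar> \<le> m powr (q - 1)) \<longrightarrow>
     \<bar>LINT x|M01. \<theta> (\<lambda>i\<in>s. u i x) * k n x\<bar> \<le> \<epsilon>"
    by (rule weak_uniform_small[OF fin u k lim \<epsilon>]) simp_all
  then show ?thesis
  proof eventually_elim
    case (elim n)
    show ?case
    proof (intro allI impI)
      fix a :: "nat \<Rightarrow> real" assume a: "\<forall>i. \<bar>a i\<bar> \<le> 1"
      define \<theta> where "\<theta> v = Jmap q (\<Sum>i\<in>s. a i * v i)" for v
      have e: "\<theta> (\<lambda>i\<in>s. u i x) = Jmap q (\<Sum>i\<in>s. a i * u i x)" for x by (simp add: \<theta>_def)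
      have "\<forall>x\<in>{0..1}. \<bar>\<theta> (\<lambda>i\<in>s. u i x)\<bar> \<le> m powr (q - 1)"
        using m(2) a q by (auto simp: e abs_Jmap intro!: powr_mono2)
      then show "\<bar>LINT x|M01. Jmap q (\<Sum>i\<in>s. a i * u i x) * k n x\<bar> \<le> \<epsilon>"
        using elim[rule_format, of \<theta>] by (simp add: e)
    qed
  qed
qed

lemma simple_weak_null:
  assumes qp: "conjugate_exponents q p" and H: "H \<in> Lhat q U" and H': "\<And>n. H' n \<in> Lp q"
    and d: "\<And>n. lpnorm q (\<lambda>x. H n x - H' n x) \<le> (1 / 2) ^ n" and E: "E \<in> sets M01"
  shows "((\<lambda>n. LINT x|M01. indicator E x * H' n x) \<longlongrightarrow> 0) U"
proof -
  note q = conjugate_exponentsD(1,2)[OF qp] and HU = Lhat_UP[OF H]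
  have EL: "(\<lambda>x. indicator E x) \<in> Lp p" using E q by (intro indicator_Lp) auto
  have lim: "((\<lambda>n. LINT x|M01. H n x * indicator E x) \<longlongrightarrow> 0) U"
    by (rule Lhat_const(3)[OF qp H EL])
  have half: "((\<lambda>n. (1 / 2 :: real) ^ n) \<longlongrightarrow> 0) U"
    by (rule sequentially_tendsto) (simp add: LIMSEQ_realpow_zero)
  have DL: "(\<lambda>x. H n x - H' n x) \<in> Lp q" for n using UP_Lp[OF HU] H' q by (intro Lp_diff) auto
  have E1: "lpnorm p (\<lambda>x. indicator E x) \<le> 1" using E q by (intro lpnorm_bounded) (auto simp: indicator_def)
  have bnd: "norm (LINT x|M01. (H n x - H' n x) * indicator E x) \<le> (1 / 2) ^ n" for n
  proof -
    have "\<bar>LINT x|M01. (H n x - H' n x) * indicator E x\<bar> \<le> lpnorm q (\<lambda>x. H n x - H' n x) * lpnorm p (\<lambda>x. indicator E x)"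
      by (rule Lp_Holder(3)[OF qp DL EL])
    also have "\<dots> \<le> (1 / 2) ^ n * 1" using d[of n] E1 by (intro mult_mono) auto
    finally show ?thesis by simp
  qed
  have lim2: "((\<lambda>n. LINT x|M01. (H n x - H' n x) * indicator E x) \<longlongrightarrow> 0) U"
    by (rule Lim_null_comparison[OF always_eventually[OF allI[OF bnd]] half])
  have "(LINT x|M01. H n x * indicator E x) - (LINT x|M01. (H n x - H' n x) * indicator E x) = (LINT x|M01. H' n x * indicator E x)" for n
    using Lp_Holder(1)[OF qp UP_Lp[OF HU] EL, of n] Lp_Holder(1)[OF qp H' EL, of n]
    by (simp add: left_diff_distrib)
  then have "((\<lambda>n. LINT x|M01. H' n x * indicator E x) \<longlongrightarrow> 0) U" using tendsto_diff[OF lim lim2] by simp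
  then show ?thesis by (simp add: mult.commute)
qed

text \<open>Weak nullity makes the linear term of the smooth expansion small, uniformly in the
  coefficients, and the remainder is a fixed multiple of \<open>|a n| powr q\<close>. Simple
  functions \<open>H'\<close> are used so that partial sums take finitely many values and this
  uniformity is available.\<close>

theorem upper_est_smooth:
  assumes q: "1 < q" "q \<le> 2" and H: "H \<in> Lhat q U"
  shows "upper_est q q U H"
proof -
  define p where "p = q / (q - 1)"
  have qp: "conjugate_exponents q p" unfolding p_def by (rule conjugate_exponents_exists[OF q(1)])
  have q1: "1 \<le> q" using q by simp
  obtain H' B where H': "\<And>n. simple_function M01 (H' n)" "\<And>n. H' n \<in> Lp q"
    "\<And>n. lpnorm q (\<lambda>x. H n x - H' n x) \<le> (1 / 2) ^ n" "\<And>n. lpnorm q (H' n) \<le> B" "0 \<le> B"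
    using simple_approximation[OF Lhat_UP[OF H] q1] by blast
  have "upper_est q q U H'"
  proof (rule upper_est_of_step[where C = "2 * q * B powr q"])
    fix s :: "nat set" and \<epsilon> :: real assume s: "finite s" and \<epsilon>: "0 < \<epsilon>"
    have "\<forall>\<^sub>F n in U. \<forall>a. (\<forall>i. \<bar>a i\<bar> \<le> 1) \<longrightarrow> \<bar>LINT x|M01. Jmap q (\<Sum>i\<in>s. a i * H' i x) * H' n x\<bar> \<le> \<epsilon> / q"
      using \<epsilon> q by (intro Jmap_sum_small s H'(1) Lp_integrable(1)[OF H'(2)] simple_weak_null[OF qp H H'(2,3)]) auto
    then show "\<forall>\<^sub>F n in U. upper_step q q (2 * q * B powr q) \<epsilon> H' s n"
    proof eventually_elim
      case (elim n)
      show ?case unfolding upper_step_def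
      proof (intro allI impI)
        fix a :: "nat \<Rightarrow> real" assume a: "\<forall>i. \<bar>a i\<bar> \<le> 1"
        let ?S = "\<lambda>x. \<Sum>i\<in>s. a i * H' i x"
        have SL: "?S \<in> Lp q" using H'(2) q by (intro Lp_sum Lp_scale) auto
        have TL: "(\<lambda>x. ?S x + a n * H' n x) \<in> Lp q" using SL H'(2) q by (intro Lp_add Lp_scale) auto
        note JL = Jmap_Lp(1)[OF qp SL]
        have JI: "integrable M01 (\<lambda>x. Jmap q (?S x) * H' n x)"
          using Lp_Holder(1)[OF conjugate_exponents_sym[OF qp] JL H'(2)] .
        have e: "\<bar>a n * (LINT x|M01. Jmap q (?S x) * H' n x)\<bar> \<le> 1 * (\<epsilon> / q)"
          unfolding abs_mult using a elim by (intro mult_mono) auto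
        have Hn: "(LINT x|M01. \<bar>H' n x\<bar> powr q) \<le> B powr q"
          using H'(4)[of n] H'(5) q lpnorm_le_iff[of q B "H' n"] by simp
        have "lpnorm q (\<lambda>x. ?S x + a n * H' n x) powr q = (LINT x|M01. \<bar>?S x + a n * H' n x\<bar> powr q)"
          using q by (simp add: lpnorm_powr)
        also have "\<dots> \<le> (LINT x|M01. \<bar>?S x\<bar> powr q + q * (a n * (Jmap q (?S x) * H' n x)) + 2 * q * (\<bar>a n\<bar> powr q * \<bar>H' n x\<bar> powr q))"
        proof (rule integral_mono)
          show "integrable M01 (\<lambda>x. \<bar>?S x + a n * H' n x\<bar> powr q)" by (rule Lp_integrable_powr[OF TL])
          show "integrable M01 (\<lambda>x. \<bar>?S x\<bar> powr q + q * (a n * (Jmap q (?S x) * H' n x)) + 2 * q * (\<bar>a n\<bar> powr q * \<bar>H' n x\<bar> powr q))"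
            using Lp_integrable_powr[OF SL] JI Lp_integrable_powr[OF H'(2)] by simp
          fix x
          show "\<bar>?S x + a n * H' n x\<bar> powr q \<le> \<bar>?S x\<bar> powr q + q * (a n * (Jmap q (?S x) * H' n x)) + 2 * q * (\<bar>a n\<bar> powr q * \<bar>H' n x\<bar> powr q)"
            using abs_powr_add_le_smooth[OF q, of "?S x" "a n * H' n x"] by (simp add: abs_mult powr_mult mult_ac)
        qed
        also have "\<dots> = (LINT x|M01. \<bar>?S x\<bar> powr q) + q * (a n * (LINT x|M01. Jmap q (?S x) * H' n x)) + 2 * q * (\<bar>a n\<bar> powr q * (LINT x|M01. \<bar>H' n x\<bar> powr q))"
          using Lp_integrable_powr[OF SL] JI Lp_integrable_powr[OF H'(2)] by simp
        also have "\<dots> \<le> lpnorm q ?S powr q + \<epsilon> + 2 * q * (\<bar>a n\<bar> powr q * B powr q)"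
        proof (intro add_mono)
          show "q * (a n * (LINT x|M01. Jmap q (?S x) * H' n x)) \<le> \<epsilon>"
            using mult_left_mono[OF order_trans[OF abs_ge_self e], of q] q by simp
          show "2 * q * (\<bar>a n\<bar> powr q * (LINT x|M01. \<bar>H' n x\<bar> powr q)) \<le> 2 * q * (\<bar>a n\<bar> powr q * B powr q)"
            using Hn q by (intro mult_left_mono) auto
        qed (use q in \<open>simp add: lpnorm_powr\<close>)
        \<comment> \<open>With \<open>r = q\<close> the first summand of the bracket is mere
          nonnegative slack; it vanishes for a null partial sum since \<open>0 powr 0 = 0\<close>,
          so the second summand carries the estimate.\<close>
        also have "\<dots> \<le> lpnorm q ?S powr q + \<epsilon> + 2 * q * B powr q * (lpnorm q ?S powr (q - q) * \<bar>a n\<bar> powr q + \<bar>a n\<bar> powr q)"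
          using q by (auto simp: algebra_simps)
        finally show "lpnorm q (\<lambda>x. ?S x + a n * H' n x) powr q \<le> lpnorm q ?S powr q + \<epsilon> + 2 * q * B powr q * (lpnorm q ?S powr (q - q) * \<bar>a n\<bar> powr q + \<bar>a n\<bar> powr q)" .
      qed
    qed
  qed (use q in auto)
  then show ?thesis using q q1 H' by (intro upper_est_perturb[OF q1 _ _ UP_Lp[OF Lhat_UP[OF H]]]) auto
qed

text \<open>Hoelder with the conjugate exponents \<open>q / (q - 2)\<close> and
  \<open>q / 2\<close>, for which the norms of the two factors are powers of the L^q norms of
  \<open>f\<close> and \<open>g\<close>.\<close>

lemma Holder_powr_square:
  assumes q: "2 < q" and f: "f \<in> Lp q" and g: "g \<in> Lp q"
  shows "integrable M01 (\<lambda>x. \<bar>f x\<bar> powr (q - 2) * (g x)\<^sup>2)"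
    and "(LINT x|M01. \<bar>f x\<bar> powr (q - 2) * (g x)\<^sup>2) \<le> lpnorm q f powr (q - 2) * (lpnorm q g)\<^sup>2"
proof -
  note [measurable] = Lp_measurable[OF f] Lp_measurable[OF g]
  have c: "conjugate_exponents (q / (q - 2)) (q / 2)"
    using q by (auto simp: conjugate_exponents_def field_simps)
  have f': "(\<lambda>x. \<bar>f x\<bar> powr (q - 2)) \<in> Lp (q / (q - 2))"
    using Lp_integrable_powr[OF f] q by (intro LpI) (auto simp: powr_powr)
  have p2: "\<bar>y\<^sup>2\<bar> powr (q / 2) = \<bar>y\<bar> powr q" for y :: real
  proof -
    have "\<bar>y\<^sup>2\<bar> = \<bar>y\<bar> powr 2" by simp
    then show ?thesis by (simp only: powr_powr) simp
  qed
  have g': "(\<lambda>x. (g x)\<^sup>2) \<in> Lp (q / 2)"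
    using Lp_integrable_powr[OF g] q by (intro LpI) (auto simp only: p2, measurable)
  show "integrable M01 (\<lambda>x. \<bar>f x\<bar> powr (q - 2) * (g x)\<^sup>2)" by (rule Lp_Holder(1)[OF c f' g'])
  have nf: "lpnorm (q / (q - 2)) (\<lambda>x. \<bar>f x\<bar> powr (q - 2)) = lpnorm q f powr (q - 2)"
    using q by (simp add: lpnorm_def powr_powr)
  have ng: "lpnorm (q / 2) (\<lambda>x. (g x)\<^sup>2) = (lpnorm q g)\<^sup>2"
  proof -
    have "(lpnorm q g)\<^sup>2 = lpnorm q g powr 2" by simp
    also have "\<dots> = (LINT x|M01. \<bar>g x\<bar> powr q) powr (2 / q)" by (simp only: lpnorm_def powr_powr) simp
    finally show ?thesis by (simp only: lpnorm_def p2) simp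
  qed
  show "(LINT x|M01. \<bar>f x\<bar> powr (q - 2) * (g x)\<^sup>2) \<le> lpnorm q f powr (q - 2) * (lpnorm q g)\<^sup>2"
    using Lp_Holder(3)[OF c f' g'] unfolding nf ng by (rule order_trans[OF abs_ge_self])
qed

text \<open>As in the smooth case the linear term is made small by weak nullity.
  \<open>Holder_powr_square\<close> turns the quadratic remainder into a multiple of the
  \<open>(q - 2)\<close>-th power of the current norm times \<open>|a n| powr 2\<close>, which is
  the increment that \<open>upper_step\<close> permits for \<open>r = 2\<close>.\<close>

theorem upper_est_type2:
  assumes q: "2 < q" and H: "H \<in> Lhat q U"
  shows "upper_est q 2 U H"
proof -
  define p where "p = q / (q - 1)"
  have qp: "conjugate_exponents q p" unfolding p_def using q by (intro conjugate_exponents_exists) simp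
  have q1: "1 \<le> q" "1 < q" using q by auto
  obtain H' B where H': "\<And>n. simple_function M01 (H' n)" "\<And>n. H' n \<in> Lp q"
    "\<And>n. lpnorm q (\<lambda>x. H n x - H' n x) \<le> (1 / 2) ^ n" "\<And>n. lpnorm q (H' n) \<le> B" "0 \<le> B"
    using simple_approximation[OF Lhat_UP[OF H] q1(1)] by blast
  obtain C where C: "0 \<le> C" "\<And>x y. \<bar>x + y\<bar> powr q \<le> \<bar>x\<bar> powr q + q * (Jmap q x * y) + C * (\<bar>x\<bar> powr (q - 2) * y\<^sup>2 + \<bar>y\<bar> powr q)"
    using abs_powr_add_le_type2[OF q] by blast
  define C' where "C' = C * (B\<^sup>2 + B powr q)"
  have "upper_est q 2 U H'"
  proof (rule upper_est_of_step[where C = C'])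
    fix s :: "nat set" and \<epsilon> :: real assume s: "finite s" and \<epsilon>: "0 < \<epsilon>"
    have "\<forall>\<^sub>F n in U. \<forall>a. (\<forall>i. \<bar>a i\<bar> \<le> 1) \<longrightarrow> \<bar>LINT x|M01. Jmap q (\<Sum>i\<in>s. a i * H' i x) * H' n x\<bar> \<le> \<epsilon> / q"
      using \<epsilon> q1 by (intro Jmap_sum_small s H'(1) Lp_integrable(1)[OF H'(2)] simple_weak_null[OF qp H H'(2,3)]) auto
    then show "\<forall>\<^sub>F n in U. upper_step q 2 C' \<epsilon> H' s n"
    proof eventually_elim
      case (elim n)
      show ?case unfolding upper_step_def
      proof (intro allI impI)
        fix a :: "nat \<Rightarrow> real" assume a: "\<forall>i. \<bar>a i\<bar> \<le> 1"
        let ?S = "\<lambda>x. \<Sum>i\<in>s. a i * H' i x"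
        have SL: "?S \<in> Lp q" using H'(2) q by (intro Lp_sum Lp_scale) auto
        have TL: "(\<lambda>x. ?S x + a n * H' n x) \<in> Lp q" using SL H'(2) q by (intro Lp_add Lp_scale) auto
        note JL = Jmap_Lp(1)[OF qp SL]
        have JI: "integrable M01 (\<lambda>x. Jmap q (?S x) * H' n x)"
          using Lp_Holder(1)[OF conjugate_exponents_sym[OF qp] JL H'(2)] .
        note HI = Holder_powr_square[OF q SL H'(2)[of n]]
        have e: "\<bar>a n * (LINT x|M01. Jmap q (?S x) * H' n x)\<bar> \<le> 1 * (\<epsilon> / q)"
          unfolding abs_mult using a elim by (intro mult_mono) auto
        have Hn: "(LINT x|M01. \<bar>H' n x\<bar> powr q) \<le> B powr q"
          using H'(4)[of n] H'(5) q lpnorm_le_iff[of q B "H' n"] by simp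
        have H2: "(LINT x|M01. \<bar>?S x\<bar> powr (q - 2) * (H' n x)\<^sup>2) \<le> lpnorm q ?S powr (q - 2) * B\<^sup>2"
          using H'(4)[of n] by (intro order_trans[OF HI(2)] mult_left_mono power_mono) auto
        have "lpnorm q (\<lambda>x. ?S x + a n * H' n x) powr q = (LINT x|M01. \<bar>?S x + a n * H' n x\<bar> powr q)"
          using q by (simp add: lpnorm_powr)
        also have "\<dots> \<le> (LINT x|M01. \<bar>?S x\<bar> powr q + q * (a n * (Jmap q (?S x) * H' n x))
            + C * ((a n)\<^sup>2 * (\<bar>?S x\<bar> powr (q - 2) * (H' n x)\<^sup>2) + \<bar>a n\<bar> powr q * \<bar>H' n x\<bar> powr q))"
        proof (rule integral_mono)
          show "integrable M01 (\<lambda>x. \<bar>?S x + a n * H' n x\<bar> powr q)" by (rule Lp_integrable_powr[OF TL])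
          show "integrable M01 (\<lambda>x. \<bar>?S x\<bar> powr q + q * (a n * (Jmap q (?S x) * H' n x))
            + C * ((a n)\<^sup>2 * (\<bar>?S x\<bar> powr (q - 2) * (H' n x)\<^sup>2) + \<bar>a n\<bar> powr q * \<bar>H' n x\<bar> powr q))"
            using Lp_integrable_powr[OF SL] JI Lp_integrable_powr[OF H'(2)] HI(1) by simp
          fix x
          show "\<bar>?S x + a n * H' n x\<bar> powr q \<le> \<bar>?S x\<bar> powr q + q * (a n * (Jmap q (?S x) * H' n x))
            + C * ((a n)\<^sup>2 * (\<bar>?S x\<bar> powr (q - 2) * (H' n x)\<^sup>2) + \<bar>a n\<bar> powr q * \<bar>H' n x\<bar> powr q)"
            using C(2)[of "?S x" "a n * H' n x"] by (simp add: abs_mult powr_mult power_mult_distrib mult_ac)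
        qed
        also have "\<dots> = (LINT x|M01. \<bar>?S x\<bar> powr q) + q * (a n * (LINT x|M01. Jmap q (?S x) * H' n x))
            + C * ((a n)\<^sup>2 * (LINT x|M01. \<bar>?S x\<bar> powr (q - 2) * (H' n x)\<^sup>2) + \<bar>a n\<bar> powr q * (LINT x|M01. \<bar>H' n x\<bar> powr q))"
          using Lp_integrable_powr[OF SL] JI Lp_integrable_powr[OF H'(2)] HI(1) by simp
        also have "\<dots> \<le> lpnorm q ?S powr q + \<epsilon> + C * ((a n)\<^sup>2 * (lpnorm q ?S powr (q - 2) * B\<^sup>2) + \<bar>a n\<bar> powr q * B powr q)"
        proof (intro add_mono mult_left_mono)
          show "q * (a n * (LINT x|M01. Jmap q (?S x) * H' n x)) \<le> \<epsilon>"
            using mult_left_mono[OF order_trans[OF abs_ge_self e], of q] q by simp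
        qed (use q C H2 Hn in \<open>auto simp: lpnorm_powr\<close>)
        also have "\<dots> \<le> lpnorm q ?S powr q + \<epsilon> + C' * (lpnorm q ?S powr (q - 2) * \<bar>a n\<bar> powr 2 + \<bar>a n\<bar> powr q)"
        proof -
          define W where "W = lpnorm q ?S powr (q - 2) * \<bar>a n\<bar> powr 2"
          have "W * B\<^sup>2 \<le> W * (B\<^sup>2 + B powr q)" "\<bar>a n\<bar> powr q * B powr q \<le> \<bar>a n\<bar> powr q * (B\<^sup>2 + B powr q)"
            by (auto intro!: mult_left_mono simp: W_def)
          then have "C * (W * B\<^sup>2 + \<bar>a n\<bar> powr q * B powr q) \<le> C * ((W + \<bar>a n\<bar> powr q) * (B\<^sup>2 + B powr q))"
            using C(1) by (intro mult_left_mono) (auto simp: distrib_right)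
          moreover have e1: "(a n)\<^sup>2 * (lpnorm q ?S powr (q - 2) * B\<^sup>2) = W * B\<^sup>2" by (simp add: W_def mult_ac)
          moreover have "C * ((W + \<bar>a n\<bar> powr q) * (B\<^sup>2 + B powr q)) = C' * (W + \<bar>a n\<bar> powr q)"
            by (simp add: C'_def mult_ac)
          ultimately show ?thesis unfolding e1 W_def[symmetric] by linarith
        qed
        finally show "lpnorm q (\<lambda>x. ?S x + a n * H' n x) powr q \<le> lpnorm q ?S powr q + \<epsilon> + C' * (lpnorm q ?S powr (q - 2) * \<bar>a n\<bar> powr 2 + \<bar>a n\<bar> powr q)" .
      qed
    qed
  qed (use q C H' in \<open>auto simp: C'_def\<close>)
  then show ?thesis using q q1 H' by (intro upper_est_perturb[OF q1(1) _ _ UP_Lp[OF Lhat_UP[OF H]]]) auto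
qed

text \<open>Partial sums of simple functions are bounded, by \<open>m\<close> say, so the mixed term
  is at most a multiple of \<open>m powr (q - 1)\<close> times the L^1 norm of the next function and
  tends to zero. For \<open>q > 2\<close> this improves on the exponent 2 of general weakly null
  sequences.\<close>

theorem upper_est_L1null:
  assumes q: "1 < q" and H: "H \<in> L1null q U"
  shows "upper_est q q U H"
proof -
  have q1: "1 \<le> q" using q by simp
  note HU = L1null_UP[OF H]
  obtain H' B where H': "\<And>n. simple_function M01 (H' n)" "\<And>n. H' n \<in> Lp q"
    "\<And>n. lpnorm q (\<lambda>x. H n x - H' n x) \<le> (1 / 2) ^ n" "\<And>n. lpnorm q (H' n) \<le> B" "0 \<le> B"
    using simple_approximation[OF HU q1] by blast
  have half: "((\<lambda>n. (1 / 2 :: real) ^ n) \<longlongrightarrow> 0) U"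
    by (rule sequentially_tendsto) (simp add: LIMSEQ_realpow_zero)
  have lim0: "((\<lambda>n. (LINT x|M01. \<bar>H n x\<bar>) + (1 / 2) ^ n) \<longlongrightarrow> 0) U"
    using tendsto_add[OF _ half, of "\<lambda>n. LINT x|M01. \<bar>H n x\<bar>" 0] H by (simp add: L1null_def)
  have bnd: "norm (LINT x|M01. \<bar>H' n x\<bar>) \<le> (LINT x|M01. \<bar>H n x\<bar>) + (1 / 2) ^ n" for n
  proof -
    have DL: "(\<lambda>x. H n x - H' n x) \<in> Lp q" using UP_Lp[OF HU] H'(2) q by (intro Lp_diff) auto
    note I = Lp_integrable(1)[OF UP_Lp[OF HU] q, of n] Lp_integrable(1)[OF H'(2) q, of n] Lp_integrable(1)[OF DL q]
    have "(LINT x|M01. \<bar>H' n x\<bar>) \<le> (LINT x|M01. \<bar>H n x\<bar> + \<bar>H n x - H' n x\<bar>)"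
      using I by (intro integral_mono) auto
    also have "\<dots> = (LINT x|M01. \<bar>H n x\<bar>) + (LINT x|M01. \<bar>H n x - H' n x\<bar>)" using I by simp
    finally show ?thesis using Lp_integrable(2)[OF DL q] H'(3)[of n] by simp
  qed
  have lim: "((\<lambda>n. LINT x|M01. \<bar>H' n x\<bar>) \<longlongrightarrow> 0) U"
    by (rule Lim_null_comparison[OF always_eventually[OF allI[OF bnd]] lim0])
  define c where "c = q * 2 powr (q - 1)"
  have c: "0 < c" using q by (simp add: c_def)
  have "upper_est q q U H'"
  proof (rule upper_est_of_step[where C = "c * B powr q"])
    fix s :: "nat set" and \<epsilon> :: real assume s: "finite s" and \<epsilon>: "0 < \<epsilon>"
    obtain m where m: "0 \<le> m" "\<forall>a x. (\<forall>i. \<bar>a i\<bar> \<le> 1) \<longrightarrow> x \<in> {0..1} \<longrightarrow> \<bar>\<Sum>i\<in>s. a i * H' i x\<bar> \<le> m"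
      using simple_sum_bound[of s H', OF s H'(1)] by blast
    have "((\<lambda>n. c * (m powr (q - 1) * (LINT x|M01. \<bar>H' n x\<bar>))) \<longlongrightarrow> 0) U"
      by (rule tendsto_mult_right_zero, rule tendsto_mult_right_zero, rule lim)
    from order_tendstoD(2)[OF this \<epsilon>]
    show "\<forall>\<^sub>F n in U. upper_step q q (c * B powr q) \<epsilon> H' s n"
    proof eventually_elim
      case (elim n)
      show ?case unfolding upper_step_def
      proof (intro allI impI)
        fix a :: "nat \<Rightarrow> real" assume a: "\<forall>i. \<bar>a i\<bar> \<le> 1"
        let ?S = "\<lambda>x. \<Sum>i\<in>s. a i * H' i x"
        have SL: "?S \<in> Lp q" using H'(2) q by (intro Lp_sum Lp_scale) auto
        have TL: "(\<lambda>x. ?S x + a n * H' n x) \<in> Lp q" using SL H'(2) q by (intro Lp_add Lp_scale) auto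
        note I = Lp_integrable(1)[OF H'(2) q, of n] Lp_integrable_powr[OF H'(2), of n] Lp_integrable_powr[OF SL]
        have Hn: "(LINT x|M01. \<bar>H' n x\<bar> powr q) \<le> B powr q"
          using H'(4)[of n] H'(5) q lpnorm_le_iff[of q B "H' n"] by simp
        have "lpnorm q (\<lambda>x. ?S x + a n * H' n x) powr q = (LINT x|M01. \<bar>?S x + a n * H' n x\<bar> powr q)"
          using q by (simp add: lpnorm_powr)
        also have "\<dots> \<le> (LINT x|M01. \<bar>?S x\<bar> powr q + c * (m powr (q - 1) * \<bar>H' n x\<bar> + \<bar>a n\<bar> powr q * \<bar>H' n x\<bar> powr q))"
        proof (rule integral_mono)
          show "integrable M01 (\<lambda>x. \<bar>?S x + a n * H' n x\<bar> powr q)" by (rule Lp_integrable_powr[OF TL])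
          show "integrable M01 (\<lambda>x. \<bar>?S x\<bar> powr q + c * (m powr (q - 1) * \<bar>H' n x\<bar> + \<bar>a n\<bar> powr q * \<bar>H' n x\<bar> powr q))"
            using I by simp
          fix x assume x: "x \<in> space M01"
          have "\<bar>?S x\<bar> powr (q - 1) * \<bar>a n * H' n x\<bar> \<le> m powr (q - 1) * (1 * \<bar>H' n x\<bar>)"
            unfolding abs_mult using m(2) x q a
            by (intro mult_mono powr_mono2) auto
          then have "c * (\<bar>?S x\<bar> powr (q - 1) * \<bar>a n * H' n x\<bar> + \<bar>a n * H' n x\<bar> powr q)
              \<le> c * (m powr (q - 1) * \<bar>H' n x\<bar> + \<bar>a n\<bar> powr q * \<bar>H' n x\<bar> powr q)"
            using c by (intro mult_left_mono add_mono) (auto simp: abs_mult powr_mult)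
          then show "\<bar>?S x + a n * H' n x\<bar> powr q \<le> \<bar>?S x\<bar> powr q + c * (m powr (q - 1) * \<bar>H' n x\<bar> + \<bar>a n\<bar> powr q * \<bar>H' n x\<bar> powr q)"
            using abs_powr_add_le_crude[OF q, of "?S x" "a n * H' n x"] by (simp add: c_def)
        qed
        also have "\<dots> = (LINT x|M01. \<bar>?S x\<bar> powr q) + c * (m powr (q - 1) * (LINT x|M01. \<bar>H' n x\<bar>) + \<bar>a n\<bar> powr q * (LINT x|M01. \<bar>H' n x\<bar> powr q))"
          using I by simp
        also have "\<dots> \<le> lpnorm q ?S powr q + \<epsilon> + c * (\<bar>a n\<bar> powr q * B powr q)"
        proof -
          have "c * (\<bar>a n\<bar> powr q * (LINT x|M01. \<bar>H' n x\<bar> powr q)) \<le> c * (\<bar>a n\<bar> powr q * B powr q)"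
            using Hn c by (intro mult_left_mono) auto
          then show ?thesis using elim q by (simp add: lpnorm_powr distrib_left)
        qed
        also have "\<dots> \<le> lpnorm q ?S powr q + \<epsilon> + c * B powr q * (lpnorm q ?S powr (q - q) * \<bar>a n\<bar> powr q + \<bar>a n\<bar> powr q)"
          using c by (auto simp: algebra_simps)
        finally show "lpnorm q (\<lambda>x. ?S x + a n * H' n x) powr q \<le> lpnorm q ?S powr q + \<epsilon> + c * B powr q * (lpnorm q ?S powr (q - q) * \<bar>a n\<bar> powr q + \<bar>a n\<bar> powr q)" .
      qed
    qed
  qed (use q c in auto)
  then show ?thesis using q q1 H' by (intro upper_est_perturb[OF q1 _ _ UP_Lp[OF HU]]) auto
qed

end

section \<open>Diagonal operators\<close>

lemma bop_Lp_sum_norm: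
  assumes T: "bop_Lp p T" and p: "1 \<le> p" and f: "\<And>i. i \<in> s \<Longrightarrow> f i \<in> Lp p" and s: "finite s"
  shows "lpnorm p (\<lambda>x. T (\<lambda>y. \<Sum>i\<in>s. f i y) x - (\<Sum>i\<in>s. T (f i) x)) = 0"
proof -
  note D = bop_LpD[OF T]
  have "AE x in M01. T (\<lambda>y. \<Sum>i\<in>s. f i y) x = (\<Sum>i\<in>s. T (f i) x)" using s f
  proof (induction s rule: finite_induct)
    case empty
    have z: "(\<lambda>y. 0) \<in> Lp p" using p by simp
    have "AE x in M01. T (\<lambda>y. 0 * 0 + 0 * 0) x = 0 * T (\<lambda>y. 0) x + 0 * T (\<lambda>y. 0) x" by (rule D(2)[OF z z])
    then show ?case by simp
  next
    case (insert i s)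
    have S: "(\<lambda>y. \<Sum>i\<in>s. f i y) \<in> Lp p" using insert p by (intro Lp_sum) auto
    have "AE x in M01. T (\<lambda>y. 1 * f i y + 1 * (\<Sum>i\<in>s. f i y)) x = 1 * T (f i) x + 1 * T (\<lambda>y. \<Sum>i\<in>s. f i y) x"
      using insert by (intro D(2) S) auto
    moreover have "AE x in M01. T (\<lambda>y. \<Sum>i\<in>s. f i y) x = (\<Sum>i\<in>s. T (f i) x)" using insert by auto
    ultimately show ?case by eventually_elim (simp add: insert(1,2))
  qed
  moreover have "(\<lambda>x. T (\<lambda>y. \<Sum>i\<in>s. f i y) x - (\<Sum>i\<in>s. T (f i) x)) \<in> Lp p"
    using f p by (intro Lp_diff Lp_sum D(1)) auto
  ultimately show ?thesis using p by (subst lpnorm_eq_0_iff) auto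
qed

text \<open>Weak lower semicontinuity of the norm, centred at \<open>h\<close>.\<close>

lemma (in ultra) lpnorm_wlim_diff_le:
  assumes pq: "conjugate_exponents p q" and F: "F \<in> UP p" and h: "h \<in> Lp p"
    and c: "\<forall>\<^sub>F n in U. lpnorm p (\<lambda>x. F n x - h x) \<le> c"
  shows "lpnorm p (\<lambda>x. wlim p U F x - h x) \<le> c"
proof -
  have p: "1 \<le> p" "0 \<le> p" using conjugate_exponentsD(1)[OF pq] by auto
  note W = wlim_Lp[OF pq F]
  have FU: "(\<lambda>n x. F n x - h x) \<in> UP p" by (rule UP_diff[OF F UP_const[OF h] p(1)])
  have "lpnorm p (\<lambda>x. wlim p U F x - h x) \<le> unorm p U (\<lambda>n x. F n x - h x)"
  proof (rule lpnorm_le_dual[OF pq Lp_diff[OF W h p(2)] _ unorm_nonneg[OF FU]])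
    fix g assume g: "g \<in> Lp q"
    have "(LINT x|M01. (wlim p U F x - h x) * g x) = (LINT x|M01. wlim p U F x * g x) - (LINT x|M01. h x * g x)"
      using Lp_Holder(1)[OF pq W g] Lp_Holder(1)[OF pq h g] by (simp add: left_diff_distrib)
    also have "\<dots> = upair U (\<lambda>n x. F n x - h x) (\<lambda>n. g)"
      using wlim_pairing[OF pq F g] upair_diff_left[OF pq F UP_const[OF h] UP_const[OF g]] by (simp add: upair_const)
    also have "\<dots> \<le> unorm p U (\<lambda>n x. F n x - h x) * lpnorm q g"
      using upair_bound[OF pq FU UP_const[OF g]] by (simp add: unorm_const)
    finally show "(LINT x|M01. (wlim p U F x - h x) * g x) \<le> unorm p U (\<lambda>n x. F n x - h x) * lpnorm q g" .
  qed
  also have "\<dots> \<le> c" by (rule unorm_le[OF FU c])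
  finally show ?thesis .
qed

section \<open>Off-diagonal sums, operators factoring through ell^r, and averaging\<close>

context selective
begin

text \<open>On the diagonal set, the rows up to \<open>m\<close> have entries below
  \<open>\<epsilon> * (1 / 2) ^ Suc m\<close> at every index after \<open>m\<close>. Indices grow at
  least as fast as their rank, so a row sum beyond the diagonal is dominated by a geometric
  series.\<close>

lemma offdiagonal_tail:
  fixes y :: "nat \<Rightarrow> nat \<Rightarrow> real"
  assumes lim: "\<And>m. (y m \<longlongrightarrow> 0) U" and \<epsilon>: "0 < \<epsilon>"
  shows "\<exists>A. (\<forall>\<^sub>F n in U. n \<in> A) \<and>
    (\<forall>n\<in>A. \<forall>s. finite s \<longrightarrow> s \<subseteq> A \<inter> {n<..} \<longrightarrow> (\<Sum>j\<in>s. \<bar>y n j\<bar>) \<le> \<epsilon>)"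
proof -
  define B where "B m = {j. \<forall>n\<in>{..m}. \<bar>y n j\<bar> < \<epsilon> * (1 / 2) ^ Suc m}" for m
  have evB: "\<forall>\<^sub>F j in U. j \<in> B m" for m
  proof -
    have "\<forall>\<^sub>F j in U. \<bar>y n j\<bar> < \<epsilon> * (1 / 2) ^ Suc m" for n
      using order_tendstoD(2)[OF tendsto_rabs[OF lim[of n]], of "\<epsilon> * (1 / 2) ^ Suc m"] \<epsilon> by simp
    then have "\<forall>\<^sub>F j in U. \<forall>n\<in>{..m}. \<bar>y n j\<bar> < \<epsilon> * (1 / 2) ^ Suc m"
      by (intro eventually_ball_finite) auto
    then show ?thesis by (simp add: B_def)
  qed
  obtain A where A: "\<forall>\<^sub>F n in U. n \<in> A" "\<forall>m\<in>A. \<forall>n\<in>A. m < n \<longrightarrow> n \<in> B m"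
    using selective_diagonal[of U B, OF selective evB] by blast
  have "(\<Sum>j\<in>s. \<bar>y n j\<bar>) \<le> \<epsilon>" if n: "n \<in> A" and s: "finite s" "s \<subseteq> A \<inter> {n<..}" for n s
  proof -
    have "(\<Sum>j\<in>s. \<bar>y n j\<bar>) \<le> \<epsilon> * (\<Sum>k<card s. (1 / 2) ^ Suc k)"
      using s
    proof (induction s rule: finite_linorder_max_induct)
      case empty then show ?case by simp
    next
      case (insert j s)
      \<comment> \<open>The last index used before \<open>j\<close>. Since \<open>s\<close> sits in
        \<open>{n<..m}\<close>, it is at least \<open>card s\<close>, so the bound granted at
        \<open>m\<close> is at least as good as the one budgeted for rank
        \<open>card s\<close>.\<close>
      define m where "m = Max (insert n s)"
      have m: "m \<in> insert n s" "\<And>k. k \<in> insert n s \<Longrightarrow> k \<le> m"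
        unfolding m_def using insert(1) Max_in[of "insert n s"] Max_ge[of "insert n s"] by blast+
      have mj: "m \<in> A" "m < j" using m(1) insert n by auto
      have "s \<subseteq> {n<..m}" using insert m(2) by auto
      then have "card s \<le> card {n<..m}" by (intro card_mono) auto
      then have cm: "card s \<le> m" by simp
      have "j \<in> B m" using A(2) mj insert by auto
      moreover have "n \<le> m" using m(2) by simp
      ultimately have "\<bar>y n j\<bar> \<le> \<epsilon> * (1 / 2) ^ Suc m"
        unfolding B_def by (metis (mono_tags, lifting) atMost_iff less_imp_le mem_Collect_eq)
      also have "\<dots> \<le> \<epsilon> * (1 / 2) ^ Suc (card s)"
        using \<epsilon> cm by (intro mult_left_mono power_decreasing) auto
      finally have 1: "\<bar>y n j\<bar> \<le> \<epsilon> * (1 / 2) ^ Suc (card s)" .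
      have IH: "(\<Sum>j\<in>s. \<bar>y n j\<bar>) \<le> \<epsilon> * (\<Sum>k<card s. (1 / 2) ^ Suc k)" using insert by auto
      have "j \<notin> s" using insert by auto
      then have "(\<Sum>i\<in>insert j s. \<bar>y n i\<bar>) = \<bar>y n j\<bar> + (\<Sum>j\<in>s. \<bar>y n j\<bar>)"
        "card (insert j s) = Suc (card s)" using insert(1) by auto
      then show ?case using 1 IH by (simp only: sum.lessThan_Suc distrib_left)
    qed
    also have "(\<Sum>k<card s. (1 / 2 :: real) ^ Suc k) = (\<Sum>k<card s. (1 / 2) ^ k) / 2"
      by (simp add: sum_divide_distrib)
    also have "\<epsilon> * ((\<Sum>k<card s. (1 / 2) ^ k) / 2) \<le> \<epsilon> * 1"
      using \<epsilon> sum_half_powers_le[of "{..<card s}"] by (intro mult_left_mono) auto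
    finally show ?thesis by simp
  qed
  then show ?thesis using A(1) by blast
qed

text \<open>For \<open>m\<close> beyond \<open>n\<close>, weak nullity of \<open>G\<close> against
  the fixed \<open>F n\<close> suffices. For \<open>m\<close> before \<open>n\<close>,
  \<open>F n\<close> is compared with the weak limit \<open>w\<close>: when \<open>n\<close> is late
  relative to \<open>m\<close>, its pairing with \<open>G m\<close> is close to that of
  \<open>w\<close>, and the pairings of \<open>w\<close> are summable along a suitable set.\<close>

lemma offdiagonal_small:
  assumes pq: "conjugate_exponents p q" and F: "F \<in> UP p" and G: "G \<in> Lhat q U" and \<epsilon>: "0 < \<epsilon>"
  shows "\<exists>A. (\<forall>\<^sub>F n in U. n \<in> A) \<and>
    (\<forall>n\<in>A. \<forall>s. finite s \<longrightarrow> s \<subseteq> A - {n} \<longrightarrow> (\<Sum>m\<in>s. \<bar>LINT x|M01. F n x * G m x\<bar>) \<le> \<epsilon>)"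
proof -
  note qp = conjugate_exponents_sym[OF pq] and GU = Lhat_UP[OF G]
  define w where "w = wlim p U F"
  have wL: "w \<in> Lp p" unfolding w_def by (rule wlim_Lp[OF pq F])
  have e4: "0 < \<epsilon> / 4" using \<epsilon> by simp
  have null: "((\<lambda>j. LINT x|M01. f x * G j x) \<longlongrightarrow> 0) U" if "f \<in> Lp p" for f
    using Lhat_const(3)[OF qp G that] by (simp add: mult.commute)
  obtain A1 where A1: "\<forall>\<^sub>F n in U. n \<in> A1"
    "\<forall>n\<in>A1. \<forall>s. finite s \<longrightarrow> s \<subseteq> A1 \<inter> {n<..} \<longrightarrow> (\<Sum>j\<in>s. \<bar>LINT x|M01. F n x * G j x\<bar>) \<le> \<epsilon> / 4"
    using offdiagonal_tail[of "\<lambda>n j. LINT x|M01. F n x * G j x", OF null[OF UP_Lp[OF F]] e4] by blast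
  obtain A2 where A2: "\<forall>\<^sub>F n in U. n \<in> A2"
    "\<forall>n\<in>A2. \<forall>s. finite s \<longrightarrow> s \<subseteq> A2 \<inter> {n<..} \<longrightarrow> (\<Sum>j\<in>s. \<bar>LINT x|M01. w x * G j x\<bar>) \<le> \<epsilon> / 4"
    using offdiagonal_tail[of "\<lambda>n j. LINT x|M01. w x * G j x", OF null[OF wL] e4] by blast
  \<comment> \<open>A base point: the tail estimate for the constant row \<open>w\<close>, read at
    \<open>n0\<close>, controls sums over all later indices of \<open>A2\<close>.\<close>
  obtain n0 where n0: "n0 \<in> A2" using eventually_ex[OF A2(1)] by blast
  define B where "B m = {n. \<bar>(LINT x|M01. F n x * G m x) - (LINT x|M01. w x * G m x)\<bar> < \<epsilon> / 4 * (1 / 2) ^ m}" for m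
  have evB: "\<forall>\<^sub>F n in U. n \<in> B m" for m
  proof -
    have "((\<lambda>n. LINT x|M01. F n x * G m x) \<longlongrightarrow> (LINT x|M01. w x * G m x)) U"
      using pairing_tendsto[OF pq F UP_const[OF UP_Lp[OF GU, of m]]] wlim_pairing[OF pq F UP_Lp[OF GU, of m]] by (simp add: w_def)
    then have "\<forall>\<^sub>F n in U. dist (LINT x|M01. F n x * G m x) (LINT x|M01. w x * G m x) < \<epsilon> / 4 * (1 / 2) ^ m"
      by (rule tendstoD) (use \<epsilon> in simp)
    then show ?thesis by (simp add: B_def dist_real_def)
  qed
  obtain A4 where A4: "\<forall>\<^sub>F n in U. n \<in> A4" "\<forall>m\<in>A4. \<forall>n\<in>A4. m < n \<longrightarrow> n \<in> B m"
    using selective_diagonal[of U B, OF selective evB] by blast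
  define A where "A = A1 \<inter> A2 \<inter> {n0<..} \<inter> A4"
  have evA: "\<forall>\<^sub>F n in U. n \<in> A"
    using A1(1) A2(1) U_gt[of n0] A4(1) by eventually_elim (simp add: A_def)
  have "(\<Sum>m\<in>s. \<bar>LINT x|M01. F n x * G m x\<bar>) \<le> \<epsilon>" if n: "n \<in> A" and s: "finite s" "s \<subseteq> A - {n}" for n s
  proof -
    let ?f = "\<lambda>m. \<bar>LINT x|M01. F n x * G m x\<bar>"
    define s1 where "s1 = s \<inter> {n<..}"
    define s2 where "s2 = s \<inter> {..<n}"
    have s12: "s = s1 \<union> s2" "s1 \<inter> s2 = {}" "finite s1" "finite s2"
      using s by (auto simp: s1_def s2_def)
    have "sum ?f s = sum ?f s1 + sum ?f s2"
      unfolding s12(1) by (rule sum.union_disjoint[OF s12(3,4,2)])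
    moreover have "sum ?f s1 \<le> \<epsilon> / 4"
    proof -
      have "n \<in> A1" "s1 \<subseteq> A1 \<inter> {n<..}" using n s by (auto simp: A_def s1_def)
      then show ?thesis using A1(2) s12(3) by blast
    qed
    moreover have "sum ?f s2 \<le> 3 * (\<epsilon> / 4)"
    proof -
      have "sum ?f s2 \<le> (\<Sum>m\<in>s2. \<bar>LINT x|M01. w x * G m x\<bar> + \<epsilon> / 4 * (1 / 2) ^ m)"
      proof (rule sum_mono)
        fix m assume m: "m \<in> s2"
        then have "n \<in> B m" using A4(2) n s by (auto simp: A_def s2_def)
        then show "?f m \<le> \<bar>LINT x|M01. w x * G m x\<bar> + \<epsilon> / 4 * (1 / 2) ^ m"           unfolding B_def mem_Collect_eq by linarith
      qed
      also have "\<dots> = (\<Sum>m\<in>s2. \<bar>LINT x|M01. w x * G m x\<bar>) + \<epsilon> / 4 * (\<Sum>m\<in>s2. (1 / 2) ^ m)"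
        by (simp add: sum.distrib sum_distrib_left)
      also have "\<dots> \<le> \<epsilon> / 4 + \<epsilon> / 4 * 2"
      proof (rule add_mono)
        have "s2 \<subseteq> A2 \<inter> {n0<..}" using s by (auto simp: A_def s2_def)
        then show "(\<Sum>m\<in>s2. \<bar>LINT x|M01. w x * G m x\<bar>) \<le> \<epsilon> / 4" using A2(2) n0 s12(4) by blast
        show "\<epsilon> / 4 * (\<Sum>m\<in>s2. (1 / 2) ^ m) \<le> \<epsilon> / 4 * 2"
          using sum_half_powers_le[OF s12(4)] \<epsilon> by (intro mult_left_mono) auto
      qed
      finally show ?thesis by simp
    qed
    ultimately show ?thesis by simp
  qed
  then show ?thesis using evA by blast
qed

text \<open>The upper estimate bounds a map from ell^r' into L^q, and its transpose is the
  coefficient map into ell^r. Concretely the estimate is tested on \<open>Jmap r\<close> of the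
  coefficients, the extremal choice in Hoelder's inequality for finite sums.\<close>

lemma upper_est_dual:
  assumes pq: "conjugate_exponents p q" and rr: "conjugate_exponents r r'"
    and G: "\<And>n. G n \<in> Lp q" and f: "f \<in> Lp p" and s: "finite s" and C: "0 \<le> C"
    and est: "\<And>a. lpnorm q (\<lambda>x. \<Sum>n\<in>s. a n * G n x) \<le> C * (\<Sum>n\<in>s. \<bar>a n\<bar> powr r') powr (1 / r')"
  shows "(\<Sum>n\<in>s. \<bar>LINT x|M01. f x * G n x\<bar> powr r) powr (1 / r) \<le> C * lpnorm p f"
proof -
  define x where "x n = (LINT x|M01. f x * G n x)" for n
  define Q where "Q = (\<Sum>n\<in>s. \<bar>x n\<bar> powr r)"
  have Q0: "0 \<le> Q" unfolding Q_def by (intro sum_nonneg) simp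
  define a where "a n = Jmap r (x n)" for n
  have "(\<Sum>n\<in>s. \<bar>a n\<bar> powr r') = Q"
    unfolding Q_def a_def by (simp add: abs_Jmap powr_powr conjugate_exponentsD(4)[OF rr])
  note aQ = this
  have SL: "(\<lambda>y. \<Sum>n\<in>s. a n * G n y) \<in> Lp q" using G conjugate_exponentsD(2)[OF pq] by (intro Lp_sum Lp_scale) auto
  have "Q = (\<Sum>n\<in>s. a n * x n)" unfolding Q_def a_def using mult_Jmap[of _ r] by (simp add: mult.commute)
  also have "\<dots> = (LINT y|M01. (\<Sum>n\<in>s. a n * (f y * G n y)))"
    unfolding x_def using Lp_Holder(1)[OF pq f G] by (subst Bochner_Integration.integral_sum) auto
  also have "\<dots> = (LINT y|M01. f y * (\<Sum>n\<in>s. a n * G n y))"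
    by (simp add: sum_distrib_left mult_ac)
  also have "\<dots> \<le> lpnorm p f * lpnorm q (\<lambda>y. \<Sum>n\<in>s. a n * G n y)"
    by (rule order_trans[OF abs_ge_self Lp_Holder(3)[OF pq f SL]])
  also have "\<dots> \<le> lpnorm p f * (C * Q powr (1 / r'))"
    using est[of a] aQ by (intro mult_left_mono) auto
  finally have 1: "Q \<le> lpnorm p f * (C * Q powr (1 / r'))" .
  have "Q powr (1 / r) \<le> C * lpnorm p f"
  proof (cases "Q = 0")
    case True then show ?thesis using C by simp
  next
    case False
    then have Qp: "0 < Q" using Q0 by simp
    have "Q = Q powr (1 / r) * Q powr (1 / r')"
      using Qp rr by (simp add: powr_add[symmetric] conjugate_exponents_def)
    then have "Q powr (1 / r) * Q powr (1 / r') \<le> (C * lpnorm p f) * Q powr (1 / r')"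
      using 1 by (simp add: mult_ac)
    then show ?thesis using Qp by simp
  qed
  then show ?thesis by (simp add: Q_def x_def)
qed

text \<open>The operator is $f \mapsto \sum_{m\in A} \langle f, G_m\rangle H_m$, bounded because it factors
  through $\ell^r$.\<close>
theorem rank_one_approximation:
  assumes pq: "conjugate_exponents p q" and rr: "conjugate_exponents r r'"
    and G: "G \<in> Lhat q U" "upper_est q r' U G" and H: "H \<in> UP p" "upper_est p r U H"
    and fin: "finite \<F>" "\<F> \<subseteq> UP p" and \<epsilon>: "0 < \<epsilon>"
  shows "\<exists>T. bop_Lp p T \<and> (\<forall>F\<in>\<F>. unorm p U (\<lambda>n x. ultra_op T F n x - upair U F G * H n x) < \<epsilon>)"
proof -
  note GU = Lhat_UP[OF G(1)]
  have p: "1 < p" "1 \<le> p" "0 \<le> p" "0 < p" using conjugate_exponentsD(1)[OF pq] by auto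
  obtain AG CG where AG: "\<forall>\<^sub>F n in U. n \<in> AG" "0 \<le> CG"
    "\<And>s a. finite s \<Longrightarrow> s \<subseteq> AG \<Longrightarrow> lpnorm q (\<lambda>x. \<Sum>n\<in>s. a n * G n x) \<le> CG * (\<Sum>n\<in>s. \<bar>a n\<bar> powr r') powr (1 / r')"
    using G(2) unfolding upper_est_def by blast
  obtain AH CH where AH: "\<forall>\<^sub>F n in U. n \<in> AH" "0 \<le> CH"
    "\<And>s a. finite s \<Longrightarrow> s \<subseteq> AH \<Longrightarrow> lpnorm p (\<lambda>x. \<Sum>n\<in>s. a n * H n x) \<le> CH * (\<Sum>n\<in>s. \<bar>a n\<bar> powr r) powr (1 / r)"
    using H(2) unfolding upper_est_def by blast
  obtain CB where CB: "0 \<le> CB" "\<And>n. lpnorm p (H n) \<le> CB" using UP_bound[OF H(1)] by blast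
  note HL = UP_Lp[OF H(1)] and GL = UP_Lp[OF GU]
  \<comment> \<open>The off-diagonal sum and the diagonal error each cost
    \<open>\<eta> * CB\<close>, together at most \<open>\<epsilon> / 2\<close>; the added 1 keeps
    the denominator positive.\<close>
  define \<eta> where "\<eta> = \<epsilon> / (4 * (CB + 1))"
  have \<eta>: "0 < \<eta>" using \<epsilon> CB(1) by (simp add: \<eta>_def)
  have \<eta>2: "2 * \<eta> * CB \<le> \<epsilon> / 2"
  proof -
    have "2 * \<eta> * CB \<le> 2 * \<eta> * (CB + 1)" using \<eta> by (intro mult_left_mono) auto
    also have "\<dots> = \<epsilon> / 2" using CB(1) by (simp add: \<eta>_def field_simps)
    finally show ?thesis .
  qed
  have "\<forall>F\<in>\<F>. \<exists>A. (\<forall>\<^sub>F n in U. n \<in> A) \<and>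
    (\<forall>n\<in>A. \<forall>s. finite s \<longrightarrow> s \<subseteq> A - {n} \<longrightarrow> (\<Sum>m\<in>s. \<bar>LINT x|M01. F n x * G m x\<bar>) \<le> \<eta>)"
  proof
    fix F assume "F \<in> \<F>"
    then have F: "F \<in> UP p" using fin(2) by blast
    show "\<exists>A. (\<forall>\<^sub>F n in U. n \<in> A) \<and>
      (\<forall>n\<in>A. \<forall>s. finite s \<longrightarrow> s \<subseteq> A - {n} \<longrightarrow> (\<Sum>m\<in>s. \<bar>LINT x|M01. F n x * G m x\<bar>) \<le> \<eta>)"
      by (rule offdiagonal_small[OF pq F G(1) \<eta>])
  qed
  then obtain AF where AF: "\<forall>F\<in>\<F>. (\<forall>\<^sub>F n in U. n \<in> AF F) \<and>
    (\<forall>n\<in>AF F. \<forall>s. finite s \<longrightarrow> s \<subseteq> AF F - {n} \<longrightarrow> (\<Sum>m\<in>s. \<bar>LINT x|M01. F n x * G m x\<bar>) \<le> \<eta>)"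
    by (rule bchoice[THEN exE])
  define A where "A = {n \<in> AG \<inter> AH. \<forall>F\<in>\<F>. n \<in> AF F}"
  have "\<forall>\<^sub>F n in U. \<forall>F\<in>\<F>. n \<in> AF F" using AF fin(1) by (intro eventually_ball_finite) auto
  with AG(1) AH(1) have evA: "\<forall>\<^sub>F n in U. n \<in> A" by eventually_elim (simp add: A_def)
  define c where "c f m = (LINT y|M01. f y * G m y)" for f m
  define S where "S f N = (\<lambda>x. \<Sum>m\<in>A \<inter> {..<N}. c f m * H m x)" for f N
  \<comment> \<open>The series is summed by its weak limit along \<open>U\<close>: the partial sums
    are bounded by the two upper estimates, and linearity and the norm bound pass to weak
    limits.\<close>
  define T where "T f = wlim p U (S f)" for f
  have SL: "S f N \<in> Lp p" for f N unfolding S_def using HL p by (intro Lp_sum Lp_scale) auto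
  have Sb: "lpnorm p (S f N) \<le> CH * CG * lpnorm p f" if f: "f \<in> Lp p" for f N
  proof -
    have "lpnorm p (S f N) \<le> CH * (\<Sum>m\<in>A \<inter> {..<N}. \<bar>c f m\<bar> powr r) powr (1 / r)"
      unfolding S_def by (intro AH(3)) (auto simp: A_def)
    also have "(\<Sum>m\<in>A \<inter> {..<N}. \<bar>c f m\<bar> powr r) powr (1 / r) \<le> CG * lpnorm p f"
      unfolding c_def by (intro upper_est_dual[OF pq rr GL f _ AG(2)] AG(3)) (auto simp: A_def)
    then have "CH * (\<Sum>m\<in>A \<inter> {..<N}. \<bar>c f m\<bar> powr r) powr (1 / r) \<le> CH * (CG * lpnorm p f)"
      using AH(2) by (intro mult_left_mono)
    finally show ?thesis by simp
  qed
  have SU: "S f \<in> UP p" if f: "f \<in> Lp p" for f using SL Sb[OF f] by (rule UPI)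
  have TL: "T f \<in> Lp p" if f: "f \<in> Lp p" for f unfolding T_def by (rule wlim_Lp[OF pq SU[OF f]])
  have clin: "c (\<lambda>y. a * f y + b * g y) m = a * c f m + b * c g m" if "f \<in> Lp p" "g \<in> Lp p" for f g a b m
    unfolding c_def using Lp_Holder(1)[OF pq that(1) GL, of m] Lp_Holder(1)[OF pq that(2) GL, of m]
    by (simp add: distrib_right mult.assoc)
  have T: "bop_Lp p T" unfolding bop_Lp_def
  proof (intro conjI ballI allI impI)
    show "T f \<in> Lp p" if "f \<in> Lp p" for f by (rule TL[OF that])
    show "AE x in M01. T (\<lambda>y. a * f y + b * g y) x = a * T f x + b * T g x" if fg: "f \<in> Lp p" "g \<in> Lp p" for f g a b
    proof -
      have L: "(\<lambda>y. a * f y + b * g y) \<in> Lp p" using fg p by (intro Lp_lin) auto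
      have L2: "(\<lambda>x. a * T f x + b * T g x) \<in> Lp p" using fg p by (intro Lp_lin TL) auto
      have S: "S (\<lambda>y. a * f y + b * g y) = (\<lambda>N x. a * S f N x + b * S g N x)"
        by (simp add: S_def clin[OF fg] sum_distrib_left sum.distrib[symmetric] fun_eq_iff algebra_simps)
      have "lpnorm p (\<lambda>x. T (\<lambda>y. a * f y + b * g y) x - (a * T f x + b * T g x)) = 0"
        unfolding T_def[of "\<lambda>y. a * f y + b * g y"]
      proof (rule lpnorm_wlim_unique[OF pq SU[OF L] L2])
        fix h assume h: "h \<in> Lp q"
        have "upair U (S (\<lambda>y. a * f y + b * g y)) (\<lambda>n. h) = a * upair U (S f) (\<lambda>n. h) + b * upair U (S g) (\<lambda>n. h)"
          unfolding S by (rule upair_lin_left[OF pq SU[OF fg(1)] SU[OF fg(2)] UP_const[OF h]])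
        also have "\<dots> = a * (LINT x|M01. T f x * h x) + b * (LINT x|M01. T g x * h x)"
          unfolding T_def using wlim_pairing[OF pq SU[OF fg(1)] h] wlim_pairing[OF pq SU[OF fg(2)] h] by simp
        also have "\<dots> = (LINT x|M01. (a * T f x + b * T g x) * h x)"
          using Lp_Holder(1)[OF pq TL[OF fg(1)] h] Lp_Holder(1)[OF pq TL[OF fg(2)] h] by (simp add: distrib_right mult.assoc)
        finally show "upair U (S (\<lambda>y. a * f y + b * g y)) (\<lambda>n. h) = (LINT x|M01. (a * T f x + b * T g x) * h x)" .
      qed
      then show ?thesis using lpnorm_eq_0_iff[OF Lp_diff[OF TL[OF L] L2 p(3)] p(4)] by simp
    qed
    show "AE x in M01. T f x = T g x" if fg: "f \<in> Lp p" "g \<in> Lp p" "AE x in M01. f x = g x" for f g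
    proof -
      have "c f m = c g m" for m
      proof -
        note [measurable] = Lp_measurable[OF fg(1)] Lp_measurable[OF fg(2)] Lp_measurable[OF GL]
        show ?thesis unfolding c_def using fg(3) by (intro integral_cong_AE) auto
      qed
      then have "S f = S g" by (simp add: S_def fun_eq_iff)
      then show ?thesis by (simp add: T_def)
    qed
    have "lpnorm p (T f) \<le> CH * CG * lpnorm p f" if f: "f \<in> Lp p" for f
    proof -
      have "lpnorm p (T f) \<le> unorm p U (S f)" unfolding T_def by (rule lpnorm_wlim_le[OF pq SU[OF f]])
      also have "\<dots> \<le> CH * CG * lpnorm p f" using Sb[OF f] by (intro unorm_le[OF SU[OF f]]) simp
      finally show ?thesis .
    qed
    then show "\<exists>C. \<forall>f\<in>Lp p. lpnorm p (T f) \<le> C * lpnorm p f" by blast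
  qed
  have "unorm p U (\<lambda>n x. ultra_op T F n x - upair U F G * H n x) < \<epsilon>" if F: "F \<in> \<F>" for F
  proof -
    have FU: "F \<in> UP p" using F fin(2) by blast
    have "((\<lambda>n. LINT x|M01. F n x * G n x) \<longlongrightarrow> upair U F G) U" by (rule pairing_tendsto[OF pq FU GU])
    then have "\<forall>\<^sub>F n in U. dist (LINT x|M01. F n x * G n x) (upair U F G) < \<eta>" using \<eta> by (rule tendstoD)
    with evA have "\<forall>\<^sub>F n in U. lpnorm p (\<lambda>x. ultra_op T F n x - upair U F G * H n x) \<le> \<epsilon> / 2"
    proof eventually_elim
      case (elim n)
      let ?c = "c (F n)"
      have Fn: "F n \<in> Lp p" by (rule UP_Lp[OF FU])
      have hL: "(\<lambda>x. ?c n * H n x) \<in> Lp p" by (rule Lp_scale[OF HL])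
      have 1: "lpnorm p (\<lambda>x. T (F n) x - ?c n * H n x) \<le> \<eta> * CB"
        unfolding T_def
      proof (rule lpnorm_wlim_diff_le[OF pq SU[OF Fn] hL])
        show "\<forall>\<^sub>F N in U. lpnorm p (\<lambda>x. S (F n) N x - ?c n * H n x) \<le> \<eta> * CB"
          using U_gt[of n]
        proof eventually_elim
          case e: (elim N)
          let ?s = "A \<inter> {..<N} - {n}"
          \<comment> \<open>Once \<open>N\<close> exceeds \<open>n\<close> the partial sum contains
            the diagonal term, and the remainder is bounded termwise by the off-diagonal sum and
            \<open>CB\<close>.\<close>
          have "A \<inter> {..<N} = insert n ?s" using elim(1) e by auto
          then have "S (F n) N x - ?c n * H n x = (\<Sum>m\<in>?s. ?c m * H m x)" for x
            unfolding S_def by (metis (no_types, lifting) add_diff_cancel_left' finite_Diff finite_Int finite_lessThan insert_Diff_single sum.insert_remove)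
          then have "lpnorm p (\<lambda>x. S (F n) N x - ?c n * H n x) = lpnorm p (\<lambda>x. \<Sum>m\<in>?s. ?c m * H m x)" by simp
          also have "\<dots> \<le> (\<Sum>m\<in>?s. lpnorm p (\<lambda>x. ?c m * H m x))" using p HL by (intro lpnorm_sum_le Lp_scale) auto
          also have "\<dots> = (\<Sum>m\<in>?s. \<bar>?c m\<bar> * lpnorm p (H m))" using p by (simp add: lpnorm_scale)
          also have "\<dots> \<le> (\<Sum>m\<in>?s. \<bar>?c m\<bar> * CB)" using CB by (intro sum_mono mult_left_mono) auto
          also have "\<dots> = (\<Sum>m\<in>?s. \<bar>?c m\<bar>) * CB" by (simp add: sum_distrib_right)
          also have "(\<Sum>m\<in>?s. \<bar>?c m\<bar>) \<le> \<eta>"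
          proof -
            have "n \<in> AF F" "finite ?s" "?s \<subseteq> AF F - {n}" using elim(1) F by (auto simp: A_def)
            then show ?thesis unfolding c_def using AF F by blast
          qed
          then have "(\<Sum>m\<in>?s. \<bar>?c m\<bar>) * CB \<le> \<eta> * CB" using CB(1) by (rule mult_right_mono)
          finally show ?case .
        qed
      qed
      have "lpnorm p (\<lambda>x. (?c n - upair U F G) * H n x) = \<bar>?c n - upair U F G\<bar> * lpnorm p (H n)"
        using p by (simp add: lpnorm_scale)
      also have "\<dots> \<le> \<eta> * CB" using elim(2) CB \<eta> by (intro mult_mono) (auto simp: c_def dist_real_def)
      finally have 2: "lpnorm p (\<lambda>x. (?c n - upair U F G) * H n x) \<le> \<eta> * CB" .
      have "(\<lambda>x. T (F n) x - upair U F G * H n x) = (\<lambda>x. (T (F n) x - ?c n * H n x) + (?c n - upair U F G) * H n x)"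
        by (simp add: algebra_simps)
      then have "lpnorm p (\<lambda>x. ultra_op T F n x - upair U F G * H n x)
          = lpnorm p (\<lambda>x. (T (F n) x - ?c n * H n x) + (?c n - upair U F G) * H n x)" by (simp add: ultra_op_def)
      also have "\<dots> \<le> lpnorm p (\<lambda>x. T (F n) x - ?c n * H n x) + lpnorm p (\<lambda>x. (?c n - upair U F G) * H n x)"
        using p HL TL[OF Fn] by (intro lpnorm_triangle Lp_diff Lp_scale) auto
      also have "\<dots> \<le> \<epsilon> / 2" using 1 2 \<eta>2 by simp
      finally show ?case .
    qed
    then have "unorm p U (\<lambda>n x. ultra_op T F n x - upair U F G * H n x) \<le> \<epsilon> / 2"
      using p H(1) FU T by (intro unorm_le UP_diff ultra_op_UP UP_scale)
    then show ?thesis using \<epsilon> by simp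
  qed
  then show ?thesis using T by blast
qed

text \<open>Over a set \<open>s\<close> of N indices the double sum of \<open>d n m\<close> differs
  from \<open>N * c\<close> by at most \<open>N * |c| / 2\<close>, since the off-diagonal row sums
  are small; the two upper estimates with all coefficients one bound it by a constant times
  \<open>N powr (1 / r + 1 / r')\<close>. As that exponent is below one, large N gives a
  contradiction unless \<open>c = 0\<close>.\<close>

theorem averaging:
  assumes pq: "conjugate_exponents p q" and T: "bop_Lp p T"
    and F: "F \<in> UP p" "upper_est p r U F" and G: "G \<in> Lhat q U" "upper_est q r' U G"
    and r: "1 / r + 1 / r' < 1"
  shows "upair U (ultra_op T F) G = 0"
proof (rule ccontr)
  let ?F = "ultra_op T F"
  have p: "1 \<le> p" "0 \<le> p" using conjugate_exponentsD(1)[OF pq] by auto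
  note GU = Lhat_UP[OF G(1)] and TF = ultra_op_UP[OF T F(1)]
  define c where "c = upair U ?F G"
  define d where "d n m = (LINT x|M01. ?F n x * G m x)" for n m
  assume "upair U ?F G \<noteq> 0"
  then have c: "0 < \<bar>c\<bar> / 4" by (simp add: c_def)
  obtain A1 where A1: "\<forall>\<^sub>F n in U. n \<in> A1" "\<forall>n\<in>A1. \<forall>s. finite s \<longrightarrow> s \<subseteq> A1 - {n} \<longrightarrow> (\<Sum>m\<in>s. \<bar>d n m\<bar>) \<le> \<bar>c\<bar> / 4"
    using offdiagonal_small[OF pq TF G(1) c] unfolding d_def[symmetric] by blast
  obtain AF CF where AF: "\<forall>\<^sub>F n in U. n \<in> AF" "0 \<le> CF"
    "\<And>s a. finite s \<Longrightarrow> s \<subseteq> AF \<Longrightarrow> lpnorm p (\<lambda>x. \<Sum>n\<in>s. a n * F n x) \<le> CF * (\<Sum>n\<in>s. \<bar>a n\<bar> powr r) powr (1 / r)"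
    using F(2) unfolding upper_est_def by blast
  obtain AG CG where AG: "\<forall>\<^sub>F n in U. n \<in> AG" "0 \<le> CG"
    "\<And>s a. finite s \<Longrightarrow> s \<subseteq> AG \<Longrightarrow> lpnorm q (\<lambda>x. \<Sum>n\<in>s. a n * G n x) \<le> CG * (\<Sum>n\<in>s. \<bar>a n\<bar> powr r') powr (1 / r')"
    using G(2) unfolding upper_est_def by blast
  obtain CT where CT: "0 \<le> CT" "\<And>f. f \<in> Lp p \<Longrightarrow> lpnorm p (T f) \<le> CT * lpnorm p f" using bop_LpD(4)[OF T] by blast
  have "((\<lambda>n. d n n) \<longlongrightarrow> c) U" unfolding d_def c_def by (rule pairing_tendsto[OF pq TF GU])
  then have ev: "\<forall>\<^sub>F n in U. dist (d n n) c < \<bar>c\<bar> / 4" using c by (rule tendstoD)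
  define A where "A = {n \<in> A1 \<inter> AF \<inter> AG. \<bar>d n n - c\<bar> < \<bar>c\<bar> / 4}"
  have "\<forall>\<^sub>F n in U. n \<in> A" using A1(1) AF(1) AG(1) ev by eventually_elim (simp add: A_def dist_real_def)
  then have inf: "infinite A" by (rule U_infinite)
  define \<beta> where "\<beta> = 1 / r + 1 / r'"
  define K where "K = CT * CF * CG"
  have K0: "0 \<le> K" using CT(1) AF(2) AG(2) by (simp add: K_def)
  have key: "real N * (\<bar>c\<bar> / 2) \<le> K * real N powr \<beta>" for N
  proof -
    obtain s where s: "finite s" "card s = N" "s \<subseteq> A" using infinite_arbitrarily_large[OF inf] by metis
    have FL: "F n \<in> Lp p" "?F n \<in> Lp p" and GL: "G n \<in> Lp q" for n
      using UP_Lp[OF F(1)] UP_Lp[OF TF] UP_Lp[OF GU] by auto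
    let ?f = "\<lambda>x. \<Sum>n\<in>s. ?F n x" and ?g = "\<lambda>x. \<Sum>n\<in>s. G n x" and ?h = "\<lambda>x. \<Sum>n\<in>s. F n x"
    have fL: "?f \<in> Lp p" "?h \<in> Lp p" and gL: "?g \<in> Lp q" using FL GL p conjugate_exponentsD(2)[OF pq] by (auto intro!: Lp_sum)
    have "lpnorm p ?h \<le> CF * real N powr (1 / r)"
      using AF(3)[OF s(1), of "\<lambda>n. 1"] s by (auto simp: A_def)
    then have "lpnorm p (T ?h) \<le> CT * (CF * real N powr (1 / r))"
      using CT(2)[OF fL(2)] mult_left_mono[OF _ CT(1)] by fastforce
    moreover have "lpnorm p (\<lambda>x. T ?h x - ?f x) = 0"
      unfolding ultra_op_def using FL(1) p s(1) by (intro bop_Lp_sum_norm[OF T]) auto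
    then have "lpnorm p ?f \<le> lpnorm p (T ?h)"
      using lpnorm_reverse_triangle[OF bop_LpD(1)[OF T fL(2)] fL(1) p(1)] by simp
    ultimately have f1: "lpnorm p ?f \<le> CT * (CF * real N powr (1 / r))" by simp
    have g1: "lpnorm q ?g \<le> CG * real N powr (1 / r')"
      using AG(3)[OF s(1), of "\<lambda>n. 1"] s by (auto simp: A_def)
    have "(\<Sum>n\<in>s. \<Sum>m\<in>s. d n m) = (LINT x|M01. ?f x * ?g x)"
      unfolding d_def sum_product using Lp_Holder(1)[OF pq FL(2) GL]
      by (subst Bochner_Integration.integral_sum) (auto intro!: Bochner_Integration.integrable_sum simp: Bochner_Integration.integral_sum)
    then have "\<bar>\<Sum>n\<in>s. \<Sum>m\<in>s. d n m\<bar> \<le> lpnorm p ?f * lpnorm q ?g" using Lp_Holder(3)[OF pq fL(1) gL] by simp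
    also have "\<dots> \<le> (CT * (CF * real N powr (1 / r))) * (CG * real N powr (1 / r'))"
      using f1 g1 CT(1) AF(2) by (intro mult_mono) auto
    also have "\<dots> = K * real N powr \<beta>" by (simp add: K_def \<beta>_def powr_add mult_ac)
    finally have up: "\<bar>\<Sum>n\<in>s. \<Sum>m\<in>s. d n m\<bar> \<le> K * real N powr \<beta>" .
    have "\<bar>(\<Sum>m\<in>s. d n m) - c\<bar> \<le> \<bar>c\<bar> / 2" if n: "n \<in> s" for n
    proof -
      have "(\<Sum>m\<in>s. d n m) = d n n + (\<Sum>m\<in>s - {n}. d n m)" using n s(1) by (simp add: sum.remove)
      moreover have "\<bar>\<Sum>m\<in>s - {n}. d n m\<bar> \<le> (\<Sum>m\<in>s - {n}. \<bar>d n m\<bar>)" by (rule sum_abs)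
      moreover have "(\<Sum>m\<in>s - {n}. \<bar>d n m\<bar>) \<le> \<bar>c\<bar> / 4"
      proof -
        have "n \<in> A1" "finite (s - {n})" "s - {n} \<subseteq> A1 - {n}" using s n by (auto simp: A_def)
        then show ?thesis using A1(2) by blast
      qed
      moreover have "\<bar>d n n - c\<bar> < \<bar>c\<bar> / 4" using n s(3) by (auto simp: A_def)
      ultimately show ?thesis by linarith
    qed
    then have "(\<Sum>n\<in>s. \<bar>(\<Sum>m\<in>s. d n m) - c\<bar>) \<le> real N * (\<bar>c\<bar> / 2)"
      using sum_bounded_above[of s "\<lambda>n. \<bar>(\<Sum>m\<in>s. d n m) - c\<bar>" "\<bar>c\<bar> / 2"] s(2) by simp
    moreover have "\<bar>(\<Sum>n\<in>s. (\<Sum>m\<in>s. d n m) - c)\<bar> \<le> (\<Sum>n\<in>s. \<bar>(\<Sum>m\<in>s. d n m) - c\<bar>)" by (rule sum_abs)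
    moreover have "(\<Sum>n\<in>s. (\<Sum>m\<in>s. d n m) - c) = (\<Sum>n\<in>s. \<Sum>m\<in>s. d n m) - real N * c"
      using s(2) by (simp add: sum_subtractf)
    moreover have "\<bar>real N * c\<bar> = real N * \<bar>c\<bar>" by (simp add: abs_mult)
    moreover have "real N * \<bar>c\<bar> = real N * (\<bar>c\<bar> / 2) + real N * (\<bar>c\<bar> / 2)" by simp
    ultimately show ?thesis using up by linarith
  qed
  \<comment> \<open>Chosen just above the ratio \<open>2 * K / |c|\<close> that the comparison
    allows; \<open>N\<close> is then taken so large that \<open>N powr (1 - \<beta>)\<close> reaches
    \<open>L\<close>.\<close>
  define L where "L = 2 * K / \<bar>c\<bar> + 1"
  have c0: "0 < \<bar>c\<bar>" using c by simp
  have L: "0 < L" using K0 c0 by (simp add: L_def add_nonneg_pos)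
  have \<beta>: "\<beta> < 1" using r by (simp add: \<beta>_def)
  obtain N :: nat where N: "max 1 (L powr (1 / (1 - \<beta>))) \<le> real N" using real_arch_simple by blast
  have N0: "0 < real N" using N by linarith
  have "L = (L powr (1 / (1 - \<beta>))) powr (1 - \<beta>)" using L \<beta> by (simp add: powr_powr)
  also have "\<dots> \<le> real N powr (1 - \<beta>)" using N \<beta> by (intro powr_mono2) auto
  finally have LN: "L \<le> real N powr (1 - \<beta>)" .
  have "real N = real N powr (1 - \<beta>) * real N powr \<beta>" using N0 by (simp add: powr_add[symmetric])
  then have "real N powr (1 - \<beta>) * real N powr \<beta> * (\<bar>c\<bar> / 2) \<le> K * real N powr \<beta>" using key[of N] by simp
  then have "(real N powr (1 - \<beta>) * (\<bar>c\<bar> / 2)) * real N powr \<beta> \<le> K * real N powr \<beta>" by (simp add: mult_ac)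
  then have "real N powr (1 - \<beta>) * (\<bar>c\<bar> / 2) \<le> K" using N0 by simp
  then have "L * (\<bar>c\<bar> / 2) \<le> K" using mult_right_mono[OF LN, of "\<bar>c\<bar> / 2"] c0 by linarith
  then have "L \<le> 2 * K / \<bar>c\<bar>" using c0 by (simp add: field_simps)
  then show False by (simp add: L_def)
qed

end

section \<open>Invariant subspaces and the weak operator closure\<close>

text \<open>Linear algebra on a finite set: \<open>J\<close> is a maximal set of points whose
  evaluations are independent on \<open>W\<close>, and \<open>\<omega>\<close> is dual to them. It
  is applied to functions \<open>\<lambda>F. upair U F G\<close> with \<open>G\<close> in a space of
  functionals: every \<open>F\<close> in \<open>I\<close> then acts like the combination of the
  \<open>j\<close> in \<open>J\<close> with weights \<open>\<omega> j F\<close>, and each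
  \<open>\<omega> j\<close> is itself realised by a functional.\<close>

lemma biorthogonal_family:
  fixes W :: "('i \<Rightarrow> real) set"
  assumes fin: "finite I" and W0: "(\<lambda>i. 0) \<in> W"
    and W: "\<And>w w' a b. w \<in> W \<Longrightarrow> w' \<in> W \<Longrightarrow> (\<lambda>i. a * w i + b * w' i) \<in> W"
  shows "\<exists>J \<omega>. J \<subseteq> I \<and> (\<forall>j\<in>J. \<omega> j \<in> W) \<and> (\<forall>i\<in>J. \<forall>j\<in>J. \<omega> j i = (if i = j then 1 else 0)) \<and>
           (\<forall>w\<in>W. \<forall>i\<in>I. w i = (\<Sum>j\<in>J. \<omega> j i * w j))"
  using fin
proof (induction I rule: finite_induct)
  case empty then show ?case by auto
next
  case (insert v I)
  have Wsum: "(\<lambda>i. \<Sum>j\<in>J. c j * \<omega> j i) \<in> W" if "finite J" "\<forall>j\<in>J. \<omega> j \<in> W" for J :: "'i set" and c \<omega>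
    using that
  proof (induction J rule: finite_induct)
    case (insert j J)
    then have "(\<lambda>i. c j * \<omega> j i + 1 * (\<Sum>j\<in>J. c j * \<omega> j i)) \<in> W" by (intro W) auto
    then show ?case using insert by simp
  qed (simp add: W0)
  obtain J \<omega> where J: "J \<subseteq> I" "\<forall>j\<in>J. \<omega> j \<in> W" "\<forall>i\<in>J. \<forall>j\<in>J. \<omega> j i = (if i = j then 1 else 0)"
    "\<forall>w\<in>W. \<forall>i\<in>I. w i = (\<Sum>j\<in>J. \<omega> j i * w j)"
    using insert(3) by blast
  have Jf: "finite J" using J(1) insert(1) finite_subset by blast
  have vJ: "v \<notin> J" using J(1) insert(2) by blast
  show ?case
  proof (cases "\<forall>w\<in>W. w v = (\<Sum>j\<in>J. \<omega> j v * w j)")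
    case True
    then have "\<forall>w\<in>W. \<forall>i\<in>insert v I. w i = (\<Sum>j\<in>J. \<omega> j i * w j)" using J(4) by blast
    then show ?thesis using J by (intro exI[of _ J] exI[of _ \<omega>]) blast
  next
    case False
    then obtain w0 where w0: "w0 \<in> W" "w0 v \<noteq> (\<Sum>j\<in>J. \<omega> j v * w0 j)" by blast
    define \<delta> where "\<delta> = w0 v - (\<Sum>j\<in>J. \<omega> j v * w0 j)"
    have \<delta>: "\<delta> \<noteq> 0" using w0(2) by (simp add: \<delta>_def)
    \<comment> \<open>\<open>w0\<close> minus its interpolation by the old family, normalised: it
      vanishes on the old points and equals 1 at \<open>v\<close>. The old functions are then
      corrected to vanish at \<open>v\<close>.\<close>
    define \<nu> where "\<nu> i = (1 / \<delta>) * w0 i + (- 1 / \<delta>) * (\<Sum>j\<in>J. w0 j * \<omega> j i)" for i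
    have \<nu>W: "\<nu> \<in> W" unfolding \<nu>_def[abs_def] by (intro W w0(1) Wsum Jf J(2))
    have \<nu>J: "\<nu> i = 0" if "i \<in> J" for i
    proof -
      have "(\<Sum>j\<in>J. w0 j * \<omega> j i) = (\<Sum>j\<in>J. if i = j then w0 j else 0)"
        using J(3) that by (intro sum.cong) auto
      also have "\<dots> = w0 i" using Jf that by simp
      finally show ?thesis by (simp add: \<nu>_def)
    qed
    have \<nu>I: "\<nu> i = 0" if "i \<in> I" for i
      using bspec[OF bspec[OF J(4) \<nu>W] that] \<nu>J by simp
    have \<nu>v: "\<nu> v = 1"
    proof -
      have "\<nu> v = (w0 v - (\<Sum>j\<in>J. \<omega> j v * w0 j)) / \<delta>" by (simp add: \<nu>_def mult.commute diff_divide_distrib)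
      then show ?thesis using \<delta> by (simp add: \<delta>_def[symmetric])
    qed
    define \<omega>' where "\<omega>' j = (if j = v then \<nu> else (\<lambda>i. 1 * \<omega> j i + (- \<omega> j v) * \<nu> i))" for j
    have 1: "\<omega>' j \<in> W" if "j \<in> insert v J" for j
    proof (cases "j = v")
      case True then show ?thesis using \<nu>W by (simp add: \<omega>'_def)
    next
      case False
      then have "\<omega> j \<in> W" using J(2) that by blast
      from W[OF this \<nu>W, of 1 "- \<omega> j v"] show ?thesis using False by (simp add: \<omega>'_def)
    qed
    have 2: "\<forall>i\<in>insert v J. \<forall>j\<in>insert v J. \<omega>' j i = (if i = j then 1 else 0)"
      using J(3) \<nu>J \<nu>v vJ by (auto simp: \<omega>'_def)
    have 3: "w i = (\<Sum>j\<in>insert v J. \<omega>' j i * w j)" if w: "w \<in> W" and i: "i \<in> insert v I" for w i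
    proof -
      have s: "(\<Sum>j\<in>insert v J. \<omega>' j i * w j) = \<nu> i * w v + (\<Sum>j\<in>J. (\<omega> j i - \<omega> j v * \<nu> i) * w j)"
        using Jf vJ by (subst sum.insert) (auto simp: \<omega>'_def intro!: sum.cong)
      show ?thesis
      proof (cases "i = v")
        case True then show ?thesis using s \<nu>v by simp
      next
        case False
        then have "i \<in> I" using i by simp
        then show ?thesis using s \<nu>I J(4) w by simp
      qed
    qed
    have "insert v J \<subseteq> insert v I" using J(1) by blast
    then show ?thesis using 1 2 3 by (intro exI[of _ "insert v J"] exI[of _ \<omega>']) blast
  qed
qed

text \<open>Closure of the ultrapowers in the strong operator topology. Norm estimates on finitely
  many vectors add up easily, and they imply the weak ones
  (\<open>in_wot_closure_approx\<close>).\<close>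

definition approx_op :: "real \<Rightarrow> nat filter \<Rightarrow> (useq \<Rightarrow> useq) \<Rightarrow> bool" where
  "approx_op p U S \<longleftrightarrow> (\<forall>\<F> \<epsilon>. finite \<F> \<longrightarrow> \<F> \<subseteq> UP p \<longrightarrow> 0 < \<epsilon> \<longrightarrow>
     (\<exists>T. bop_Lp p T \<and> (\<forall>F\<in>\<F>. unorm p U (\<lambda>n x. ultra_op T F n x - S F n x) < \<epsilon>)))"

definition rank_one :: "nat filter \<Rightarrow> useq \<Rightarrow> useq \<Rightarrow> useq \<Rightarrow> useq" where
  "rank_one U G H F = (\<lambda>n x. upair U F G * H n x)"

text \<open>\<open>ueq\<close> bundled with membership in \<open>UP p\<close>, which frees
  transitivity and congruence from membership conditions.\<close>

definition eqv :: "real \<Rightarrow> nat filter \<Rightarrow> useq \<Rightarrow> useq \<Rightarrow> bool" where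
  "eqv p U F G \<longleftrightarrow> F \<in> UP p \<and> G \<in> UP p \<and> unorm p U (\<lambda>n x. F n x - G n x) = 0"

text \<open>The candidate for M, cut out of the weakly null part by a test family in the conjugate
  ultrapower: \<open>Lhat 2 U\<close> for \<open>p > 2\<close>, \<open>L1null q U\<close> for
  \<open>p < 2\<close>.\<close>

definition Mspace :: "real \<Rightarrow> nat filter \<Rightarrow> useq set \<Rightarrow> useq set" where
  "Mspace p U \<G> = {F \<in> Lhat p U. \<forall>G\<in>\<G>. upair U F G = 0}"

lemma subspace_sumI:
  assumes "F \<in> UP p" "G \<in> X" "H \<in> Y" "ueq p U F (\<lambda>n x. G n x + H n x)"
  shows "F \<in> subspace_sum p U X Y"
  unfolding subspace_sum_def
  by (intro CollectI conjI assms(1) bexI[where x = G] bexI[where x = H] assms(2-4))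

lemma subspace_sum_commute: "subspace_sum p U X Y = subspace_sum p U Y X"
proof -
  have "F \<in> subspace_sum p U Y X" if F: "F \<in> subspace_sum p U X Y" for F X Y
  proof -
    obtain G H where GH: "F \<in> UP p" "G \<in> X" "H \<in> Y" "ueq p U F (\<lambda>n x. G n x + H n x)"
      using F unfolding subspace_sum_def by blast
    have "ueq p U F (\<lambda>n x. H n x + G n x)" using GH(4) by (simp add: add.commute)
    then show ?thesis by (rule subspace_sumI[OF GH(1,3,2)])
  qed
  then show ?thesis by blast
qed

section \<open>Equality in the ultrapower and strong limits of ultrapowers\<close>

context ultra
begin

lemma eqv_refl: "F \<in> UP p \<Longrightarrow> eqv p U F F"
  by (simp add: eqv_def unorm_const)

lemma eqv_sym: "eqv p U F G \<Longrightarrow> eqv p U G F"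
  unfolding eqv_def using unorm_minus_commute[of p F G] by simp

lemma eqv_trans:
  assumes "1 \<le> p" "eqv p U F G" "eqv p U G H"
  shows "eqv p U F H"
  using unorm_diff_trans[of F p G H] unorm_nonneg[OF UP_diff[of F p H]] assms by (auto simp: eqv_def)

lemma eqv_lin:
  assumes p: "1 \<le> p" and "eqv p U F F'" "eqv p U G G'"
  shows "eqv p U (\<lambda>n x. a * F n x + b * G n x) (\<lambda>n x. a * F' n x + b * G' n x)"
proof -
  have U: "F \<in> UP p" "F' \<in> UP p" "G \<in> UP p" "G' \<in> UP p" and z: "unorm p U (\<lambda>n x. F n x - F' n x) = 0" "unorm p U (\<lambda>n x. G n x - G' n x) = 0"
    using assms by (auto simp: eqv_def)
  have "unorm p U (\<lambda>n x. a * (F n x - F' n x) + b * (G n x - G' n x)) \<le> 0"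
    using unorm_lin_le[OF UP_diff[OF U(1,2) p] UP_diff[OF U(3,4) p] p, of a b] z by simp
  moreover have "(\<lambda>n x. a * (F n x - F' n x) + b * (G n x - G' n x)) = (\<lambda>n x. (a * F n x + b * G n x) - (a * F' n x + b * G' n x))"
    by (simp add: algebra_simps)
  moreover have "0 \<le> unorm p U (\<lambda>n x. (a * F n x + b * G n x) - (a * F' n x + b * G' n x))"
    using U p by (intro unorm_nonneg UP_diff UP_lin)
  ultimately show ?thesis using U p by (auto simp: eqv_def intro!: UP_lin)
qed

lemma eqv_add: "1 \<le> p \<Longrightarrow> eqv p U F F' \<Longrightarrow> eqv p U G G' \<Longrightarrow> eqv p U (\<lambda>n x. F n x + G n x) (\<lambda>n x. F' n x + G' n x)"
  using eqv_lin[of p F F' G G' 1 1] by simp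

lemma eqv_sum:
  assumes p: "1 \<le> p" and "\<And>i. i \<in> s \<Longrightarrow> eqv p U (F i) (F' i)" and s: "finite s"
  shows "eqv p U (\<lambda>n x. \<Sum>i\<in>s. c i * F i n x) (\<lambda>n x. \<Sum>i\<in>s. c i * F' i n x)"
  using s assms(2)
proof (induction s rule: finite_induct)
  case empty then show ?case using p by (simp add: eqv_refl UP_zero)
next
  case (insert i s)
  have "eqv p U (\<lambda>n x. c i * F i n x + 1 * (\<Sum>i\<in>s. c i * F i n x)) (\<lambda>n x. c i * F' i n x + 1 * (\<Sum>i\<in>s. c i * F' i n x))"
    using insert by (intro eqv_lin p) auto
  then show ?case using insert by simp
qed

lemma eqv_ueq: "1 \<le> p \<Longrightarrow> F \<in> UP p \<Longrightarrow> G \<in> UP p \<Longrightarrow> eqv p U F G \<longleftrightarrow> ueq p U F G"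
  by (simp add: eqv_def ueq_iff)

lemma bop_UD:
  assumes S: "bop_U p U S" and p: "1 \<le> p"
  shows "\<And>F. F \<in> UP p \<Longrightarrow> S F \<in> UP p"
    and "\<And>F G. eqv p U F G \<Longrightarrow> eqv p U (S F) (S G)"
    and "\<And>F G a b. F \<in> UP p \<Longrightarrow> G \<in> UP p \<Longrightarrow> eqv p U (S (\<lambda>n x. a * F n x + b * G n x)) (\<lambda>n x. a * S F n x + b * S G n x)"
proof -
  show SU: "S F \<in> UP p" if "F \<in> UP p" for F using S that unfolding bop_U_def by blast
  show "eqv p U (S F) (S G)" if e: "eqv p U F G" for F G
  proof -
    have FG: "F \<in> UP p" "G \<in> UP p" using e by (auto simp: eqv_def)
    then have "ueq p U F G" using e p eqv_ueq by blast
    then have "ueq p U (S F) (S G)" using S FG unfolding bop_U_def by blast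
    then show ?thesis using SU FG p eqv_ueq by blast
  qed
  show "eqv p U (S (\<lambda>n x. a * F n x + b * G n x)) (\<lambda>n x. a * S F n x + b * S G n x)" if FG: "F \<in> UP p" "G \<in> UP p" for F G a b
  proof -
    have "ueq p U (S (\<lambda>n x. a * F n x + b * G n x)) (\<lambda>n x. a * S F n x + b * S G n x)"
      using S FG unfolding bop_U_def by blast
    then show ?thesis using FG p SU by (subst eqv_ueq) (auto intro!: UP_lin)
  qed
qed

lemma bop_U_sum:
  assumes S: "bop_U p U S" and p: "1 \<le> p" and F: "\<And>i. i \<in> s \<Longrightarrow> F i \<in> UP p" and s: "finite s"
  shows "eqv p U (S (\<lambda>n x. \<Sum>i\<in>s. c i * F i n x)) (\<lambda>n x. \<Sum>i\<in>s. c i * S (F i) n x)"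
  using s F
proof (induction s rule: finite_induct)
  case empty
  have z: "(\<lambda>n x. 0) \<in> UP p" using p by (rule UP_zero)
  have "eqv p U (S (\<lambda>n x. 0 * 0 + 0 * 0)) (\<lambda>n x. 0 * S (\<lambda>n x. 0) n x + 0 * S (\<lambda>n x. 0) n x)"
    by (rule bop_UD(3)[OF S p z z])
  then show ?case by simp
next
  case (insert i s)
  have U: "(\<lambda>n x. \<Sum>i\<in>s. c i * F i n x) \<in> UP p" using insert p by (intro UP_sum UP_scale) auto
  have "eqv p U (S (\<lambda>n x. c i * F i n x + 1 * (\<Sum>i\<in>s. c i * F i n x))) (\<lambda>n x. c i * S (F i) n x + 1 * S (\<lambda>n x. \<Sum>i\<in>s. c i * F i n x) n x)"
    using insert by (intro bop_UD(3)[OF S p] U) auto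
  moreover have "eqv p U (\<lambda>n x. c i * S (F i) n x + 1 * S (\<lambda>n x. \<Sum>i\<in>s. c i * F i n x) n x) (\<lambda>n x. c i * S (F i) n x + 1 * (\<Sum>i\<in>s. c i * S (F i) n x))"
    using insert by (intro eqv_lin p eqv_refl bop_UD(1)[OF S p]) auto
  ultimately have "eqv p U (S (\<lambda>n x. c i * F i n x + 1 * (\<Sum>i\<in>s. c i * F i n x))) (\<lambda>n x. c i * S (F i) n x + 1 * (\<Sum>i\<in>s. c i * S (F i) n x))"
    by (rule eqv_trans[OF p])
  then show ?case using insert by simp
qed

lemma closed_usub_eqv:
  assumes X: "closed_usub p U X" and p: "1 \<le> p" and F: "F \<in> X" and e: "eqv p U F G"
  shows "G \<in> X"
proof -
  have "F \<in> UP p" "G \<in> UP p" using e by (auto simp: eqv_def)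
  then have "ueq p U F G" using e p eqv_ueq by blast
  then show ?thesis using X F \<open>G \<in> UP p\<close> unfolding closed_usub_def by blast
qed

lemma closed_usub_lin:
  assumes "closed_usub p U X" "F \<in> X" "G \<in> X"
  shows "(\<lambda>n x. a * F n x + b * G n x) \<in> X"
  using assms unfolding closed_usub_def by blast

lemma closed_usubD:
  assumes X: "closed_usub p U X"
  shows "X \<subseteq> UP p" "(\<lambda>n x. 0) \<in> X"
  using X unfolding closed_usub_def by blast+

lemma rank_one_UP: "1 \<le> p \<Longrightarrow> H \<in> UP p \<Longrightarrow> rank_one U G H F \<in> UP p"
  unfolding rank_one_def by (rule UP_scale)

lemma approx_op_zero:
  assumes p: "1 \<le> p"
  shows "approx_op p U (\<lambda>F n x. 0)"
  unfolding approx_op_def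
proof (intro allI impI)
  fix \<F> :: "useq set" and \<epsilon> :: real assume "0 < \<epsilon>"
  then show "\<exists>T. bop_Lp p T \<and> (\<forall>F\<in>\<F>. unorm p U (\<lambda>n x. ultra_op T F n x - 0) < \<epsilon>)"
    using bop_Lp_zero[OF p] by (intro exI[of _ "\<lambda>f x. 0"]) (simp add: ultra_op_def unorm_const)
qed

lemma approx_op_add:
  assumes p: "1 \<le> p" and A: "approx_op p U A" and B: "approx_op p U B"
    and AU: "\<And>F. F \<in> UP p \<Longrightarrow> A F \<in> UP p" and BU: "\<And>F. F \<in> UP p \<Longrightarrow> B F \<in> UP p"
  shows "approx_op p U (\<lambda>F n x. A F n x + B F n x)"
  unfolding approx_op_def
proof (intro allI impI)
  fix \<F> :: "useq set" and \<epsilon> :: real assume f: "finite \<F>" "\<F> \<subseteq> UP p" "0 < \<epsilon>"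
  then have e: "0 < \<epsilon> / 2" by simp
  obtain S where S: "bop_Lp p S" "\<forall>F\<in>\<F>. unorm p U (\<lambda>n x. ultra_op S F n x - A F n x) < \<epsilon> / 2"
    using A f e unfolding approx_op_def by blast
  obtain T where T: "bop_Lp p T" "\<forall>F\<in>\<F>. unorm p U (\<lambda>n x. ultra_op T F n x - B F n x) < \<epsilon> / 2"
    using B f e unfolding approx_op_def by blast
  have "unorm p U (\<lambda>n x. ultra_op (\<lambda>f x. S f x + T f x) F n x - (A F n x + B F n x)) < \<epsilon>" if F: "F \<in> \<F>" for F
  proof -
    have FU: "F \<in> UP p" using F f by blast
    have "(\<lambda>n x. ultra_op (\<lambda>f x. S f x + T f x) F n x - (A F n x + B F n x)) = (\<lambda>n x. (ultra_op S F n x - A F n x) + (ultra_op T F n x - B F n x))"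
      by (simp add: ultra_op_def algebra_simps)
    moreover have "unorm p U (\<lambda>n x. (ultra_op S F n x - A F n x) + (ultra_op T F n x - B F n x)) \<le>
      unorm p U (\<lambda>n x. ultra_op S F n x - A F n x) + unorm p U (\<lambda>n x. ultra_op T F n x - B F n x)"
      using FU by (intro unorm_triangle UP_diff ultra_op_UP S T AU BU p)
    ultimately show ?thesis using S(2) T(2) F by fastforce
  qed
  then show "\<exists>T. bop_Lp p T \<and> (\<forall>F\<in>\<F>. unorm p U (\<lambda>n x. ultra_op T F n x - (A F n x + B F n x)) < \<epsilon>)"
    using bop_Lp_add[OF S(1) T(1) p] by blast
qed

lemma approx_op_sum:
  assumes p: "1 \<le> p" and s: "finite s" and A: "\<And>i. i \<in> s \<Longrightarrow> approx_op p U (A i)"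
    and AU: "\<And>i F. i \<in> s \<Longrightarrow> F \<in> UP p \<Longrightarrow> A i F \<in> UP p"
  shows "approx_op p U (\<lambda>F n x. \<Sum>i\<in>s. A i F n x)"
  using s A AU
proof (induction s rule: finite_induct)
  case empty then show ?case using approx_op_zero[OF p] by simp
next
  case (insert i s)
  have "approx_op p U (\<lambda>F n x. A i F n x + (\<Sum>i\<in>s. A i F n x))"
    using insert by (intro approx_op_add[OF p, of "A i" "\<lambda>F n x. \<Sum>i\<in>s. A i F n x"] UP_sum p) auto
  then show ?case using insert by simp
qed

text \<open>A genuine rank one operator on L^p serves all \<open>F\<close> at once, since its
  ultrapower equals the target.\<close>

lemma approx_rank_one_const:
  assumes pq: "conjugate_exponents p q" and g: "g \<in> Lp q" and h: "h \<in> Lp p"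
  shows "approx_op p U (rank_one U (\<lambda>n. g) (\<lambda>n. h))"
  unfolding approx_op_def
proof (intro allI impI)
  fix \<F> :: "useq set" and \<epsilon> :: real assume f: "finite \<F>" "\<F> \<subseteq> UP p" "0 < \<epsilon>"
  have p: "0 < p" using conjugate_exponentsD(1)[OF pq] by simp
  let ?T = "\<lambda>f x. (LINT y|M01. f y * g y) * h x"
  have "unorm p U (\<lambda>n x. ultra_op ?T F n x - rank_one U (\<lambda>n. g) (\<lambda>n. h) F n x) = 0" if F: "F \<in> UP p" for F
  proof -
    have "((\<lambda>n. LINT y|M01. F n y * g y) \<longlongrightarrow> upair U F (\<lambda>n. g)) U"
      by (rule pairing_tendsto[OF pq F UP_const[OF g]])
    then have "((\<lambda>n. \<bar>(LINT y|M01. F n y * g y) - upair U F (\<lambda>n. g)\<bar> * lpnorm p h) \<longlongrightarrow> \<bar>upair U F (\<lambda>n. g) - upair U F (\<lambda>n. g)\<bar> * lpnorm p h) U"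
      by (intro tendsto_intros)
    moreover have "lpnorm p (\<lambda>x. ultra_op ?T F n x - rank_one U (\<lambda>n. g) (\<lambda>n. h) F n x) = \<bar>(LINT y|M01. F n y * g y) - upair U F (\<lambda>n. g)\<bar> * lpnorm p h" for n
      using lpnorm_scale[OF p, of "(LINT y|M01. F n y * g y) - upair U F (\<lambda>n. g)" h]
      by (simp add: ultra_op_def rank_one_def left_diff_distrib)
    ultimately show ?thesis unfolding unorm_def by (intro LimI) simp
  qed
  then show "\<exists>T. bop_Lp p T \<and> (\<forall>F\<in>\<F>. unorm p U (\<lambda>n x. ultra_op T F n x - rank_one U (\<lambda>n. g) (\<lambda>n. h) F n x) < \<epsilon>)"
    using bop_Lp_rank_one[OF pq g h] f by (intro exI[of _ ?T]) auto
qed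

text \<open>On finitely many \<open>F\<close> the operator \<open>rank_one U G H\<close> is
  Lipschitz in \<open>H\<close>. For \<open>p < 2\<close> the members of M are only limits of
  sequences with an upper 2-estimate, and this closure reaches them.\<close>

lemma approx_rank_one_closed:
  assumes pq: "conjugate_exponents p q" and G: "G \<in> UP q" and H: "H \<in> UP p"
    and cl: "\<And>\<delta>. 0 < \<delta> \<Longrightarrow> \<exists>H'\<in>UP p. approx_op p U (rank_one U G H') \<and> unorm p U (\<lambda>n x. H n x - H' n x) < \<delta>"
  shows "approx_op p U (rank_one U G H)"
  unfolding approx_op_def
proof (intro allI impI)
  fix \<F> :: "useq set" and \<epsilon> :: real assume f: "finite \<F>" "\<F> \<subseteq> UP p" "0 < \<epsilon>"
  have p: "1 \<le> p" using conjugate_exponentsD(1)[OF pq] by simp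
  define K where "K = (\<Sum>F\<in>\<F>. \<bar>upair U F G\<bar>) + 1"
  have K: "0 < K" unfolding K_def by (intro add_nonneg_pos sum_nonneg) auto
  have KF: "\<bar>upair U F G\<bar> \<le> K" if "F \<in> \<F>" for F
    using member_le_sum[OF that, of "\<lambda>F. \<bar>upair U F G\<bar>"] f by (simp add: K_def)
  have e: "0 < \<epsilon> / 2" "0 < \<epsilon> / (2 * K)" using f K by auto
  obtain H' where H': "H' \<in> UP p" "approx_op p U (rank_one U G H')" "unorm p U (\<lambda>n x. H n x - H' n x) < \<epsilon> / (2 * K)"
    using cl[OF e(2)] by blast
  obtain T where T: "bop_Lp p T" "\<forall>F\<in>\<F>. unorm p U (\<lambda>n x. ultra_op T F n x - rank_one U G H' F n x) < \<epsilon> / 2"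
    using H'(2) f e unfolding approx_op_def by blast
  have "unorm p U (\<lambda>n x. ultra_op T F n x - rank_one U G H F n x) < \<epsilon>" if F: "F \<in> \<F>" for F
  proof -
    have FU: "F \<in> UP p" using F f by blast
    have "(\<lambda>n x. rank_one U G H' F n x - rank_one U G H F n x) = (\<lambda>n x. upair U F G * (H' n x - H n x))"
      by (simp add: rank_one_def right_diff_distrib)
    then have "unorm p U (\<lambda>n x. rank_one U G H' F n x - rank_one U G H F n x) = \<bar>upair U F G\<bar> * unorm p U (\<lambda>n x. H n x - H' n x)"
      using unorm_scale[OF UP_diff[OF H'(1) H p] p] by (simp add: unorm_minus_commute[of p H])
    also have "\<dots> \<le> K * (\<epsilon> / (2 * K))"
      using KF[OF F] H'(3) unorm_nonneg[OF UP_diff[OF H H'(1) p]] K by (intro mult_mono) auto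
    finally have "unorm p U (\<lambda>n x. rank_one U G H' F n x - rank_one U G H F n x) \<le> \<epsilon> / 2" using K by simp
    then show ?thesis
      using unorm_diff_trans[OF ultra_op_UP[OF T(1) FU] rank_one_UP[OF p H'(1)] rank_one_UP[OF p H] p, of G F G F] T(2) F by fastforce
  qed
  then show "\<exists>T. bop_Lp p T \<and> (\<forall>F\<in>\<F>. unorm p U (\<lambda>n x. ultra_op T F n x - rank_one U G H F n x) < \<epsilon>)"
    using T(1) by blast
qed

text \<open>Approximation on the one-element family \<open>{F}\<close> exhibits \<open>A F\<close>
  as a limit of images of \<open>F\<close> under ultrapowers, all of which stay in
  \<open>X\<close>.\<close>

lemma closed_usub_approx_op:
  assumes X: "closed_usub p U X" and inv: "\<And>T. bop_Lp p T \<Longrightarrow> invariant_under (ultra_op T) X"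
    and p: "1 \<le> p" and A: "approx_op p U A" and F: "F \<in> X" and AF: "A F \<in> UP p"
  shows "A F \<in> X"
proof -
  have FU: "F \<in> UP p" using closed_usubD(1)[OF X] F by blast
  have "\<exists>H\<in>X. unorm p U (uminus_seq (A F) H) < \<epsilon>" if \<epsilon>: "0 < \<epsilon>" for \<epsilon>
  proof -
    have "finite {F}" "{F} \<subseteq> UP p" using FU by auto
    then obtain T where T: "bop_Lp p T" "unorm p U (\<lambda>n x. ultra_op T F n x - A F n x) < \<epsilon>"
      using A \<epsilon> unfolding approx_op_def by blast
    have "ultra_op T F \<in> X" using inv[OF T(1)] F unfolding invariant_under_def by blast
    moreover have "unorm p U (uminus_seq (A F) (ultra_op T F)) < \<epsilon>"
      using T(2) by (simp add: uminus_seq_def unorm_minus_commute[of p "A F"])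
    ultimately show ?thesis by blast
  qed
  then show ?thesis using X AF unfolding closed_usub_def by blast
qed

lemma dual_U_upair:
  assumes pq: "conjugate_exponents p q" and G: "G \<in> UP q"
  shows "dual_U p U (\<lambda>F. upair U F G)"
  unfolding dual_U_def
proof (intro conjI ballI allI impI exI[of _ "unorm q U G"])
  show "upair U F G = upair U F' G" if "F \<in> UP p" "F' \<in> UP p" "ueq p U F F'" for F F'
    by (rule upair_ueq_left[OF pq that(1,2) G that(3)])
  show "upair U (\<lambda>n x. a * F n x + b * F' n x) G = a * upair U F G + b * upair U F' G" if "F \<in> UP p" "F' \<in> UP p" for F F' a b
    by (rule upair_lin_left[OF pq that G])
  show "\<bar>upair U F G\<bar> \<le> unorm q U G * unorm p U F" if "F \<in> UP p" for F
    using upair_bound[OF pq that G] by (simp add: mult.commute)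
qed

lemma in_wot_closure_approx:
  assumes p: "1 \<le> p" and A: "approx_op p U S" and SU: "\<And>F. F \<in> UP p \<Longrightarrow> S F \<in> UP p"
  shows "in_wot_closure p U S"
  unfolding in_wot_closure_def
proof (intro allI impI)
  fix P :: "(useq \<times> (useq \<Rightarrow> real)) set" and \<epsilon> :: real
  assume P: "finite P" "\<forall>(F, \<Phi>)\<in>P. F \<in> UP p \<and> dual_U p U \<Phi>" and \<epsilon>: "0 < \<epsilon>"
  have "\<forall>pr\<in>P. \<exists>C. \<forall>F\<in>UP p. \<bar>snd pr F\<bar> \<le> C * unorm p U F"
  proof
    fix pr assume "pr \<in> P"
    then have "dual_U p U (snd pr)" using P(2) by (cases pr) auto
    then show "\<exists>C. \<forall>F\<in>UP p. \<bar>snd pr F\<bar> \<le> C * unorm p U F" unfolding dual_U_def by (elim conjE)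
  qed
  then obtain C where C: "\<forall>pr\<in>P. \<forall>F\<in>UP p. \<bar>snd pr F\<bar> \<le> C pr * unorm p U F" by (rule bchoice[THEN exE])
  define K where "K = (\<Sum>pr\<in>P. \<bar>C pr\<bar>) + 1"
  have K: "0 < K" unfolding K_def by (intro add_nonneg_pos sum_nonneg) auto
  have CK: "C pr \<le> K" if "pr \<in> P" for pr
    using member_le_sum[OF that, of "\<lambda>pr. \<bar>C pr\<bar>"] P(1) by (simp add: K_def)
  have f: "finite (fst ` P)" "fst ` P \<subseteq> UP p" "0 < \<epsilon> / K" using P \<epsilon> K by auto
  then obtain T where T: "bop_Lp p T" "\<forall>F\<in>fst ` P. unorm p U (\<lambda>n x. ultra_op T F n x - S F n x) < \<epsilon> / K"
    using A unfolding approx_op_def by blast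
  have "\<bar>\<Phi> (S F) - \<Phi> (ultra_op T F)\<bar> < \<epsilon>" if pr: "(F, \<Phi>) \<in> P" for F \<Phi>
  proof -
    have FU: "F \<in> UP p" and \<Phi>: "dual_U p U \<Phi>" using P(2) pr by auto
    note U = SU[OF FU] ultra_op_UP[OF T(1) FU]
    have "\<Phi> (\<lambda>n x. 1 * S F n x + (-1) * ultra_op T F n x) = 1 * \<Phi> (S F) + (-1) * \<Phi> (ultra_op T F)"
      using \<Phi> U unfolding dual_U_def by blast
    then have "\<bar>\<Phi> (S F) - \<Phi> (ultra_op T F)\<bar> = \<bar>\<Phi> (\<lambda>n x. S F n x - ultra_op T F n x)\<bar>" by simp
    also have "\<dots> \<le> C (F, \<Phi>) * unorm p U (\<lambda>n x. S F n x - ultra_op T F n x)"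
      using C pr UP_diff[OF U p] by fastforce
    also have "\<dots> \<le> K * unorm p U (\<lambda>n x. S F n x - ultra_op T F n x)"
      using CK[OF pr] unorm_nonneg[OF UP_diff[OF U p]] by (rule mult_right_mono)
    also have "\<dots> < K * (\<epsilon> / K)"
      using T(2) pr K by (intro mult_strict_left_mono) (force simp: unorm_minus_commute[of p "S F"])+
    finally show ?thesis using K by simp
  qed
  then show "\<exists>T. bop_Lp p T \<and> (\<forall>(F, \<Phi>)\<in>P. \<bar>\<Phi> (S F) - \<Phi> (ultra_op T F)\<bar> < \<epsilon>)" using T(1) by blast
qed

text \<open>The neighbourhood of \<open>S\<close> given by the single vector \<open>F\<close> and
  the pairing with \<open>G\<close>, of radius \<open>|upair U (S F) G|\<close>, would contain an
  ultrapower. That ultrapower sends \<open>F\<close> into the annihilator, which contradicts a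
  positive radius.\<close>

lemma wot_closure_annih_invariant:
  assumes pq: "conjugate_exponents p q" and S: "in_wot_closure p U S" and SU: "\<And>F. F \<in> UP p \<Longrightarrow> S F \<in> UP p"
    and V: "V \<subseteq> UP q" and inv: "\<And>T F. bop_Lp p T \<Longrightarrow> F \<in> annih p U V \<Longrightarrow> ultra_op T F \<in> annih p U V"
  shows "invariant_under S (annih p U V)"
  unfolding invariant_under_def
proof
  fix F assume F: "F \<in> annih p U V"
  then have FU: "F \<in> UP p" by (simp add: annih_def)
  have "upair U (S F) G = 0" if G: "G \<in> V" for G
  proof (rule ccontr)
    assume nz: "upair U (S F) G \<noteq> 0"
    have GU: "G \<in> UP q" using G V by blast
    let ?P = "{(F, \<lambda>F. upair U F G)}"
    have fP: "finite ?P" and dP: "\<forall>(F, \<Phi>)\<in>?P. F \<in> UP p \<and> dual_U p U \<Phi>"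
      using FU dual_U_upair[OF pq GU] by auto
    from S have "finite ?P \<longrightarrow> (\<forall>(F, \<Phi>)\<in>?P. F \<in> UP p \<and> dual_U p U \<Phi>) \<longrightarrow>
        (\<forall>\<epsilon>>0. \<exists>T. bop_Lp p T \<and> (\<forall>(F, \<Phi>)\<in>?P. \<bar>\<Phi> (S F) - \<Phi> (ultra_op T F)\<bar> < \<epsilon>))"
      unfolding in_wot_closure_def by (rule spec)
    from this[THEN mp, OF fP, THEN mp, OF dP]
    have "\<exists>T. bop_Lp p T \<and> (\<forall>(F, \<Phi>)\<in>?P. \<bar>\<Phi> (S F) - \<Phi> (ultra_op T F)\<bar> < \<bar>upair U (S F) G\<bar>)"
      using nz by simp
    then obtain T where T: "bop_Lp p T" "\<bar>upair U (S F) G - upair U (ultra_op T F) G\<bar> < \<bar>upair U (S F) G\<bar>"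
      by auto
    then show False using annihD[OF inv[OF T(1) F] G] by simp
  qed
  then show "S F \<in> annih p U V" using SU[OF FU] by (simp add: annih_def)
qed

lemma ueq_refl: "F \<in> UP p \<Longrightarrow> 1 \<le> p \<Longrightarrow> ueq p U F F"
  by (simp add: ueq_iff unorm_const)

lemma const_LpC:
  assumes f: "f \<in> Lp p" and p: "1 \<le> p"
  shows "(\<lambda>n. f) \<in> LpC p U"
  unfolding LpC_def
proof (intro CollectI conjI)
  show "(\<lambda>n. f) \<in> UP p" by (rule UP_const[OF f])
  show "\<exists>g\<in>Lp p. ueq p U (\<lambda>n. f) (\<lambda>n. g)" by (intro bexI[where x = f] ueq_refl UP_const f p)
qed

lemma uzero_subset_closed:
  assumes X: "closed_usub p U X" and p: "1 \<le> p"
  shows "uzero p U \<subseteq> X"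
proof
  fix F assume "F \<in> uzero p U"
  then have "F \<in> UP p" "unorm p U F = 0" using p uzero_iff by auto
  then have "eqv p U F (\<lambda>n x. 0)" using p by (simp add: eqv_def UP_zero)
  then show "F \<in> X" using closed_usub_eqv[OF X p closed_usubD(2)[OF X] eqv_sym] by blast
qed

lemma Lhat_inter_LpC:
  assumes pq: "conjugate_exponents p q" and F: "F \<in> Lhat p U" "F \<in> LpC p U"
  shows "unorm p U F = 0"
proof (rule ccontr)
  assume "unorm p U F \<noteq> 0"
  then obtain G where "G \<in> Lhat q U" "upair U F G \<noteq> 0" using Lhat_separation[OF pq F(1)] by blast
  then show False using F(2) unfolding LpC_annih[OF pq] by (simp add: annih_def)
qed

end

text \<open>What the two ranges of \<open>p\<close> have in common. \<open>rank_one_\<G>\<close> and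
  \<open>rank_one_M\<close> supply operators, \<open>M_invariant\<close> together with the
  annihilator form supplies obstructions, and the last two assumptions keep M strictly between zero
  and the weakly null part; from these the classification is formal.\<close>

locale invariant_setting = ultra +
  fixes p q :: real and \<G> :: "useq set"
  assumes pq: "conjugate_exponents p q"
    and \<G>_Lhat: "\<G> \<subseteq> Lhat q U"
    and \<G>_ne: "(\<lambda>n x. 0) \<in> \<G>"
    and \<G>_lin: "\<And>G G' a b. G \<in> \<G> \<Longrightarrow> G' \<in> \<G> \<Longrightarrow> (\<lambda>n x. a * G n x + b * G' n x) \<in> \<G>"
    and rank_one_\<G>: "\<And>G H. G \<in> \<G> \<Longrightarrow> H \<in> Lhat p U \<Longrightarrow> approx_op p U (rank_one U G H)"
    and rank_one_M: "\<And>G H. G \<in> Lhat q U \<Longrightarrow> H \<in> Mspace p U \<G> \<Longrightarrow> approx_op p U (rank_one U G H)"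
    and M_invariant: "\<And>T F. bop_Lp p T \<Longrightarrow> F \<in> Mspace p U \<G> \<Longrightarrow> ultra_op T F \<in> Mspace p U \<G>"
    and M_complemented: "\<exists>N. closed_usub p U N \<and> N \<subseteq> Lhat p U \<and> Mspace p U \<G> \<inter> N = uzero p U \<and>
          subspace_sum p U (Mspace p U \<G>) N = Lhat p U"
    and M_nonzero: "\<exists>F\<in>Mspace p U \<G>. unorm p U F \<noteq> 0"
    and M_proper: "\<exists>F\<in>Lhat p U. F \<notin> Mspace p U \<G>"
begin

abbreviation "M \<equiv> Mspace p U \<G>"

lemma p_ge_1: "1 \<le> p" and p_gt_1: "1 < p"
  using conjugate_exponentsD(1)[OF pq] by auto

lemmas qp = conjugate_exponents_sym[OF pq]

lemma \<G>_UP: "G \<in> \<G> \<Longrightarrow> G \<in> UP q"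
  using \<G>_Lhat Lhat_UP by blast

text \<open>Adding the constant sequences to \<open>\<G>\<close> encodes weak nullity, so M too is a
  plain annihilator.\<close>

lemma M_annih: "M = annih p U (\<G> \<union> (\<lambda>g n. g) ` Lp q)"
  unfolding Mspace_def Lhat_annih[OF pq] annih_def by auto

lemma M_annih_UP: "\<G> \<union> (\<lambda>g n. g) ` Lp q \<subseteq> UP q"
  using \<G>_UP UP_const by auto

lemma closed_M: "closed_usub p U M"
  unfolding M_annih by (rule closed_usub_annih[OF pq M_annih_UP])

lemma closed_Lhat: "closed_usub p U (Lhat p U)"
  unfolding Lhat_annih[OF pq] by (rule closed_usub_annih[OF pq]) (auto intro: UP_const)

lemma closed_LpC: "closed_usub p U (LpC p U)"
  unfolding LpC_annih[OF pq] by (rule closed_usub_annih[OF pq]) (auto intro: Lhat_UP)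

lemma closed_annih_\<G>: "closed_usub p U (annih p U \<G>)"
  by (rule closed_usub_annih[OF pq]) (auto intro: \<G>_UP)

lemma M_Lhat: "M \<subseteq> Lhat p U"
  by (auto simp: Mspace_def)

abbreviation hat :: "useq \<Rightarrow> useq" where "hat F \<equiv> \<lambda>n x. F n x - wlim p U F x"

lemma upair_hat: "F \<in> UP p \<Longrightarrow> G \<in> Lhat q U \<Longrightarrow> upair U (hat F) G = upair U F G"
  by (rule wlim_decomposition[OF pq])

text \<open>\<open>\<G>\<close> consists of weakly null sequences and does not see weak limits;
  annihilating it is therefore a condition on the weakly null part alone, namely membership in
  M.\<close>

lemma annih_\<G>_eq: "subspace_sum p U (LpC p U) M = annih p U \<G>"
proof (intro equalityI subsetI)
  fix F assume "F \<in> subspace_sum p U (LpC p U) M"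
  then obtain G H where GH: "G \<in> LpC p U" "H \<in> M" "F \<in> UP p" "ueq p U F (\<lambda>n x. G n x + H n x)"
    by (auto simp: subspace_sum_def)
  have U: "G \<in> UP p" "H \<in> UP p" using GH(1,2) closed_usubD(1)[OF closed_LpC] closed_usubD(1)[OF closed_M] by auto
  have "upair U F K = 0" if K: "K \<in> \<G>" for K
  proof -
    have "upair U F K = upair U (\<lambda>n x. G n x + H n x) K"
      by (rule upair_ueq_left[OF pq GH(3) UP_add[OF U p_ge_1] \<G>_UP[OF K] GH(4)])
    also have "\<dots> = upair U G K + upair U H K" by (rule upair_add_left[OF pq U \<G>_UP[OF K]])
    also have "upair U G K = 0" using GH(1) K \<G>_Lhat unfolding LpC_annih[OF pq] annih_def by blast
    also have "upair U H K = 0" using GH(2) K by (simp add: Mspace_def)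
    finally show ?thesis by simp
  qed
  then show "F \<in> annih p U \<G>" using GH(3) by (simp add: annih_def)
next
  fix F assume F: "F \<in> annih p U \<G>"
  then have FU: "F \<in> UP p" by (simp add: annih_def)
  have "upair U (hat F) G = 0" if "G \<in> \<G>" for G
    using upair_hat[OF FU, of G] that \<G>_Lhat annihD[OF F that] by auto
  then have h: "hat F \<in> M" using hat_Lhat[OF pq FU] by (simp add: Mspace_def)
  have w: "(\<lambda>n. wlim p U F) \<in> LpC p U" by (rule const_LpC[OF wlim_Lp[OF pq FU] p_ge_1])
  have "ueq p U F (\<lambda>n x. wlim p U F x + (F n x - wlim p U F x))"
    using FU p_ge_1 by (simp add: ueq_iff unorm_const)
  then show "F \<in> subspace_sum p U (LpC p U) M" by (rule subspace_sumI[OF FU w h])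
qed

text \<open>Each \<open>F\<close> of the finite family is split into its weak limit, a combination
  of finitely many \<open>hat j\<close>, and a remainder \<open>m F\<close> in M. On each layer
  \<open>biorthogonal_family\<close> gives a finite sum of rank one operators that reproduces
  \<open>S\<close>: constant functionals may hit constants, functionals in \<open>\<G>\<close> any
  weakly null target, and arbitrary weakly null functionals any target in M. The three invariance
  assumptions put the images under \<open>S\<close> into exactly these targets.\<close>

lemma approximation_of_invariant:
  assumes S: "bop_U p U S" and SL: "invariant_under S (LpC p U)" and SH: "invariant_under S (Lhat p U)" and SM: "invariant_under S M"
  shows "approx_op p U S"
  unfolding approx_op_def
proof (intro allI impI)
  fix \<F> :: "useq set" and \<epsilon> :: real assume fin: "finite \<F>" and \<F>: "\<F> \<subseteq> UP p" and \<epsilon>: "0 < \<epsilon>"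
  note p = p_ge_1 and SU = bop_UD(1)[OF S p_ge_1]
  have FU: "F \<in> UP p" if "F \<in> \<F>" for F using \<F> that by blast
  have cU: "(\<lambda>n. wlim p U F) \<in> UP p" and cL: "wlim p U F \<in> Lp p" if "F \<in> \<F>" for F
    using wlim_Lp[OF pq FU[OF that]] UP_const by auto
  have hL: "hat F \<in> Lhat p U" and hU: "hat F \<in> UP p" if "F \<in> \<F>" for F
    using hat_Lhat[OF pq FU[OF that]] Lhat_UP by auto


  \<comment> \<open>First layer: the values of constant functionals on the family, extended by 0
    outside \<open>\<F>\<close> so that linearity in the functional holds at every point.\<close>
  define w1 where "w1 g F = (if F \<in> \<F> then upair U F (\<lambda>n. g) else 0)" for g F
  have q0: "0 \<le> q" "1 \<le> q" using conjugate_exponentsD(2)[OF pq] by auto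
  have "\<exists>J \<omega>. J \<subseteq> \<F> \<and> (\<forall>j\<in>J. \<omega> j \<in> w1 ` Lp q) \<and> (\<forall>i\<in>J. \<forall>j\<in>J. \<omega> j i = (if i = j then 1 else 0)) \<and>
           (\<forall>w\<in>w1 ` Lp q. \<forall>i\<in>\<F>. w i = (\<Sum>j\<in>J. \<omega> j i * w j))"
  proof (rule biorthogonal_family[OF fin])
    have "w1 (\<lambda>x. 0) = (\<lambda>i. 0)" by (auto simp: w1_def fun_eq_iff upair_commute[of U _ "\<lambda>n x. 0"] upair_zero_left)
    moreover have "(\<lambda>x. 0) \<in> Lp q" using q0 by simp
    ultimately show "(\<lambda>i. 0) \<in> w1 ` Lp q" by (rule image_eqI[OF sym])
    fix w w' a b assume "w \<in> w1 ` Lp q" "w' \<in> w1 ` Lp q"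
    then obtain g g' where g: "g \<in> Lp q" "g' \<in> Lp q" "w = w1 g" "w' = w1 g'" by blast
    have "w1 (\<lambda>x. a * g x + b * g' x) = (\<lambda>i. a * w i + b * w' i)"
      unfolding g(3,4) w1_def using upair_lin_right[OF pq FU UP_const[OF g(1)] UP_const[OF g(2)]] by (auto simp: fun_eq_iff)
    from image_eqI[where f = w1, OF this[symmetric] Lp_lin[OF g(1,2) q0(1)]]
    show "(\<lambda>i. a * w i + b * w' i) \<in> w1 ` Lp q" .
  qed
  then obtain J1 \<omega>1 where J1: "J1 \<subseteq> \<F>" "\<forall>j\<in>J1. \<omega>1 j \<in> w1 ` Lp q"
    "\<forall>w\<in>w1 ` Lp q. \<forall>i\<in>\<F>. w i = (\<Sum>j\<in>J1. \<omega>1 j i * w j)" by blast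
  have fin1: "finite J1" using J1(1) fin finite_subset by blast
  have "\<forall>j\<in>J1. \<exists>g. g \<in> Lp q \<and> \<omega>1 j = w1 g" using J1(2) by blast
  then obtain g where g: "\<forall>j\<in>J1. g j \<in> Lp q \<and> \<omega>1 j = w1 (g j)" by (rule bchoice[THEN exE])
  \<comment> \<open>Invariance of L^p makes the images of constants equal, in the ultrapower, to
    constants, as required by \<open>approx_rank_one_const\<close>.\<close>
  have "\<forall>j\<in>J1. \<exists>s. s \<in> Lp p \<and> eqv p U (S (\<lambda>n. wlim p U j)) (\<lambda>n. s)"
  proof
    fix j assume j: "j \<in> J1"
    then have j': "j \<in> \<F>" using J1(1) by blast
    have "(\<lambda>n. wlim p U j) \<in> LpC p U" by (rule const_LpC[OF cL[OF j'] p])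
    then have "S (\<lambda>n. wlim p U j) \<in> LpC p U" using SL unfolding invariant_under_def by blast
    then show "\<exists>s. s \<in> Lp p \<and> eqv p U (S (\<lambda>n. wlim p U j)) (\<lambda>n. s)" using p UP_const by (auto simp: LpC_def eqv_ueq)
  qed
  then obtain \<sigma> where \<sigma>: "\<forall>j\<in>J1. \<sigma> j \<in> Lp p \<and> eqv p U (S (\<lambda>n. wlim p U j)) (\<lambda>n. \<sigma> j)" by (rule bchoice[THEN exE])
  define A1 where "A1 F = (\<lambda>n x. \<Sum>j\<in>J1. rank_one U (\<lambda>n. g j) (\<lambda>n. \<sigma> j) F n x)" for F
  have A1: "approx_op p U A1" unfolding A1_def[abs_def]
    using g \<sigma> p by (intro approx_op_sum fin1 approx_rank_one_const[OF pq] rank_one_UP UP_const) auto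
  have A1U: "A1 F \<in> UP p" for F unfolding A1_def using \<sigma> p by (intro UP_sum rank_one_UP UP_const) auto
  have A1F: "eqv p U (A1 F) (S (\<lambda>n. wlim p U F))" if F: "F \<in> \<F>" for F
  proof -
    let ?w = "\<lambda>n x. \<Sum>j\<in>J1. \<omega>1 j F * wlim p U j x"
    have sL: "(\<lambda>x. \<Sum>j\<in>J1. \<omega>1 j F * wlim p U j x) \<in> Lp p" using cL J1(1) p by (intro Lp_sum Lp_scale) auto
    have "lpnorm p (\<lambda>x. wlim p U F x - (\<Sum>j\<in>J1. \<omega>1 j F * wlim p U j x)) = 0"
    proof (rule lpnorm_wlim_unique[OF pq FU[OF F] sL])
      fix h assume h: "h \<in> Lp q"
      have "upair U F (\<lambda>n. h) = w1 h F" using F by (simp add: w1_def)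
      also have "\<dots> = (\<Sum>j\<in>J1. \<omega>1 j F * w1 h j)" using J1(3) h F by blast
      also have "\<dots> = (\<Sum>j\<in>J1. \<omega>1 j F * upair U j (\<lambda>n. h))" using J1(1) by (intro sum.cong) (auto simp: w1_def)
      also have "\<dots> = (\<Sum>j\<in>J1. \<omega>1 j F * upair U (\<lambda>n. wlim p U j) (\<lambda>n. h))"
        using J1(1) wlim_upair[OF pq FU h] by (intro sum.cong) auto
      also have "\<dots> = upair U ?w (\<lambda>n. h)"
        using J1(1) cU by (intro upair_sum_left[OF pq _ UP_const[OF h], symmetric]) auto
      finally show "upair U F (\<lambda>n. h) = (LINT x|M01. (\<Sum>j\<in>J1. \<omega>1 j F * wlim p U j x) * h x)" by (simp add: upair_const)
    qed
    then have "eqv p U (\<lambda>n. wlim p U F) ?w" using cU[OF F] UP_const[OF sL] by (simp add: eqv_def unorm_const)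
    then have 1: "eqv p U (S (\<lambda>n. wlim p U F)) (S ?w)" by (rule bop_UD(2)[OF S p])
    have 2: "eqv p U (S ?w) (\<lambda>n x. \<Sum>j\<in>J1. \<omega>1 j F * S (\<lambda>n. wlim p U j) n x)"
      using J1(1) cU by (intro bop_U_sum[OF S p _ fin1]) auto
    have 3: "eqv p U (\<lambda>n x. \<Sum>j\<in>J1. \<omega>1 j F * S (\<lambda>n. wlim p U j) n x) (\<lambda>n x. \<Sum>j\<in>J1. \<omega>1 j F * \<sigma> j x)"
      using \<sigma> by (intro eqv_sum[OF p _ fin1]) auto
    have "A1 F = (\<lambda>n x. \<Sum>j\<in>J1. \<omega>1 j F * \<sigma> j x)"
      unfolding A1_def rank_one_def using g F by (intro ext sum.cong) (auto simp: w1_def)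
    then show ?thesis using eqv_sym[OF eqv_trans[OF p eqv_trans[OF p 1 2] 3]] by simp
  qed

  \<comment> \<open>Second layer: the values of functionals in \<open>\<G>\<close> on the weakly
    null parts. Modulo M, each \<open>hat F\<close> is a combination of the \<open>hat j\<close>
    with \<open>j\<close> in \<open>J2\<close>.\<close>
  define w2 where "w2 G F = (if F \<in> \<F> then upair U (hat F) G else 0)" for G F
  have "\<exists>J \<omega>. J \<subseteq> \<F> \<and> (\<forall>j\<in>J. \<omega> j \<in> w2 ` \<G>) \<and> (\<forall>i\<in>J. \<forall>j\<in>J. \<omega> j i = (if i = j then 1 else 0)) \<and>
           (\<forall>w\<in>w2 ` \<G>. \<forall>i\<in>\<F>. w i = (\<Sum>j\<in>J. \<omega> j i * w j))"
  proof (rule biorthogonal_family[OF fin])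
    have "w2 (\<lambda>n x. 0) = (\<lambda>i. 0)" by (auto simp: w2_def fun_eq_iff upair_commute[of U _ "\<lambda>n x. 0"] upair_zero_left)
    from this[symmetric] \<G>_ne show "(\<lambda>i. 0) \<in> w2 ` \<G>" by (rule image_eqI)
    fix w w' a b assume "w \<in> w2 ` \<G>" "w' \<in> w2 ` \<G>"
    then obtain K K' where K: "K \<in> \<G>" "K' \<in> \<G>" "w = w2 K" "w' = w2 K'" by blast
    have "w2 (\<lambda>n x. a * K n x + b * K' n x) = (\<lambda>i. a * w i + b * w' i)"
      unfolding K(3,4) w2_def using upair_lin_right[OF pq hU \<G>_UP[OF K(1)] \<G>_UP[OF K(2)]] by (auto simp: fun_eq_iff)
    from image_eqI[where f = w2, OF this[symmetric] \<G>_lin[OF K(1,2)]]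
    show "(\<lambda>i. a * w i + b * w' i) \<in> w2 ` \<G>" .
  qed
  then obtain J2 \<omega>2 where J2: "J2 \<subseteq> \<F>" "\<forall>j\<in>J2. \<omega>2 j \<in> w2 ` \<G>"
    "\<forall>w\<in>w2 ` \<G>. \<forall>i\<in>\<F>. w i = (\<Sum>j\<in>J2. \<omega>2 j i * w j)" by blast
  have fin2: "finite J2" using J2(1) fin finite_subset by blast
  have "\<forall>j\<in>J2. \<exists>K. K \<in> \<G> \<and> \<omega>2 j = w2 K" using J2(2) by blast
  then obtain K where K: "\<forall>j\<in>J2. K j \<in> \<G> \<and> \<omega>2 j = w2 (K j)" by (rule bchoice[THEN exE])
  define A2 where "A2 F = (\<lambda>n x. \<Sum>j\<in>J2. rank_one U (K j) (S (hat j)) F n x)" for F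
  have ShL: "S (hat j) \<in> Lhat p U" if "j \<in> \<F>" for j using SH hL[OF that] unfolding invariant_under_def by blast
  have A2: "approx_op p U A2" unfolding A2_def[abs_def]
    using K J2(1) ShL p by (intro approx_op_sum fin2 rank_one_\<G> rank_one_UP) (auto intro: Lhat_UP)
  have A2U: "A2 F \<in> UP p" for F unfolding A2_def using ShL J2(1) p by (intro UP_sum rank_one_UP) (auto intro: Lhat_UP)
  have A2F: "A2 F = (\<lambda>n x. \<Sum>j\<in>J2. \<omega>2 j F * S (hat j) n x)" if F: "F \<in> \<F>" for F
    unfolding A2_def rank_one_def using K F upair_hat[OF FU[OF F]] \<G>_Lhat
    by (intro ext sum.cong) (auto simp: w2_def)

  \<comment> \<open>What the second layer leaves over. Every functional in \<open>\<G>\<close>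
    vanishes on it, so it lies in M.\<close>
  define m where "m F = (\<lambda>n x. hat F n x - (\<Sum>j\<in>J2. \<omega>2 j F * hat j n x))" for F
  have sU: "(\<lambda>n x. \<Sum>j\<in>J2. \<omega>2 j F * hat j n x) \<in> UP p" for F using J2(1) hU p by (intro UP_sum UP_scale) auto
  have mU: "m F \<in> UP p" if "F \<in> \<F>" for F unfolding m_def by (intro UP_diff hU that sU p)
  have upm: "upair U (m F) G = upair U (hat F) G - (\<Sum>j\<in>J2. \<omega>2 j F * upair U (hat j) G)" if F: "F \<in> \<F>" and G: "G \<in> UP q" for F G
    unfolding m_def using upair_diff_left[OF pq hU[OF F] sU G] upair_sum_left[OF pq _ G, of J2 hat "\<lambda>j. \<omega>2 j F"] J2(1) hU by auto
  have mM: "m F \<in> M" if F: "F \<in> \<F>" for F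
  proof -
    have "upair U (m F) G = 0" if G: "G \<in> \<G>" for G
    proof -
      have "w2 G F = (\<Sum>j\<in>J2. \<omega>2 j F * w2 G j)" using J2(3) G F by blast
      also have "\<dots> = (\<Sum>j\<in>J2. \<omega>2 j F * upair U (hat j) G)" using J2(1) by (intro sum.cong) (auto simp: w2_def)
      finally show ?thesis using upm[OF F \<G>_UP[OF G]] F by (simp add: w2_def)
    qed
    moreover have "upair U (m F) (\<lambda>n. h) = 0" if h: "h \<in> Lp q" for h
      using upm[OF F UP_const[OF h]] Lhat_const(1)[OF pq hL h] F J2(1) by (simp add: subset_iff)
    ultimately show ?thesis using mU[OF F] unfolding M_annih annih_def by auto
  qed

  define w3 where "w3 G F = (if F \<in> \<F> then upair U (m F) G else 0)" for G F
  have "\<exists>J \<omega>. J \<subseteq> \<F> \<and> (\<forall>j\<in>J. \<omega> j \<in> w3 ` Lhat q U) \<and> (\<forall>i\<in>J. \<forall>j\<in>J. \<omega> j i = (if i = j then 1 else 0)) \<and>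
           (\<forall>w\<in>w3 ` Lhat q U. \<forall>i\<in>\<F>. w i = (\<Sum>j\<in>J. \<omega> j i * w j))"
  proof (rule biorthogonal_family[OF fin])
    have "w3 (\<lambda>n x. 0) = (\<lambda>i. 0)" by (auto simp: w3_def fun_eq_iff upair_commute[of U _ "\<lambda>n x. 0"] upair_zero_left)
    from this[symmetric] subsetD[OF \<G>_Lhat \<G>_ne] show "(\<lambda>i. 0) \<in> w3 ` Lhat q U" by (rule image_eqI)
    fix w w' a b assume "w \<in> w3 ` Lhat q U" "w' \<in> w3 ` Lhat q U"
    then obtain G G' where G: "G \<in> Lhat q U" "G' \<in> Lhat q U" "w = w3 G" "w' = w3 G'" by blast
    have "w3 (\<lambda>n x. a * G n x + b * G' n x) = (\<lambda>i. a * w i + b * w' i)"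
      unfolding G(3,4) w3_def using upair_lin_right[OF pq mU Lhat_UP[OF G(1)] Lhat_UP[OF G(2)]] by (auto simp: fun_eq_iff)
    from image_eqI[where f = w3, OF this[symmetric] Lhat_lin[OF qp G(1,2)]]
    show "(\<lambda>i. a * w i + b * w' i) \<in> w3 ` Lhat q U" .
  qed
  then obtain J3 \<omega>3 where J3: "J3 \<subseteq> \<F>" "\<forall>j\<in>J3. \<omega>3 j \<in> w3 ` Lhat q U"
    "\<forall>w\<in>w3 ` Lhat q U. \<forall>i\<in>\<F>. w i = (\<Sum>j\<in>J3. \<omega>3 j i * w j)" by blast
  have fin3: "finite J3" using J3(1) fin finite_subset by blast
  have "\<forall>j\<in>J3. \<exists>\<Gamma>. \<Gamma> \<in> Lhat q U \<and> \<omega>3 j = w3 \<Gamma>" using J3(2) by blast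
  then obtain \<Gamma> where \<Gamma>: "\<forall>j\<in>J3. \<Gamma> j \<in> Lhat q U \<and> \<omega>3 j = w3 (\<Gamma> j)" by (rule bchoice[THEN exE])
  \<comment> \<open>\<open>\<Gamma> k\<close> is adapted to the vectors \<open>m F\<close> only.
    Subtracting \<open>\<Delta> k\<close>, its composition with the second-layer projection, gives a
    functional whose value on \<open>F\<close> is that of \<open>\<Gamma> k\<close> on
    \<open>m F\<close>, so the layers do not interfere.\<close>
  define \<Delta> where "\<Delta> k = (\<lambda>n x. \<Sum>j\<in>J2. upair U (hat j) (\<Gamma> k) * K j n x)" for k
  have \<Delta>U: "\<Delta> k \<in> UP q" for k unfolding \<Delta>_def using K q0 by (intro UP_sum UP_scale) (auto intro: \<G>_UP)
  have up\<Delta>: "upair U F (\<Delta> k) = (\<Sum>j\<in>J2. upair U (hat j) (\<Gamma> k) * upair U F (K j))" if "F \<in> UP p" for F k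
    unfolding \<Delta>_def using K by (intro upair_sum_right[OF pq _ that]) (auto intro: \<G>_UP)
  have \<Delta>L: "\<Delta> k \<in> Lhat q U" for k
    unfolding Lhat_iff[OF qp] using \<Delta>U up\<Delta>[OF UP_const] K \<G>_Lhat Lhat_const(2)[OF qp]
    by (auto simp: upair_commute[of U "\<Delta> k"] intro!: sum.neutral)
  define \<Gamma>' where "\<Gamma>' k = (\<lambda>n x. 1 * \<Gamma> k n x + (-1) * \<Delta> k n x)" for k
  have \<Gamma>'L: "\<Gamma>' k \<in> Lhat q U" if "k \<in> J3" for k unfolding \<Gamma>'_def using \<Gamma> that by (intro Lhat_lin[OF qp] \<Delta>L) auto
  have up\<Gamma>': "upair U F (\<Gamma>' k) = \<omega>3 k F" if F: "F \<in> \<F>" and k: "k \<in> J3" for F k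
  proof -
    have \<Gamma>L: "\<Gamma> k \<in> Lhat q U" using \<Gamma> k by blast
    have "upair U F (\<Gamma>' k) = upair U (hat F) (\<Gamma>' k)" using upair_hat[OF FU[OF F] \<Gamma>'L[OF k]] by simp
    also have "\<dots> = upair U (hat F) (\<Gamma> k) - upair U (hat F) (\<Delta> k)"
      unfolding \<Gamma>'_def using upair_lin_right[OF pq hU[OF F] Lhat_UP[OF \<Gamma>L] \<Delta>U, of 1 "-1" k] by simp
    also have "upair U (hat F) (\<Delta> k) = (\<Sum>j\<in>J2. \<omega>2 j F * upair U (hat j) (\<Gamma> k))"
      unfolding up\<Delta>[OF hU[OF F]] using K F by (intro sum.cong) (auto simp: w2_def mult.commute)
    also have "upair U (hat F) (\<Gamma> k) - \<dots> = upair U (m F) (\<Gamma> k)" using upm[OF F Lhat_UP[OF \<Gamma>L]] by simp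
    also have "\<dots> = \<omega>3 k F" using \<Gamma> k F by (simp add: w3_def)
    finally show ?thesis .
  qed
  define A3 where "A3 F = (\<lambda>n x. \<Sum>k\<in>J3. rank_one U (\<Gamma>' k) (S (m k)) F n x)" for F
  have SmM: "S (m k) \<in> M" if "k \<in> \<F>" for k using SM mM[OF that] unfolding invariant_under_def by blast
  have SmU: "S (m k) \<in> UP p" if "k \<in> \<F>" for k using SmM[OF that] closed_usubD(1)[OF closed_M] by blast
  have A3: "approx_op p U A3" unfolding A3_def[abs_def]
    using J3(1) SmM SmU \<Gamma>'L p by (intro approx_op_sum fin3 rank_one_M rank_one_UP) auto
  have A3U: "A3 F \<in> UP p" for F unfolding A3_def using SmU J3(1) p by (intro UP_sum rank_one_UP) auto
  have A3F: "eqv p U (A3 F) (S (m F))" if F: "F \<in> \<F>" for F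
  proof -
    let ?s = "\<lambda>n x. \<Sum>k\<in>J3. \<omega>3 k F * m k n x"
    have sU: "?s \<in> UP p" using J3(1) mU p by (intro UP_sum UP_scale) auto
    have "eqv p U (m F) ?s"
    proof -
      have mL: "(\<lambda>n x. 1 * m F n x + (-1) * ?s n x) \<in> Lhat p U"
      proof (rule Lhat_lin[OF pq])
        show "m F \<in> Lhat p U" using mM[OF F] M_Lhat by blast
        show "?s \<in> Lhat p U" unfolding Lhat_iff[OF pq]
        proof (intro conjI ballI sU)
          fix h assume h: "h \<in> Lp q"
          have "upair U ?s (\<lambda>n. h) = (\<Sum>k\<in>J3. \<omega>3 k F * upair U (m k) (\<lambda>n. h))"
            using J3(1) mU by (intro upair_sum_left[OF pq _ UP_const[OF h]]) auto
          also have "\<dots> = 0"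
          proof (intro sum.neutral ballI)
            fix k assume "k \<in> J3"
            then have "m k \<in> Lhat p U" using J3(1) mM M_Lhat by blast
            then show "\<omega>3 k F * upair U (m k) (\<lambda>n. h) = 0" using Lhat_const(1)[OF pq _ h] by simp
          qed
          finally show "upair U ?s (\<lambda>n. h) = 0" .
        qed
      qed
      have "unorm p U (\<lambda>n x. 1 * m F n x + (-1) * ?s n x) = 0"
      proof (rule ccontr)
        assume "unorm p U (\<lambda>n x. 1 * m F n x + (-1) * ?s n x) \<noteq> 0"
        then obtain G where G: "G \<in> Lhat q U" "upair U (\<lambda>n x. 1 * m F n x + (-1) * ?s n x) G \<noteq> 0"
          using Lhat_separation[OF pq mL] by blast
        have "upair U (m F) G = w3 G F" using F by (simp add: w3_def)
        also have "\<dots> = (\<Sum>k\<in>J3. \<omega>3 k F * w3 G k)" using J3(3) G(1) F by blast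
        also have "\<dots> = (\<Sum>k\<in>J3. \<omega>3 k F * upair U (m k) G)" using J3(1) by (intro sum.cong) (auto simp: w3_def)
        also have "\<dots> = upair U ?s G" using J3(1) mU by (intro upair_sum_left[OF pq _ Lhat_UP[OF G(1)], symmetric]) auto
        finally show False using G(2) upair_lin_left[OF pq mU[OF F] sU Lhat_UP[OF G(1)], of 1 "-1"] by simp
      qed
      then show ?thesis using mU[OF F] sU by (simp add: eqv_def)
    qed
    then have 1: "eqv p U (S (m F)) (S ?s)" by (rule bop_UD(2)[OF S p])
    have 2: "eqv p U (S ?s) (\<lambda>n x. \<Sum>k\<in>J3. \<omega>3 k F * S (m k) n x)"
      using J3(1) mU by (intro bop_U_sum[OF S p _ fin3]) auto
    have "A3 F = (\<lambda>n x. \<Sum>k\<in>J3. \<omega>3 k F * S (m k) n x)"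
      unfolding A3_def rank_one_def using up\<Gamma>'[OF F] by (intro ext sum.cong) auto
    then show ?thesis using eqv_sym[OF eqv_trans[OF p 1 2]] by simp
  qed

  define A where "A F = (\<lambda>n x. A1 F n x + (A2 F n x + A3 F n x))" for F
  have A: "approx_op p U A" unfolding A_def[abs_def]
    by (intro approx_op_add[OF p A1] approx_op_add[OF p A2 A3] A1U A2U A3U UP_add p)
  have AU: "A F \<in> UP p" for F unfolding A_def by (intro UP_add A1U A2U A3U p)
  have AF: "eqv p U (A F) (S F)" if F: "F \<in> \<F>" for F
  proof -
    let ?s = "\<lambda>n x. \<Sum>j\<in>J2. \<omega>2 j F * hat j n x"
    have "eqv p U (S ?s) (\<lambda>n x. \<Sum>j\<in>J2. \<omega>2 j F * S (hat j) n x)"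
      using J2(1) hU by (intro bop_U_sum[OF S p _ fin2]) auto
    then have 1: "eqv p U (A2 F) (S ?s)" unfolding A2F[OF F] by (rule eqv_sym)
    have "eqv p U (S (\<lambda>n x. 1 * ?s n x + 1 * m F n x)) (\<lambda>n x. 1 * S ?s n x + 1 * S (m F) n x)"
      by (rule bop_UD(3)[OF S p sU mU[OF F]])
    moreover have "(\<lambda>n x. 1 * ?s n x + 1 * m F n x) = hat F" by (simp add: m_def)
    ultimately have 2: "eqv p U (S (hat F)) (\<lambda>n x. S ?s n x + S (m F) n x)" by simp
    have 3: "eqv p U (\<lambda>n x. A2 F n x + A3 F n x) (S (hat F))"
      by (rule eqv_trans[OF p eqv_add[OF p 1 A3F[OF F]] eqv_sym[OF 2]])
    have "eqv p U (S (\<lambda>n x. 1 * wlim p U F x + 1 * hat F n x)) (\<lambda>n x. 1 * S (\<lambda>n. wlim p U F) n x + 1 * S (hat F) n x)"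
      by (rule bop_UD(3)[OF S p cU[OF F] hU[OF F]])
    then have 4: "eqv p U (S F) (\<lambda>n x. S (\<lambda>n. wlim p U F) n x + S (hat F) n x)" by simp
    show ?thesis unfolding A_def by (rule eqv_trans[OF p eqv_add[OF p A1F[OF F] 3] eqv_sym[OF 4]])
  qed
  obtain T where T: "bop_Lp p T" "\<forall>F\<in>\<F>. unorm p U (\<lambda>n x. ultra_op T F n x - A F n x) < \<epsilon>"
    using A fin \<F> \<epsilon> unfolding approx_op_def by blast
  have "unorm p U (\<lambda>n x. ultra_op T F n x - S F n x) < \<epsilon>" if F: "F \<in> \<F>" for F
    using unorm_diff_trans[OF ultra_op_UP[OF T(1) FU[OF F]] AU SU[OF FU[OF F]] p, of F] AF[OF F] T(2) F
    by (fastforce simp: eqv_def)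
  then show "\<exists>T. bop_Lp p T \<and> (\<forall>F\<in>\<F>. unorm p U (\<lambda>n x. ultra_op T F n x - S F n x) < \<epsilon>)" using T(1) by blast
qed

text \<open>Invariance passes to WOT limits because the three spaces are annihilators; conversely an
  invariant operator is even a strong limit.\<close>

lemma M_char_M: "M_char p U M"
  unfolding M_char_def
proof (intro conjI allI impI closed_M M_Lhat M_complemented)
  fix S assume S: "bop_U p U S"
  note SU = bop_UD(1)[OF S p_ge_1]
  show "in_wot_closure p U S \<longleftrightarrow> invariant_under S (LpC p U) \<and> invariant_under S (Lhat p U) \<and> invariant_under S M"
  proof
    assume W: "in_wot_closure p U S"
    have "invariant_under S (LpC p U)" unfolding LpC_annih[OF pq]
      using LpC_invariant[OF _ p_ge_1] Lhat_UP by (intro wot_closure_annih_invariant[OF pq W SU]) (auto simp: LpC_annih[OF pq])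
    moreover have "invariant_under S (Lhat p U)" unfolding Lhat_annih[OF pq]
      using Lhat_invariant[OF _ p_ge_1] UP_const by (intro wot_closure_annih_invariant[OF pq W SU]) (auto simp: Lhat_annih[OF pq])
    moreover have "invariant_under S M" unfolding M_annih
      using M_invariant M_annih_UP unfolding M_annih by (intro wot_closure_annih_invariant[OF pq W SU]) auto
    ultimately show "invariant_under S (LpC p U) \<and> invariant_under S (Lhat p U) \<and> invariant_under S M" by blast
  next
    assume "invariant_under S (LpC p U) \<and> invariant_under S (Lhat p U) \<and> invariant_under S M"
    then show "in_wot_closure p U S"
      using approximation_of_invariant[OF S] by (intro in_wot_closure_approx[OF p_ge_1 _ SU]) auto
  qed
qed

lemma one_LpC: "(\<lambda>n x. 1) \<in> LpC p U" and one_not_Lhat: "(\<lambda>n x. 1) \<notin> Lhat p U"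
proof -
  have L: "(\<lambda>x. 1) \<in> Lp p" "(\<lambda>x. 1) \<in> Lp q" using p_gt_1 conjugate_exponentsD(2)[OF pq] by auto
  then show "(\<lambda>n x. 1) \<in> LpC p U" using const_LpC[OF L(1) p_ge_1] by simp
  have "upair U (\<lambda>n x. 1) (\<lambda>n x. 1) = 1" using upair_const[of "\<lambda>x. 1" "\<lambda>x. 1"] by simp
  then show "(\<lambda>n x. 1) \<notin> Lhat p U" using Lhat_const(1)[OF pq _ L(2), of "\<lambda>n x. 1"] by auto
qed

lemma closed_scale:
  assumes X: "closed_usub p U X" and c: "c \<noteq> 0" and F: "(\<lambda>n x. c * F n x) \<in> X"
  shows "F \<in> X"
  using closed_usub_lin[OF X F F, of "1 / c" 0] c by simp

text \<open>One vector of \<open>X\<close> with nonzero pairing against an admissible functional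
  forces all admissible targets into \<open>X\<close>. Hence leaving \<open>Lhat\<close> forces L^p
  in, leaving the annihilator of \<open>\<G>\<close> forces all of \<open>Lhat\<close> in, and
  leaving L^p forces M in; combining these inclusions settles every case.\<close>

lemma invariant_cases:
  assumes X: "closed_usub p U X" and inv: "\<And>T. bop_Lp p T \<Longrightarrow> invariant_under (ultra_op T) X"
  shows "X \<in> {uzero p U, UP p, LpC p U, Lhat p U, M, annih p U \<G>}"
proof -
  note p = p_ge_1 and XU = closed_usubD(1)[OF X]
  have rank: "H \<in> X" if "F \<in> X" "approx_op p U (rank_one U G H)" "H \<in> UP p" "upair U F G \<noteq> 0" for F G H
  proof (rule closed_scale[OF X that(4)])
    show "(\<lambda>n x. upair U F G * H n x) \<in> X"
      using closed_usub_approx_op[where A = "rank_one U G H" and F = F, OF X inv p that(2,1) rank_one_UP[OF p that(3)]]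
      by (simp add: rank_one_def)
  qed
  have a: "LpC p U \<subseteq> X" if nx: "\<not> X \<subseteq> Lhat p U"
  proof -
    obtain F where F: "F \<in> X" "F \<notin> Lhat p U" using nx by blast
    then have "F \<in> UP p" using XU by blast
    then obtain g where g: "g \<in> Lp q" "upair U F (\<lambda>n. g) \<noteq> 0" using F(2) Lhat_iff[OF pq, of F] by blast
    have "G \<in> X" if G: "G \<in> LpC p U" for G
    proof -
      obtain h where h: "h \<in> Lp p" "ueq p U G (\<lambda>n. h)" "G \<in> UP p" using G by (auto simp: LpC_def)
      have "(\<lambda>n. h) \<in> X" by (rule rank[OF F(1) approx_rank_one_const[OF pq g(1) h(1)] UP_const[OF h(1)] g(2)])
      moreover have "eqv p U G (\<lambda>n. h)" using eqv_ueq[OF p h(3) UP_const[OF h(1)]] h(2) by blast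
      ultimately show ?thesis using closed_usub_eqv[OF X p _ eqv_sym] by blast
    qed
    then show ?thesis by blast
  qed
  have b: "Lhat p U \<subseteq> X" if nx: "\<not> X \<subseteq> annih p U \<G>"
  proof -
    obtain F where F: "F \<in> X" "F \<notin> annih p U \<G>" using nx by blast
    then obtain G where G: "G \<in> \<G>" "upair U F G \<noteq> 0" using XU unfolding annih_def by blast
    show ?thesis
    proof
      fix H assume H: "H \<in> Lhat p U"
      show "H \<in> X" by (rule rank[OF F(1) rank_one_\<G>[OF G(1) H] Lhat_UP[OF H] G(2)])
    qed
  qed
  have c: "M \<subseteq> X" if nx: "\<not> X \<subseteq> LpC p U"
  proof -
    obtain F where F: "F \<in> X" "F \<notin> LpC p U" using nx by blast
    then obtain G where G: "G \<in> Lhat q U" "upair U F G \<noteq> 0" using XU unfolding LpC_annih[OF pq] annih_def by blast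
    show ?thesis
    proof
      fix H assume H: "H \<in> M"
      have "H \<in> UP p" using H closed_usubD(1)[OF closed_M] by blast
      then show "H \<in> X" by (rule rank[OF F(1) rank_one_M[OF G(1) H] _ G(2)])
    qed
  qed
  have sum: "F \<in> X" if "F \<in> UP p" "LpC p U \<subseteq> X" "hat F \<in> X" for F
  proof -
    note W = wlim_Lp[OF pq that(1)]
    have "(\<lambda>n. wlim p U F) \<in> LpC p U" by (rule const_LpC[OF W p])
    then have "(\<lambda>n. wlim p U F) \<in> X" using that(2) by blast
    from closed_usub_lin[OF X this that(3), of 1 1] show ?thesis by simp
  qed
  have Lh: "Lhat p U \<inter> annih p U \<G> = M" by (auto simp: Mspace_def annih_def intro: Lhat_UP)
  show ?thesis
  proof (cases "X \<subseteq> Lhat p U")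
    case 1: True
    show ?thesis
    proof (cases "X \<subseteq> annih p U \<G>")
      case True
      then have XM: "X \<subseteq> M" using 1 Lh by blast
      show ?thesis
      proof (cases "X \<subseteq> LpC p U")
        case True
        have "X \<subseteq> uzero p U"
        proof
          fix F assume F: "F \<in> X"
          have "unorm p U F = 0" using Lhat_inter_LpC[OF pq, of F] F 1 True by blast
          then show "F \<in> uzero p U" using uzero_iff[OF p, of F] F XU by blast
        qed
        then have "X = uzero p U" using uzero_subset_closed[OF X p] by blast
        then show ?thesis by simp
      next
        case False
        then show ?thesis using c XM by auto
      qed
    next
      case False
      then show ?thesis using b 1 by auto
    qed
  next
    case 1: False
    note L = a[OF 1]
    show ?thesis
    proof (cases "X \<subseteq> annih p U \<G>")
      case 2: True
      show ?thesis
      proof (cases "X \<subseteq> LpC p U")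
        case True then show ?thesis using L by auto
      next
        case False
        have "annih p U \<G> \<subseteq> X"
        proof
          fix F assume F: "F \<in> annih p U \<G>"
          then have FU: "F \<in> UP p" by (simp add: annih_def)
          have "upair U (hat F) G = 0" if "G \<in> \<G>" for G
            using upair_hat[OF FU, of G] that \<G>_Lhat annihD[OF F that] by auto
          then have "hat F \<in> M" using hat_Lhat[OF pq FU] by (simp add: Mspace_def)
          then show "F \<in> X" using sum[OF FU L] c[OF False] by blast
        qed
        then show ?thesis using 2 by auto
      qed
    next
      case False
      have "UP p \<subseteq> X" using sum[OF _ L] hat_Lhat[OF pq] b[OF False] by blast
      then show ?thesis using XU by auto
    qed
  qed
qed

lemma invariant_spaces:
  assumes "X \<in> {LpC p U, Lhat p U, M, annih p U \<G>}" and T: "bop_Lp p T"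
  shows "invariant_under (ultra_op T) X"
proof -
  have "ultra_op T F \<in> annih p U \<G>" if F: "F \<in> annih p U \<G>" for F
  proof -
    have FU: "F \<in> UP p" using F by (simp add: annih_def)
    note W = wlim_Lp[OF pq FU] and hU = Lhat_UP[OF hat_Lhat[OF pq FU]]
    have "upair U (hat F) G = 0" if "G \<in> \<G>" for G
      using upair_hat[OF FU, of G] that \<G>_Lhat annihD[OF F that] by auto
    then have "hat F \<in> M" using hat_Lhat[OF pq FU] by (simp add: Mspace_def)
    then have 1: "ultra_op T (hat F) \<in> M" by (rule M_invariant[OF T])
    have 2: "ultra_op T (\<lambda>n. wlim p U F) \<in> LpC p U"
      by (rule LpC_invariant[OF T p_ge_1 const_LpC[OF W p_ge_1]])
    have "eqv p U (ultra_op T (\<lambda>n x. 1 * wlim p U F x + 1 * hat F n x)) (\<lambda>n x. 1 * ultra_op T (\<lambda>n. wlim p U F) n x + 1 * ultra_op T (hat F) n x)"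
      by (rule bop_UD(3)[OF bop_U_ultra_op[OF T p_ge_1] p_ge_1 UP_const[OF W] hU])
    then have "eqv p U (ultra_op T F) (\<lambda>n x. ultra_op T (\<lambda>n. wlim p U F) n x + ultra_op T (hat F) n x)" by simp
    then have "ueq p U (ultra_op T F) (\<lambda>n x. ultra_op T (\<lambda>n. wlim p U F) n x + ultra_op T (hat F) n x)"
      using p_ge_1 by (auto simp: eqv_def ueq_iff)
    then show ?thesis unfolding annih_\<G>_eq[symmetric] by (rule subspace_sumI[OF ultra_op_UP[OF T FU] 2 1])
  qed
  then show ?thesis using assms(1) LpC_invariant[OF T p_ge_1] Lhat_invariant[OF T p_ge_1] M_invariant[OF T]
    unfolding invariant_under_def by auto
qed

text \<open>Three witnesses suffice: the constant 1, a nonnull \<open>u\<close> in M, and a weakly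
  null \<open>v\<close> outside M.\<close>

lemma distinct_spaces:
  shows "LpC p U \<noteq> Lhat p U" "LpC p U \<noteq> M" "LpC p U \<noteq> annih p U \<G>" "Lhat p U \<noteq> M" "Lhat p U \<noteq> annih p U \<G>" "M \<noteq> annih p U \<G>"
    and "uzero p U \<notin> {LpC p U, Lhat p U, M, annih p U \<G>}" "UP p \<notin> {LpC p U, Lhat p U, M, annih p U \<G>}"
proof -
  obtain u where u: "u \<in> M" "unorm p U u \<noteq> 0" using M_nonzero by blast
  obtain v where v: "v \<in> Lhat p U" "v \<notin> M" using M_proper by blast
  let ?o = "\<lambda>n x. 1 :: real"
  have oA: "?o \<in> annih p U \<G>" using one_LpC \<G>_Lhat unfolding LpC_annih[OF pq] annih_def by blast
  have oM: "?o \<notin> M" using one_not_Lhat M_Lhat by blast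
  have uA: "u \<in> annih p U \<G>" using u(1) closed_usubD(1)[OF closed_M] by (auto simp: annih_def Mspace_def)
  have uL: "u \<in> Lhat p U" using u(1) M_Lhat by blast
  have uC: "u \<notin> LpC p U" using Lhat_inter_LpC[OF pq uL] u(2) by blast
  have vA: "v \<notin> annih p U \<G>" using v by (auto simp: annih_def Mspace_def)
  have oU: "?o \<in> UP p" using one_LpC closed_usubD(1)[OF closed_LpC] by blast
  have uU: "u \<in> UP p" "v \<in> UP p" using uL v(1) Lhat_UP by auto
  show "LpC p U \<noteq> Lhat p U" using one_LpC one_not_Lhat by blast
  show "LpC p U \<noteq> M" using one_LpC oM by blast
  show "LpC p U \<noteq> annih p U \<G>" using uA uC by blast
  show "Lhat p U \<noteq> M" using v by blast
  show "Lhat p U \<noteq> annih p U \<G>" using v vA by blast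
  show "M \<noteq> annih p U \<G>" using oA oM by blast
  have o0: "?o \<notin> uzero p U"
  proof
    assume "?o \<in> uzero p U"
    then have "unorm p U ?o = 0" using p_ge_1 uzero_iff by blast
    moreover have "unorm p U ?o = 1" using unorm_const[of p "\<lambda>x. 1"] by simp
    ultimately show False by simp
  qed
  have u0: "u \<notin> uzero p U" using u(2) p_ge_1 uzero_iff by blast
  show "uzero p U \<notin> {LpC p U, Lhat p U, M, annih p U \<G>}" using one_LpC oA o0 u(1) uL u0 by blast
  show "UP p \<notin> {LpC p U, Lhat p U, M, annih p U \<G>}" using oU uU uC one_not_Lhat oM vA by blast
qed

theorem inv_subspaces_eq:
  "inv_subspaces p U = {LpC p U, Lhat p U, M, subspace_sum p U (LpC p U) M}" (is "?I = ?S")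
  and card_inv_subspaces: "card (inv_subspaces p U) = 4"
proof -
  have S: "?S = {LpC p U, Lhat p U, M, annih p U \<G>}" by (simp add: annih_\<G>_eq)
  show I: "?I = ?S"
  proof (intro equalityI subsetI)
    fix X assume "X \<in> ?I"
    then have X: "closed_usub p U X" "X \<noteq> uzero p U" "X \<noteq> UP p" "\<And>T. bop_Lp p T \<Longrightarrow> invariant_under (ultra_op T) X"
      unfolding inv_subspaces_def by blast+
    show "X \<in> ?S" using invariant_cases[OF X(1,4)] X(2,3) unfolding S by blast
  next
    fix X assume X: "X \<in> ?S"
    then have "closed_usub p U X" using closed_LpC closed_Lhat closed_M closed_annih_\<G> unfolding S by blast
    moreover have "X \<noteq> uzero p U" "X \<noteq> UP p" using X distinct_spaces(7,8) unfolding S by blast+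
    moreover have "\<forall>T. bop_Lp p T \<longrightarrow> invariant_under (ultra_op T) X" using invariant_spaces X unfolding S by blast
    ultimately show "X \<in> ?I" unfolding inv_subspaces_def by blast
  qed
  show "card ?I = 4" unfolding I S using distinct_spaces(1-6) by simp
qed

text \<open>Ultrapowers lie in their own closure, so \<open>M'\<close> is invariant, and being
  inside \<open>Lhat\<close> it can only be zero, \<open>Lhat\<close> or M. In the first two cases a
  rank one operator that sends \<open>u\<close> in M to a nonzero multiple of \<open>v\<close>
  outside M would meet the criterion for \<open>M'\<close> and violate the one for M.\<close>

theorem M_char_unique:
  assumes M': "M_char p U M'"
  shows "M' = M"
proof -
  have c: "closed_usub p U M'" and sub: "M' \<subseteq> Lhat p U"
    and iff: "\<And>S. bop_U p U S \<Longrightarrow> in_wot_closure p U S \<longleftrightarrow>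
      invariant_under S (LpC p U) \<and> invariant_under S (Lhat p U) \<and> invariant_under S M'"
    using M' unfolding M_char_def by blast+
  have inv: "invariant_under (ultra_op T) M'" if T: "bop_Lp p T" for T
  proof -
    have "in_wot_closure p U (ultra_op T)" unfolding in_wot_closure_def using T by fastforce
    then show ?thesis using iff[OF bop_U_ultra_op[OF T p_ge_1]] by blast
  qed
  have oA: "(\<lambda>n x. 1) \<in> annih p U \<G>" using one_LpC \<G>_Lhat unfolding LpC_annih[OF pq] annih_def by blast
  have oU: "(\<lambda>n x. 1) \<in> UP p" using one_LpC closed_usubD(1)[OF closed_LpC] by blast
  have cases: "M' = uzero p U \<or> M' = Lhat p U \<or> M' = M"
    using invariant_cases[OF c inv] sub one_LpC one_not_Lhat oA oU by blast
  have False if E: "M' = uzero p U \<or> M' = Lhat p U"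
  proof -
    obtain u where u: "u \<in> M" "unorm p U u \<noteq> 0" using M_nonzero by blast
    obtain v where v: "v \<in> Lhat p U" "v \<notin> M" using M_proper by blast
    note vU = Lhat_UP[OF v(1)]
    obtain G where G: "G \<in> Lhat q U" "upair U u G \<noteq> 0"
      using Lhat_separation[OF pq _ u(2)] u(1) M_Lhat by blast
    note GU = Lhat_UP[OF G(1)]
    let ?S = "rank_one U G v"
    have SU: "?S F \<in> UP p" for F by (rule rank_one_UP[OF p_ge_1 vU])
    have S: "bop_U p U ?S" unfolding bop_U_def
    proof (intro conjI ballI allI impI exI[of _ "unorm q U G * unorm p U v"])
      show "?S F \<in> UP p" for F by (rule SU)
      show "ueq p U (?S F) (?S F')" if "F \<in> UP p" "F' \<in> UP p" "ueq p U F F'" for F F'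
        using upair_ueq_left[OF pq that(1,2) GU that(3)] ueq_refl[OF SU p_ge_1, of F'] by (simp add: rank_one_def)
      show "ueq p U (?S (\<lambda>n x. a * F n x + b * F' n x)) (\<lambda>n x. a * ?S F n x + b * ?S F' n x)" if "F \<in> UP p" "F' \<in> UP p" for F F' a b
      proof -
        have "?S (\<lambda>n x. a * F n x + b * F' n x) = (\<lambda>n x. a * ?S F n x + b * ?S F' n x)"
          unfolding rank_one_def upair_lin_left[OF pq that GU] by (simp add: algebra_simps)
        note e = this
        from ueq_refl[OF SU p_ge_1, of "\<lambda>n x. a * F n x + b * F' n x"] show ?thesis unfolding e .
      qed
      show "unorm p U (?S F) \<le> unorm q U G * unorm p U v * unorm p U F" if "F \<in> UP p" for F
        unfolding rank_one_def unorm_scale[OF vU p_ge_1]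
        using mult_right_mono[OF upair_bound[OF pq that GU] unorm_nonneg[OF vU]] by (simp add: mult_ac)
    qed
    have z: "?S F \<in> X" if "closed_usub p U X" "upair U F G = 0" for F X
      using closed_usubD(2)[OF that(1)] that(2) by (simp add: rank_one_def)
    have "invariant_under ?S (LpC p U)" unfolding invariant_under_def
      using z[OF closed_LpC] G(1) LpC_annih[OF pq] annihD by blast
    moreover have H: "invariant_under ?S (Lhat p U)" unfolding invariant_under_def rank_one_def
      using closed_usub_lin[OF closed_Lhat v(1) v(1), of _ 0] by simp
    moreover have "invariant_under ?S M'"
    proof (cases "M' = Lhat p U")
      case True then show ?thesis using H by simp
    next
      case False
      then have Z: "M' = uzero p U" using E by blast
      have "upair U F G = 0" if "F \<in> M'" for F
        using that p_ge_1 upair_null_left[OF pq _ GU] unfolding Z by (simp add: uzero_iff)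
      then show ?thesis unfolding invariant_under_def using z[OF c] by blast
    qed
    ultimately have "in_wot_closure p U ?S" using iff[OF S] by blast
    then have "invariant_under ?S M" using M_char_M S unfolding M_char_def by blast
    then have "?S u \<in> M" using u(1) unfolding invariant_under_def by blast
    then have "v \<in> M" unfolding rank_one_def using closed_scale[OF closed_M G(2)] by blast
    then show False using v(2) by blast
  qed
  then show ?thesis using cases by blast
qed

end

section \<open>The two cases\<close>

lemma conjugate_2_2: "conjugate_exponents 2 2"
  by (simp add: conjugate_exponents_def)

lemma conjugate_lt_2: "conjugate_exponents p q \<Longrightarrow> 2 < p \<Longrightarrow> q < 2"
  and conjugate_gt_2: "conjugate_exponents p q \<Longrightarrow> p < 2 \<Longrightarrow> 2 < q"
proof -
  have *: "(p - 1) * (q - 1) = 1" if "conjugate_exponents p q"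
    using conjugate_exponentsD(3)[OF that] by (simp add: algebra_simps)
  show "q < 2" if "conjugate_exponents p q" "2 < p"
  proof (rule ccontr)
    assume "\<not> q < 2"
    then have "1 * (q - 1) < (p - 1) * (q - 1)" using that(2) by (intro mult_strict_right_mono) auto
    then show False using *[OF that(1)] \<open>\<not> q < 2\<close> by simp
  qed
  show "2 < q" if "conjugate_exponents p q" "p < 2"
  proof (rule ccontr)
    assume "\<not> 2 < q"
    moreover have "1 < q" using conjugate_exponentsD(2)[OF that(1)] .
    ultimately have "(p - 1) * (q - 1) < 1 * (q - 1)" using that(2) by (intro mult_strict_right_mono) auto
    then show False using *[OF that(1)] \<open>\<not> 2 < q\<close> by simp
  qed
qed

lemma integral_M01_cos:
  assumes "0 < (k :: nat)"
  shows "(LINT x|M01. cos (real k * pi * x)) = 0"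
proof -
  have "(LINT x|M01. cos (real k * pi * x)) = (LINT x|lborel. cos (real k * pi * x) * indicator {0..1} x)"
    unfolding M01_def by (subst integral_restrict_space) (auto simp: mult.commute)
  also have "\<dots> = sin (real k * pi * 1) / (real k * pi) - sin (real k * pi * 0) / (real k * pi)"
    by (rule integral_FTC_Icc_real) (use assms in \<open>auto intro!: derivative_eq_intros continuous_intros simp: field_simps\<close>)
  also have "\<dots> = 0" using sin_npi[of k] by simp
  finally show ?thesis .
qed

text \<open>Product-to-sum formulas reduce everything to integrals of single cosines, which vanish
  at positive frequencies.\<close>

lemma cos_separated:
  fixes n m :: nat
  assumes nm: "0 < n" "n < m"
  shows "(LINT x|M01. (cos (real n * pi * x) - cos (real m * pi * x))\<^sup>2) = 1"
proof -
  have int: "integrable M01 (\<lambda>x. cos (real k * pi * x))" for k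
    by (rule M01.integrable_const_bound[where B = 1]) (auto intro!: measurable_M01_borel)
  have e: "(cos (real n * pi * x) - cos (real m * pi * x))\<^sup>2 =
    1 + cos (real (2 * n) * pi * x) / 2 + cos (real (2 * m) * pi * x) / 2 - cos (real (m - n) * pi * x) - cos (real (m + n) * pi * x)" for x
  proof -
    define a where "a = real n * pi * x"
    define b where "b = real m * pi * x"
    have r: "real (2 * n) * pi * x = 2 * a" "real (2 * m) * pi * x = 2 * b" "real (m - n) * pi * x = b - a" "real (m + n) * pi * x = b + a"
      using nm by (auto simp: a_def b_def of_nat_diff algebra_simps)
    have "(cos a - cos b)\<^sup>2 = (cos a)\<^sup>2 + (cos b)\<^sup>2 - 2 * (cos a * cos b)" by (simp add: power2_eq_square algebra_simps)
    moreover have "cos (2 * a) = 2 * (cos a)\<^sup>2 - 1" "cos (2 * b) = 2 * (cos b)\<^sup>2 - 1" by (rule cos_double_cos)+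
    moreover have "cos (b - a) + cos (b + a) = 2 * (cos a * cos b)" by (simp add: cos_add cos_diff)
    ultimately have "(cos a - cos b)\<^sup>2 = 1 + cos (2 * a) / 2 + cos (2 * b) / 2 - cos (b - a) - cos (b + a)" by linarith
    then show ?thesis unfolding r a_def[symmetric] b_def[symmetric] .
  qed
  have z: "(LINT x|M01. cos (real k * pi * x)) = 0" if "0 < k" for k using integral_M01_cos[OF that] .
  have "(LINT x|M01. (cos (real n * pi * x) - cos (real m * pi * x))\<^sup>2) =
    (LINT x|M01. 1 + cos (real (2 * n) * pi * x) / 2 + cos (real (2 * m) * pi * x) / 2 - cos (real (m - n) * pi * x) - cos (real (m + n) * pi * x))"
    by (simp only: e)
  also have "\<dots> = 1 + (LINT x|M01. cos (real (2 * n) * pi * x)) / 2 + (LINT x|M01. cos (real (2 * m) * pi * x)) / 2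
      - (LINT x|M01. cos (real (m - n) * pi * x)) - (LINT x|M01. cos (real (m + n) * pi * x))"
    using int[of "2 * n"] int[of "2 * m"] int[of "m - n"] int[of "m + n"] by simp
  also have "\<dots> = 1" using z[of "2 * n"] z[of "2 * m"] z[of "m - n"] z[of "m + n"] nm by simp
  finally show ?thesis .
qed

section \<open>The two complementary parts of the weakly null sequences\<close>

context ultra
begin

text \<open>Testing on the signs of \<open>F n\<close> turns the pairing into the L^1 norm. In this
  form closedness is immediate.\<close>

lemma L1null_annih:
  assumes pq: "conjugate_exponents p q"
  shows "L1null p U = annih p U {H. (\<forall>n. H n \<in> borel_measurable M01) \<and> (\<forall>n x. \<bar>H n x\<bar> \<le> 1)}"
proof (intro equalityI subsetI)
  note pq' = conjugate_exponentsD(1,2)[OF pq]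
  fix F assume F: "F \<in> L1null p U"
  have "upair U F H = 0" if "\<And>n. H n \<in> borel_measurable M01" "\<And>n x. \<bar>H n x\<bar> \<le> 1" for H
    by (rule L1null_upair_bounded[OF pq'(1) F that(1)]) (rule that(2))
  then show "F \<in> annih p U {H. (\<forall>n. H n \<in> borel_measurable M01) \<and> (\<forall>n x. \<bar>H n x\<bar> \<le> 1)}"
    using L1null_UP[OF F] by (simp add: annih_def)
next
  note pq' = conjugate_exponentsD(1,2)[OF pq]
  fix F assume F: "F \<in> annih p U {H. (\<forall>n. H n \<in> borel_measurable M01) \<and> (\<forall>n x. \<bar>H n x\<bar> \<le> 1)}"
  then have FU: "F \<in> UP p" by (simp add: annih_def)
  let ?H = "\<lambda>n x. sgn (F n x)"
  have m: "?H n \<in> borel_measurable M01" for n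
    using Lp_measurable[OF UP_Lp[OF FU, of n]] by simp
  have b: "\<bar>?H n x\<bar> \<le> 1" for n x by (simp add: abs_sgn_eq)
  have HU: "?H \<in> UP q" by (rule UP_uniformly_bounded[where K = 1, OF m]) (use b pq' in auto)
  have "upair U F ?H = 0" by (rule annihD[OF F]) (use m b in simp)
  moreover have "F n x * ?H n x = \<bar>F n x\<bar>" for n x by (simp add: sgn_if)
  ultimately have "((\<lambda>n. LINT x|M01. \<bar>F n x\<bar>) \<longlongrightarrow> 0) U" using pairing_tendsto[OF pq FU HU] by simp
  then show "F \<in> L1null p U" using FU by (simp add: L1null_def)
qed

lemma closed_L1null:
  assumes pq: "conjugate_exponents p q"
  shows "closed_usub p U (L1null p U)"
proof -
  have "H \<in> UP q" if "\<forall>n. H n \<in> borel_measurable M01" "\<forall>n x. \<bar>H n x\<bar> \<le> 1" for H :: useq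
    using that conjugate_exponentsD(2)[OF pq] by (intro UP_uniformly_bounded[where K = 1]) auto
  then show ?thesis unfolding L1null_annih[OF pq] by (intro closed_usub_annih[OF pq]) auto
qed

lemma Mspace_L1null_UP: "F \<in> Mspace p U (L1null q U) \<Longrightarrow> F \<in> annih p U (L1null q U)"
  by (auto simp: Mspace_def annih_def intro: Lhat_UP)

lemma closed_Mspace_L1null:
  assumes pq: "conjugate_exponents p q"
  shows "closed_usub p U (Mspace p U (L1null q U))"
proof -
  have "Mspace p U (L1null q U) = annih p U (L1null q U \<union> (\<lambda>g n. g) ` Lp q)"
    unfolding Mspace_def Lhat_annih[OF pq] annih_def by auto
  moreover have "L1null q U \<union> (\<lambda>g n. g) ` Lp q \<subseteq> UP q" using L1null_UP UP_const by blast
  ultimately show ?thesis using closed_usub_annih[OF pq, of "L1null q U \<union> (\<lambda>g n. g) ` Lp q"] by simp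
qed

lemma L1null_inter_Mspace:
  assumes pq: "conjugate_exponents p q"
  shows "L1null p U \<inter> Mspace p U (L1null q U) = uzero p U"
proof (intro equalityI subsetI)
  have p: "1 \<le> p" using conjugate_exponentsD(1)[OF pq] by simp
  fix F assume F: "F \<in> L1null p U \<inter> Mspace p U (L1null q U)"
  then have "unorm p U F = 0" by (intro L1null_self_dual[OF pq]) (auto simp: Mspace_def)
  then show "F \<in> uzero p U" using F p L1null_UP by (simp add: uzero_iff)
next
  have p: "1 \<le> p" using conjugate_exponentsD(1)[OF pq] by simp
  fix F assume "F \<in> uzero p U"
  then show "F \<in> L1null p U \<inter> Mspace p U (L1null q U)"
    using uzero_subset_closed[OF closed_L1null[OF pq] p] uzero_subset_closed[OF closed_Mspace_L1null[OF pq] p] by blast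
qed

text \<open>The nontrivial inclusion is the subsequence splitting: the \<open>L1null\<close> part of
  a weakly null sequence is weakly null, hence so is the rest.\<close>

lemma L1null_plus_Mspace:
  assumes pq: "conjugate_exponents p q"
  shows "subspace_sum p U (L1null p U) (Mspace p U (L1null q U)) = Lhat p U" (is "?A = _")
    and "subspace_sum p U (Mspace p U (L1null q U)) (L1null p U) = Lhat p U" (is "?B = _")
proof -
  have p: "1 \<le> p" using conjugate_exponentsD(1)[OF pq] by simp
  have BA: "?B = ?A" by (rule subspace_sum_commute)
  show "?A = Lhat p U"
  proof (intro equalityI subsetI)
    fix F assume "F \<in> ?A"
    then obtain G H where GH: "F \<in> UP p" "G \<in> L1null p U" "H \<in> Mspace p U (L1null q U)" "ueq p U F (\<lambda>n x. G n x + H n x)"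
      unfolding subspace_sum_def by blast
    have L: "G \<in> Lhat p U" "H \<in> Lhat p U" using L1null_Lhat[OF pq GH(2)] GH(3) by (auto simp: Mspace_def)
    have s: "(\<lambda>n x. G n x + H n x) \<in> Lhat p U" using Lhat_lin[OF pq L, of 1 1] by simp
    have "eqv p U F (\<lambda>n x. G n x + H n x)" using GH(1,4) Lhat_UP[OF s] p eqv_ueq by blast
    moreover have "closed_usub p U (Lhat p U)"
      unfolding Lhat_annih[OF pq] by (rule closed_usub_annih[OF pq]) (auto intro: UP_const)
    ultimately show "F \<in> Lhat p U" using closed_usub_eqv[OF _ p s eqv_sym] by blast
  next
    fix F assume F: "F \<in> Lhat p U"
    note FU = Lhat_UP[OF F]
    obtain d e where de: "d \<in> L1null p U" "e \<in> annih p U (L1null q U)" "\<And>n x. F n x = d n x + e n x"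
      using L1null_decomposition[OF pq FU] by metis
    have "e = (\<lambda>n x. 1 * F n x + (-1) * d n x)" using de(3) by (simp add: fun_eq_iff)
    then have "e \<in> Lhat p U" using Lhat_lin[OF pq F L1null_Lhat[OF pq de(1)], of 1 "-1"] by simp
    then have "e \<in> Mspace p U (L1null q U)" using de(2) by (simp add: Mspace_def annih_def)
    moreover have "F = (\<lambda>n x. d n x + e n x)" using de(3) by (simp add: fun_eq_iff)
    then have "ueq p U F (\<lambda>n x. d n x + e n x)" using eqv_refl[OF FU] eqv_ueq[OF p FU FU] by metis
    ultimately show "F \<in> ?A" using subspace_sumI[OF FU de(1)] by blast
  qed
  then show "?B = Lhat p U" using BA by simp
qed

lemma L1null_nonzero:
  assumes pq: "conjugate_exponents p q"
  shows "\<exists>F\<in>L1null p U. unorm p U F \<noteq> 0"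
proof -
  have p: "1 < p" using conjugate_exponentsD(1)[OF pq] .
  \<comment> \<open>Indicators of shrinking intervals, normalised in L^p; their L^1 norms are
    \<open>real (Suc n) powr (1 / p - 1)\<close> and tend to zero.\<close>
  define c where "c n = real (Suc n) powr (1 / p)" for n
  define E where "E n = {0..1 / real (Suc n)}" for n
  define F where "F n x = c n * indicator (E n) x" for n x
  have E01: "E n \<subseteq> {0..1}" for n by (auto simp: E_def field_simps)
  have E: "E n \<in> sets M01" for n
    unfolding M01_def using E01[of n] by (subst sets_restrict_space_iff) (auto simp: E_def)
  have mE: "measure M01 (E n) = 1 / real (Suc n)" for n
    unfolding M01_def using E01[of n] by (subst measure_restrict_space) (auto simp: E_def)
  have c0: "0 < c n" "c n powr p = real (Suc n)" for n using p by (auto simp: c_def powr_powr)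
  have FL: "F n \<in> Lp p" for n unfolding F_def using p by (intro Lp_scale indicator_Lp E) simp
  have n1: "lpnorm p (F n) = 1" for n
  proof -
    have "lpnorm p (F n) = c n * (1 / real (Suc n)) powr (1 / p)"
      unfolding F_def using p c0(1)[of n] E by (simp add: lpnorm_scale lpnorm_indicator mE)
    also have "\<dots> = 1" by (simp add: c_def powr_divide)
    finally show ?thesis .
  qed
  have FU: "F \<in> UP p" using FL n1 by (intro UPI[where C = 1]) auto
  have "(LINT x|M01. \<bar>F n x\<bar>) = real (Suc n) powr (1 / p - 1)" for n
  proof -
    have "(LINT x|M01. \<bar>F n x\<bar>) = (LINT x|M01. c n * indicator (E n) x)"
      using c0[of n] by (intro Bochner_Integration.integral_cong) (auto simp: F_def abs_mult)
    also have "\<dots> = c n * measure M01 (E n)" using E01[of n] E by (simp add: Int_absorb2)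
    also have "\<dots> = real (Suc n) powr (1 / p - 1)" by (simp add: mE c_def powr_diff)
    finally show ?thesis .
  qed
  moreover have "(\<lambda>n. real (Suc n) powr (1 / p - 1)) \<longlonglongrightarrow> 0"
  proof (rule tendsto_neg_powr)
    show "1 / p - 1 < 0" using p by simp
    show "filterlim (\<lambda>n. real (Suc n)) at_top sequentially"
      by (rule filterlim_compose[OF filterlim_real_sequentially filterlim_Suc])
  qed
  ultimately have "((\<lambda>n. LINT x|M01. \<bar>F n x\<bar>) \<longlongrightarrow> 0) U" by (simp add: sequentially_tendsto)
  then have "F \<in> L1null p U" using FU by (simp add: L1null_def)
  moreover have "unorm p U F = 1" unfolding unorm_def n1 by (rule LimI) simp
  ultimately show ?thesis by force
qed

text \<open>Cosines are uniformly bounded and hence annihilate \<open>L1null\<close> sequences; so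
  do their differences with the weak limit \<open>w\<close>. They do not converge in norm, since any
  two of distinct positive frequencies are at a fixed L^2 distance.\<close>

lemma Mspace_L1null_nonzero:
  assumes pq: "conjugate_exponents p q"
  shows "\<exists>F\<in>Mspace p U (L1null q U). unorm p U F \<noteq> 0"
proof -
  note qp = conjugate_exponents_sym[OF pq]
  have p: "1 < p" "1 \<le> p" "0 < p" using conjugate_exponentsD(1)[OF pq] by auto
  define H where "H n x = cos (real n * pi * x)" for n :: nat and x
  have Hm: "H n \<in> borel_measurable M01" for n
    unfolding H_def by (rule measurable_M01_borel) measurable
  have Hb: "\<bar>H n x\<bar> \<le> 1" for n x by (simp add: H_def)
  have HU: "H \<in> UP p" by (rule UP_uniformly_bounded[where K = 1, OF Hm]) (use Hb p in auto)
  define w where "w = wlim p U H"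
  have w: "w \<in> Lp p" unfolding w_def by (rule wlim_Lp[OF pq HU])
  let ?F = "\<lambda>n x. H n x - w x"
  have FL: "?F \<in> Lhat p U" unfolding w_def by (rule hat_Lhat[OF pq HU])
  have "upair U ?F G = 0" if G: "G \<in> L1null q U" for G
  proof -
    have "upair U G H = 0"
      by (rule L1null_upair_bounded[OF conjugate_exponentsD(2)[OF pq] G Hm]) (rule Hb)
    then show ?thesis
      using upair_diff_left[OF pq HU UP_const[OF w] L1null_UP[OF G]] Lhat_const(2)[OF qp L1null_Lhat[OF qp G] w]
      by (simp add: upair_commute[of U H])
  qed
  then have "?F \<in> Mspace p U (L1null q U)" using FL by (simp add: Mspace_def)
  moreover have "unorm p U ?F \<noteq> 0"
  proof
    assume "unorm p U ?F = 0"
    then have "((\<lambda>n. lpnorm p (?F n)) \<longlongrightarrow> 0) U" using unorm_tendsto[OF Lhat_UP[OF FL]] by simp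
    \<comment> \<open>Two such indices give an L^p distance below 1/4. The difference is at most 2
      in modulus, so its squared L^2 norm would be below 1/2, against the value 1 from
      \<open>cos_separated\<close>.\<close>
    then have ev: "\<forall>\<^sub>F n in U. lpnorm p (?F n) < 1 / 8" by (rule order_tendstoD) simp
    obtain n where n: "lpnorm p (?F n) < 1 / 8" "0 < n"
      using eventually_ex[OF eventually_conj[OF ev U_gt[of 0]]] by blast
    obtain m where m: "lpnorm p (?F m) < 1 / 8" "n < m"
      using eventually_ex[OF eventually_conj[OF ev U_gt[of n]]] by blast
    have HL: "H k \<in> Lp p" for k by (rule UP_Lp[OF HU])
    have D: "(\<lambda>x. H n x - H m x) \<in> Lp p" using HL p by (intro Lp_diff) auto
    have "lpnorm p (\<lambda>x. H n x - H m x) \<le> lpnorm p (\<lambda>x. H n x - w x) + lpnorm p (\<lambda>x. w x - H m x)"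
      by (rule lpnorm_diff_trans[OF HL w HL p(2)])
    also have "\<dots> < 1 / 4" using n(1) m(1) by (simp add: lpnorm_minus_commute[of p w])
    finally have 1: "(LINT x|M01. \<bar>H n x - H m x\<bar>) < 1 / 4" using Lp_integrable(2)[OF D p(1)] by simp
    have "1 = (LINT x|M01. (H n x - H m x)\<^sup>2)" unfolding H_def using cos_separated[OF n(2) m(2)] by simp
    also have "\<dots> \<le> (LINT x|M01. 2 * \<bar>H n x - H m x\<bar>)"
    proof (rule integral_mono)
      show "integrable M01 (\<lambda>x. 2 * \<bar>H n x - H m x\<bar>)" using Lp_integrable(1)[OF D p(1)] by simp
      have b: "\<bar>H n x - H m x\<bar> \<le> 2" for x using Hb[of n x] Hb[of m x] by linarith
      have sq: "(H n x - H m x)\<^sup>2 = \<bar>H n x - H m x\<bar> * \<bar>H n x - H m x\<bar>" for x by (simp add: power2_eq_square)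
      show "(H n x - H m x)\<^sup>2 \<le> 2 * \<bar>H n x - H m x\<bar>" for x
        unfolding sq using b[of x] by (intro mult_right_mono) auto
      show "integrable M01 (\<lambda>x. (H n x - H m x)\<^sup>2)"
      proof (rule M01.integrable_const_bound[where B = 4])
        show "AE x in M01. norm ((H n x - H m x)\<^sup>2) \<le> 4"
        proof (rule AE_I2)
          fix x
          have "\<bar>H n x - H m x\<bar> * \<bar>H n x - H m x\<bar> \<le> 2 * 2" using b[of x] by (intro mult_mono) auto
          then show "norm ((H n x - H m x)\<^sup>2) \<le> 4" by (simp add: sq)
        qed
        show "(\<lambda>x. (H n x - H m x)\<^sup>2) \<in> borel_measurable M01" using Hm by measurable
      qed
    qed
    also have "\<dots> < 1" using 1 by simp
    finally show False by simp
  qed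
  ultimately show ?thesis by blast
qed

lemma Lhat_2_subset:
  assumes pq: "conjugate_exponents p q" and p: "2 < p"
  shows "Lhat 2 U \<subseteq> Lhat q U"
proof
  fix G assume G: "G \<in> Lhat 2 U"
  have q: "1 < q" "q \<le> 2" using conjugate_exponentsD(2)[OF pq] conjugate_lt_2[OF pq p] by auto
  show "G \<in> Lhat q U"
    unfolding Lhat_iff[OF conjugate_exponents_sym[OF pq]]
  proof (intro conjI ballI)
    show "G \<in> UP q" by (rule UP_exponent_mono[OF Lhat_UP[OF G] q])
    fix f assume "f \<in> Lp p"
    then have "f \<in> Lp 2" using p Lp_exponent_mono(1)[of f p 2] by simp
    then show "upair U G (\<lambda>n. f) = 0" by (rule Lhat_const(1)[OF conjugate_2_2 G])
  qed
qed

text \<open>The exponent 2 lies strictly below \<open>p\<close>, so \<open>L1null_powr\<close>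
  applies; conversely the L^1 norm is at most the L^2 norm.\<close>

lemma L1null_iff_L2:
  assumes p: "2 < p" and F: "F \<in> UP p"
  shows "F \<in> L1null p U \<longleftrightarrow> ((\<lambda>n. lpnorm 2 (F n)) \<longlongrightarrow> 0) U"
proof
  assume "F \<in> L1null p U"
  then have "((\<lambda>n. LINT x|M01. \<bar>F n x\<bar> powr 2) \<longlongrightarrow> 0) U" using p by (intro L1null_powr[of p]) auto
  then have "((\<lambda>n. (LINT x|M01. \<bar>F n x\<bar> powr 2) powr (1 / 2)) \<longlongrightarrow> 0) U"
    by (intro tendsto_zero_powrI[where b = "1/2"]) auto
  then show "((\<lambda>n. lpnorm 2 (F n)) \<longlongrightarrow> 0) U" by (simp add: lpnorm_def)
next
  assume lim: "((\<lambda>n. lpnorm 2 (F n)) \<longlongrightarrow> 0) U"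
  have L2: "F n \<in> Lp 2" for n using p by (intro Lp_exponent_mono(1)[OF UP_Lp[OF F]]) auto
  have b: "norm (LINT x|M01. \<bar>F n x\<bar>) \<le> lpnorm 2 (F n)" for n using Lp_integrable(2)[OF L2] by simp
  show "F \<in> L1null p U" unfolding L1null_def
    using F Lim_null_comparison[OF always_eventually[OF allI[OF b]] lim] by simp
qed

text \<open>Bounded sequences minus their L^2 weak limits belong to \<open>Lhat 2 U\<close>, and a
  weakly null \<open>F\<close> does not see the limits; so \<open>F\<close> annihilates all bounded
  sequences, as in \<open>L1null_annih\<close>. In the other direction \<open>F\<close> is null in
  the L^2 ultrapower.\<close>

lemma Mspace_Lhat_2:
  assumes pq: "conjugate_exponents p q" and p: "2 < p"
  shows "Mspace p U (Lhat 2 U) = L1null p U"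
proof (intro equalityI subsetI)
  have q: "1 < q" "q \<le> 2" using conjugate_exponentsD(2)[OF pq] conjugate_lt_2[OF pq p] by auto
  fix F assume F: "F \<in> Mspace p U (Lhat 2 U)"
  then have FL: "F \<in> Lhat p U" by (simp add: Mspace_def)
  note FU = Lhat_UP[OF FL]
  show "F \<in> L1null p U" unfolding L1null_annih[OF pq] annih_def
  proof (intro CollectI conjI ballI FU)
    fix H :: useq assume H: "H \<in> {H. (\<forall>n. H n \<in> borel_measurable M01) \<and> (\<forall>n x. \<bar>H n x\<bar> \<le> 1)}"
    have H2: "H \<in> UP 2" using H by (intro UP_uniformly_bounded[where K = 1]) auto
    have Hq: "H \<in> UP q" by (rule UP_exponent_mono[OF H2 q])
    note W = wlim_Lp[OF conjugate_2_2 H2]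
    have Wq: "wlim 2 U H \<in> Lp q" by (rule Lp_exponent_mono(1)[OF W q])
    have "upair U F (\<lambda>n x. H n x - wlim 2 U H x) = 0"
      using F hat_Lhat[OF conjugate_2_2 H2] by (simp add: Mspace_def)
    then show "upair U F H = 0"
      using upair_diff_right[OF pq FU Hq UP_const[OF Wq]] Lhat_const(1)[OF pq FL Wq] by simp
  qed
next
  fix F assume F: "F \<in> L1null p U"
  note FU = L1null_UP[OF F]
  have F2: "F \<in> UP 2" using p by (intro UP_exponent_mono[OF FU]) auto
  have "unorm 2 U F = 0" unfolding unorm_def by (rule LimI) (use F L1null_iff_L2[OF p FU] in blast)
  then have "upair U F G = 0" if "G \<in> Lhat 2 U" for G
    using upair_null_left[OF conjugate_2_2 F2 Lhat_UP[OF that]] by simp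
  then show "F \<in> Mspace p U (Lhat 2 U)" using L1null_Lhat[OF pq F] by (simp add: Mspace_def)
qed

end

section \<open>Verification of the abstract setting above and below the exponent two\<close>

context selective
begin

lemma approx_rank_one:
  assumes "conjugate_exponents p q" "conjugate_exponents r r'" "G \<in> Lhat q U" "upper_est q r' U G"
    "H \<in> UP p" "upper_est p r U H"
  shows "approx_op p U (rank_one U G H)"
  unfolding approx_op_def rank_one_def using rank_one_approximation[OF assms] by blast

lemma upper_est_Lhat_2:
  assumes "1 < q" "q \<le> 2" "G \<in> Lhat 2 U"
  shows "upper_est q 2 U G"
proof (rule upper_est_exponent_mono)
  show "upper_est 2 2 U G" using upper_est_smooth[of 2 G] assms by simp
  show "G n \<in> Lp 2" for n by (rule UP_Lp[OF Lhat_UP[OF assms(3)]])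
qed (use assms in auto)

text \<open>Functionals in \<open>Lhat 2 U\<close> and arbitrary weakly null targets are joined
  through ell^2; arbitrary weakly null functionals and \<open>L1null\<close> targets through ell^p.
  Invariance is \<open>averaging\<close> with exponent sum \<open>1 / p + 1 / 2\<close>, which is
  below one exactly because \<open>p > 2\<close>.\<close>

lemma invariant_setting_gt_2:
  assumes pq: "conjugate_exponents p q" and p: "2 < p"
  shows "invariant_setting U p q (Lhat 2 U)"
proof -
  note qp = conjugate_exponents_sym[OF pq] and M = Mspace_Lhat_2[OF pq p]
  have q: "1 < q" "q \<le> 2" using conjugate_exponentsD(2)[OF pq] conjugate_lt_2[OF pq p] by auto
  have p1: "1 < p" "1 \<le> p" using p by auto
  note sub = Lhat_2_subset[OF pq p]
  show ?thesis
  proof (unfold_locales, unfold M)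
    show "conjugate_exponents p q" by fact
    show "Lhat 2 U \<subseteq> Lhat q U" by fact
    show "(\<lambda>n x. 0) \<in> Lhat 2 U" unfolding Lhat_iff[OF conjugate_2_2] by (auto simp: UP_zero upair_zero_left)
    show "(\<lambda>n x. a * G n x + b * G' n x) \<in> Lhat 2 U" if "G \<in> Lhat 2 U" "G' \<in> Lhat 2 U" for G G' a b
      by (rule Lhat_lin[OF conjugate_2_2 that])
    show "approx_op p U (rank_one U G H)" if "G \<in> Lhat 2 U" "H \<in> Lhat p U" for G H
      using that sub by (intro approx_rank_one[OF pq conjugate_2_2] upper_est_Lhat_2[OF q] upper_est_type2[OF p] Lhat_UP) auto
    show "approx_op p U (rank_one U G H)" if "G \<in> Lhat q U" "H \<in> L1null p U" for G H
      using that by (intro approx_rank_one[OF pq pq] upper_est_smooth[OF q] upper_est_L1null[OF p1(1)] L1null_UP)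
    show "ultra_op T F \<in> L1null p U" if T: "bop_Lp p T" and F: "F \<in> L1null p U" for T F
    proof -
      have "upair U (ultra_op T F) G = 0" if G: "G \<in> Lhat 2 U" for G
      proof (rule averaging[OF pq T L1null_UP[OF F] upper_est_L1null[OF p1(1) F] _ upper_est_Lhat_2[OF q G]])
        show "G \<in> Lhat q U" using G sub by blast
        show "1 / p + 1 / 2 < 1" using p by (simp add: field_simps)
      qed
      moreover have "ultra_op T F \<in> Lhat p U" by (rule Lhat_invariant[OF T p1(2) L1null_Lhat[OF pq F]])
      ultimately show ?thesis unfolding M[symmetric] by (simp add: Mspace_def)
    qed
    show "\<exists>N. closed_usub p U N \<and> N \<subseteq> Lhat p U \<and> L1null p U \<inter> N = uzero p U \<and> subspace_sum p U (L1null p U) N = Lhat p U"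
      using closed_Mspace_L1null[OF pq] L1null_inter_Mspace[OF pq] L1null_plus_Mspace(1)[OF pq]
      by (intro exI[of _ "Mspace p U (L1null q U)"]) (auto simp: Mspace_def)
    show "\<exists>F\<in>L1null p U. unorm p U F \<noteq> 0" by (rule L1null_nonzero[OF pq])
    obtain v where v: "v \<in> Mspace p U (L1null q U)" "unorm p U v \<noteq> 0" using Mspace_L1null_nonzero[OF pq] by blast
    have "v \<notin> L1null p U"
      using L1null_inter_Mspace[OF pq] v uzero_iff[OF p1(2), of v] by blast
    then show "\<exists>F\<in>Lhat p U. F \<notin> L1null p U" using v(1) by (auto simp: Mspace_def)
  qed
qed

text \<open>Bounded approximants minus their L^2 weak limit \<open>w\<close> are weakly null in L^2,
  where the exponent is 2. The subtraction is harmless: as \<open>H\<close> is weakly null,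
  \<open>w\<close> is up to sign the weak limit of the approximation error and inherits its small
  norm.\<close>

lemma Mspace_L1null_approx:
  assumes pq: "conjugate_exponents p q" and p: "p < 2" and H: "H \<in> Mspace p U (L1null q U)" and \<delta>: "0 < \<delta>"
  shows "\<exists>H'\<in>UP p. upper_est p 2 U H' \<and> unorm p U (\<lambda>n x. H n x - H' n x) < \<delta>"
proof -
  note qp = conjugate_exponents_sym[OF pq]
  have p1: "1 < p" "p \<le> 2" "1 \<le> p" using conjugate_exponentsD(1)[OF pq] p by auto
  have q2: "2 \<le> q" using conjugate_gt_2[OF pq p] by simp
  have HL: "H \<in> Lhat p U" using H by (simp add: Mspace_def)
  note HU = Lhat_UP[OF HL]
  have d2: "0 < \<delta> / 2" using \<delta> by simp
  obtain B K where B: "\<And>n. B n \<in> borel_measurable M01" "\<And>n x. \<bar>B n x\<bar> \<le> K" "unorm p U (\<lambda>n x. H n x - B n x) < \<delta> / 2"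
    using annih_L1null_approx[OF pq Mspace_L1null_UP[OF H] d2] by metis
  have B2: "B \<in> UP 2" by (rule UP_uniformly_bounded[where K = K, OF B(1)]) (use B(2) in auto)
  have Bp: "B \<in> UP p" by (rule UP_exponent_mono[OF B2 p1(1,2)])
  define w where "w = wlim 2 U B"
  have w2: "w \<in> Lp 2" unfolding w_def by (rule wlim_Lp[OF conjugate_2_2 B2])
  have wp: "w \<in> Lp p" by (rule Lp_exponent_mono(1)[OF w2 p1(1,2)])
  let ?H = "\<lambda>n x. B n x - w x"
  have L2: "?H \<in> Lhat 2 U" unfolding w_def by (rule hat_Lhat[OF conjugate_2_2 B2])
  have HpU: "?H \<in> UP p" by (rule UP_diff[OF Bp UP_const[OF wp] p1(3)])
  note DU = UP_diff[OF HU Bp p1(3)]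
  have "lpnorm p w \<le> unorm p U (\<lambda>n x. H n x - B n x)"
  proof (rule lpnorm_le_dual[OF pq wp _ unorm_nonneg[OF DU]])
    fix g assume g: "g \<in> Lp q"
    have g2: "g \<in> Lp 2" using q2 by (intro Lp_exponent_mono(1)[OF g]) auto
    have "(LINT x|M01. w x * g x) = upair U B (\<lambda>n. g)" unfolding w_def by (rule wlim_pairing[OF conjugate_2_2 B2 g2])
    also have "\<dots> = - upair U (\<lambda>n x. H n x - B n x) (\<lambda>n. g)"
      using upair_diff_left[OF pq HU Bp UP_const[OF g]] Lhat_const(1)[OF pq HL g] by simp
    also have "\<dots> \<le> unorm p U (\<lambda>n x. H n x - B n x) * lpnorm q g"
      using upair_bound[OF pq DU UP_const[OF g]] by (simp add: unorm_const)
    finally show "(LINT x|M01. w x * g x) \<le> unorm p U (\<lambda>n x. H n x - B n x) * lpnorm q g" .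
  qed
  then have w: "lpnorm p w < \<delta> / 2" using B(3) by simp
  have "(\<lambda>n x. H n x - ?H n x) = (\<lambda>n x. (H n x - B n x) + w x)" by (simp add: algebra_simps)
  then have "unorm p U (\<lambda>n x. H n x - ?H n x) \<le> unorm p U (\<lambda>n x. H n x - B n x) + lpnorm p w"
    using unorm_triangle[OF DU UP_const[OF wp] p1(3)] by (simp add: unorm_const)
  then have "unorm p U (\<lambda>n x. H n x - ?H n x) < \<delta>" using w B(3) by simp
  then show ?thesis using HpU upper_est_Lhat_2[OF p1(1,2) L2] by (intro bexI[of _ ?H]) auto
qed

text \<open>The roles of the two sides are exchanged: \<open>L1null\<close> functionals and
  arbitrary weakly null targets are joined through ell^p, arbitrary weakly null functionals and
  targets in M through ell^2. Elements of M acquire the upper 2-estimate only after approximation,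
  so both the rank one operators and the invariance are obtained by a limit.\<close>

lemma invariant_setting_lt_2:
  assumes pq: "conjugate_exponents p q" and p: "p < 2"
  shows "invariant_setting U p q (L1null q U)"
proof -
  note qp = conjugate_exponents_sym[OF pq]
  have q: "2 < q" "1 < q" "1 \<le> q" using conjugate_gt_2[OF pq p] by auto
  have p1: "1 < p" "1 \<le> p" "p \<le> 2" using conjugate_exponentsD(1)[OF pq] p by auto
  show ?thesis
  proof (unfold_locales)
    show "conjugate_exponents p q" by fact
    show "L1null q U \<subseteq> Lhat q U" using L1null_Lhat[OF qp] by blast
    show "(\<lambda>n x. 0) \<in> L1null q U" using q by (simp add: L1null_def UP_zero)
    show "(\<lambda>n x. a * G n x + b * G' n x) \<in> L1null q U" if "G \<in> L1null q U" "G' \<in> L1null q U" for G G' a b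
      by (rule L1null_lin[OF q(2) that])
    show "approx_op p U (rank_one U G H)" if "G \<in> L1null q U" "H \<in> Lhat p U" for G H
      using that by (intro approx_rank_one[OF pq pq] upper_est_smooth[OF p1(1,3)] upper_est_L1null[OF q(2)] L1null_Lhat[OF qp] Lhat_UP)
    show "approx_op p U (rank_one U G H)" if G: "G \<in> Lhat q U" and H: "H \<in> Mspace p U (L1null q U)" for G H
    proof (rule approx_rank_one_closed[OF pq Lhat_UP[OF G]])
      show "H \<in> UP p" using H by (auto simp: Mspace_def intro: Lhat_UP)
      fix \<delta> :: real assume "0 < \<delta>"
      then obtain H' where "H' \<in> UP p" "upper_est p 2 U H'" "unorm p U (\<lambda>n x. H n x - H' n x) < \<delta>"
        using Mspace_L1null_approx[OF pq p H] by blast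
      then show "\<exists>H'\<in>UP p. approx_op p U (rank_one U G H') \<and> unorm p U (\<lambda>n x. H n x - H' n x) < \<delta>"
        using approx_rank_one[OF pq conjugate_2_2 G upper_est_type2[OF q(1) G]] by blast
    qed
    show "ultra_op T F \<in> Mspace p U (L1null q U)" if T: "bop_Lp p T" and F: "F \<in> Mspace p U (L1null q U)" for T F
    proof -
      have FL: "F \<in> Lhat p U" using F by (simp add: Mspace_def)
      note FU = Lhat_UP[OF FL]
      obtain C where C: "0 \<le> C" "\<forall>F\<in>UP p. unorm p U (ultra_op T F) \<le> C * unorm p U F" using unorm_ultra_op_le[OF T] by blast
      have "upair U (ultra_op T F) G = 0" if G: "G \<in> L1null q U" for G
      proof (rule ccontr)
        assume nz: "upair U (ultra_op T F) G \<noteq> 0"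
        note GU = L1null_UP[OF G]
        \<comment> \<open>\<open>K\<close> bounds the change of the pairing per unit of distance
          between \<open>F\<close> and its approximant \<open>F'\<close>, for which
          \<open>averaging\<close> applies with exponent sum \<open>1 / 2 + 1 / q\<close>.\<close>
        define K where "K = C * unorm q U G + 1"
        have K: "0 < K" using C(1) unorm_nonneg[OF GU] by (simp add: K_def add_nonneg_pos)
        have "0 < \<bar>upair U (ultra_op T F) G\<bar> / K" using nz K by simp
        then obtain F' where F': "F' \<in> UP p" "upper_est p 2 U F'" "unorm p U (\<lambda>n x. F n x - F' n x) < \<bar>upair U (ultra_op T F) G\<bar> / K"
          using Mspace_L1null_approx[OF pq p F] by blast
        note TU = ultra_op_UP[OF T FU] ultra_op_UP[OF T F'(1)] and DU = UP_diff[OF FU F'(1) p1(2)]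
        have "upair U (ultra_op T F') G = 0"
        proof (rule averaging[OF pq T F'(1,2) L1null_Lhat[OF qp G] upper_est_L1null[OF q(2) G]])
          show "1 / 2 + 1 / q < 1" using q by (simp add: field_simps)
        qed
        then have "\<bar>upair U (ultra_op T F) G\<bar> = \<bar>upair U (\<lambda>n x. ultra_op T F n x - ultra_op T F' n x) G\<bar>"
          using upair_diff_left[OF pq TU GU] by simp
        also have "\<dots> \<le> unorm p U (\<lambda>n x. ultra_op T F n x - ultra_op T F' n x) * unorm q U G"
          by (rule upair_bound[OF pq UP_diff[OF TU p1(2)] GU])
        also have "\<dots> \<le> (C * unorm p U (\<lambda>n x. F n x - F' n x)) * unorm q U G"
          unfolding unorm_ultra_op_diff[OF T FU F'(1) p1(2)]
          using bspec[OF C(2) DU] unorm_nonneg[OF GU] by (rule mult_right_mono)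
        also have "\<dots> = unorm p U (\<lambda>n x. F n x - F' n x) * (C * unorm q U G)" by simp
        also have "\<dots> \<le> unorm p U (\<lambda>n x. F n x - F' n x) * K"
          using unorm_nonneg[OF DU] by (intro mult_left_mono) (auto simp: K_def)
        also have "\<dots> < \<bar>upair U (ultra_op T F) G\<bar>" using F'(3) K by (simp add: field_simps)
        finally show False by simp
      qed
      then show ?thesis using Lhat_invariant[OF T p1(2) FL] by (simp add: Mspace_def)
    qed
    show "\<exists>N. closed_usub p U N \<and> N \<subseteq> Lhat p U \<and> Mspace p U (L1null q U) \<inter> N = uzero p U \<and>
        subspace_sum p U (Mspace p U (L1null q U)) N = Lhat p U"
      using closed_L1null[OF pq] L1null_inter_Mspace[OF pq] L1null_plus_Mspace(2)[OF pq] L1null_Lhat[OF pq]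
      by (intro exI[of _ "L1null p U"]) (auto simp: Int_commute)
    show "\<exists>F\<in>Mspace p U (L1null q U). unorm p U F \<noteq> 0" by (rule Mspace_L1null_nonzero[OF pq])
    obtain v where v: "v \<in> L1null p U" "unorm p U v \<noteq> 0" using L1null_nonzero[OF pq] by blast
    have "v \<notin> Mspace p U (L1null q U)"
      using L1null_inter_Mspace[OF pq] v uzero_iff[OF p1(2), of v] by blast
    then show "\<exists>F\<in>Lhat p U. F \<notin> Mspace p U (L1null q U)" using L1null_Lhat[OF pq v(1)] by blast
  qed
qed

end

theorem theorem6p1:
  fixes p :: real and U :: "nat filter"
  assumes "1 < p" and "p \<noteq> 2" and "selective_ultrafilter U"
  shows "(\<exists>!M. M_char p U M) \<and>
         (\<forall>M. M_char p U M \<longrightarrow>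
            inv_subspaces p U = {LpC p U, Lhat p U, M, subspace_sum p U (LpC p U) M} \<and>
            card (inv_subspaces p U) = 4 \<and>
            (2 < p \<longrightarrow> M = {F \<in> UP p. ((\<lambda>n. lpnorm 2 (F n)) \<longlongrightarrow> 0) U}))"
proof -
  interpret selective U
    using selective_nonprincipal[OF assms(3)] assms(3) by unfold_locales
  define q where "q = p / (p - 1)"
  have pq: "conjugate_exponents p q" unfolding q_def by (rule conjugate_exponents_exists[OF assms(1)])
  define \<G> where "\<G> = (if 2 < p then Lhat 2 U else L1null q U)"
  interpret I: invariant_setting U p q \<G>
    using invariant_setting_gt_2[OF pq] invariant_setting_lt_2[OF pq] assms(2) by (simp add: \<G>_def)
  have "Mspace p U \<G> = {F \<in> UP p. ((\<lambda>n. lpnorm 2 (F n)) \<longlongrightarrow> 0) U}" if p: "2 < p"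
  proof -
    have "Mspace p U \<G> = L1null p U" using Mspace_Lhat_2[OF pq p] p by (simp add: \<G>_def)
    also have "\<dots> = {F \<in> UP p. ((\<lambda>n. lpnorm 2 (F n)) \<longlongrightarrow> 0) U}"
      using L1null_iff_L2[OF p] L1null_UP by blast
    finally show ?thesis .
  qed
  note M_gt_2 = this
  show ?thesis
  proof (intro conjI allI impI)
    show "\<exists>!M. M_char p U M" using I.M_char_M I.M_char_unique by (rule ex1I)
    fix M assume "M_char p U M"
    then have M: "M = Mspace p U \<G>" by (rule I.M_char_unique)
    show "inv_subspaces p U = {LpC p U, Lhat p U, M, subspace_sum p U (LpC p U) M}"
      unfolding M by (rule I.inv_subspaces_eq)
    show "card (inv_subspaces p U) = 4" by (rule I.card_inv_subspaces)
    show "M = {F \<in> UP p. ((\<lambda>n. lpnorm 2 (F n)) \<longlongrightarrow> 0) U}" if "2 < p"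
      unfolding M by (rule M_gt_2[OF that])
  qed
qed

end
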